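(* Let $\mathsf k$ be a commutative noetherian domain, $r\ge1$, and $\mathbf k=\mathsf k[\hbar,y_1,\dots,y_r]$ with fraction field $\mathbf k'$. The assignment $C_k\mapsto p_k(y_1,\dots,y_r)$, $D_{-1,k}\mapsto x^+_k$, $D_{1,k}\mapsto x^-_k$ ($k\ge0$) defines a representation of level $r$ of the Lie algebra $\mathscr W$ on $\operatorname{tr}(\mathcal C^r/\mathbb Z)'=\bigoplus_{n\ge0}\mathbf k'\otimes_{\mathbf k}\operatorname{tr}(R^r(n))$.
   Context: $p_k(y_1,\dots,y_r)=\sum_py_p^k$. $R(n)$ is the $\mathbf k$-algebra generated by $\tau_1,\dots,\tau_{n-1},x_1,\dots,x_n$ with relations $x_kx_l=x_lx_k$; $\tau_k\tau_l=\tau_l\tau_k$ if $|k-l|>1$; $\tau_l^2=1$; $\tau_kx_l-x_{s_k(l)}\tau_k=\hbar(\delta_{l,k+1}-\delta_{l,k})$; $\tau_{k+1}\tau_k\tau_{k+1}=\tau_k\tau_{k+1}\tau_k$. $R^r(n)$ is the quotient of $R(n)$ by the two-sided ideal generated by $\prod_{p=1}^r(x_1-y_p)$; $R^r(0)=\mathbf k$. There is a canonical homomorphism $R^r(n)\to R^r(n+1)$, for which $R^r(n+1)$ is a free left $R^r(n)$-module of finite rank. $\mathcal C^r=\bigoplus_nR^r(n)$-grproj (finitely generated projective graded modules); $\operatorname{tr}(A)=A/[A,A]$ with $[A,A]$ the span of commutators, and $\operatorname{tr}(\mathcal C^r/\mathbb Z)=\bigoplus_n\operatorname{tr}(R^r(n))$.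 Operators: $x^-_k:\operatorname{tr}(R^r(n))\to\operatorname{tr}(R^r(n+1))$, $\operatorname{tr}(f)\mapsto\operatorname{tr}(fx_{n+1}^k)$; $x^+_k:\operatorname{tr}(R^r(n))\to\operatorname{tr}(R^r(n-1))$ sends $\operatorname{tr}(f)$ to the trace (class in $\operatorname{tr}(R^r(n-1))$ of the sum of the diagonal entries of a matrix) of the endomorphism $m\mapsto x_n^kmf$ of the free left $R^r(n-1)$-module $R^r(n)$ (and $x_k^+=0$ on $\operatorname{tr}(R^r(0))$). $\mathscr W$ is the Lie $\mathbf k'$-algebra generated by $C_k,D_{-1,k},D_{0,k+1},D_{1,k}$ ($k\ge0$) with relations: $C_k$ central; $[D_{0,l+1},D_{0,k+1}]=0$; $[D_{0,l+1},D_{1,k}]=\hbar D_{1,l+k}$, $[D_{0,l+1},D_{-1,k}]=-\hbar D_{-1,l+k}$; $3[D_{1,2},D_{1,1}]-[D_{1,3},D_{1,0}]+\hbar^2[D_{1,1},D_{1,0}]=0$; $3[D_{-1,2},D_{-1,1}]-[D_{-1,3},D_{-1,0}]+\hbar^2[D_{-1,1},D_{-1,0}]=0$; $[D_{1,0},[D_{1,0},D_{1,1}]]=[D_{-1,0},[D_{-1,0},D_{-1,1}]]=0$; $[D_{-1,k},D_{1,l}]=E_{k+l}$, where $\sum_{k\ge0}E_kz^k=C_0+\sum_{k\ge1}\big(\gamma_\hbar(D_{0,k+1})-\gamma_{-\hbar}(D_{0,k+1})+C_k\big)z^k$ and $\gamma_t(D_{0,k+1})=\sum_{p=1}^k\binom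 kpD_{0,k-p+1}t^{p-1}$. Level $r$ means that $C_0$ acts by $r$. In the representation of the theorem the generator $D_{0,l+1}$ ($l\ge0$) acts by $\operatorname{tr}(f)\mapsto\hbar\operatorname{tr}(f\,p_l(x_1,\dots,x_n))$ for $f\in R^r(n)$, with $p_l(x_1,\dots,x_n)=\sum_{i=1}^nx_i^l$. *)

theory Defs
  imports
    "HOL-Library.Poly_Mapping"
    "HOL-Library.Option_ord"
    "HOL-Library.FuncSet"
    "HOL-Library.Cardinality"
    "HOL-Combinatorics.Transposition"
    "HOL-Computational_Algebra.Polynomial_Factorial"
    "HOL-Algebra.QuotRing"
    "HOL-Algebra.Module"
    "HOL-Algebra.Ring_Divisibility"
begin

section \<open>Modules over a commutative ring given as a type\<close>

text \<open>
  Scalars are types (the base ring and its fraction field); modules and algebras over them are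
  \<^typ>\<open>('k, 'm) module\<close> records. For a record that is only meant as a module the fields
  \<open>mult\<close> and \<open>one\<close> are \<open>undefined\<close>.
\<close>

definition ring_of_type :: "'k::ring_1 ring" where
  "ring_of_type = \<lparr>carrier = UNIV, monoid.mult = (*), one = 1, zero = 0, add = (+)\<rparr>"

definition module_span :: "('k::comm_ring_1, 'm) module \<Rightarrow> 'm set \<Rightarrow> 'm set" where
  "module_span M S = \<Inter> {H. submodule H (ring_of_type :: 'k ring) M \<and> S \<subseteq> H}"

definition quot_module :: "('k, 'm) module \<Rightarrow> 'm set \<Rightarrow> ('k, 'm set) module" where
  "quot_module M N =
     \<lparr>carrier = a_rcosets\<^bsub>M\<^esub> N, monoid.mult = undefined, one = undefined, zero = N, add = set_add M,
      module.smult = (\<lambda>c Y. \<Union>m\<in>Y. N +>\<^bsub>M\<^esub> (c \<odot>\<^bsub>M\<^esub> m))\<rparr>"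

definition free_module :: "'m set \<Rightarrow> ('l::comm_ring_1, 'm \<Rightarrow>\<^sub>0 'l) module" where
  "free_module B =
     \<lparr>carrier = {f. Poly_Mapping.keys f \<subseteq> B}, monoid.mult = undefined, one = undefined, zero = 0,
      add = (+), module.smult = (\<lambda>c. Poly_Mapping.map ((*) c))\<rparr>"

text \<open>
  The extension of scalars \<open>'l \<otimes>\<^sub>k M\<close> along \<open>\<phi> : 'k \<rightarrow> 'l\<close>, as the \<open>'l\<close>-module with one
  generator \<open>1 \<otimes> m\<close> for every \<open>m\<close> in \<open>M\<close>, subject to additivity in \<open>m\<close> and
  \<open>1 \<otimes> a m = \<phi>(a) (1 \<otimes> m)\<close>.
\<close>

definition tensor_relations ::
    "('k \<Rightarrow> 'l::comm_ring_1) \<Rightarrow> ('k, 'm) module \<Rightarrow> ('m \<Rightarrow>\<^sub>0 'l) set" where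
  "tensor_relations \<phi> M =
     {Poly_Mapping.single (m \<oplus>\<^bsub>M\<^esub> m') 1 - Poly_Mapping.single m 1 - Poly_Mapping.single m' 1
        | m m'. m \<in> carrier M \<and> m' \<in> carrier M} \<union>
     {Poly_Mapping.single (a \<odot>\<^bsub>M\<^esub> m) 1 - Poly_Mapping.single m (\<phi> a) | a m. m \<in> carrier M}"

definition tensor_kernel ::
    "('k \<Rightarrow> 'l::comm_ring_1) \<Rightarrow> ('k, 'm) module \<Rightarrow> ('m \<Rightarrow>\<^sub>0 'l) set" where
  "tensor_kernel \<phi> M = module_span (free_module (carrier M)) (tensor_relations \<phi> M)"

definition extend_scalars ::
    "('k \<Rightarrow> 'l::comm_ring_1) \<Rightarrow> ('k, 'm) module \<Rightarrow> ('l, ('m \<Rightarrow>\<^sub>0 'l) set) module" where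
  "extend_scalars \<phi> M = quot_module (free_module (carrier M)) (tensor_kernel \<phi> M)"

definition pure_tensor ::
    "('k \<Rightarrow> 'l::comm_ring_1) \<Rightarrow> ('k, 'm) module \<Rightarrow> 'l \<Rightarrow> 'm \<Rightarrow> ('m \<Rightarrow>\<^sub>0 'l) set" where
  "pure_tensor \<phi> M c m =
     tensor_kernel \<phi> M +>\<^bsub>free_module (carrier M) :: ('l, 'm \<Rightarrow>\<^sub>0 'l) module\<^esub> Poly_Mapping.single m c"

definition direct_sum :: "(nat \<Rightarrow> ('k, 'm) module) \<Rightarrow> ('k, nat \<Rightarrow> 'm) module" where
  "direct_sum M =
     \<lparr>carrier = {v. (\<forall>n. v n \<in> carrier (M n)) \<and> finite {n. v n \<noteq> \<zero>\<^bsub>M n\<^esub>}},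
      monoid.mult = undefined, one = undefined, zero = (\<lambda>n. \<zero>\<^bsub>M n\<^esub>),
      add = (\<lambda>v w n. v n \<oplus>\<^bsub>M n\<^esub> w n), module.smult = (\<lambda>c v n. c \<odot>\<^bsub>M n\<^esub> v n)\<rparr>"

definition summand :: "(nat \<Rightarrow> ('k, 'm) module) \<Rightarrow> nat \<Rightarrow> 'm \<Rightarrow> nat \<Rightarrow> 'm" where
  "summand M n m = (\<lambda>i. if i = n then m else \<zero>\<^bsub>M i\<^esub>)"

definition linear_endos :: "('k, 'm) module \<Rightarrow> ('m \<Rightarrow> 'm) set" where
  "linear_endos V =
     {F \<in> carrier V \<rightarrow>\<^sub>E carrier V.
        (\<forall>u\<in>carrier V. \<forall>v\<in>carrier V. F (u \<oplus>\<^bsub>V\<^esub> v) = F u \<oplus>\<^bsub>V\<^esub> F v) \<and>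
        (\<forall>c. \<forall>v\<in>carrier V. F (c \<odot>\<^bsub>V\<^esub> v) = c \<odot>\<^bsub>V\<^esub> F v)}"


section \<open>The trace of an algebra and of an endomorphism of a free left module\<close>

definition commutator_span :: "('k::comm_ring_1, 'b) module \<Rightarrow> 'b set" where
  "commutator_span A =
     module_span A {(a \<otimes>\<^bsub>A\<^esub> b) \<ominus>\<^bsub>A\<^esub> (b \<otimes>\<^bsub>A\<^esub> a) | a b. a \<in> carrier A \<and> b \<in> carrier A}"

definition tr_module :: "('k::comm_ring_1, 'b) module \<Rightarrow> ('k, 'b set) module" where
  "tr_module A = quot_module A (commutator_span A)"

definition tr_class :: "('k::comm_ring_1, 'b) module \<Rightarrow> 'b \<Rightarrow> 'b set" where
  "tr_class A a = commutator_span A +>\<^bsub>A\<^esub> a"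

text \<open>
  \<open>B\<close> is regarded as a left \<open>A\<close>-module through \<open>\<iota> : A \<rightarrow> B\<close>. Coordinates with respect to a basis
  \<open>b\<^sub>0, \<dots>, b\<^sub>N\<^sub>-\<^sub>1\<close> are extensional functions on \<open>{..<N}\<close>.
\<close>

definition coordinates ::
    "('k, 'b) module \<Rightarrow> ('b \<Rightarrow> 'c) \<Rightarrow> ('k, 'c) module \<Rightarrow> 'c list \<Rightarrow> 'c \<Rightarrow> (nat \<Rightarrow> 'b) \<Rightarrow> bool" where
  "coordinates A \<iota> B bs m cs \<longleftrightarrow>
     cs \<in> {..<length bs} \<rightarrow>\<^sub>E carrier A \<and>
     m = (\<Oplus>\<^bsub>B\<^esub> i \<in> {..<length bs}. \<iota> (cs i) \<otimes>\<^bsub>B\<^esub> (bs ! i))"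

definition left_basis ::
    "('k, 'b) module \<Rightarrow> ('b \<Rightarrow> 'c) \<Rightarrow> ('k, 'c) module \<Rightarrow> 'c list \<Rightarrow> bool" where
  "left_basis A \<iota> B bs \<longleftrightarrow>
     set bs \<subseteq> carrier B \<and> (\<forall>m\<in>carrier B. \<exists>!cs. coordinates A \<iota> B bs m cs)"

text \<open>
  The matrix of \<open>F\<close> has as its \<open>i\<close>-th row the coordinates of \<open>F(b\<^sub>i)\<close>. The class of the sum of its
  diagonal entries modulo commutators does not depend on the basis; where the definition is used,
  the module is free of finite rank.
\<close>

definition endo_tr ::
    "('k::comm_ring_1, 'b) module \<Rightarrow> ('b \<Rightarrow> 'c) \<Rightarrow> ('k, 'c) module \<Rightarrow> ('c \<Rightarrow> 'c) \<Rightarrow> 'b set" where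
  "endo_tr A \<iota> B F =
     (let bs = (SOME bs. left_basis A \<iota> B bs)
      in tr_class A (\<Oplus>\<^bsub>A\<^esub> i \<in> {..<length bs}. (THE cs. coordinates A \<iota> B bs (F (bs ! i)) cs) i))"


section \<open>The base ring and its fraction field\<close>

text \<open>
  The base ring is the polynomial ring over \<open>'a\<close> in \<open>\<hbar>\<close> (the variable \<^const>\<open>None\<close>) and
  \<open>y\<^sub>p\<close> (the variable \<open>Some p\<close>), where \<open>p\<close> ranges over a finite linearly ordered index type \<open>'r\<close>;
  the number \<open>r\<close> is \<open>CARD('r)\<close>, which is at least 1. Polynomials are finitely supported functions
  from exponents to coefficients.
\<close>

type_synonym ('a, 'r) base = "('r option \<Rightarrow>\<^sub>0 nat) \<Rightarrow>\<^sub>0 'a"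
type_synonym ('a, 'r) frac = "('a, 'r) base fract"

definition hbar :: "('a::idom, 'r::{finite,linorder}) base" where
  "hbar = Poly_Mapping.single (Poly_Mapping.single None 1) 1"

definition yvar :: "'r::{finite,linorder} \<Rightarrow> ('a::idom, 'r) base" where
  "yvar p = Poly_Mapping.single (Poly_Mapping.single (Some p) 1) 1"


section \<open>Degenerate affine and cyclotomic Hecke algebras\<close>

datatype gen = GTau nat | GX nat

text \<open>
  Words are multiplied by concatenation, which is written additively so that finitely supported
  functions on words form the free associative algebra.
\<close>

datatype 'g word = Word (letters: "'g list")

instantiation word :: (type) monoid_add
begin
definition zero_word :: "'a word" where "0 = Word []"
definition plus_word :: "'a word \<Rightarrow> 'a word \<Rightarrow> 'a word" where
  "u + v = Word (letters u @ letters v)"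
instance
  by standard (simp_all add: zero_word_def plus_word_def)
end

type_synonym ('a, 'r) nc_poly = "gen word \<Rightarrow>\<^sub>0 ('a, 'r) base"

definition scal :: "('a::idom, 'r::{finite,linorder}) base \<Rightarrow> ('a, 'r) nc_poly" where
  "scal c = Poly_Mapping.single 0 c"

definition taugen :: "nat \<Rightarrow> ('a::idom, 'r::{finite,linorder}) nc_poly" where
  "taugen k = Poly_Mapping.single (Word [GTau k]) 1"

definition xgen :: "nat \<Rightarrow> ('a::idom, 'r::{finite,linorder}) nc_poly" where
  "xgen k = Poly_Mapping.single (Word [GX k]) 1"

definition gens :: "nat \<Rightarrow> gen set" where
  "gens n = GTau ` {1..<n} \<union> GX ` {1..n}"

definition free_algebra :: "nat \<Rightarrow> ('a::idom, 'r::{finite,linorder}) nc_poly ring" where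
  "free_algebra n =
     \<lparr>carrier = {f. \<forall>w\<in>Poly_Mapping.keys f. set (letters w) \<subseteq> gens n},
      monoid.mult = (*), one = 1, zero = 0, add = (+)\<rparr>"

definition affine_relations :: "nat \<Rightarrow> ('a::idom, 'r::{finite,linorder}) nc_poly set" where
  "affine_relations n =
     {xgen k * xgen l - xgen l * xgen k | k l. k \<in> {1..n} \<and> l \<in> {1..n}} \<union>
     {taugen k * taugen l - taugen l * taugen k | k l. k \<in> {1..<n} \<and> l \<in> {1..<n} \<and> \<bar>int k - int l\<bar> > 1} \<union>
     {taugen l * taugen l - 1 | l. l \<in> {1..<n}} \<union>
     {taugen k * xgen l - xgen (transpose k (k + 1) l) * taugen k
        - scal (hbar * (of_bool (l = k + 1) - of_bool (l = k)))
        | k l. k \<in> {1..<n} \<and> l \<in> {1..n}} \<union>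
     {taugen (k + 1) * taugen k * taugen (k + 1) - taugen k * taugen (k + 1) * taugen k | k. 1 \<le> k \<and> k + 1 < n}"

definition R_affine :: "nat \<Rightarrow> ('a::idom, 'r::{finite,linorder}) nc_poly set ring" where
  "R_affine n = free_algebra n Quot (Idl\<^bsub>free_algebra n\<^esub> (affine_relations n))"

definition affine_class ::
    "nat \<Rightarrow> ('a::idom, 'r::{finite,linorder}) nc_poly \<Rightarrow> ('a, 'r) nc_poly set" where
  "affine_class n f = Idl\<^bsub>free_algebra n\<^esub> (affine_relations n) +>\<^bsub>free_algebra n\<^esub> f"

text \<open>
  The product over \<open>p\<close> of \<open>x\<^sub>1 - y\<^sub>p\<close> is taken along the order of the index type; the factors
  commute. There is no \<open>x\<^sub>1\<close> for \<open>n = 0\<close>, and no relation is imposed there, so that \<open>R\<^sup>r(0)\<close>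
  is the base ring.
\<close>

definition cyclotomic_relations ::
    "nat \<Rightarrow> ('a::idom, 'r::{finite,linorder}) nc_poly set set" where
  "cyclotomic_relations n =
     (if n = 0 then {}
      else {affine_class n
              (prod_list (map (\<lambda>p. xgen 1 - scal (yvar p)) (sorted_list_of_set (UNIV :: 'r set))))})"

definition cyclotomic_class ::
    "nat \<Rightarrow> ('a::idom, 'r::{finite,linorder}) nc_poly \<Rightarrow> ('a, 'r) nc_poly set set" where
  "cyclotomic_class n f =
     Idl\<^bsub>R_affine n\<^esub> (cyclotomic_relations n) +>\<^bsub>R_affine n\<^esub> affine_class n f"

definition R_cyclotomic ::
    "nat \<Rightarrow> (('a::idom, 'r::{finite,linorder}) base, ('a, 'r) nc_poly set set) module" where
  "R_cyclotomic n =
     (let Q = R_affine n Quot (Idl\<^bsub>R_affine n\<^esub> (cyclotomic_relations n))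
      in ring.extend Q (module.fields (\<lambda>c a. cyclotomic_class n (scal c) \<otimes>\<^bsub>Q\<^esub> a)))"

text \<open>The canonical homomorphism \<open>R\<^sup>r(n) \<rightarrow> R\<^sup>r(n+1)\<close>, sending generators to generators.\<close>

definition R_incl ::
    "nat \<Rightarrow> ('a::idom, 'r::{finite,linorder}) nc_poly set set \<Rightarrow> ('a, 'r) nc_poly set set" where
  "R_incl n a =
     (THE b. \<exists>f\<in>carrier (free_algebra n). a = cyclotomic_class n f \<and> b = cyclotomic_class (n + 1) f)"

text \<open>
  Elements of \<open>tr(R\<^sup>r(n))\<close> are cosets of the commutator space, so a map given on \<open>tr(f)\<close> by a
  formula in \<open>f\<close> is evaluated by applying the formula to the elements of the coset.
\<close>

definition x_minus ::
    "nat \<Rightarrow> nat \<Rightarrow> ('a::idom, 'r::{finite,linorder}) nc_poly set set set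
       \<Rightarrow> ('a, 'r) nc_poly set set set" where
  "x_minus k n t =
     the_elem ((\<lambda>f. tr_class (R_cyclotomic (n + 1))
       (R_incl n f \<otimes>\<^bsub>R_cyclotomic (n + 1)\<^esub> cyclotomic_class (n + 1) (xgen (n + 1) ^ k))) ` t)"

text \<open>\<open>x_plus k n\<close> maps \<open>tr(R\<^sup>r(n+1))\<close> to \<open>tr(R\<^sup>r(n))\<close>.\<close>

definition x_plus ::
    "nat \<Rightarrow> nat \<Rightarrow> ('a::idom, 'r::{finite,linorder}) nc_poly set set set
       \<Rightarrow> ('a, 'r) nc_poly set set set" where
  "x_plus k n t =
     the_elem ((\<lambda>f. endo_tr (R_cyclotomic n) (R_incl n) (R_cyclotomic (n + 1))
       (\<lambda>m. cyclotomic_class (n + 1) (xgen (n + 1) ^ k)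
              \<otimes>\<^bsub>R_cyclotomic (n + 1)\<^esub> m \<otimes>\<^bsub>R_cyclotomic (n + 1)\<^esub> f)) ` t)"

definition power_sum_mult ::
    "nat \<Rightarrow> nat \<Rightarrow> ('a::idom, 'r::{finite,linorder}) nc_poly set set set
       \<Rightarrow> ('a, 'r) nc_poly set set set" where
  "power_sum_mult l n t =
     the_elem ((\<lambda>f. tr_class (R_cyclotomic n)
       (f \<otimes>\<^bsub>R_cyclotomic n\<^esub> cyclotomic_class n (\<Sum>i=1..n. xgen i ^ l))) ` t)"

definition tr_R ::
    "nat \<Rightarrow> (('a::idom, 'r::{finite,linorder}) base, ('a, 'r) nc_poly set set set) module" where
  "tr_R n = tr_module (R_cyclotomic n)"

type_synonym ('a, 'r) tr_frac = "('a, 'r) nc_poly set set set \<Rightarrow>\<^sub>0 ('a, 'r) frac"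

definition tr_R_frac ::
    "nat \<Rightarrow> (('a::idom, 'r::{finite,linorder}) frac, ('a, 'r) tr_frac set) module" where
  "tr_R_frac n = extend_scalars to_fract (tr_R n)"

definition tr_category_frac ::
    "(('a::idom, 'r::{finite,linorder}) frac, nat \<Rightarrow> ('a, 'r) tr_frac set) module" where
  "tr_category_frac = direct_sum tr_R_frac"

text \<open>The element \<open>c \<otimes> t\<close> of the \<open>n\<close>-th summand, for \<open>t\<close> in \<open>tr(R\<^sup>r(n))\<close>.\<close>

definition at_degree ::
    "nat \<Rightarrow> ('a::idom, 'r::{finite,linorder}) frac \<Rightarrow> ('a, 'r) nc_poly set set set
       \<Rightarrow> nat \<Rightarrow> ('a, 'r) tr_frac set" where
  "at_degree n c t = summand tr_R_frac n (pure_tensor to_fract (tr_R n) c t)"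


section \<open>Lie algebras given by generators and relations\<close>

record ('k, 'l) lie_algebra = "('k, 'l) module" +
  bracket :: "'l \<Rightarrow> 'l \<Rightarrow> 'l"

datatype ('k, 'g) lie_term =
    Gen 'g
  | LZero
  | LAdd "('k, 'g) lie_term" "('k, 'g) lie_term"
  | LScale 'k "('k, 'g) lie_term"
  | LBr "('k, 'g) lie_term" "('k, 'g) lie_term"

abbreviation LDiff ::
    "('k::comm_ring_1, 'g) lie_term \<Rightarrow> ('k, 'g) lie_term \<Rightarrow> ('k, 'g) lie_term" where
  "LDiff s t \<equiv> LAdd s (LScale (- 1) t)"

definition LSum :: "('k, 'g) lie_term list \<Rightarrow> ('k, 'g) lie_term" where
  "LSum ts = foldr LAdd ts LZero"

text \<open>
  The least congruence containing the relations and all instances of the axioms of a Lie algebra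
  over \<open>'k\<close>. In any characteristic the bracket is alternating.
\<close>

inductive lie_eq ::
    "(('k::comm_ring_1, 'g) lie_term \<times> ('k, 'g) lie_term) set
       \<Rightarrow> ('k, 'g) lie_term \<Rightarrow> ('k, 'g) lie_term \<Rightarrow> bool"
  for Rel where
  rel: "(s, t) \<in> Rel \<Longrightarrow> lie_eq Rel s t"
| refl: "lie_eq Rel s s"
| sym: "lie_eq Rel s t \<Longrightarrow> lie_eq Rel t s"
| trans: "lie_eq Rel s t \<Longrightarrow> lie_eq Rel t u \<Longrightarrow> lie_eq Rel s u"
| cong_add: "lie_eq Rel s s' \<Longrightarrow> lie_eq Rel t t' \<Longrightarrow> lie_eq Rel (LAdd s t) (LAdd s' t')"
| cong_scale: "lie_eq Rel s s' \<Longrightarrow> lie_eq Rel (LScale c s) (LScale c s')"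
| cong_br: "lie_eq Rel s s' \<Longrightarrow> lie_eq Rel t t' \<Longrightarrow> lie_eq Rel (LBr s t) (LBr s' t')"
| add_assoc: "lie_eq Rel (LAdd (LAdd s t) u) (LAdd s (LAdd t u))"
| add_comm: "lie_eq Rel (LAdd s t) (LAdd t s)"
| add_zero: "lie_eq Rel (LAdd LZero s) s"
| add_inverse: "lie_eq Rel (LAdd s (LScale (- 1) s)) LZero"
| scale_one: "lie_eq Rel (LScale 1 s) s"
| scale_scale: "lie_eq Rel (LScale c (LScale d s)) (LScale (c * d) s)"
| scale_add: "lie_eq Rel (LScale c (LAdd s t)) (LAdd (LScale c s) (LScale c t))"
| add_scale: "lie_eq Rel (LScale (c + d) s) (LAdd (LScale c s) (LScale d s))"
| br_add_left: "lie_eq Rel (LBr (LAdd s t) u) (LAdd (LBr s u) (LBr t u))"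
| br_add_right: "lie_eq Rel (LBr s (LAdd t u)) (LAdd (LBr s t) (LBr s u))"
| br_scale_left: "lie_eq Rel (LBr (LScale c s) t) (LScale c (LBr s t))"
| br_scale_right: "lie_eq Rel (LBr s (LScale c t)) (LScale c (LBr s t))"
| br_alternating: "lie_eq Rel (LBr s s) LZero"
| jacobi: "lie_eq Rel (LAdd (LBr s (LBr t u)) (LAdd (LBr t (LBr u s)) (LBr u (LBr s t)))) LZero"

definition lie_class ::
    "(('k::comm_ring_1, 'g) lie_term \<times> ('k, 'g) lie_term) set
       \<Rightarrow> ('k, 'g) lie_term \<Rightarrow> ('k, 'g) lie_term set" where
  "lie_class Rel s = {t. lie_eq Rel s t}"

definition presented_lie_algebra ::
    "(('k::comm_ring_1, 'g) lie_term \<times> ('k, 'g) lie_term) set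
       \<Rightarrow> ('k, ('k, 'g) lie_term set) lie_algebra" where
  "presented_lie_algebra Rel =
     \<lparr>carrier = range (lie_class Rel), monoid.mult = undefined, one = undefined,
      zero = lie_class Rel LZero,
      add = (\<lambda>S T. \<Union>s\<in>S. \<Union>t\<in>T. lie_class Rel (LAdd s t)),
      module.smult = (\<lambda>c S. \<Union>s\<in>S. lie_class Rel (LScale c s)),
      bracket = (\<lambda>S T. \<Union>s\<in>S. \<Union>t\<in>T. lie_class Rel (LBr s t))\<rparr>"

definition lie_representation ::
    "('k, 'l) lie_algebra \<Rightarrow> ('k, 'm) module \<Rightarrow> ('l \<Rightarrow> 'm \<Rightarrow> 'm) \<Rightarrow> bool" where
  "lie_representation L V \<rho> \<longleftrightarrow>
     \<rho> \<in> carrier L \<rightarrow>\<^sub>E linear_endos V \<and>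
     (\<forall>a\<in>carrier L. \<forall>b\<in>carrier L. \<forall>v\<in>carrier V. \<rho> (a \<oplus>\<^bsub>L\<^esub> b) v = \<rho> a v \<oplus>\<^bsub>V\<^esub> \<rho> b v) \<and>
     (\<forall>c. \<forall>a\<in>carrier L. \<forall>v\<in>carrier V. \<rho> (c \<odot>\<^bsub>L\<^esub> a) v = c \<odot>\<^bsub>V\<^esub> \<rho> a v) \<and>
     (\<forall>a\<in>carrier L. \<forall>b\<in>carrier L. \<forall>v\<in>carrier V.
        \<rho> (bracket L a b) v = \<rho> a (\<rho> b v) \<ominus>\<^bsub>V\<^esub> \<rho> b (\<rho> a v))"


section \<open>The Lie algebra \<open>\<W>\<close>\<close>

text \<open>\<open>D0_Suc k\<close> is the generator \<open>D\<^sub>0\<^sub>,\<^sub>k\<^sub>+\<^sub>1\<close>.\<close>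

datatype wgen = C_gen nat | D_neg nat | D0_Suc nat | D_pos nat

text \<open>\<open>gamma_D t k\<close> is \<open>\<gamma>\<^sub>t(D\<^sub>0\<^sub>,\<^sub>k\<^sub>+\<^sub>1)\<close>.\<close>

definition gamma_D :: "'k::field \<Rightarrow> nat \<Rightarrow> ('k, wgen) lie_term" where
  "gamma_D t k =
     LSum (map (\<lambda>p. LScale (of_nat (k choose p) * t ^ (p - 1)) (Gen (D0_Suc (k - p)))) [1..<k + 1])"

definition E_term :: "'k::field \<Rightarrow> nat \<Rightarrow> ('k, wgen) lie_term" where
  "E_term h k =
     (if k = 0 then Gen (C_gen 0)
      else LAdd (LDiff (gamma_D h k) (gamma_D (- h) k)) (Gen (C_gen k)))"

definition cubic_relation ::
    "'k::field \<Rightarrow> (nat \<Rightarrow> wgen) \<Rightarrow> ('k, wgen) lie_term \<times> ('k, wgen) lie_term" where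
  "cubic_relation h D =
     (LAdd (LDiff (LScale 3 (LBr (Gen (D 2)) (Gen (D 1)))) (LBr (Gen (D 3)) (Gen (D 0))))
           (LScale (h ^ 2) (LBr (Gen (D 1)) (Gen (D 0)))),
      LZero)"

definition serre_relation ::
    "(nat \<Rightarrow> wgen) \<Rightarrow> ('k, wgen) lie_term \<times> ('k, wgen) lie_term" where
  "serre_relation D = (LBr (Gen (D 0)) (LBr (Gen (D 0)) (Gen (D 1))), LZero)"

definition W_relations :: "'k::field \<Rightarrow> (('k, wgen) lie_term \<times> ('k, wgen) lie_term) set" where
  "W_relations h =
     {(LBr (Gen (C_gen k)) s, LZero) | k s. True} \<union>
     {(LBr (Gen (D0_Suc l)) (Gen (D0_Suc k)), LZero) | k l. True} \<union>
     {(LBr (Gen (D0_Suc l)) (Gen (D_pos k)), LScale h (Gen (D_pos (l + k)))) | k l. True} \<union>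
     {(LBr (Gen (D0_Suc l)) (Gen (D_neg k)), LScale (- h) (Gen (D_neg (l + k)))) | k l. True} \<union>
     {cubic_relation h D_pos, cubic_relation h D_neg, serre_relation D_pos, serre_relation D_neg} \<union>
     {(LBr (Gen (D_neg k)) (Gen (D_pos l)), E_term h (k + l)) | k l. True}"

definition W_algebra ::
    "(('a::idom, 'r::{finite,linorder}) frac, (('a, 'r) frac, wgen) lie_term set) lie_algebra" where
  "W_algebra = presented_lie_algebra (W_relations (to_fract hbar))"

definition W_gen ::
    "wgen \<Rightarrow> (('a::idom, 'r::{finite,linorder}) frac, wgen) lie_term set" where
  "W_gen g = lie_class (W_relations (to_fract hbar)) (Gen g)"

definition has_level ::
    "((('a::idom, 'r::{finite,linorder}) frac, wgen) lie_term set
        \<Rightarrow> (nat \<Rightarrow> ('a, 'r) tr_frac set) \<Rightarrow> nat \<Rightarrow> ('a, 'r) tr_frac set) \<Rightarrow> nat \<Rightarrow> bool" where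
  "has_level \<rho> r \<longleftrightarrow>
     (\<forall>v\<in>carrier tr_category_frac. \<rho> (W_gen (C_gen 0)) v = of_nat r \<odot>\<^bsub>tr_category_frac\<^esub> v)"

end

theory Submission
  imports Defs "HOL-Library.Function_Algebras" "HOL-Computational_Algebra.Formal_Power_Series"
begin

text \<open>
  The algebra \<open>R\<^sup>r(n)\<close> acts faithfully on functions of a colouring and a labelling of the positions:
  \<open>x\<^sub>1\<close> multiplies by the parameter \<open>y\<close> of the first colour and \<open>\<tau>\<^sub>k\<close> is a transposition corrected by a
  divided difference. A dimension count for this action gives a basis of \<open>R\<^sup>r(n+1)\<close> over \<open>R\<^sup>r(n)\<close>, so
  \<open>x\<^sup>+\<^sub>k\<close> is a trace taken in a ring of operators.

  The cubic and the Serre relations for \<open>x\<^sup>-\<close> are identities modulo commutators between elements that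
  commute with \<open>R\<^sup>r(n)\<close>; the same identities give the relations for \<open>x\<^sup>+\<close>, by cyclicity of the trace.
  By the Mackey decomposition of \<open>R\<^sup>r(n+1)\<close> into \<open>R\<^sup>r(n) x\<^sub>n\<^sub>+\<^sub>1\<^sup>a\<close> for \<open>a < r\<close> and
  \<open>R\<^sup>r(n) \<tau>\<^sub>n R\<^sup>r(n)\<close>, the bracket of \<open>x\<^sup>+\<^sub>k\<close> and \<open>x\<^sup>-\<^sub>l\<close> is multiplication by a central element that depends
  only on \<open>k + l\<close>. Let \<open>S\<^sub>m\<close> be the coefficient of \<open>x\<^sub>n\<^sub>+\<^sub>1\<close> to the power \<open>r - 1\<close> in \<open>x\<^sub>n\<^sub>+\<^sub>1\<^sup>m\<close>. The central
  elements and the \<open>E\<^sub>m\<close> satisfy the same Newton identities with the \<open>S\<^sub>m\<close>, so they agree.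
\<close>

section \<open>Additive endomorphisms\<close>

text \<open>The ground domain may have any characteristic, so integers cannot be divided by, and
  this shapes several steps: Newton identities are compared through a sequence whose leading term is
  1, and the cubic relation is exhibited as explicit commutators. In characteristic 2 the difference
  of \<open>\<gamma>_\<hbar>\<close> and \<open>\<gamma>_{-\<hbar>}\<close> vanishes, so the action
  of \<open>D_{0,l+1}\<close> cannot be read off from brackets of \<open>x^+\<close> and
  \<open>x^-\<close>; it is prescribed along with theirs, shown to be compatible, and the resulting
  representation is unique.

  The polynomial representation of the affine algebra does not descend to the cyclotomic quotient,
  where \<open>x_1\<close> may only have the eigenvalues \<open>y_p\<close>. The colours supply
  these eigenvalues. Over the fraction field the differences of distinct \<open>y_p\<close> are
  invertible, which both the divided differences and interpolation in \<open>x_1\<close> need. Once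
  the action is known to be faithful, nested cosets of words are exchanged for elements of one ring
  type, and the algebra is done there. Traces in that ring are meaningful only up to commutators, so
  identities between them are stated as membership in \<open>Comm\<close>.\<close>

typedef (overloaded) 'v endo = "{f :: 'v::ab_group_add \<Rightarrow> 'v. \<forall>x y. f (x + y) = f x + f y}"
  morphisms app Endo
  by (rule exI[of _ "\<lambda>x. x"]) simp

setup_lifting type_definition_endo

lemma app_add: "app F (x + y) = app F x + app F y"
  by transfer simp

instantiation endo :: (ab_group_add) ring
begin
lift_definition zero_endo :: "'a endo" is "\<lambda>x. 0" by simp
lift_definition plus_endo :: "'a endo \<Rightarrow> 'a endo \<Rightarrow> 'a endo" is "\<lambda>f g x. f x + g x"
  by (simp add: ac_simps)
lift_definition minus_endo :: "'a endo \<Rightarrow> 'a endo \<Rightarrow> 'a endo" is "\<lambda>f g x. f x - g x"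
  by (simp add: ac_simps)
lift_definition uminus_endo :: "'a endo \<Rightarrow> 'a endo" is "\<lambda>f x. - f x"
  by (simp add: ac_simps)
lift_definition times_endo :: "'a endo \<Rightarrow> 'a endo \<Rightarrow> 'a endo" is "\<lambda>f g x. f (g x)"
  by simp
instance
  by standard (transfer; simp add: fun_eq_iff ac_simps)+
end

instantiation endo :: ("{ab_group_add, zero_neq_one}") ring_1
begin
lift_definition one_endo :: "'a endo" is "\<lambda>x. x" by simp
instance
proof
  fix a :: "'a endo"
  show "1 * a = a" "a * 1 = a" by (transfer; simp)+
  show "(0 :: 'a endo) \<noteq> 1"
    by transfer (metis zero_neq_one)
qed
end

lemma endo_eqI: "(\<And>x. app F x = app G x) \<Longrightarrow> F = G"
  by transfer auto

lemma app_simps [simp]: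
  "app 0 x = 0" "app (F + G) x = app F x + app G x" "app (F - G) x = app F x - app G x"
  "app (- F) x = - app F x" "app (F * G) x = app F (app G x)"
  by (transfer; simp)+

lemma app_one [simp]: "app 1 x = x"
  by transfer simp

lemma app_zero [simp]: "app F 0 = 0"
  using app_add[of F 0 0] by simp

lemma app_minus [simp]: "app F (- x) = - app F x"
  using app_add[of F x "- x"] by (simp add: eq_neg_iff_add_eq_0 add.commute)

lemma app_diff: "app F (x - y) = app F x - app F y"
  using app_add[of F x "- y"] by simp

lemma app_sum: "app F (\<Sum>i\<in>I. g i) = (\<Sum>i\<in>I. app F (g i))"
  by (induction I rule: infinite_finite_induct) (simp_all add: app_add)

lemma sum_app: "app (\<Sum>i\<in>I. F i) x = (\<Sum>i\<in>I. app (F i) x)"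
  by (induction I rule: infinite_finite_induct) simp_all


section \<open>A representation on coloured labellings\<close>

type_synonym 'r config = "(nat \<Rightarrow> 'r) \<times> (nat \<Rightarrow> nat)"

lift_definition Sc :: "'k::comm_ring_1 \<Rightarrow> ('z \<Rightarrow> 'k) endo" is
  "\<lambda>c f z. c * f z"
  by (simp add: fun_eq_iff algebra_simps)

lift_definition Mu :: "('z \<Rightarrow> 'k::comm_ring_1) \<Rightarrow> ('z \<Rightarrow> 'k) endo" is
  "\<lambda>g f z. g z * f z"
  by (simp add: fun_eq_iff algebra_simps)

definition swp :: "nat \<Rightarrow> (nat \<Rightarrow> 'b) \<Rightarrow> nat \<Rightarrow> 'b" where
  "swp k c = c(k := c (Suc k), Suc k := c k)"

text \<open>
  On a product \<open>F(y\<^sub>c\<^sub>(\<^sub>k\<^sub>)) G(y\<^sub>c\<^sub>(\<^sub>k\<^sub>+\<^sub>1\<^sub>))\<close> the second summand is \<open>\<hbar>\<close> times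
  \<open>(F(u) - F(v)) (G(u) - G(v)) / (u - v)\<close>, which accounts for reordering noncommuting variables.
\<close>
lift_definition To :: "'k::field \<Rightarrow> ('r \<Rightarrow> 'k) \<Rightarrow> nat \<Rightarrow> ('r config \<Rightarrow> 'k) endo" is
  "\<lambda>h y k f (c, w). f (swp k c, swp k w) + h *
     (if c k = c (Suc k) then 0
      else (f (c(Suc k := c k), w) + f (c(k := c (Suc k)), w) - f (c, w) - f (swp k c, w))
             / (y (c k) - y (c (Suc k))))"
  by (auto simp: fun_eq_iff algebra_simps add_divide_distrib diff_divide_distrib)

lemma Sc_hom: "Sc (a + b) = Sc a + Sc b" "Sc (a * b) = Sc a * Sc b" "Sc 1 = 1" "Sc 0 = 0"
  "Sc (a - b) = Sc a - Sc b" "Sc (- a) = - Sc a"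
  by (transfer; simp add: fun_eq_iff algebra_simps)+

lemma app_Sc: "app (Sc c) f = (\<lambda>z. c * f z)"
  by transfer simp

lemma app_Mu: "app (Mu g) f z = g z * f z"
  by transfer simp

lemma Sc_Mu: "Sc c * Mu g = Mu g * Sc c"
  by transfer (auto simp: fun_eq_iff)

lemma app_To: "app (To h y k) f (c, w) = f (swp k c, swp k w) + h *
     (if c k = c (Suc k) then 0
      else (f (c(Suc k := c k), w) + f (c(k := c (Suc k)), w) - f (c, w) - f (swp k c, w))
             / (y (c k) - y (c (Suc k))))"
  by transfer simp

lemma Sc_To: "Sc a * To h y k = To h y k * Sc a"
  by (rule endo_eqI)
    (auto simp: fun_eq_iff app_Sc app_To algebra_simps add_divide_distrib diff_divide_distrib)

text \<open>Every configuration is an update of itself at the positions \<open>k\<close> and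
  \<open>k + 1\<close>. In these coordinates a swap exchanges arguments, and the operator identities
  below become rational identities between finitely many values of \<open>f\<close>.\<close>

lemma To_upd2:
  fixes f :: "'r config \<Rightarrow> 'k::field" and k :: nat
  defines "g \<equiv> \<lambda>c w a b p q. f (c(k := a, Suc k := b), w(k := p, Suc k := q))"
  shows "app (To h y k) f (c(k := a, Suc k := b), w(k := p, Suc k := q)) = g c w b a q p + h *
    (if a = b then 0 else (g c w a a p q + g c w b b p q - g c w a b p q - g c w b a p q) / (y a - y b))"
proof -
  have [simp]: "u(Suc k := a', k := b') = u(k := b', Suc k := a')" for u :: "nat \<Rightarrow> 'x" and a' b'
    by (auto simp: fun_eq_iff)
  show ?thesis unfolding app_To g_def swp_def by simp
qed

lemma To_square:
  assumes "inj y"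
  shows "To h y k * To h y k = (1 :: ('r config \<Rightarrow> 'k::field) endo)"
proof (rule endo_eqI, rule ext)
  fix f :: "'r config \<Rightarrow> 'k" and z :: "'r config"
  have "app (To h y k * To h y k) f (c(k := a, Suc k := b), w(k := p, Suc k := q))
      = f (c(k := a, Suc k := b), w(k := p, Suc k := q))" for c w a b p q
  proof (cases "a = b")
    case True
    then show ?thesis by (simp add: To_upd2)
  next
    case False
    then have "y a - y b \<noteq> 0" "y b - y a \<noteq> 0" using assms by (auto dest: injD)
    with False show ?thesis
      by (simp add: To_upd2 divide_simps, simp add: algebra_simps)
  qed
  from this[of "fst z" "fst z k" "fst z (Suc k)" "snd z" "snd z k" "snd z (Suc k)"]
  show "app (To h y k * To h y k) f z = app 1 f z" by simp
qed

lemma To_braid: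
  assumes "inj y"
  shows "To h y k * To h y (Suc k) * To h y k = (To h y (Suc k) * To h y k * To h y (Suc k) :: ('r config \<Rightarrow> 'k::field) endo)"
proof (rule endo_eqI, rule ext)
  fix f :: "'r config \<Rightarrow> 'k" and z :: "'r config"
  define U where "U = (\<lambda>(c :: nat \<Rightarrow> 'r) (w :: nat \<Rightarrow> nat) a b d p q s.
    (c(k := a, Suc k := b, Suc (Suc k) := d), w(k := p, Suc k := q, Suc (Suc k) := s)))"
  have T1: "app (To h y k) f (U c w a b d p q s) = f (U c w b a d q p s) + h *
    (if a = b then 0 else (f (U c w a a d p q s) + f (U c w b b d p q s) - f (U c w a b d p q s) - f (U c w b a d p q s)) / (y a - y b))"
    for f :: "'r config \<Rightarrow> 'k" and c w a b d p q s
  proof -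
    have *: "u(k := a, Suc k := b, Suc (Suc k) := d) = (u(Suc (Suc k) := d))(k := a, Suc k := b)"
      for u :: "nat \<Rightarrow> 'x" and a b d by (auto simp: fun_eq_iff)
    show ?thesis unfolding U_def * by (rule To_upd2)
  qed
  have T2: "app (To h y (Suc k)) f (U c w d a b s p q) = f (U c w d b a s q p) + h *
    (if a = b then 0 else (f (U c w d a a s p q) + f (U c w d b b s p q) - f (U c w d a b s p q) - f (U c w d b a s p q)) / (y a - y b))"
    for f :: "'r config \<Rightarrow> 'k" and c w a b d p q s
    unfolding U_def by (rule To_upd2)
  have "app (To h y k * To h y (Suc k) * To h y k) f (U c w a b d p q s)
      = app (To h y (Suc k) * To h y k * To h y (Suc k)) f (U c w a b d p q s)" for c w a b d p q s
  proof -
    consider "a = b" "b = d" | "a = b" "a \<noteq> d" | "a = d" "a \<noteq> b" | "b = d" "a \<noteq> b" | "a \<noteq> b" "b \<noteq> d" "a \<noteq> d" by auto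
    then show ?thesis
    proof cases
      case 1
      then show ?thesis by (simp add: T1 T2)
    next
      case 2
      then have "y d - y b \<noteq> 0" "y b - y d \<noteq> 0" using assms by (auto dest: injD)
      with 2 show ?thesis by (simp add: T1 T2 divide_simps, simp add: algebra_simps)
    next
      case 3
      then have "y d - y b \<noteq> 0" "y b - y d \<noteq> 0" using assms by (auto dest: injD)
      with 3 show ?thesis by (simp add: T1 T2 divide_simps, simp add: algebra_simps)
    next
      case 4
      then have "y a - y d \<noteq> 0" "y d - y a \<noteq> 0" using assms by (auto dest: injD)
      with 4 show ?thesis by (simp add: T1 T2 divide_simps, simp add: algebra_simps)
    next
      case 5
      \<comment> \<open>With the reciprocals as unknowns the only relation needed is the partial
        fraction identity \<open>P * Q = R * P + R * Q\<close>, which expresses that the first two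
        differences add up to the third.\<close>
      define P Q R where "P = 1 / (y a - y b)" and "Q = 1 / (y b - y d)" and "R = 1 / (y a - y d)"
      have ne: "y a - y b \<noteq> 0" "y b - y d \<noteq> 0" "y a - y d \<noteq> 0" using 5 assms by (auto dest: injD)
      have i: "u / (y a - y b) = u * P" "u / (y b - y a) = - u * P" "u / (y b - y d) = u * Q" "u / (y d - y b) = - u * Q"
        "u / (y a - y d) = u * R" "u / (y d - y a) = - u * R" for u
        using 5 unfolding P_def Q_def R_def
        by (simp_all add: minus_divide_right)
      have PQ: "P * Q = R * P + R * Q" unfolding P_def Q_def R_def using ne by (simp add: divide_simps)
      have PQ': "P * (Q * u) = R * P * u + R * Q * u" for u
        using arg_cong[OF PQ, of "\<lambda>x. x * u"] by (simp only: distrib_right mult.assoc)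
      note d = 5 5[symmetric]
      have "app (To h y k * To h y (Suc k) * To h y k) f (U c w a b d p q s)
         - app (To h y (Suc k) * To h y k * To h y (Suc k)) f (U c w a b d p q s) = 0"
        apply (simp add: T1 T2 d i)
        apply (simp add: algebra_simps PQ PQ')
        done
      then show ?thesis by simp
    qed
  qed
  from this[of "fst z" "snd z" "fst z k" "fst z (Suc k)" "fst z (Suc (Suc k))" "snd z k" "snd z (Suc k)" "snd z (Suc (Suc k))"]
  show "app (To h y k * To h y (Suc k) * To h y k) f z = app (To h y (Suc k) * To h y k * To h y (Suc k)) f z"
    by (simp add: U_def)
qed

lemma To_far_less:
  assumes "inj y" "Suc k < l"
  shows "To h y k * To h y l = (To h y l * To h y k :: ('r config \<Rightarrow> 'k::field) endo)"
proof (rule endo_eqI, rule ext)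
  fix f :: "'r config \<Rightarrow> 'k" and z :: "'r config"
  define U where "U = (\<lambda>(c :: nat \<Rightarrow> 'r) (w :: nat \<Rightarrow> nat) a b d e p q s t.
    (c(k := a, Suc k := b, l := d, Suc l := e), w(k := p, Suc k := q, l := s, Suc l := t)))"
  have T1: "app (To h y k) f (U c w a b d e p q s t) = f (U c w b a d e q p s t) + h *
    (if a = b then 0 else (f (U c w a a d e p q s t) + f (U c w b b d e p q s t)
       - f (U c w a b d e p q s t) - f (U c w b a d e p q s t)) / (y a - y b))"
    for f :: "'r config \<Rightarrow> 'k" and c w a b d e p q s t
  proof -
    have *: "u(k := a, Suc k := b, l := d, Suc l := e) = (u(l := d, Suc l := e))(k := a, Suc k := b)"
      for u :: "nat \<Rightarrow> 'x" and a b d e using assms(2) by (auto simp: fun_eq_iff)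
    show ?thesis unfolding U_def * by (rule To_upd2)
  qed
  have T2: "app (To h y l) f (U c w a b d e p q s t) = f (U c w a b e d p q t s) + h *
    (if d = e then 0 else (f (U c w a b d d p q s t) + f (U c w a b e e p q s t)
       - f (U c w a b d e p q s t) - f (U c w a b e d p q s t)) / (y d - y e))"
    for f :: "'r config \<Rightarrow> 'k" and c w a b d e p q s t
    unfolding U_def by (rule To_upd2)
  have i: "u / (y a - y b) = inverse (y a - y b) * u" for u a b
    by (simp add: divide_inverse)
  have "app (To h y k * To h y l) f (U c w a b d e p q s t)
      = app (To h y l * To h y k) f (U c w a b d e p q s t)" for c w a b d e p q s t
    by (cases "a = b"; cases "d = e"; simp add: T1 T2 i algebra_simps)
  from this[of "fst z" "snd z" "fst z k" "fst z (Suc k)" "fst z l" "fst z (Suc l)"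
      "snd z k" "snd z (Suc k)" "snd z l" "snd z (Suc l)"]
  show "app (To h y k * To h y l) f z = app (To h y l * To h y k) f z"
    by (simp add: U_def)
qed

definition X1 :: "('r \<Rightarrow> 'k::field) \<Rightarrow> ('r config \<Rightarrow> 'k) endo" where
  "X1 y = Mu (\<lambda>z. y (fst z 1))"

lemma X1_To:
  assumes "1 < k"
  shows "X1 y * To h y k = To h y k * X1 y"
  using assms unfolding X1_def
  by (intro endo_eqI ext) (auto simp: app_Mu app_To swp_def diff_divide_distrib add_divide_distrib algebra_simps)

text \<open>The operator next to \<open>X1\<close> is the future \<open>x_2\<close>. Here the exact
  coefficient of the divided difference in \<open>To\<close> meets \<open>X1\<close>: with
  \<open>e = y a - y b\<close> the factor \<open>1 / e\<close> cancels against the difference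
  \<open>e\<close> of the two eigenvalues involved.\<close>

lemma X1_X2:
  fixes y :: "'r \<Rightarrow> 'k::field"
  assumes "inj y"
  shows "X1 y * (To h y 1 * X1 y * To h y 1 + Sc h * To h y 1) = (To h y 1 * X1 y * To h y 1 + Sc h * To h y 1) * X1 y"
proof (rule endo_eqI, rule ext)
  fix f :: "'r config \<Rightarrow> 'k" and z :: "'r config"
  define U where "U = (\<lambda>(c :: nat \<Rightarrow> 'r) (w :: nat \<Rightarrow> nat) a b p q.
    (c(1 := a, Suc 1 := b), w(1 := p, Suc 1 := q)))"
  have T1: "app (To h y 1) f (U c w a b p q) = f (U c w b a q p) + h *
    (if a = b then 0 else (f (U c w a a p q) + f (U c w b b p q) - f (U c w a b p q) - f (U c w b a p q)) / (y a - y b))"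
    for f :: "'r config \<Rightarrow> 'k" and c w a b p q
    unfolding U_def by (rule To_upd2)
  have M: "app (X1 y) f (U c w a b p q) = y a * f (U c w a b p q)" for f c w a b p q
    by (simp add: X1_def app_Mu U_def)
  have S: "app (Sc h) f z = h * f z" for f :: "'r config \<Rightarrow> 'k" and z by (simp add: app_Sc)
  have "app (X1 y * (To h y 1 * X1 y * To h y 1 + Sc h * To h y 1)) f (U c w a b p q)
      = app ((To h y 1 * X1 y * To h y 1 + Sc h * To h y 1) * X1 y) f (U c w a b p q)" for c w a b p q
  proof (cases "a = b")
    case True
    with T1 show ?thesis by (simp add: M S algebra_simps del: One_nat_def)
  next
    case False
    define P where "P = 1 / (y a - y b)"
    have ne: "y a - y b \<noteq> 0" using False assms by (auto dest: injD)
    have i: "u / (y a - y b) = u * P" "u / (y b - y a) = - u * P" for u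
      using ne unfolding P_def by (simp_all add: minus_divide_right)
    define e where "e = y a - y b"
    have ya: "y a = y b + e" by (simp add: e_def)
    have Pe: "P * e = 1" using ne by (simp add: P_def e_def)
    have Pe': "P * (e * u) = u" for u using Pe by (simp flip: mult.assoc)
    show ?thesis using False False[symmetric]
      by (simp add: T1 M S i del: One_nat_def) (simp add: ya algebra_simps Pe Pe')
  qed
  from this[of "fst z" "snd z" "fst z 1" "fst z (Suc 1)" "snd z 1" "snd z (Suc 1)"]
  show "app (X1 y * (To h y 1 * X1 y * To h y 1 + Sc h * To h y 1)) f z
      = app ((To h y 1 * X1 y * To h y 1 + Sc h * To h y 1) * X1 y) f z"
    by (simp add: U_def)
qed

text \<open>At each configuration the factor belonging to the colour of position 1 vanishes.\<close>

lemma X1_cyclotomic: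
  assumes "set ps = UNIV"
  shows "prod_list (map (\<lambda>p. X1 y - Sc (y p)) ps) = (0 :: ('r config \<Rightarrow> 'k::field) endo)"
proof -
  have "app (prod_list (map (\<lambda>p. X1 y - Sc (y p)) qs)) f z = prod_list (map (\<lambda>p. y (fst z 1) - y p) qs) * f z"
    for f and z :: "'r config" and qs
    by (induction qs arbitrary: f) (simp_all add: X1_def app_Mu app_Sc fun_eq_iff left_diff_distrib)
  moreover have "prod_list (map (\<lambda>p. y (fst z 1) - y p) ps) = 0" for z :: "'r config"
    using assms by (auto simp: prod_list_zero_iff image_iff)
  ultimately show ?thesis by (intro endo_eqI ext) simp
qed


section \<open>Jucys--Murphy recursion in a ring\<close>

text \<open>The relation between \<open>\<tau>_k\<close> and \<open>x_k\<close> together with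
  \<open>\<tau>_k^2 = 1\<close> forces \<open>x_{k+1} = \<tau>_k x_k \<tau>_k + h \<tau>_k\<close>,
  so \<open>x_1\<close> determines all the others. The axioms mention only \<open>x_1\<close> and
  the transpositions; the remaining relations of the affine algebra are derived from them.\<close>

locale jm_ring =
  fixes T :: "nat \<Rightarrow> 'b::ring_1" and x1 h :: 'b
  assumes T_sq: "1 \<le> k \<Longrightarrow> T k * T k = 1"
    and T_braid: "1 \<le> k \<Longrightarrow> T k * T (Suc k) * T k = T (Suc k) * T k * T (Suc k)"
    and T_far: "1 \<le> k \<Longrightarrow> Suc k < l \<Longrightarrow> T k * T l = T l * T k"
    and h_T: "h * T k = T k * h" and h_x1: "h * x1 = x1 * h"
    and x1_T: "1 < k \<Longrightarrow> x1 * T k = T k * x1"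
    and x1_x2: "x1 * (T 1 * x1 * T 1 + h * T 1) = (T 1 * x1 * T 1 + h * T 1) * x1"
begin

text \<open>Positions start at 1, so \<open>X 1\<close> is \<open>x1\<close>; the value at 0 is a
  placeholder that starts the recursion.\<close>

primrec X :: "nat \<Rightarrow> 'b" where
  "X 0 = x1"
| "X (Suc k) = (if k = 0 then x1 else T k * X k * T k + h * T k)"

lemma X_Suc: "1 \<le> k \<Longrightarrow> X (Suc k) = T k * X k * T k + h * T k"
  by simp

lemma X_one: "X (Suc 0) = x1" by simp

declare X.simps [simp del]

lemma h_X: "h * X k = X k * h"
proof (induction k)
  case (Suc k)
  have "h * (T k * X k * T k) = T k * X k * T k * h"
    by (metis Suc.IH h_T mult.assoc)
  then show ?case
    by (simp add: X.simps h_x1 distrib_left distrib_right mult.assoc) (metis h_T mult.assoc)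
qed (simp add: X.simps h_x1)

lemma T_X_Suc: "1 \<le> k \<Longrightarrow> T k * X (Suc k) = X k * T k + h"
proof -
  assume k: "1 \<le> k"
  have "T k * X (Suc k) = (T k * T k) * X k * T k + h * (T k * T k)"
  proof -
    have "T k * (h * T k) = h * (T k * T k)" by (metis h_T mult.assoc)
    then show ?thesis using k by (simp add: X_Suc distrib_left mult.assoc)
  qed
  then show ?thesis using k by (simp add: T_sq)
qed

lemma X_Suc_T: "1 \<le> k \<Longrightarrow> X (Suc k) * T k = T k * X k + h"
proof -
  assume k: "1 \<le> k"
  have "X (Suc k) * T k = T k * X k * (T k * T k) + h * (T k * T k)"
    using k by (simp add: X_Suc distrib_right mult.assoc)
  then show ?thesis using k by (simp add: T_sq)
qed

lemma T_X: "1 \<le> k \<Longrightarrow> T k * X k = X (Suc k) * T k - h"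
  by (simp add: X_Suc_T)

lemma X_T_less: "1 \<le> l \<Longrightarrow> l < k \<Longrightarrow> X l * T k = T k * X l"
proof (induction l)
  case (Suc l)
  show ?case
  proof (cases "l = 0")
    case True
    then show ?thesis using Suc by (simp add: X_one x1_T)
  next
    case False
    with Suc have IH: "X l * T k = T k * X l" and far: "T l * T k = T k * T l"
      by (simp_all add: T_far)
    have "T l * X l * T l * T k = T k * (T l * X l * T l)"
      by (metis IH far mult.assoc)
    moreover have "h * T l * T k = T k * (h * T l)"
      by (metis h_T far mult.assoc)
    ultimately show ?thesis using False by (simp add: X_Suc distrib_left distrib_right)
  qed
qed simp

text \<open>The decisive case is \<open>l = k + 2\<close>. With \<open>s = T k\<close> and
  \<open>t = T (k + 1)\<close> the element is \<open>t s X_k s t + h t s t + h t\<close>. The braid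
  relation carries \<open>s\<close> through the first term, because \<open>X_k\<close> commutes with
  \<open>t\<close>; the other two terms trade places, since \<open>t s t s = s t\<close> and
  \<open>s t s t = t s\<close>.\<close>

lemma X_T_greater: "1 \<le> k \<Longrightarrow> Suc k < l \<Longrightarrow> X l * T k = T k * X l"
proof (induction l)
  case (Suc l)
  show ?case
  proof (cases "Suc k < l")
    case True
    with Suc have IH: "X l * T k = T k * X l" and far: "T l * T k = T k * T l"
      by (simp_all add: T_far[of k l])
    have "T l * X l * T l * T k = T k * (T l * X l * T l)"
      by (metis IH far mult.assoc)
    moreover have "h * T l * T k = T k * (h * T l)"
      by (metis h_T far mult.assoc)
    ultimately show ?thesis using Suc True by (simp add: X_Suc distrib_left distrib_right)
  next
    case False
    with Suc have l: "l = Suc k" by simp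
    let ?s = "T k" and ?t = "T (Suc k)"
    have st: "?s * ?t * ?s = ?t * ?s * ?t" and ss: "?s * ?s = 1" and tt: "?t * ?t = 1"
      using Suc.prems by (simp_all add: T_braid T_sq)
    have xt: "X k * ?t = ?t * X k" using Suc.prems by (simp add: X_T_less)
    have "?t * (h * ?s) = h * (?t * ?s)" by (metis h_T mult.assoc)
    then have e: "X (Suc l) = ?t * ?s * X k * ?s * ?t + h * (?t * ?s * ?t) + h * ?t"
      using Suc.prems l by (simp add: X_Suc distrib_left distrib_right flip: mult.assoc)
    have "?t * ?s * X k * ?s * ?t * ?s = ?s * (?t * ?s * X k * ?s * ?t)"
      by (metis st xt mult.assoc)
    moreover have "h * (?t * ?s * ?t) * ?s + h * ?t * ?s = ?s * (h * (?t * ?s * ?t) + h * ?t)"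
    proof -
      have "?t * ?s * ?t * ?s = ?s * ?t" "?s * (?t * ?s * ?t) = ?t * ?s"
        by (metis st ss mult.assoc mult.right_neutral, metis st ss mult.assoc mult.left_neutral)
      moreover have "?s * (h * z) = h * (?s * z)" for z by (metis h_T mult.assoc)
      ultimately show ?thesis by (simp add: distrib_left mult.assoc add.commute)
    qed
    ultimately show ?thesis unfolding l e[unfolded l]
      by (simp add: distrib_left distrib_right mult.assoc add.assoc)
  qed
qed simp

text \<open>An element \<open>X a\<close> that commutes with \<open>X (a + 1)\<close> commutes with
  all later ones, as these arise by multiplication with transpositions beyond \<open>a\<close>. The
  adjacent case spreads upwards from the axiom \<open>x1_x2\<close>: \<open>X (k + 2)\<close>
  commutes with \<open>T k\<close> and, by induction, with \<open>X k\<close>, and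
  \<open>X (k + 1)\<close> is built from these two and \<open>h\<close>.\<close>

lemma X_commute_less: "1 \<le> k \<Longrightarrow> k < l \<Longrightarrow> X k * X l = X l * X k"
proof (induction k arbitrary: l)
  case (Suc k)
  have step: "X a * X b = X b * X a" if "1 \<le> a" "Suc a \<le> b" "X a * X (Suc a) = X (Suc a) * X a" for a b
    using that(2)
  proof (induction b rule: dec_induct)
    case base
    then show ?case using that by simp
  next
    case (step b)
    have "X a * T b = T b * X a" using step that(1) by (simp add: X_T_less)
    moreover have "X a * (T b * X b * T b) = T b * X b * T b * X a"
      using calculation step.IH by (metis mult.assoc)
    moreover have "X a * (h * T b) = h * T b * X a"
      using calculation(1) h_X[of a] by (metis mult.assoc)
    ultimately show ?case using step that(1)
      by (simp add: X_Suc distrib_left distrib_right)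
  qed
  have "X (Suc k) * X (Suc (Suc k)) = X (Suc (Suc k)) * X (Suc k)"
  proof (cases "k = 0")
    case True
    then show ?thesis using x1_x2 by (simp add: X_one X_Suc)
  next
    case False
    let ?Y = "X (Suc (Suc k))"
    have a: "?Y * T k = T k * ?Y" using False by (simp add: X_T_greater)
    have b: "X k * ?Y = ?Y * X k" using False Suc.IH by simp
    have "T k * X k * T k * ?Y = ?Y * (T k * X k * T k)" by (metis a b mult.assoc)
    moreover have "h * T k * ?Y = ?Y * (h * T k)" by (metis a h_X mult.assoc)
    ultimately show ?thesis using False X_Suc[of k] by (simp add: distrib_left distrib_right)
  qed
  then show ?case using step[of "Suc k" l] Suc.prems by simp
qed simp

lemma X_commute: "1 \<le> k \<Longrightarrow> 1 \<le> l \<Longrightarrow> X k * X l = X l * X k"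
  using X_commute_less by (metis linorder_neqE_nat)

end

section \<open>Words modulo the relations\<close>

abbreviation Fr :: "nat \<Rightarrow> ('a::idom, 'r::{finite,linorder}) nc_poly set" where
  "Fr n \<equiv> carrier (free_algebra n)"

lemma free_algebra_simps [simp]:
  "monoid.mult (free_algebra n) = (*)" "one (free_algebra n) = 1"
  "zero (free_algebra n) = 0" "add (free_algebra n) = (+)"
  by (simp_all add: free_algebra_def)

lemma letters_simps [simp]: "letters 0 = []" "letters (u + v) = letters u @ letters v"
  by (simp_all add: zero_word_def plus_word_def)

lemma Fr_iff: "f \<in> Fr n \<longleftrightarrow> (\<forall>w\<in>Poly_Mapping.keys f. set (letters w) \<subseteq> gens n)"
  by (simp add: free_algebra_def)

lemma Fr_add [simp, intro]: "f \<in> Fr n \<Longrightarrow> g \<in> Fr n \<Longrightarrow> f + g \<in> Fr n"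
  using keys_add[of f g] unfolding Fr_iff by (meson UnE subsetD)

lemma Fr_uminus [simp, intro]: "f \<in> Fr n \<Longrightarrow> - f \<in> Fr n"
  by (simp add: Fr_iff in_keys_iff)

lemma Fr_diff [simp, intro]: "f \<in> Fr n \<Longrightarrow> g \<in> Fr n \<Longrightarrow> f - g \<in> Fr n"
  using Fr_add[of f n "- g"] by simp

lemma Fr_mult [simp, intro]: "f \<in> Fr n \<Longrightarrow> g \<in> Fr n \<Longrightarrow> f * g \<in> Fr n"
proof -
  assume f: "f \<in> Fr n" and g: "g \<in> Fr n"
  have "set (letters w) \<subseteq> gens n" if w: "w \<in> Poly_Mapping.keys (f * g)" for w
  proof -
    obtain a b where "w = a + b" "a \<in> Poly_Mapping.keys f" "b \<in> Poly_Mapping.keys g"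
      using w keys_mult[of f g] by blast
    with f g show ?thesis by (simp add: Fr_iff)
  qed
  then show ?thesis by (simp add: Fr_iff)
qed

lemma Fr_scal [simp, intro]: "scal c \<in> Fr n"
  by (auto simp: Fr_iff scal_def split: if_splits)

lemma Fr_zero [simp, intro]: "0 \<in> Fr n"
  by (simp add: Fr_iff)

lemma scal_one: "scal 1 = 1"
  by (simp add: scal_def)

lemma scal_zero: "scal 0 = 0"
  by (simp add: scal_def)

lemma scal_add: "scal (c + d) = scal c + scal d"
  by (simp add: scal_def single_add)

lemma scal_diff: "scal (c - d) = scal c - scal d"
  by (simp add: scal_def single_diff)

lemma scal_uminus: "scal (- c) = - scal c"
  by (simp add: scal_def single_uminus)

lemma scal_mult: "scal (c * d) = scal c * scal d"
  by (simp add: scal_def mult_single)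

lemma Fr_one [simp, intro]: "1 \<in> Fr n"
  using Fr_scal[of 1] by (simp add: scal_one)

lemma Fr_xgen [simp, intro]: "1 \<le> k \<Longrightarrow> k \<le> n \<Longrightarrow> xgen k \<in> Fr n"
  by (simp add: Fr_iff xgen_def gens_def)

lemma Fr_taugen [simp, intro]: "1 \<le> k \<Longrightarrow> k < n \<Longrightarrow> taugen k \<in> Fr n"
  by (simp add: Fr_iff taugen_def gens_def)

lemma Fr_power [simp, intro]: "f \<in> Fr n \<Longrightarrow> f ^ k \<in> Fr n"
  by (induction k) auto

lemma Fr_sum [simp, intro]: "(\<And>i. i \<in> I \<Longrightarrow> f i \<in> Fr n) \<Longrightarrow> (\<Sum>i\<in>I. f i) \<in> Fr n"
  by (induction I rule: infinite_finite_induct) auto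

lemma Fr_mono: "n \<le> m \<Longrightarrow> f \<in> Fr n \<Longrightarrow> f \<in> Fr m"
  unfolding Fr_iff gens_def by fastforce

lemma poly_mapping_sum_single: "f = (\<Sum>w\<in>Poly_Mapping.keys f. Poly_Mapping.single w (Poly_Mapping.lookup f w))"
  by (rule poly_mapping_eqI) (auto simp: lookup_sum lookup_single when_def in_keys_iff)

lemma scal_central: "scal c * f = f * scal c"
proof -
  have "scal c * Poly_Mapping.single w d = Poly_Mapping.single w d * scal c" for w d
    by (simp add: scal_def mult_single mult.commute)
  then show ?thesis
    by (subst (1 2) poly_mapping_sum_single[of f]) (simp add: sum_distrib_left sum_distrib_right)
qed

text \<open>A word grows by letters on its right. This form suits the proofs below, where a span is
  shown to be stable under right multiplication or an element to commute with one generator after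
  another.\<close>

lemma Fr_induct [consumes 1, case_names scal add x tau]:
  assumes f: "f \<in> Fr n"
    and scal: "\<And>c. P (scal c)"
    and add: "\<And>f g. f \<in> Fr n \<Longrightarrow> g \<in> Fr n \<Longrightarrow> P f \<Longrightarrow> P g \<Longrightarrow> P (f + g)"
    and x: "\<And>f k. f \<in> Fr n \<Longrightarrow> P f \<Longrightarrow> 1 \<le> k \<Longrightarrow> k \<le> n \<Longrightarrow> P (f * xgen k)"
    and tau: "\<And>f k. f \<in> Fr n \<Longrightarrow> P f \<Longrightarrow> 1 \<le> k \<Longrightarrow> k < n \<Longrightarrow> P (f * taugen k)"
  shows "P f"
proof -
  have mono: "Poly_Mapping.single (Word l) c \<in> Fr n \<and> P (Poly_Mapping.single (Word l) c)"
    if "set l \<subseteq> gens n" for l c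
    using that
  proof (induction l rule: rev_induct)
    case Nil
    then show ?case using scal[of c] Fr_scal[of c n] by (simp add: scal_def zero_word_def)
  next
    case (snoc g l)
    then have IH: "Poly_Mapping.single (Word l) c \<in> Fr n" "P (Poly_Mapping.single (Word l) c)" and g: "g \<in> gens n"
      by auto
    have "Word (l @ [g]) = Word l + Word [g]" by (simp add: plus_word_def)
    then have e: "Poly_Mapping.single (Word (l @ [g])) c = Poly_Mapping.single (Word l) c * Poly_Mapping.single (Word [g]) 1"
      by (simp add: mult_single)
    from g consider k where "g = GTau k" "1 \<le> k" "k < n" | k where "g = GX k" "1 \<le> k" "k \<le> n"
      by (auto simp: gens_def)
    then show ?case
    proof cases
      case 1
      then have "Poly_Mapping.single (Word l) c * taugen k \<in> Fr n \<and> P (Poly_Mapping.single (Word l) c * taugen k)"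
        using tau[OF IH] IH(1) by (intro conjI Fr_mult Fr_taugen) auto
      with 1 show ?thesis unfolding e by (simp add: taugen_def)
    next
      case 2
      then have "Poly_Mapping.single (Word l) c * xgen k \<in> Fr n \<and> P (Poly_Mapping.single (Word l) c * xgen k)"
        using x[OF IH] IH(1) by (intro conjI Fr_mult Fr_xgen) auto
      with 2 show ?thesis unfolding e by (simp add: xgen_def)
    qed
  qed
  have "(\<Sum>w\<in>K. Poly_Mapping.single w (Poly_Mapping.lookup f w)) \<in> Fr n
      \<and> P (\<Sum>w\<in>K. Poly_Mapping.single w (Poly_Mapping.lookup f w))"
    if "K \<subseteq> Poly_Mapping.keys f" for K
    using finite_subset[OF that finite_keys] that
  proof (induction K rule: finite_induct)
    case empty
    then show ?case using scal[of 0] by (simp add: scal_def)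
  next
    case (insert w K)
    have "set (letters w) \<subseteq> gens n" using insert f by (auto simp: Fr_iff)
    with mono[of "letters w"] have "Poly_Mapping.single w c \<in> Fr n \<and> P (Poly_Mapping.single w c)" for c
      by simp
    with insert show ?case by (auto intro: add)
  qed
  then show ?thesis using poly_mapping_sum_single[of f] by (metis order_refl)
qed

section \<open>The free algebra and its two successive quotients\<close>

lemma ring_free_algebra: "ring (free_algebra n)"
proof (rule ringI)
  show "abelian_group (free_algebra n)"
  proof (rule abelian_groupI)
    show "\<exists>y\<in>Fr n. y \<oplus>\<^bsub>free_algebra n\<^esub> x = \<zero>\<^bsub>free_algebra n\<^esub>" if "x \<in> Fr n" for x
      using that by (intro bexI[of _ "- x"]) auto
  qed (auto simp: ac_simps)
  show "Group.monoid (free_algebra n)"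
    by (rule Group.monoidI) (auto simp: ac_simps)
qed (auto simp: algebra_simps)

lemma free_algebra_minus:
  fixes f g :: "('a::idom, 'b::{finite,linorder}) nc_poly"
  assumes "f \<in> Fr n" "g \<in> Fr n"
  shows "a_inv (free_algebra n) f = - f" "f \<ominus>\<^bsub>free_algebra n\<^esub> g = f - g"
proof -
  interpret ring "free_algebra n" by (rule ring_free_algebra)
  have *: "a_inv (free_algebra n) f = - f" if "f \<in> Fr n" for f :: "('a, 'b) nc_poly"
    using minus_equality[of "- f" f] that by simp
  show "a_inv (free_algebra n) f = - f" using assms by (simp add: *)
  show "f \<ominus>\<^bsub>free_algebra n\<^esub> g = f - g"
    using assms by (simp add: a_minus_def *)
qed

definition cyc_poly :: "('a::idom, 'r::{finite,linorder}) nc_poly" where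
  "cyc_poly = prod_list (map (\<lambda>p. xgen 1 - scal (yvar p)) (sorted_list_of_set UNIV))"

definition cyc_ideal :: "nat \<Rightarrow> ('a::idom, 'r::{finite,linorder}) nc_poly set set" where
  "cyc_ideal n = Idl\<^bsub>R_affine n\<^esub> (cyclotomic_relations n)"

text \<open>The quotient is formed in two steps, by the affine relations and then by the class of
  the cyclotomic polynomial. Pulling both back to words gives a single two-sided ideal, and cosets
  of cosets can be avoided.\<close>

definition rel_ideal :: "nat \<Rightarrow> ('a::idom, 'r::{finite,linorder}) nc_poly set" where
  "rel_ideal n = {f \<in> Fr n. cyclotomic_class n f = cyc_ideal n}"

definition aff_ideal :: "nat \<Rightarrow> ('a::idom, 'r::{finite,linorder}) nc_poly set" where
  "aff_ideal n = Idl\<^bsub>free_algebra n\<^esub> (affine_relations n)"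

lemma transpose_range: "k \<in> {1..<n} \<Longrightarrow> l \<in> {1..n} \<Longrightarrow> transpose k (Suc k) l \<in> {1..n}"
  by (auto simp: transpose_def)

lemma affine_relations_Fr: "affine_relations n \<subseteq> Fr n"
  unfolding affine_relations_def using transpose_range
  by (auto intro!: Fr_diff Fr_mult)

lemma ideal_aff: "ideal (aff_ideal n) (free_algebra n)"
  unfolding aff_ideal_def by (rule ring.genideal_ideal[OF ring_free_algebra affine_relations_Fr])

lemma R_affine_eq: "R_affine n = free_algebra n Quot aff_ideal n"
  by (simp add: R_affine_def aff_ideal_def)

lemma ring_R_affine: "ring (R_affine n)"
  unfolding R_affine_eq by (rule ideal.quotient_is_ring[OF ideal_aff])

lemma affine_class_eq: "affine_class n f = aff_ideal n +>\<^bsub>free_algebra n\<^esub> f"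
  by (simp add: affine_class_def aff_ideal_def)

lemma affine_class_hom: "affine_class n \<in> ring_hom (free_algebra n) (R_affine n)"
  using ideal.rcos_ring_hom[OF ideal_aff[of n]] unfolding R_affine_eq affine_class_eq[abs_def] .

lemma cyc_poly_Fr:
  assumes "0 < n"
  shows "cyc_poly \<in> Fr n"
proof -
  have "prod_list (map (\<lambda>p. xgen 1 - scal (yvar p)) ps) \<in> Fr n" for ps
    by (induction ps) (use assms in auto)
  then show ?thesis by (simp add: cyc_poly_def)
qed

lemma cyclotomic_relations_eq: "cyclotomic_relations n = (if n = 0 then {} else {affine_class n cyc_poly})"
  by (simp add: cyclotomic_relations_def cyc_poly_def)

lemma cyclotomic_relations_carrier: "cyclotomic_relations n \<subseteq> carrier (R_affine n)"
  using ring_hom_closed[OF affine_class_hom cyc_poly_Fr] by (auto simp: cyclotomic_relations_eq)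

lemma ideal_cyc: "ideal (cyc_ideal n) (R_affine n)"
  unfolding cyc_ideal_def by (rule ring.genideal_ideal[OF ring_R_affine cyclotomic_relations_carrier])

definition Rcyc :: "nat \<Rightarrow> ('a::idom, 'r::{finite,linorder}) nc_poly set set ring" where
  "Rcyc n = R_affine n Quot cyc_ideal n"

lemma ring_Rcyc: "ring (Rcyc n)"
  unfolding Rcyc_def by (rule ideal.quotient_is_ring[OF ideal_cyc])

lemma R_cyclotomic_simps:
  "carrier (R_cyclotomic n) = carrier (Rcyc n)" "monoid.mult (R_cyclotomic n) = monoid.mult (Rcyc n)"
  "one (R_cyclotomic n) = one (Rcyc n)" "zero (R_cyclotomic n) = zero (Rcyc n)" "add (R_cyclotomic n) = add (Rcyc n)"
  "module.smult (R_cyclotomic n) c a = cyclotomic_class n (scal c) \<otimes>\<^bsub>Rcyc n\<^esub> a"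
  by (simp_all add: R_cyclotomic_def Rcyc_def cyc_ideal_def Let_def ring.defs module.defs)

lemma cyclotomic_class_eq: "cyclotomic_class n f = cyc_ideal n +>\<^bsub>R_affine n\<^esub> affine_class n f"
  by (simp add: cyclotomic_class_def cyc_ideal_def)

lemma cyclotomic_class_hom: "cyclotomic_class n \<in> ring_hom (free_algebra n) (Rcyc n)"
proof -
  have "(+>\<^bsub>R_affine n\<^esub>) (cyc_ideal n) \<in> ring_hom (R_affine n) (Rcyc n)"
    unfolding Rcyc_def by (rule ideal.rcos_ring_hom[OF ideal_cyc])
  from ring_hom_trans[OF affine_class_hom this] show ?thesis
    by (simp add: comp_def cyclotomic_class_eq[abs_def])
qed

lemma Rcyc_zero: "\<zero>\<^bsub>Rcyc n\<^esub> = cyc_ideal n"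
  by (simp add: Rcyc_def FactRing_def)

lemma carrier_R_affine: "carrier (R_affine n) = affine_class n ` Fr n"
  by (auto simp: R_affine_eq FactRing_def A_RCOSETS_def' affine_class_eq[abs_def])

lemma carrier_Rcyc: "carrier (Rcyc n) = cyclotomic_class n ` Fr n"
  by (auto simp: Rcyc_def FactRing_def A_RCOSETS_def' carrier_R_affine cyclotomic_class_eq[abs_def])

lemma class_hom_ring: "ring_hom_ring (free_algebra n) (Rcyc n) (cyclotomic_class n)"
  by (intro ring_hom_ringI2 ring_free_algebra ring_Rcyc cyclotomic_class_hom)

lemma rel_ideal_ideal: "ideal (rel_ideal n) (free_algebra n)"
  using ring_hom_ring.kernel_is_ideal[OF class_hom_ring[of n]]
  by (simp add: a_kernel_def' rel_ideal_def Rcyc_zero)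

lemma rel_ideal_closed:
  fixes f g a :: "('a::idom, 'r::{finite,linorder}) nc_poly"
  shows
  "f \<in> rel_ideal n \<Longrightarrow> f \<in> Fr n" "(0 :: ('a, 'r) nc_poly) \<in> rel_ideal n"
  "f \<in> rel_ideal n \<Longrightarrow> g \<in> rel_ideal n \<Longrightarrow> f + g \<in> rel_ideal n" "f \<in> rel_ideal n \<Longrightarrow> - f \<in> rel_ideal n"
  "f \<in> rel_ideal n \<Longrightarrow> g \<in> rel_ideal n \<Longrightarrow> f - g \<in> rel_ideal n"
  "a \<in> Fr n \<Longrightarrow> f \<in> rel_ideal n \<Longrightarrow> a * f \<in> rel_ideal n" "a \<in> Fr n \<Longrightarrow> f \<in> rel_ideal n \<Longrightarrow> f * a \<in> rel_ideal n"
proof -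
  let ?R = "free_algebra n :: ('a, 'r) nc_poly ring"
  have I: "ideal (rel_ideal n :: ('a, 'r) nc_poly set) ?R" by (rule rel_ideal_ideal)
  then have A: "additive_subgroup (rel_ideal n :: ('a, 'r) nc_poly set) ?R" by (rule ideal.axioms(1))
  show Fr: "f \<in> Fr n" if "f \<in> rel_ideal n" for f :: "('a, 'r) nc_poly" using that by (simp add: rel_ideal_def)
  show "(0 :: ('a, 'r) nc_poly) \<in> rel_ideal n" using additive_subgroup.zero_closed[OF A] by simp
  show add: "f + g \<in> rel_ideal n" if "f \<in> rel_ideal n" "g \<in> rel_ideal n" for f g :: "('a, 'r) nc_poly"
    using additive_subgroup.a_closed[OF A that] by simp
  show neg: "- f \<in> rel_ideal n" if "f \<in> rel_ideal n" for f :: "('a, 'r) nc_poly"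
    using additive_subgroup.a_inv_closed[OF A that]
    by (simp add: free_algebra_minus(1)[OF Fr[OF that] Fr[OF that]])
  show "f - g \<in> rel_ideal n" if "f \<in> rel_ideal n" "g \<in> rel_ideal n"
    using add[OF that(1) neg[OF that(2)]] by simp
  show "a * f \<in> rel_ideal n" if "a \<in> Fr n" "f \<in> rel_ideal n"
    using ideal.I_l_closed[OF I that(2,1)] by simp
  show "f * a \<in> rel_ideal n" if "a \<in> Fr n" "f \<in> rel_ideal n"
    using ideal.I_r_closed[OF I that(2,1)] by simp
qed

lemma class_simps:
  assumes "f \<in> Fr n" "g \<in> Fr n"
  shows "cyclotomic_class n f \<in> carrier (Rcyc n)"
    and "cyclotomic_class n (f + g) = cyclotomic_class n f \<oplus>\<^bsub>Rcyc n\<^esub> cyclotomic_class n g"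
    "cyclotomic_class n (f * g) = cyclotomic_class n f \<otimes>\<^bsub>Rcyc n\<^esub> cyclotomic_class n g"
proof -
  interpret ring_hom_ring "free_algebra n" "Rcyc n" "cyclotomic_class n" by (rule class_hom_ring)
  show "cyclotomic_class n f \<in> carrier (Rcyc n)" using assms by simp
  show "cyclotomic_class n (f + g) = cyclotomic_class n f \<oplus>\<^bsub>Rcyc n\<^esub> cyclotomic_class n g"
    using hom_add[OF assms] by simp
  show "cyclotomic_class n (f * g) = cyclotomic_class n f \<otimes>\<^bsub>Rcyc n\<^esub> cyclotomic_class n g"
    using hom_mult[OF assms] by simp
qed

lemma class_zero_one: "cyclotomic_class n 1 = \<one>\<^bsub>Rcyc n\<^esub>" "cyclotomic_class n 0 = \<zero>\<^bsub>Rcyc n\<^esub>"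
proof -
  interpret ring_hom_ring "free_algebra n" "Rcyc n" "cyclotomic_class n" by (rule class_hom_ring)
  show "cyclotomic_class n 1 = \<one>\<^bsub>Rcyc n\<^esub>" "cyclotomic_class n 0 = \<zero>\<^bsub>Rcyc n\<^esub>"
    using hom_one hom_zero by simp_all
qed

lemma class_eq_iff:
  assumes "f \<in> Fr n" "g \<in> Fr n"
  shows "cyclotomic_class n f = cyclotomic_class n g \<longleftrightarrow> f - g \<in> rel_ideal n"
proof -
  interpret Q: ring "Rcyc n" by (rule ring_Rcyc)
  have "cyclotomic_class n f = cyclotomic_class n (f - g) \<oplus>\<^bsub>Rcyc n\<^esub> cyclotomic_class n g"
    using class_simps(2)[of "f - g" n g] assms by simp
  moreover have "f - g \<in> rel_ideal n \<longleftrightarrow> cyclotomic_class n (f - g) = \<zero>\<^bsub>Rcyc n\<^esub>"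
    using assms by (simp add: rel_ideal_def Rcyc_zero)
  ultimately show ?thesis
    using assms class_simps(1)[of "f - g" n] class_simps(1)[of g n] by (auto simp: Q.add.l_cancel_one')
qed

lemma affine_in_rel_ideal:
  assumes "f \<in> affine_relations n"
  shows "f \<in> rel_ideal n"
proof -
  have f: "f \<in> Fr n" using assms affine_relations_Fr by blast
  interpret A: ring "R_affine n" by (rule ring_R_affine)
  have "f \<in> aff_ideal n"
    using assms ring.genideal_self[OF ring_free_algebra affine_relations_Fr] by (auto simp: aff_ideal_def)
  then have "affine_class n f = \<zero>\<^bsub>R_affine n\<^esub>"
    unfolding affine_class_eq R_affine_eq FactRing_def by (simp add: ring.a_rcos_zero[OF ring_free_algebra ideal_aff])
  moreover have "cyc_ideal n +>\<^bsub>R_affine n\<^esub> \<zero>\<^bsub>R_affine n\<^esub> = cyc_ideal n"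
    by (rule A.a_rcos_zero[OF ideal_cyc additive_subgroup.zero_closed[OF ideal.axioms(1)[OF ideal_cyc]]])
  ultimately show ?thesis using f by (simp add: rel_ideal_def cyclotomic_class_eq)
qed

lemma cyc_poly_in_rel_ideal:
  assumes "0 < n"
  shows "cyc_poly \<in> (rel_ideal n :: ('a::idom, 'b::{finite,linorder}) nc_poly set)"
proof -
  have *: "affine_class n cyc_poly \<in> (cyc_ideal n :: ('a, 'b) nc_poly set set)"
    using ring.genideal_self[OF ring_R_affine cyclotomic_relations_carrier[of n]] assms
    unfolding cyc_ideal_def by (simp add: cyclotomic_relations_eq)
  show ?thesis
    using assms by (simp add: rel_ideal_def cyclotomic_class_eq ring.a_rcos_zero[OF ring_R_affine ideal_cyc *] cyc_poly_Fr)
qed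

text \<open>Ideals of words that contain the affine ideal correspond to ideals of the affine
  quotient, so minimality in each of the two steps combines to minimality among words. It is applied
  to the kernel of evaluation and to the words that become zero one level higher.\<close>

lemma rel_ideal_least:
  fixes Z :: "('a::idom, 'r::{finite,linorder}) nc_poly set"
  assumes Z: "ideal Z (free_algebra n)" and aff: "affine_relations n \<subseteq> Z"
    and cyc: "0 < n \<Longrightarrow> cyc_poly \<in> Z"
  shows "rel_ideal n \<subseteq> Z"
proof
  fix f :: "('a, 'r) nc_poly" assume "f \<in> rel_ideal n"
  then have f: "f \<in> Fr n" and fJ: "cyclotomic_class n f = cyc_ideal n" by (auto simp: rel_ideal_def)
  interpret F: ring "free_algebra n :: ('a, 'r) nc_poly ring" by (rule ring_free_algebra)
  interpret A: ring "R_affine n :: ('a, 'r) nc_poly set ring" by (rule ring_R_affine)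
  have ZF: "g \<in> Fr n" if "g \<in> Z" for g using that ideal.Icarr[OF Z] by auto
  have affZ: "(aff_ideal n :: ('a, 'r) nc_poly set) \<subseteq> Z"
    unfolding aff_ideal_def by (rule F.genideal_minimal[OF Z aff])
  have I: "ideal (affine_class n ` Z) (R_affine n)"
    using F.ring_ideal_imp_quot_ideal[OF ideal_aff Z]
    unfolding R_affine_eq affine_class_eq[abs_def] .
  have "(cyclotomic_relations n :: ('a, 'r) nc_poly set set) \<subseteq> affine_class n ` Z"
    using cyc by (auto simp: cyclotomic_relations_eq)
  then have "(cyc_ideal n :: ('a, 'r) nc_poly set set) \<subseteq> affine_class n ` Z"
    unfolding cyc_ideal_def by (rule A.genideal_minimal[OF I])
  moreover have "affine_class n f \<in> cyc_ideal n"
    using fJ f unfolding cyclotomic_class_eq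
    by (intro ideal.rcos_const_imp_mem[OF ideal_cyc]) (auto simp: carrier_R_affine)
  ultimately obtain g :: "('a, 'r) nc_poly" where g: "g \<in> Z" "affine_class n f = affine_class n g" by auto
  then have "f - g \<in> aff_ideal n"
    using F.quotient_eq_iff_same_a_r_cos[OF ideal_aff f ZF] f ZF free_algebra_minus(2)[OF f ZF]
    unfolding affine_class_eq by auto
  with affZ have "f - g \<in> Z" by blast
  then have "(f - g) + g \<in> Z" using g additive_subgroup.a_closed[OF ideal.axioms(1)[OF Z], of "f - g" g] by simp
  then show "f \<in> Z" by simp
qed

lemma rel_ideal_rels:
  shows rel_xx: "1 \<le> k \<Longrightarrow> k \<le> n \<Longrightarrow> 1 \<le> l \<Longrightarrow> l \<le> n \<Longrightarrow> xgen k * xgen l - xgen l * xgen k \<in> rel_ideal n"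
    and rel_tt: "1 \<le> k \<Longrightarrow> k < n \<Longrightarrow> 1 \<le> l \<Longrightarrow> l < n \<Longrightarrow> \<bar>int k - int l\<bar> > 1 \<Longrightarrow> taugen k * taugen l - taugen l * taugen k \<in> rel_ideal n"
    and rel_sq: "1 \<le> k \<Longrightarrow> k < n \<Longrightarrow> taugen k * taugen k - 1 \<in> rel_ideal n"
    and rel_tx: "1 \<le> k \<Longrightarrow> k < n \<Longrightarrow> 1 \<le> l \<Longrightarrow> l \<le> n \<Longrightarrow> taugen k * xgen l - xgen (transpose k (k + 1) l) * taugen k
        - scal (hbar * (of_bool (l = k + 1) - of_bool (l = k))) \<in> rel_ideal n"
    and rel_br: "1 \<le> k \<Longrightarrow> k + 1 < n \<Longrightarrow> taugen (k + 1) * taugen k * taugen (k + 1) - taugen k * taugen (k + 1) * taugen k \<in> rel_ideal n"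
proof -
  assume "1 \<le> k" "k \<le> n" "1 \<le> l" "l \<le> n"
  then have "xgen k * xgen l - xgen l * xgen k \<in> affine_relations n"
    unfolding affine_relations_def Un_iff mem_Collect_eq by - (rule disjI1, rule disjI1, rule disjI1, rule disjI1, rule exI[of _ k], rule exI[of _ l], simp)
  then show "xgen k * xgen l - xgen l * xgen k \<in> rel_ideal n" by (rule affine_in_rel_ideal)
next
  assume "1 \<le> k" "k < n" "1 \<le> l" "l < n" "\<bar>int k - int l\<bar> > 1"
  then have "taugen k * taugen l - taugen l * taugen k \<in> affine_relations n"
    unfolding affine_relations_def Un_iff mem_Collect_eq by - (rule disjI1, rule disjI1, rule disjI1, rule disjI2, rule exI[of _ k], rule exI[of _ l], simp)
  then show "taugen k * taugen l - taugen l * taugen k \<in> rel_ideal n" by (rule affine_in_rel_ideal)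
next
  assume "1 \<le> k" "k < n"
  then have "taugen k * taugen k - 1 \<in> affine_relations n"
    unfolding affine_relations_def Un_iff mem_Collect_eq by - (rule disjI1, rule disjI1, rule disjI2, rule exI[of _ k], simp)
  then show "taugen k * taugen k - 1 \<in> rel_ideal n" by (rule affine_in_rel_ideal)
next
  assume "1 \<le> k" "k < n" "1 \<le> l" "l \<le> n"
  then have "taugen k * xgen l - xgen (transpose k (k + 1) l) * taugen k
        - scal (hbar * (of_bool (l = k + 1) - of_bool (l = k))) \<in> affine_relations n"
    unfolding affine_relations_def Un_iff mem_Collect_eq by - (rule disjI1, rule disjI2, rule exI[of _ k], rule exI[of _ l], simp)
  then show "taugen k * xgen l - xgen (transpose k (k + 1) l) * taugen k
        - scal (hbar * (of_bool (l = k + 1) - of_bool (l = k))) \<in> rel_ideal n" by (rule affine_in_rel_ideal)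
next
  assume "1 \<le> k" "k + 1 < n"
  then have "taugen (k + 1) * taugen k * taugen (k + 1) - taugen k * taugen (k + 1) * taugen k \<in> affine_relations n"
    unfolding affine_relations_def Un_iff mem_Collect_eq by - (rule disjI2, rule exI[of _ k], simp)
  then show "taugen (k + 1) * taugen k * taugen (k + 1) - taugen k * taugen (k + 1) * taugen k \<in> rel_ideal n" by (rule affine_in_rel_ideal)
qed

lemma rel_tx_far:
  assumes "1 \<le> k" "k < n" "1 \<le> l" "l \<le> n" "l \<noteq> k" "l \<noteq> Suc k"
  shows "taugen k * xgen l - xgen l * taugen k \<in> rel_ideal n"
  using rel_tx[OF assms(1-4)] assms(5,6) by (simp add: transpose_apply_other scal_zero)

lemma rel_xt_near:
  assumes "1 \<le> k" "k < n"
  shows "xgen (Suc k) * taugen k - (taugen k * xgen k + scal hbar) \<in> rel_ideal n"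
proof -
  have "taugen k * xgen k - xgen (Suc k) * taugen k + scal hbar \<in> rel_ideal n"
    using rel_tx[OF assms, of k] assms by (simp add: scal_uminus)
  from rel_ideal_closed(4)[OF this] show ?thesis by (simp add: algebra_simps)
qed

section \<open>Congruence of words modulo the relations\<close>

definition cg :: "nat \<Rightarrow> ('a::idom, 'r::{finite,linorder}) nc_poly \<Rightarrow> ('a, 'r) nc_poly \<Rightarrow> bool" where
  "cg n f g \<longleftrightarrow> f - g \<in> rel_ideal n"

lemma cg_refl [simp]: "cg n f f"
  by (simp add: cg_def rel_ideal_closed)

lemma cg_sym: "cg n f g \<Longrightarrow> cg n g f"
  unfolding cg_def using rel_ideal_closed(4) by fastforce

lemma cg_trans [trans]: "cg n f g \<Longrightarrow> cg n g k \<Longrightarrow> cg n f k"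
  unfolding cg_def using rel_ideal_closed(3)[of "f - g" n "g - k"] by simp

lemma cg_add: "cg n f g \<Longrightarrow> cg n f' g' \<Longrightarrow> cg n (f + f') (g + g')"
  unfolding cg_def using rel_ideal_closed(3)[of "f - g" n "f' - g'"] by (simp add: algebra_simps)

lemma cg_diff: "cg n f g \<Longrightarrow> cg n f' g' \<Longrightarrow> cg n (f - f') (g - g')"
  unfolding cg_def using rel_ideal_closed(5)[of "f - g" n "f' - g'"] by (simp add: algebra_simps)

lemma cg_left: "cg n f g \<Longrightarrow> a \<in> Fr n \<Longrightarrow> cg n (a * f) (a * g)"
  unfolding cg_def using rel_ideal_closed(6)[of a n "f - g"] by (simp add: algebra_simps)

lemma cg_right: "cg n f g \<Longrightarrow> a \<in> Fr n \<Longrightarrow> cg n (f * a) (g * a)"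
  unfolding cg_def using rel_ideal_closed(7)[of a n "f - g"] by (simp add: algebra_simps)

text \<open>The words in \<open>Fr n\<close> that die at level \<open>n + 1\<close> form an ideal
  containing all relations of level \<open>n\<close>. Congruences may therefore be carried upwards
  in the inductions on \<open>n\<close>.\<close>

lemma rel_ideal_mono: "rel_ideal n \<subseteq> (rel_ideal (Suc n) :: ('a::idom, 'r::{finite,linorder}) nc_poly set)"
proof -
  let ?Z = "{f \<in> Fr n. f \<in> (rel_ideal (Suc n) :: ('a, 'r) nc_poly set)}"
  have Fr: "f \<in> Fr (Suc n)" if "f \<in> Fr n" for f :: "('a, 'r) nc_poly"
    using Fr_mono[OF _ that] by simp
  have "ideal ?Z (free_algebra n)"
  proof (rule idealI)
    show "subgroup ?Z (add_monoid (free_algebra n))"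
    proof (rule group.subgroupI)
      show "Group.group (add_monoid (free_algebra n :: ('a, 'r) nc_poly ring))"
        by (rule abelian_group.a_group[OF ring.is_abelian_group[OF ring_free_algebra]])
      fix f g assume f: "f \<in> ?Z" and g: "g \<in> ?Z"
      show "inv\<^bsub>add_monoid (free_algebra n)\<^esub> f \<in> ?Z"
        using f rel_ideal_closed(4) free_algebra_minus(1)[of f n f] by (auto simp: a_inv_def)
      show "f \<otimes>\<^bsub>add_monoid (free_algebra n)\<^esub> g \<in> ?Z" using f g rel_ideal_closed(3) by auto
    next
      show "?Z \<noteq> {}" using rel_ideal_closed(2) by blast
    qed auto
  next
    fix a x :: "('a, 'r) nc_poly" assume a: "a \<in> ?Z" and x: "x \<in> Fr n"
    show "x \<otimes>\<^bsub>free_algebra n\<^esub> a \<in> ?Z" "a \<otimes>\<^bsub>free_algebra n\<^esub> x \<in> ?Z"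
      using a x rel_ideal_closed(6,7)[OF Fr[OF x], of a] by auto
  qed (rule ring_free_algebra)
  moreover have "affine_relations n \<subseteq> ?Z"
  proof -
    have "f \<in> rel_ideal (Suc n)" if "f \<in> affine_relations n" for f :: "('a, 'r) nc_poly"
      using that unfolding affine_relations_def Un_iff mem_Collect_eq
    proof (elim disjE exE conjE)
      fix k l assume "f = xgen k * xgen l - xgen l * xgen k" "k \<in> {1..n}" "l \<in> {1..n}"
      then show ?thesis using rel_xx[of k "Suc n" l] by simp
    next
      fix k l assume "f = taugen k * taugen l - taugen l * taugen k" "k \<in> {1..<n}" "l \<in> {1..<n}" "\<bar>int k - int l\<bar> > 1"
      then show ?thesis using rel_tt[of k "Suc n" l] by simp
    next
      fix l assume "f = taugen l * taugen l - 1" "l \<in> {1..<n}"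
      then show ?thesis using rel_sq[of l "Suc n"] by simp
    next
      fix k l assume f: "f = taugen k * xgen l - xgen (transpose k (k + 1) l) * taugen k
          - scal (hbar * (of_bool (l = k + 1) - of_bool (l = k)))" and "k \<in> {1..<n}" "l \<in> {1..n}"
      then show ?thesis unfolding f by (intro rel_tx) auto
    next
      fix k assume "f = taugen (k + 1) * taugen k * taugen (k + 1) - taugen k * taugen (k + 1) * taugen k"
        "1 \<le> k" "k + 1 < n"
      then show ?thesis using rel_br[of k "Suc n"] by simp
    qed
    then show ?thesis using affine_relations_Fr by blast
  qed
  moreover have "cyc_poly \<in> ?Z" if "0 < n"
    using cyc_poly_in_rel_ideal[of "Suc n"] cyc_poly_Fr[OF that] by simp
  ultimately have "rel_ideal n \<subseteq> ?Z" by (rule rel_ideal_least)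
  then show ?thesis by blast
qed

section \<open>Mackey decomposition: the spanning part\<close>

inductive_set mackey :: "nat \<Rightarrow> ('a::idom, 'r::{finite,linorder}) nc_poly set" for n where
  x: "a \<in> Fr n \<Longrightarrow> i < CARD('r) \<Longrightarrow> a * xgen (Suc n) ^ i \<in> mackey n"
| t: "a \<in> Fr n \<Longrightarrow> b \<in> Fr n \<Longrightarrow> 1 \<le> n \<Longrightarrow> a * taugen n * b \<in> mackey n"
| add: "f \<in> mackey n \<Longrightarrow> g \<in> mackey n \<Longrightarrow> f + g \<in> mackey n"
| J: "f \<in> rel_ideal (Suc n) \<Longrightarrow> f \<in> mackey n"

lemma mackey_cg: "f \<in> mackey n \<Longrightarrow> cg (Suc n) g f \<Longrightarrow> g \<in> mackey n"
  using mackey.add[OF _ mackey.J, of f n "g - f"] by (simp add: cg_def)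

lemma Fr_Suc: "f \<in> Fr n \<Longrightarrow> f \<in> Fr (Suc n)"
  by (rule Fr_mono[of n]) auto

lemma mackey_Fr: "f \<in> mackey n \<Longrightarrow> f \<in> Fr (Suc n)"
proof (induction rule: mackey.induct)
  case (x a i)
  then show ?case by (intro Fr_mult Fr_power Fr_xgen Fr_Suc[of a]) auto
next
  case (t a b)
  then show ?case by (intro Fr_mult Fr_taugen Fr_Suc[of a] Fr_Suc[of b]) auto
qed (auto intro: rel_ideal_closed(1))

lemma mackey_left: "f \<in> mackey n \<Longrightarrow> a \<in> Fr n \<Longrightarrow> a * f \<in> mackey n"
proof (induction rule: mackey.induct)
  case (x b i)
  then show ?case using mackey.x[of "a * b" n i] by (simp add: mult.assoc)
next
  case (t b c)
  then show ?case using mackey.t[of "a * b" n c] by (simp add: mult.assoc)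
next
  case (add f g)
  then show ?case by (simp add: distrib_left mackey.add)
next
  case (J f)
  then show ?case using mackey.J[OF rel_ideal_closed(6)] Fr_Suc by blast
qed

lemma mackey_minus: "f \<in> mackey n \<Longrightarrow> - f \<in> mackey n"
  using mackey_left[of f n "scal (- 1)"] by (simp add: scal_uminus scal_one)

lemma mackey_diff: "f \<in> mackey n \<Longrightarrow> g \<in> mackey n \<Longrightarrow> f - g \<in> mackey n"
  using mackey.add[of f n "- g"] mackey_minus[of g n] by simp

lemma mackey_sum: "(\<And>i. i \<in> I \<Longrightarrow> f i \<in> mackey n) \<Longrightarrow> sum f I \<in> mackey n"
  by (induction I rule: infinite_finite_induct) (auto intro: mackey.add mackey.J rel_ideal_closed)

lemma comm_step:
  assumes "cg m (u * f) (f * u)" "cg m (u * g) (g * u)" "f \<in> Fr m" "g \<in> Fr m"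
  shows "cg m (u * (f * g)) (f * g * u)"
  using cg_trans[OF cg_right[OF assms(1,4)] cg_left[OF assms(2,3), unfolded mult.assoc[symmetric]]]
  by (simp add: mult.assoc)

lemma x_comm: "f \<in> Fr n \<Longrightarrow> cg (Suc n) (xgen (Suc n) * f) (f * xgen (Suc n))"
proof (induction rule: Fr_induct)
  case (scal c)
  then show ?case by (simp add: scal_central)
next
  case (add f g)
  then show ?case by (simp add: distrib_left distrib_right cg_add)
next
  case (x f k)
  then show ?case
    by (intro comm_step) (auto simp: cg_def intro: rel_xx Fr_Suc)
next
  case (tau f k)
  then have "cg (Suc n) (xgen (Suc n) * taugen k) (taugen k * xgen (Suc n))"
    by (intro cg_sym[of _ "taugen k * xgen (Suc n)"]) (auto simp: cg_def intro: rel_tx_far)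
  with tau show ?case
    by (intro comm_step) (auto intro: Fr_Suc)
qed

lemma x_pow_comm: "f \<in> Fr n \<Longrightarrow> cg (Suc n) (xgen (Suc n) ^ i * f) (f * xgen (Suc n) ^ i)"
proof (induction i)
  case (Suc i)
  have "cg (Suc n) (xgen (Suc n) * (xgen (Suc n) ^ i * f)) (xgen (Suc n) * (f * xgen (Suc n) ^ i))"
    using Suc by (intro cg_left) auto
  also have "cg (Suc n) \<dots> (f * xgen (Suc n) ^ Suc i)"
    using cg_right[OF x_comm[OF Suc.prems], of "xgen (Suc n) ^ i"] by (simp add: mult.assoc)
  finally show ?case by (simp add: mult.assoc)
qed simp

lemma t_comm: "f \<in> Fr n \<Longrightarrow> cg (Suc (Suc n)) (taugen (Suc n) * f) (f * taugen (Suc n))"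
proof (induction rule: Fr_induct)
  case (scal c)
  then show ?case by (simp add: scal_central)
next
  case (add f g)
  then show ?case by (simp add: distrib_left distrib_right cg_add)
next
  case (x f k)
  then show ?case
    by (intro comm_step) (auto simp: cg_def intro: rel_tx_far Fr_Suc)
next
  case (tau f k)
  then show ?case
    by (intro comm_step) (auto simp: cg_def intro: rel_tt Fr_Suc)
qed

text \<open>The correction is \<open>\<hbar>\<close> times the divided difference of the
  \<open>t\<close>-th power, that is, the quotient of \<open>x_{n+1}^t - x_n^t\<close> by
  \<open>x_{n+1} - x_n\<close> written out as a sum.\<close>

lemma x_pow_t:
  assumes n: "1 \<le> n"
  shows "cg (Suc n) (xgen (Suc n) ^ t * taugen n :: ('a::idom, 'r::{finite,linorder}) nc_poly)
    (taugen n * xgen n ^ t + scal hbar * (\<Sum>u<t. xgen n ^ u * xgen (Suc n) ^ (t - Suc u)))"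
proof (induction t)
  case (Suc t)
  let ?X = "xgen (Suc n) :: ('a, 'r) nc_poly" and ?x = "xgen n :: ('a, 'r) nc_poly"
  let ?T = "taugen n :: ('a, 'r) nc_poly" and ?h = "scal hbar :: ('a, 'r) nc_poly"
  have comm: "cg (Suc n) (?X * (?h * (\<Sum>u<t. ?x ^ u * ?X ^ (t - Suc u)))) (?h * (\<Sum>u<t. ?x ^ u * ?X ^ (t - u)))"
  proof -
    have "cg (Suc n) (\<Sum>u\<in>U. ?X * (?x ^ u * ?X ^ (t - Suc u))) (\<Sum>u\<in>U. ?x ^ u * ?X ^ (t - u))" if "U \<subseteq> {..<t}" for U
      using finite_subset[OF that finite_lessThan] that
    proof (induction U rule: finite_induct)
      case (insert u U)
      have "cg (Suc n) (?X * ?x ^ u * ?X ^ (t - Suc u)) (?x ^ u * ?X * ?X ^ (t - Suc u))"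
        using n by (intro cg_right[OF x_comm] Fr_power Fr_xgen) auto
      moreover have "t - u = Suc (t - Suc u)" using insert by auto
      moreover have "cg (Suc n) (\<Sum>u\<in>U. ?X * (?x ^ u * ?X ^ (t - Suc u))) (\<Sum>u\<in>U. ?x ^ u * ?X ^ (t - u))"
        by (rule insert.IH) (use insert.prems in auto)
      ultimately show ?case
        using insert cg_add[of "Suc n" "?X * ?x ^ u * ?X ^ (t - Suc u)" "?x ^ u * ?X * ?X ^ (t - Suc u)"]
        by (simp add: mult.assoc)
    qed simp
    from cg_left[OF this[of "{..<t}"], of ?h] show ?thesis
      by (simp add: sum_distrib_left mult.assoc scal_central[of hbar ?X, symmetric] flip: mult.assoc)
  qed
  have "cg (Suc n) (?X * (?X ^ t * ?T)) (?X * (?T * ?x ^ t + ?h * (\<Sum>u<t. ?x ^ u * ?X ^ (t - Suc u))))"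
    using Suc by (intro cg_left) auto
  also have "\<dots> = ?X * ?T * ?x ^ t + ?X * (?h * (\<Sum>u<t. ?x ^ u * ?X ^ (t - Suc u)))"
    by (simp add: distrib_left mult.assoc)
  also have "cg (Suc n) \<dots> ((?T * ?x + ?h) * ?x ^ t + ?h * (\<Sum>u<t. ?x ^ u * ?X ^ (t - u)))"
    using n by (intro cg_add comm cg_right) (auto simp: cg_def intro: rel_xt_near[simplified])
  also have "\<dots> = ?T * ?x ^ Suc t + ?h * (\<Sum>u<Suc t. ?x ^ u * ?X ^ (Suc t - Suc u))"
    by (simp add: distrib_left distrib_right mult.assoc add.commute)
  finally show ?case by (simp add: mult.assoc)
qed simp

lemma mackey_x_pow_t:
  assumes "1 \<le> n" "t < CARD('r)"
  shows "xgen (Suc n) ^ t * taugen n \<in> (mackey n :: ('a::idom, 'r::{finite,linorder}) nc_poly set)"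
proof -
  have "taugen n * xgen n ^ t \<in> (mackey n :: ('a, 'r) nc_poly set)"
    using mackey.t[of 1 n "xgen n ^ t"] assms by auto
  moreover have "xgen n ^ u * xgen (Suc n) ^ (t - Suc u) \<in> (mackey n :: ('a, 'r) nc_poly set)" if "u < t" for u
    using assms that by (intro mackey.x) auto
  ultimately have "taugen n * xgen n ^ t + scal hbar * (\<Sum>u<t. xgen n ^ u * xgen (Suc n) ^ (t - Suc u))
      \<in> (mackey n :: ('a, 'r) nc_poly set)"
    by (intro mackey.add mackey_left[OF _ Fr_scal] mackey_sum) auto
  then show ?thesis by (rule mackey_cg[OF _ x_pow_t[OF assms(1)]])
qed

lemma mackey_txt:
  assumes "1 \<le> n" "t < CARD('r)"
  shows "taugen n * xgen n ^ t * taugen n \<in> (mackey n :: ('a::idom, 'r::{finite,linorder}) nc_poly set)"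
proof -
  let ?X = "xgen (Suc n) :: ('a, 'r) nc_poly" and ?x = "xgen n :: ('a, 'r) nc_poly"
  let ?T = "taugen n :: ('a, 'r) nc_poly" and ?h = "scal hbar :: ('a, 'r) nc_poly"
  let ?S = "\<Sum>u<t. ?x ^ u * ?X ^ (t - Suc u)"
  have "cg (Suc n) (?T * ?x ^ t) (?X ^ t * ?T - ?h * ?S)"
    using cg_diff[OF cg_sym[OF x_pow_t[OF assms(1), of t]] cg_refl[of _ "?h * ?S"]] by simp
  from cg_right[OF this, of ?T] have "cg (Suc n) (?T * ?x ^ t * ?T) (?X ^ t * (?T * ?T) - ?h * ?S * ?T)"
    using assms by (simp add: left_diff_distrib mult.assoc)
  also have "cg (Suc n) \<dots> (?X ^ t * 1 - ?h * ?S * ?T)"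
    using assms rel_sq[of n "Suc n"] by (intro cg_diff cg_left) (auto simp: cg_def)
  finally have "cg (Suc n) (?T * ?x ^ t * ?T) (1 * ?X ^ t - ?h * (\<Sum>u<t. ?x ^ u * (?X ^ (t - Suc u) * ?T)))"
    by (simp add: sum_distrib_right mult.assoc)
  moreover have "?x ^ u * (?X ^ (t - Suc u) * ?T) \<in> mackey n" if "u < t" for u
    using assms that by (intro mackey_left[OF mackey_x_pow_t]) auto
  then have "1 * ?X ^ t - ?h * (\<Sum>u<t. ?x ^ u * (?X ^ (t - Suc u) * ?T)) \<in> mackey n"
    using assms by (intro mackey_diff mackey.x mackey_left[OF _ Fr_scal] mackey_sum) auto
  ultimately show ?thesis using mackey_cg by blast
qed

text \<open>Put \<open>b\<close> into Mackey form one level lower. Its outer factors from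
  \<open>Fr m\<close> commute with the new transposition. A power of \<open>x_{m+1}\<close> in the
  middle is treated by \<open>mackey_txt\<close>; an old transposition in the middle is turned
  inside out by the braid relation.\<close>

lemma mackey_tat:
  assumes IH: "Fr (Suc m) \<subseteq> (mackey m :: ('a::idom, 'r::{finite,linorder}) nc_poly set)"
    and b: "b \<in> (Fr (Suc m) :: ('a, 'r) nc_poly set)"
  shows "taugen (Suc m) * b * taugen (Suc m) \<in> mackey (Suc m)"
proof -
  have "b \<in> mackey m" using IH b by blast
  then show ?thesis
  proof (induction rule: mackey.induct)
    let ?T = "taugen (Suc m) :: ('a, 'r) nc_poly"
    case (x a i)
    have "cg (Suc (Suc m)) (?T * a * (xgen (Suc m) ^ i * ?T)) (a * ?T * (xgen (Suc m) ^ i * ?T))"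
      using x by (intro cg_right[OF t_comm] Fr_mult Fr_power Fr_xgen Fr_taugen) auto
    then have "cg (Suc (Suc m)) (?T * (a * xgen (Suc m) ^ i) * ?T) (a * (?T * xgen (Suc m) ^ i * ?T))"
      by (simp only: mult.assoc)
    moreover have "a * (?T * xgen (Suc m) ^ i * ?T) \<in> mackey (Suc m)"
      using x by (intro mackey_left[OF mackey_txt] Fr_Suc) auto
    ultimately show ?case using mackey_cg by blast
  next
    let ?T = "taugen (Suc m) :: ('a, 'r) nc_poly" and ?U = "taugen m :: ('a, 'r) nc_poly"
    case (t a b)
    then obtain p where p: "m = Suc p" by (cases m) auto
    have a: "a \<in> Fr (Suc m)" "a \<in> Fr (Suc (Suc m))" and b': "b \<in> Fr (Suc m)" "b \<in> Fr (Suc (Suc m))" using t by (auto intro: Fr_Suc)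
    have U: "?U \<in> Fr (Suc m)" "?U \<in> Fr (Suc (Suc m))" "?T \<in> Fr (Suc (Suc m))" using t by auto
    have "cg (Suc (Suc m)) (?T * a * (?U * b * ?T)) (a * ?T * (?U * b * ?T))"
      by (rule cg_right[OF t_comm[OF t(1)]]) (intro Fr_mult U b')
    also have "a * ?T * (?U * b * ?T) = a * ?T * ?U * (b * ?T)" by (simp add: mult.assoc)
    also have "cg (Suc (Suc m)) \<dots> (a * ?T * ?U * (?T * b))"
      by (rule cg_left[OF cg_sym[OF t_comm[OF t(2)]]]) (intro Fr_mult U a)
    also have "a * ?T * ?U * (?T * b) = a * (?T * ?U * ?T) * b" by (simp add: mult.assoc)
    also have "cg (Suc (Suc m)) \<dots> (a * (?U * ?T * ?U) * b)"
    proof (rule cg_right[OF cg_left[OF _ a(2)] b'(2)])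
      show "cg (Suc (Suc m)) (?T * ?U * ?T) (?U * ?T * ?U)"
        using t(3) rel_br[of m "Suc (Suc m)"] by (simp add: cg_def)
    qed
    finally have "cg (Suc (Suc m)) (?T * (a * ?U * b) * ?T) ((a * ?U) * ?T * (?U * b))"
      by (simp add: mult.assoc)
    moreover have "(a * ?U) * ?T * (?U * b) \<in> mackey (Suc m)"
      by (rule mackey.t) (use a b' U in \<open>auto intro!: Fr_mult\<close>)
    ultimately show ?case using mackey_cg by blast
  next
    case (add f g)
    then show ?case by (simp add: distrib_left distrib_right mackey.add)
  next
    case (J f)
    then have "f \<in> rel_ideal (Suc (Suc m))" using rel_ideal_mono by blast
    then show ?case by (intro mackey.J rel_ideal_closed(6,7) Fr_taugen) auto
  qed
qed

lemma mackey_right: "f \<in> mackey n \<Longrightarrow> b \<in> Fr n \<Longrightarrow> f * b \<in> mackey n"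
proof (induction rule: mackey.induct)
  case (x a i)
  have "cg (Suc n) (a * (xgen (Suc n) ^ i * b)) (a * (b * xgen (Suc n) ^ i))"
    using x by (intro cg_left[OF x_pow_comm] Fr_Suc) auto
  then have "cg (Suc n) (a * xgen (Suc n) ^ i * b) (a * b * xgen (Suc n) ^ i)"
    by (simp only: mult.assoc)
  moreover have "a * b * xgen (Suc n) ^ i \<in> mackey n" using x by (intro mackey.x) auto
  ultimately show ?case using mackey_cg by blast
next
  case (t a c)
  then show ?case using mackey.t[of a n "c * b"] by (simp add: mult.assoc)
next
  case (add f g)
  then show ?case by (simp add: distrib_right mackey.add)
next
  case (J f)
  then show ?case using mackey.J[OF rel_ideal_closed(7)] Fr_Suc by blast
qed

lemma prod_list_expand:
  fixes x :: "'b::ring_1"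
  assumes add: "\<And>c d. s (c + d) = s c + s d" and diff: "\<And>c d. s (c - d) = s c - s d"
    and mult: "\<And>c d. s (c * d) = s c * s d" and one: "s 1 = 1" and zero: "s 0 = 0"
    and comm: "\<And>c. s c * x = x * s (c :: 'c::ring_1)"
  shows "\<exists>c. prod_list (map (\<lambda>p. x - s (y p)) ps) = x ^ length ps + (\<Sum>a<length ps. s (c a) * x ^ a)"
proof (induction ps)
  case (Cons p ps)
  then obtain c where c: "prod_list (map (\<lambda>p. x - s (y p)) ps) = x ^ length ps + (\<Sum>a<length ps. s (c a) * x ^ a)"
    by blast
  let ?m = "length ps"
  \<comment> \<open>Multiplication by \<open>x - y_p\<close> shifts the coefficients by one and
    subtracts \<open>y_p\<close> times the old ones; the old coefficient at index \<open>?m\<close>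
    is the leading 1.\<close>
  define d where "d a = (case a of 0 \<Rightarrow> 0 | Suc b \<Rightarrow> c b) - y p * (if a = ?m then 1 else c a)" for a
  have "(\<Sum>a<Suc ?m. s (d a) * x ^ a)
      = (\<Sum>a<Suc ?m. s (case a of 0 \<Rightarrow> 0 | Suc b \<Rightarrow> c b) * x ^ a)
        - (\<Sum>a<Suc ?m. s (y p) * (s (if a = ?m then 1 else c a) * x ^ a))"
    by (simp add: d_def diff mult left_diff_distrib sum_subtractf mult.assoc)
  also have "(\<Sum>a<Suc ?m. s (case a of 0 \<Rightarrow> 0 | Suc b \<Rightarrow> c b) * x ^ a) = (\<Sum>a<?m. s (c a) * x ^ Suc a)"
    by (subst sum.lessThan_Suc_shift) (simp add: zero)
  also have "\<dots> = x * (\<Sum>a<?m. s (c a) * x ^ a)"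
    by (simp add: sum_distrib_left flip: mult.assoc comm)
  also have "(\<Sum>a<Suc ?m. s (y p) * (s (if a = ?m then 1 else c a) * x ^ a))
      = s (y p) * (x ^ ?m + (\<Sum>a<?m. s (c a) * x ^ a))"
    by (simp add: one sum_distrib_left distrib_left add.commute)
  finally show ?case
    by (intro exI[of _ d]) (simp add: c left_diff_distrib distrib_left add.commute)
qed simp

text \<open>At level 0 the cyclotomic polynomial is monic of degree \<open>r\<close> and allows
  reduction. At higher levels \<open>x_{n+1}^r\<close> is conjugated to
  \<open>\<tau>_n x_n^r \<tau>_n\<close>; its middle lies in \<open>Fr n\<close> and is rewritten by
  the induction hypothesis, while the corrections involve lower powers only.\<close>

lemma mackey_x_pow_CARD:
  assumes IH: "n = 0 \<or> (\<exists>m. n = Suc m \<and> Fr n \<subseteq> (mackey m :: ('a::idom, 'r::{finite,linorder}) nc_poly set))"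
  shows "xgen (Suc n) ^ CARD('r) \<in> (mackey n :: ('a, 'r) nc_poly set)"
proof (cases "n = 0")
  case True
  let ?x = "xgen 1 :: ('a, 'r) nc_poly"
  obtain c where c: "(cyc_poly :: ('a, 'r) nc_poly) = ?x ^ CARD('r) + (\<Sum>a<CARD('r). scal (c a) * ?x ^ a)"
    using prod_list_expand[of scal ?x, OF scal_add scal_diff scal_mult scal_one scal_zero scal_central,
        of yvar "sorted_list_of_set UNIV"]
    by (auto simp: cyc_poly_def)
  have "cg 1 (?x ^ CARD('r)) (- (\<Sum>a<CARD('r). scal (c a) * ?x ^ a))"
    using cyc_poly_in_rel_ideal[of 1] c by (auto simp: cg_def)
  moreover have "- (\<Sum>a<CARD('r). scal (c a) * ?x ^ a) \<in> mackey 0"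
    by (intro mackey_minus mackey_sum) (auto intro!: mackey.x[where n = 0, simplified])
  ultimately show ?thesis using True mackey_cg[where n = 0] by (simp flip: One_nat_def)
next
  case False
  then obtain m where n: "n = Suc m" and sub: "Fr n \<subseteq> (mackey m :: ('a, 'r) nc_poly set)" using IH by auto
  let ?X = "xgen (Suc n) :: ('a, 'r) nc_poly" and ?x = "xgen n :: ('a, 'r) nc_poly"
  let ?T = "taugen n :: ('a, 'r) nc_poly" and ?h = "scal hbar :: ('a, 'r) nc_poly" and ?r = "CARD('r)"
  let ?S = "\<Sum>u<?r. ?x ^ u * ?X ^ (?r - Suc u)"
  have "cg (Suc n) (?X ^ ?r * (?T * ?T)) (?T * ?x ^ ?r * ?T + ?h * ?S * ?T)"
    using cg_right[OF x_pow_t[of n ?r], of ?T] n by (simp add: distrib_right mult.assoc)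
  moreover have "cg (Suc n) (?X ^ ?r * (?T * ?T)) (?X ^ ?r * 1)"
    using n rel_sq[of n "Suc n"] by (intro cg_left) (auto simp: cg_def)
  ultimately have "cg (Suc n) (?X ^ ?r) (?T * ?x ^ ?r * ?T + ?h * (\<Sum>u<?r. ?x ^ u * (?X ^ (?r - Suc u) * ?T)))"
    using cg_trans[OF cg_sym] by (simp add: sum_distrib_right mult.assoc)
  moreover have "?T * ?x ^ ?r * ?T \<in> mackey n"
    using mackey_tat[of m "?x ^ ?r"] sub n by auto
  moreover have "?h * (\<Sum>u<?r. ?x ^ u * (?X ^ (?r - Suc u) * ?T)) \<in> mackey n"
    using n by (intro mackey_left mackey_sum mackey_x_pow_t) auto
  ultimately show ?thesis using mackey_cg mackey.add by blast
qed

lemma mackey_right_x: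
  assumes IH: "n = 0 \<or> (\<exists>m. n = Suc m \<and> Fr n \<subseteq> (mackey m :: ('a::idom, 'r::{finite,linorder}) nc_poly set))"
  shows "f \<in> (mackey n :: ('a, 'r) nc_poly set) \<Longrightarrow> f * xgen (Suc n) \<in> mackey n"
proof (induction rule: mackey.induct)
  case (x a i)
  have "xgen (Suc n) ^ Suc i \<in> (mackey n :: ('a, 'r) nc_poly set)"
  proof (cases "Suc i = CARD('r)")
    case True
    then show ?thesis using mackey_x_pow_CARD[OF IH] by metis
  next
    case False
    have "1 * xgen (Suc n) ^ Suc i \<in> (mackey n :: ('a, 'r) nc_poly set)"
      using False x by (intro mackey.x) auto
    then show ?thesis by simp
  qed
  from mackey_left[OF this x(1)] show ?case by (simp add: mult.assoc power_commutes)
next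
  case (t a b)
  let ?X = "xgen (Suc n) :: ('a, 'r) nc_poly" and ?T = "taugen n :: ('a, 'r) nc_poly"
  have a: "a \<in> Fr (Suc n)" and b: "b \<in> Fr (Suc n)" using t by (auto intro: Fr_Suc)
  have "cg (Suc n) (a * ?T * (b * ?X)) (a * ?T * (?X * b))"
    using t a by (intro cg_left[OF cg_sym[OF x_comm]] Fr_mult Fr_taugen) auto
  also have "a * ?T * (?X * b) = a * (?T * ?X) * b" by (simp add: mult.assoc)
  also have "cg (Suc n) \<dots> (a * (xgen n * ?T + scal hbar) * b)"
  proof -
    have "cg (Suc n) (?T * ?X) (xgen n * ?T + scal hbar)"
      using rel_tx[of n "Suc n" "Suc n"] t by (simp add: cg_def diff_diff_eq)
    then show ?thesis using a b by (intro cg_right cg_left)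
  qed
  also have "a * (xgen n * ?T + scal hbar) * b = (a * xgen n) * ?T * b + (a * scal hbar * b) * ?X ^ 0"
    by (simp add: distrib_left distrib_right mult.assoc)
  finally have "cg (Suc n) (a * ?T * b * ?X) \<dots>" by (simp add: mult.assoc)
  moreover have "(a * xgen n) * ?T * b + (a * scal hbar * b) * ?X ^ 0 \<in> mackey n"
    using t by (intro mackey.add mackey.t mackey.x) auto
  ultimately show ?case using mackey_cg by blast
next
  case (add f g)
  then show ?case by (simp add: distrib_right mackey.add)
next
  case (J f)
  then show ?case by (intro mackey.J rel_ideal_closed(7)) auto
qed

lemma mackey_right_t:
  assumes n: "n = Suc m" and IH: "Fr n \<subseteq> (mackey m :: ('a::idom, 'r::{finite,linorder}) nc_poly set)"
  shows "f \<in> (mackey n :: ('a, 'r) nc_poly set) \<Longrightarrow> f * taugen n \<in> mackey n"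
proof (induction rule: mackey.induct)
  case (x a i)
  then show ?case using mackey_left[OF mackey_x_pow_t[of n i], of a] n by (simp add: mult.assoc)
next
  case (t a b)
  then show ?case using mackey_left[OF mackey_tat[of m b], of a] n IH by (simp add: mult.assoc)
next
  case (add f g)
  then show ?case by (simp add: distrib_right mackey.add)
next
  case (J f)
  then show ?case using n by (intro mackey.J rel_ideal_closed(7)) auto
qed

text \<open>The Mackey span contains the scalars and is stable under right multiplication:
  generators of level \<open>n\<close> are absorbed on the right, and \<open>x_{n+1}\<close> and
  \<open>\<tau>_n\<close> are handled by \<open>mackey_right_x\<close> and
  \<open>mackey_right_t\<close>. Induction on the level is needed for products
  \<open>\<tau>_n b \<tau>_n\<close> and for the power \<open>x_{n+1}^r\<close>.\<close>

theorem Fr_subset_mackey: "Fr (Suc n) \<subseteq> (mackey n :: ('a::idom, 'r::{finite,linorder}) nc_poly set)"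
proof (induction n)
  case 0
  have IH: "(0::nat) = 0 \<or> (\<exists>m. 0 = Suc m \<and> Fr 0 \<subseteq> (mackey m :: ('a, 'r) nc_poly set))" by simp
  show ?case
  proof
    fix f :: "('a, 'r) nc_poly" assume "f \<in> Fr (Suc 0)"
    then show "f \<in> mackey 0"
    proof (induction rule: Fr_induct)
      case (scal c)
      then show ?case using mackey.x[of "scal c" 0 0] by simp
    next
      case (x f k)
      then have "k = Suc 0" by simp
      then show ?case using mackey_right_x[OF IH x.IH] by simp
    qed (auto intro: mackey.add)
  qed
next
  case (Suc m)
  have IH: "Suc m = 0 \<or> (\<exists>m'. Suc m = Suc m' \<and> Fr (Suc m) \<subseteq> (mackey m' :: ('a, 'r) nc_poly set))" using Suc by simp
  show ?case
  proof
    fix f :: "('a, 'r) nc_poly" assume "f \<in> Fr (Suc (Suc m))"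
    then show "f \<in> mackey (Suc m)"
    proof (induction rule: Fr_induct)
      case (scal c)
      then show ?case using mackey.x[of "scal c" "Suc m" 0] by simp
    next
      case (x f k)
      show ?case
      proof (cases "k = Suc (Suc m)")
        case True
        then show ?thesis using mackey_right_x[OF IH x.IH] by simp
      next
        case False
        then show ?thesis using x by (intro mackey_right) auto
      qed
    next
      case (tau f k)
      show ?case
      proof (cases "k = Suc m")
        case True
        then show ?thesis using mackey_right_t[OF HOL.refl Suc tau.IH] by simp
      next
        case False
        then show ?thesis using tau by (intro mackey_right) auto
      qed
    qed (auto intro: mackey.add)
  qed
qed

section \<open>Linear independence of the monomials\<close>

type_synonym ('a, 'r) vec = "'r config \<Rightarrow> ('a, 'r) frac"
type_synonym ('a, 'r) opr = "('a, 'r) vec endo"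

definition hf :: "('a::idom, 'r::{finite,linorder}) frac" where
  "hf = to_fract hbar"

definition yf :: "'r::{finite,linorder} \<Rightarrow> ('a::idom, 'r) frac" where
  "yf p = to_fract (yvar p)"

lemma yvar_inj:
  assumes "yvar p = (yvar q :: ('a::idom, 'r::{finite,linorder}) base)"
  shows "p = q"
proof -
  let ?m = "\<lambda>p :: 'r. Poly_Mapping.single (Some p) (1::nat)"
  have "Poly_Mapping.lookup (yvar q :: ('a, 'r) base) (?m p) = 1"
    unfolding assms[symmetric] by (simp add: yvar_def)
  then have "?m q = ?m p"
    unfolding yvar_def by (metis lookup_single_not_eq zero_neq_one)
  then have "Poly_Mapping.lookup (?m q) (Some p) = 1" by simp
  then show ?thesis by (metis lookup_single_not_eq option.inject zero_neq_one)
qed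

lemma inj_yf: "inj (yf :: 'r::{finite,linorder} \<Rightarrow> ('a::idom, 'r) frac)"
  by (rule injI) (simp add: yf_def yvar_inj)

definition tau :: "nat \<Rightarrow> ('a::idom, 'r::{finite,linorder}) opr" where
  "tau = To hf yf"

interpretation jm: jm_ring "tau :: nat \<Rightarrow> ('a::idom, 'r::{finite,linorder}) opr" "X1 yf" "Sc hf"
proof
  show "tau k * tau k = (1 :: ('a, 'r) opr)" for k
    unfolding tau_def by (rule To_square[OF inj_yf])
  show "tau k * tau (Suc k) * tau k = (tau (Suc k) * tau k * tau (Suc k) :: ('a, 'r) opr)" for k
    unfolding tau_def by (rule To_braid[OF inj_yf])
  show "Suc k < l \<Longrightarrow> tau k * tau l = (tau l * tau k :: ('a, 'r) opr)" for k l
    unfolding tau_def by (rule To_far_less[OF inj_yf])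
  show "Sc hf * tau k = (tau k * Sc hf :: ('a, 'r) opr)" for k
    unfolding tau_def by (rule Sc_To)
  show "Sc hf * X1 yf = (X1 yf * Sc hf :: ('a, 'r) opr)"
    unfolding X1_def by (rule Sc_Mu)
  show "1 < k \<Longrightarrow> X1 yf * tau k = (tau k * X1 yf :: ('a, 'r) opr)" for k
    unfolding tau_def by (rule X1_To)
  show "X1 yf * (tau 1 * X1 yf * tau 1 + Sc hf * tau 1)
      = ((tau 1 * X1 yf * tau 1 + Sc hf * tau 1) * X1 yf :: ('a, 'r) opr)"
    unfolding tau_def by (rule X1_X2[OF inj_yf])
qed

definition x_op :: "nat \<Rightarrow> ('a::idom, 'r::{finite,linorder}) opr" where
  "x_op = jm.X"

lemma Sc_tau: "Sc c * tau k = tau k * Sc c"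
  unfolding tau_def by (rule Sc_To)

lemma comm_mult:
  fixes a b c :: "'b::semigroup_mult"
  assumes "a * b = b * a" "a * c = c * a"
  shows "a * (b * c) = b * c * a"
  using assms by (metis mult.assoc)

lemma Sc_comm: "Sc a * Sc b = Sc b * Sc a"
  unfolding Sc_hom(2)[symmetric] by (simp only: mult.commute[of a b])

lemma Sc_x_op: "Sc c * x_op k = x_op k * (Sc c :: ('a::idom, 'r::{finite,linorder}) opr)"
  unfolding x_op_def
proof (induction k)
  case 0
  show ?case unfolding jm.X.simps by (simp add: X1_def Sc_Mu)
next
  case (Suc k)
  show ?case
  proof (cases "k = 0")
    case True
    then show ?thesis by (simp add: jm.X_one) (simp add: X1_def Sc_Mu)
  next
    case False
    have "Sc c * (tau k * jm.X k * tau k) = tau k * jm.X k * tau k * (Sc c :: ('a, 'r) opr)"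
      by (intro comm_mult Suc Sc_tau)
    moreover have "Sc c * (Sc hf * tau k) = Sc hf * tau k * (Sc c :: ('a, 'r) opr)"
      by (intro comm_mult Sc_comm Sc_tau)
    ultimately show ?thesis using False
      by (simp add: jm.X_Suc distrib_left distrib_right)
  qed
qed

section \<open>Evaluation of words as operators\<close>

fun gen_op :: "gen \<Rightarrow> ('a::idom, 'r::{finite,linorder}) opr" where
  "gen_op (GTau k) = tau k"
| "gen_op (GX k) = x_op k"

definition word_op :: "gen word \<Rightarrow> ('a::idom, 'r::{finite,linorder}) opr" where
  "word_op w = prod_list (map gen_op (letters w))"

definition ev :: "('a::idom, 'r::{finite,linorder}) nc_poly \<Rightarrow> ('a, 'r) opr" where
  "ev f = (\<Sum>w\<in>Poly_Mapping.keys f. Sc (to_fract (Poly_Mapping.lookup f w)) * word_op w)"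

lemma word_op_simps [simp]: "word_op 0 = 1" "word_op (u + v) = word_op u * word_op v"
  by (simp_all add: word_op_def)

lemma Sc_word_op: "Sc c * word_op w = word_op w * (Sc c :: ('a::idom, 'b::{finite,linorder}) opr)"
proof -
  have "Sc c * prod_list (map gen_op l) = prod_list (map gen_op l) * (Sc c :: ('a, 'b) opr)" for l
  proof (induction l)
    case (Cons g l)
    have "Sc c * gen_op g = gen_op g * (Sc c :: ('a, 'b) opr)" by (cases g) (simp_all add: Sc_tau Sc_x_op)
    from comm_mult[OF this Cons] show ?case by simp
  qed simp
  then show ?thesis by (simp add: word_op_def)
qed

lemma ev_superset:
  "finite K \<Longrightarrow> Poly_Mapping.keys f \<subseteq> K \<Longrightarrow> ev f = (\<Sum>w\<in>K. Sc (to_fract (Poly_Mapping.lookup f w)) * word_op w)"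
  unfolding ev_def by (rule sum.mono_neutral_left) (auto simp: in_keys_iff Sc_hom)

lemma ev_add: "ev (f + g) = ev f + ev g"
proof -
  let ?K = "Poly_Mapping.keys f \<union> Poly_Mapping.keys g"
  have "ev (f + g) = (\<Sum>w\<in>?K. Sc (to_fract (Poly_Mapping.lookup (f + g) w)) * word_op w)"
    by (rule ev_superset) (auto dest: subsetD[OF keys_add])
  also have "\<dots> = (\<Sum>w\<in>?K. Sc (to_fract (Poly_Mapping.lookup f w)) * word_op w)
      + (\<Sum>w\<in>?K. Sc (to_fract (Poly_Mapping.lookup g w)) * word_op w)"
    by (simp add: lookup_add Sc_hom distrib_right sum.distrib)
  also have "\<dots> = ev f + ev g"
    using ev_superset[of ?K f] ev_superset[of ?K g] by simp
  finally show ?thesis .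
qed

lemma ev_zero [simp]: "ev 0 = 0"
  by (simp add: ev_def)

lemma ev_sum: "ev (\<Sum>i\<in>I. f i) = (\<Sum>i\<in>I. ev (f i))"
  by (induction I rule: infinite_finite_induct) (simp_all add: ev_add)

lemma ev_uminus: "ev (- f) = - ev f"
  using ev_add[of f "- f"] by (simp add: eq_neg_iff_add_eq_0 add.commute)

lemma ev_diff: "ev (f - g) = ev f - ev g"
  using ev_add[of f "- g"] by (simp add: ev_uminus)

lemma ev_single: "ev (Poly_Mapping.single w c) = Sc (to_fract c) * word_op w"
  by (cases "c = 0") (simp_all add: ev_def Sc_hom)

lemma ev_mult: "ev (f * g) = (ev f * ev g :: ('a::idom, 'b::{finite,linorder}) opr)"
proof -
  have s: "ev (Poly_Mapping.single w c * Poly_Mapping.single v d)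
      = ev (Poly_Mapping.single w c) * ev (Poly_Mapping.single v d)" for w v and c d :: "('a, 'b) base"
  proof -
    have "Sc (to_fract d) * (word_op w * F) = word_op w * (Sc (to_fract d) * (F :: ('a, 'b) opr))" for F
      using Sc_word_op[of "to_fract d" w] by (simp flip: mult.assoc)
    then show ?thesis by (simp add: mult_single ev_single Sc_hom mult.assoc)
  qed
  show ?thesis
    by (subst (1 2) poly_mapping_sum_single[of f], subst (1 2) poly_mapping_sum_single[of g])
      (simp add: sum_distrib_left sum_distrib_right ev_sum s)
qed

lemma ev_scal: "ev (scal c) = Sc (to_fract c)"
  by (simp add: scal_def ev_single)

lemma ev_one [simp]: "ev 1 = 1"
  using ev_scal[of 1] by (simp add: scal_one Sc_hom)

lemma ev_power: "ev (f ^ k) = ev f ^ k"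
  by (induction k) (simp_all add: ev_mult)

lemma ev_xgen: "ev (xgen k) = x_op k" and ev_taugen: "ev (taugen k) = tau k"
  by (simp_all add: xgen_def taugen_def ev_single word_op_def Sc_hom)

lemma Sc_ev: "Sc c * ev f = ev f * (Sc c :: ('a::idom, 'b::{finite,linorder}) opr)"
proof -
  have "Sc c * (Sc d * word_op w) = Sc d * word_op w * (Sc c :: ('a, 'b) opr)" for d w
    by (intro comm_mult Sc_comm Sc_word_op)
  then show ?thesis by (simp add: ev_def sum_distrib_left sum_distrib_right)
qed

lemma ev_relation:
  assumes "f \<in> affine_relations n"
  shows "ev f = (0 :: ('a::idom, 'r::{finite,linorder}) opr)"
  using assms unfolding affine_relations_def Un_iff mem_Collect_eq
proof (elim disjE exE conjE)
  fix k l assume "f = xgen k * xgen l - xgen l * xgen k" "k \<in> {1..n}" "l \<in> {1..n}"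
  moreover have "x_op k * x_op l = (x_op l * x_op k :: ('a, 'r) opr)"
    unfolding x_op_def using calculation by (intro jm.X_commute) auto
  ultimately show ?thesis by (simp add: ev_diff ev_mult ev_xgen)
next
  fix k l assume f: "f = taugen k * taugen l - taugen l * taugen k" and "k \<in> {1..<n}" "l \<in> {1..<n}" "\<bar>int k - int l\<bar> > 1"
  then consider "1 \<le> k" "Suc k < l" | "1 \<le> l" "Suc l < k" by fastforce
  then have "tau k * tau l = (tau l * tau k :: ('a, 'r) opr)"
    by cases (auto intro: jm.T_far jm.T_far[symmetric])
  then show ?thesis unfolding f by (simp add: ev_diff ev_mult ev_taugen)
next
  fix l assume "f = taugen l * taugen l - 1" "l \<in> {1..<n}"
  moreover have "tau l * tau l = (1 :: ('a, 'r) opr)"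
    using calculation by (intro jm.T_sq) auto
  ultimately show ?thesis by (simp add: ev_diff ev_mult ev_taugen)
next
  fix k l assume f: "f = taugen k * xgen l - xgen (transpose k (k + 1) l) * taugen k
      - scal (hbar * (of_bool (l = k + 1) - of_bool (l = k)))" and kl: "k \<in> {1..<n}" "l \<in> {1..n}"
  consider "l = k" | "l = Suc k" | "l < k" | "Suc k < l" by linarith
  then show ?thesis
  proof cases
    case 1
    moreover have "tau k * x_op k = (x_op (Suc k) * tau k - Sc hf :: ('a, 'r) opr)"
      unfolding x_op_def using kl by (intro jm.T_X) auto
    ultimately show ?thesis unfolding f using kl
      by (simp add: ev_diff ev_mult ev_taugen ev_xgen ev_scal Sc_hom hf_def)
  next
    case 2
    moreover have "tau k * x_op (Suc k) = (x_op k * tau k + Sc hf :: ('a, 'r) opr)"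
      unfolding x_op_def using kl by (intro jm.T_X_Suc) auto
    ultimately show ?thesis unfolding f using kl
      by (simp add: ev_diff ev_mult ev_taugen ev_xgen ev_scal Sc_hom hf_def)
  next
    case 3
    moreover have "x_op l * tau k = (tau k * x_op l :: ('a, 'r) opr)"
      unfolding x_op_def using kl calculation by (intro jm.X_T_less) auto
    ultimately show ?thesis unfolding f using kl
      by (simp add: ev_diff ev_mult ev_taugen ev_xgen ev_scal Sc_hom transpose_apply_other)
  next
    case 4
    moreover have "x_op l * tau k = (tau k * x_op l :: ('a, 'r) opr)"
      unfolding x_op_def using kl calculation by (intro jm.X_T_greater) auto
    ultimately show ?thesis unfolding f using kl
      by (simp add: ev_diff ev_mult ev_taugen ev_xgen ev_scal Sc_hom transpose_apply_other)
  qed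
next
  fix k assume "f = taugen (k + 1) * taugen k * taugen (k + 1) - taugen k * taugen (k + 1) * taugen k" "1 \<le> k"
  moreover have "tau k * tau (Suc k) * tau k = (tau (Suc k) * tau k * tau (Suc k) :: ('a, 'r) opr)"
    using calculation by (intro jm.T_braid) auto
  ultimately show ?thesis by (simp add: ev_diff ev_mult ev_taugen)
qed

lemma ev_cyc_poly: "ev cyc_poly = (0 :: ('a::idom, 'r::{finite,linorder}) opr)"
proof -
  have "ev (prod_list (map (\<lambda>p. xgen 1 - scal (yvar p)) ps)) = (prod_list (map (\<lambda>p. X1 yf - Sc (yf p)) ps) :: ('a, 'r) opr)"
    for ps :: "'r list"
    by (induction ps) (simp_all add: ev_mult ev_diff ev_xgen ev_scal x_op_def jm.X_one flip: yf_def)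
  then show ?thesis
    unfolding cyc_poly_def by (simp only: X1_cyclotomic[OF set_sorted_list_of_set[OF finite]])
qed

lemma ev_rel_ideal: "f \<in> rel_ideal n \<Longrightarrow> ev f = (0 :: ('a::idom, 'r::{finite,linorder}) opr)"
proof -
  let ?Z = "{f \<in> Fr n. ev f = (0 :: ('a, 'r) opr)}"
  have "ideal ?Z (free_algebra n)"
  proof (rule idealI)
    show "subgroup ?Z (add_monoid (free_algebra n))"
    proof (rule group.subgroupI)
      show "Group.group (add_monoid (free_algebra n :: ('a, 'r) nc_poly ring))"
        by (rule abelian_group.a_group[OF ring.is_abelian_group[OF ring_free_algebra]])
      fix f g assume f: "f \<in> ?Z" and g: "g \<in> ?Z"
      show "inv\<^bsub>add_monoid (free_algebra n)\<^esub> f \<in> ?Z"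
        using f free_algebra_minus(1)[of f n f] by (auto simp: a_inv_def ev_uminus)
      show "f \<otimes>\<^bsub>add_monoid (free_algebra n)\<^esub> g \<in> ?Z" using f g by (auto simp: ev_add)
    next
      show "?Z \<noteq> {}" using ev_zero by blast
    qed auto
  qed (auto simp: ev_mult ring_free_algebra)
  moreover have "affine_relations n \<subseteq> ?Z"
    using affine_relations_Fr ev_relation by blast
  moreover have "0 < n \<Longrightarrow> cyc_poly \<in> ?Z"
    using cyc_poly_Fr ev_cyc_poly by blast
  ultimately have "rel_ideal n \<subseteq> ?Z" by (rule rel_ideal_least)
  then show "f \<in> rel_ideal n \<Longrightarrow> ev f = 0" by blast
qed

lemma ev_cg: "cg n f g \<Longrightarrow> ev f = ev g"
  using ev_rel_ideal[of "f - g" n] by (simp add: cg_def ev_diff)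


subsection \<open>Spanning sets\<close>

text \<open>For \<open>j \<le> n\<close> the word of the index \<open>(j, a)\<close> is
  \<open>\<tau>_n ... \<tau>_{j+1} x_{j+1}^a\<close>: a coset representative of the symmetric group
  on \<open>n\<close> points in the one on \<open>n + 1\<close> points, times a power.\<close>

primrec basis_word :: "nat \<Rightarrow> nat \<times> nat \<Rightarrow> ('a::idom, 'r::{finite,linorder}) nc_poly" where
  "basis_word 0 i = xgen 1 ^ snd i"
| "basis_word (Suc n) i = (if fst i = Suc n then xgen (Suc (Suc n)) ^ snd i else taugen (Suc n) * basis_word n i)"

definition basis_idx :: "'r::{finite,linorder} itself \<Rightarrow> nat \<Rightarrow> (nat \<times> nat) set" where
  "basis_idx _ n = {..n} \<times> {..<CARD('r)}"

lemma basis_idx_basic [simp]: "finite (basis_idx R n)" "card (basis_idx (R :: 'r::{finite,linorder} itself) n) = Suc n * CARD('r)"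
  by (simp_all add: basis_idx_def)

lemma basis_word_Fr: "fst i \<le> n \<Longrightarrow> basis_word n i \<in> Fr (Suc n)"
proof (induction n)
  case 0
  then show ?case by simp
next
  case (Suc n)
  then show ?case by (auto intro!: Fr_mult Fr_power intro: Fr_Suc)
qed

lemma basis_word_top: "basis_word n (n, a) = xgen (Suc n) ^ a"
  by (cases n) simp_all

lemma sum_basis_idx:
  fixes g :: "nat \<times> nat \<Rightarrow> 'b::comm_monoid_add"
  shows "(\<Sum>i\<in>basis_idx (R :: 'r::{finite,linorder} itself) (Suc n). g i)
    = (\<Sum>a<CARD('r). g (Suc n, a)) + (\<Sum>i\<in>basis_idx R n. g i)"
proof -
  have "basis_idx R (Suc n) = Pair (Suc n) ` {..<CARD('r)} \<union> basis_idx R n"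
    by (auto simp: basis_idx_def)
  moreover have "Pair (Suc n) ` {..<CARD('r)} \<inter> basis_idx R n = {}"
    by (auto simp: basis_idx_def)
  ultimately have "(\<Sum>i\<in>basis_idx R (Suc n). g i) = (\<Sum>i\<in>Pair (Suc n) ` {..<CARD('r)}. g i) + (\<Sum>i\<in>basis_idx R n. g i)"
    by (simp add: sum.union_disjoint)
  then show ?thesis by (simp add: sum.reindex inj_on_def)
qed

lemma sum_basis_idx_0:
  fixes g :: "nat \<times> nat \<Rightarrow> 'b::comm_monoid_add"
  shows "(\<Sum>i\<in>basis_idx (R :: 'r::{finite,linorder} itself) 0. g i) = (\<Sum>a<CARD('r). g (0, a))"
proof -
  have "basis_idx R 0 = Pair 0 ` {..<CARD('r)}" by (auto simp: basis_idx_def)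
  then show ?thesis by (simp add: sum.reindex inj_on_def)
qed

lemma cg_mono: "cg n f g \<Longrightarrow> cg (Suc n) f g"
  using rel_ideal_mono by (auto simp: cg_def)

lemma cg_sum: "(\<And>i. i \<in> I \<Longrightarrow> cg n (f i) (g i)) \<Longrightarrow> cg n (sum f I) (sum g I)"
  by (induction I rule: infinite_finite_induct) (auto intro: cg_add)

text \<open>In a term \<open>a \<tau>_n b\<close> the factor \<open>b\<close> is expanded first, one
  level lower. Its coefficients then commute with \<open>\<tau>_n\<close> and join \<open>a\<close>
  on the left, and \<open>\<tau>_n\<close> times a basis word is the next basis word.\<close>

lemma basis_word_span:
  fixes f :: "('a::idom, 'r::{finite,linorder}) nc_poly"
  assumes "f \<in> Fr (Suc n)"
  shows "\<exists>\<alpha>. (\<forall>i. \<alpha> i \<in> Fr n) \<and> cg (Suc n) f (\<Sum>i\<in>basis_idx TYPE('r) n. \<alpha> i * basis_word n i)"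
  using assms
proof (induction n arbitrary: f rule: less_induct)
  case (less n)
  have "f \<in> mackey n" using less.prems Fr_subset_mackey by blast
  then show ?case
  proof (induction rule: mackey.induct)
    case (x a j)
    have "(\<Sum>i\<in>basis_idx TYPE('r) n. (if i = (n, j) then a else 0) * basis_word n i) = a * xgen (Suc n) ^ j"
    proof -
      have "(\<Sum>i\<in>basis_idx TYPE('r) n. (if i = (n, j) then a else 0) * basis_word n i)
          = (\<Sum>i\<in>basis_idx TYPE('r) n. if i = (n, j) then a * basis_word n i else 0)"
        by (rule sum.cong) auto
      then show ?thesis using x by (simp add: basis_word_top basis_idx_def)
    qed
    then show ?case using x by (intro exI[of _ "\<lambda>i. if i = (n, j) then a else 0"]) simp
  next
    case (t a b)
    then obtain m where n: "n = Suc m" by (cases n) auto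
    obtain \<beta> where b: "\<forall>i. \<beta> i \<in> Fr m" "cg (Suc m) b (\<Sum>i\<in>basis_idx TYPE('r) m. \<beta> i * basis_word m i)"
      using less.IH[of m b] t n by auto
    let ?T = "taugen n :: ('a, 'r) nc_poly"
    have T: "?T \<in> Fr (Suc n)" and a: "a \<in> Fr (Suc n)" using t by (auto intro: Fr_Suc)
    have "cg (Suc n) (a * ?T * b) (a * ?T * (\<Sum>i\<in>basis_idx TYPE('r) m. \<beta> i * basis_word m i))"
      using cg_mono[OF b(2)] n T a by (intro cg_left Fr_mult) auto
    also have "\<dots> = (\<Sum>i\<in>basis_idx TYPE('r) m. a * (?T * \<beta> i) * basis_word m i)"
      by (simp add: sum_distrib_left mult.assoc)
    also have "cg (Suc n) \<dots> (\<Sum>i\<in>basis_idx TYPE('r) m. a * (\<beta> i * ?T) * basis_word m i)"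
    proof (rule cg_sum)
      fix i assume "i \<in> basis_idx TYPE('r) m"
      then have "basis_word m i \<in> Fr (Suc n)" using n Fr_Suc[OF basis_word_Fr[of i m]] by (auto simp: basis_idx_def)
      then show "cg (Suc n) (a * (?T * \<beta> i) * basis_word m i) (a * (\<beta> i * ?T) * basis_word m i)"
        using t_comm[of "\<beta> i" m] b(1) n by (intro cg_right cg_left a) auto
    qed
    also have "\<dots> = (\<Sum>i\<in>basis_idx TYPE('r) m. a * \<beta> i * basis_word n i)"
      using n by (intro sum.cong) (auto simp: mult.assoc basis_idx_def)
    also have "\<dots> = (\<Sum>i\<in>basis_idx TYPE('r) n. (if fst i = n then 0 else a * \<beta> i) * basis_word n i)"
      unfolding n sum_basis_idx by (auto intro!: sum.cong simp: basis_idx_def)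
    finally have "cg (Suc n) (a * ?T * b) (\<Sum>i\<in>basis_idx TYPE('r) n. (if fst i = n then 0 else a * \<beta> i) * basis_word n i)" .
    moreover have "\<forall>i. (if fst i = n then 0 else a * \<beta> i) \<in> Fr n"
      using b(1) n t by (auto intro!: Fr_mult intro: Fr_Suc)
    ultimately show ?case by (intro exI[of _ "\<lambda>i. if fst i = n then 0 else a * \<beta> i"]) auto
  next
    case (add f g)
    then obtain \<alpha> \<beta> where "\<forall>i. \<alpha> i \<in> Fr n" "cg (Suc n) f (\<Sum>i\<in>basis_idx TYPE('r) n. \<alpha> i * basis_word n i)"
      "\<forall>i. \<beta> i \<in> Fr n" "cg (Suc n) g (\<Sum>i\<in>basis_idx TYPE('r) n. \<beta> i * basis_word n i)" by blast
    then show ?case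
      by (intro exI[of _ "\<lambda>i. \<alpha> i + \<beta> i"]) (auto simp: distrib_right sum.distrib cg_add)
  next
    case (J f)
    then show ?case by (intro exI[of _ "\<lambda>i. 0"]) (auto simp: cg_def)
  qed
qed

primrec monomials :: "nat \<Rightarrow> ('a::idom, 'r::{finite,linorder}) nc_poly set" where
  "monomials 0 = {1}"
| "monomials (Suc n) = (\<lambda>(b, i). b * basis_word n i) ` (monomials n \<times> basis_idx TYPE('r) n)"

lemma finite_monomials [simp]: "finite (monomials n)"
  by (induction n) auto

text \<open>The monomials are collected as a set, so coincidences between products are not excluded
  at this stage and only an upper bound is available. Equality is a result of the dimension
  count.\<close>

lemma card_monomials_le: "card (monomials n :: ('a::idom, 'r::{finite,linorder}) nc_poly set) \<le> CARD('r) ^ n * fact n"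
proof (induction n)
  case (Suc n)
  have "card (monomials (Suc n) :: ('a, 'r) nc_poly set) \<le> card ((monomials n :: ('a, 'r) nc_poly set) \<times> basis_idx TYPE('r) n)"
    unfolding monomials.simps by (rule card_image_le) auto
  also have "\<dots> \<le> CARD('r) ^ n * fact n * (Suc n * CARD('r))"
    using Suc by (simp only: card_cartesian_product basis_idx_basic) (rule mult_le_mono1)
  finally show ?case by (simp add: algebra_simps)
qed simp

lemma monomials_Fr: "b \<in> monomials n \<Longrightarrow> b \<in> Fr n"
proof (induction n arbitrary: b)
  case (Suc n)
  then show ?case by (auto intro!: Fr_mult basis_word_Fr intro: Fr_Suc simp: basis_idx_def)
qed simp

lemma monomials_span:
  fixes f :: "('a::idom, 'r::{finite,linorder}) nc_poly"
  assumes "f \<in> Fr n"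
  shows "\<exists>c. cg n f (\<Sum>b\<in>monomials n. scal (c b) * b)"
  using assms
proof (induction n arbitrary: f)
  case 0
  then show ?case
  proof (induction rule: Fr_induct)
    case (scal c)
    then show ?case by (intro exI[of _ "\<lambda>_. c"]) simp
  next
    case (add f g)
    then obtain c d where "cg 0 f (\<Sum>b\<in>monomials 0. scal (c b) * b)" "cg 0 g (\<Sum>b\<in>monomials 0. scal (d b) * b)" by blast
    then show ?case
      by (intro exI[of _ "\<lambda>b. c b + d b"]) (simp add: scal_add distrib_right sum.distrib cg_add)
  qed auto
next
  case (Suc n)
  obtain \<alpha> where \<alpha>: "\<forall>i. \<alpha> i \<in> Fr n" "cg (Suc n) f (\<Sum>i\<in>basis_idx TYPE('r) n. \<alpha> i * basis_word n i)"
    using basis_word_span[OF Suc.prems] by blast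
  have "\<forall>i. \<exists>c. cg n (\<alpha> i) (\<Sum>b\<in>monomials n. scal (c b) * b)" 
    by (rule allI, rule Suc.IH, rule spec[OF \<alpha>(1)])
  from choice[OF this] obtain c where c: "\<And>i. cg n (\<alpha> i) (\<Sum>b\<in>monomials n. scal (c i b) * b)" by (elim exE) blast
  let ?P = "(monomials n :: ('a, 'r) nc_poly set) \<times> basis_idx TYPE('r) n" and ?g = "\<lambda>(b, i). b * basis_word n i :: ('a, 'r) nc_poly"
  note \<alpha>(2)
  also have "cg (Suc n) (\<Sum>i\<in>basis_idx TYPE('r) n. \<alpha> i * basis_word n i) (\<Sum>i\<in>basis_idx TYPE('r) n. (\<Sum>b\<in>monomials n. scal (c i b) * b) * basis_word n i)"
    using cg_mono[OF c] by (intro cg_sum cg_right basis_word_Fr) (auto simp: basis_idx_def)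
  also have "\<dots> = (\<Sum>i\<in>basis_idx TYPE('r) n. \<Sum>b\<in>monomials n. scal (c i b) * (b * basis_word n i))"
    by (simp add: sum_distrib_right mult.assoc)
  also have "\<dots> = (\<Sum>p\<in>?P. scal (c (snd p) (fst p)) * ?g p)"
    by (subst sum.swap) (simp add: sum.cartesian_product case_prod_unfold)
  also have "\<dots> = (\<Sum>b\<in>?g ` ?P. \<Sum>p\<in>{p\<in>?P. ?g p = b}. scal (c (snd p) (fst p)) * ?g p)"
    by (rule sum.image_gen) simp
  also have "\<dots> = (\<Sum>b\<in>?g ` ?P. scal (\<Sum>p\<in>{p\<in>?P. ?g p = b}. c (snd p) (fst p)) * b)"
  proof (rule sum.cong[OF HOL.refl])
    fix b
    have "scal (\<Sum>p\<in>S. c (snd p) (fst p)) = (\<Sum>p\<in>S. scal (c (snd p) (fst p)))" for S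
      by (induction S rule: infinite_finite_induct) (auto simp: scal_add scal_zero)
    then show "(\<Sum>p\<in>{p\<in>?P. ?g p = b}. scal (c (snd p) (fst p)) * ?g p)
        = scal (\<Sum>p\<in>{p\<in>?P. ?g p = b}. c (snd p) (fst p)) * b"
      by (auto simp: sum_distrib_right intro!: sum.cong)
  qed
  finally have "cg (Suc n) f (\<Sum>b\<in>monomials (Suc n). scal (\<Sum>p\<in>{p\<in>?P. ?g p = b}. c (snd p) (fst p)) * b)" by simp
  then show ?case by (rule exI[where P = "\<lambda>c. cg (Suc n) f (\<Sum>b\<in>monomials (Suc n). scal (c b) * b)"])
qed


subsection \<open>Counting\<close>

interpretation vs: vector_space "\<lambda>(c :: ('a::idom, 'r::{finite,linorder}) frac) (f :: ('a, 'r) vec). (\<lambda>z. c * f z)"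
  by standard (auto simp: fun_eq_iff algebra_simps)

text \<open>The vector to which the algebra is applied. Being constant in the colours it is permuted
  by the \<open>\<tau>_k\<close> without divided differences; being supported on one labelling it
  lets permutations be told apart.\<close>

definition v0 :: "('a::idom, 'r::{finite,linorder}) vec" where
  "v0 = (\<lambda>(c, w). of_bool (w = id))"

definition Lspan :: "nat \<Rightarrow> ('a::idom, 'r::{finite,linorder}) vec set" where
  "Lspan n = vs.span ((\<lambda>b. app (ev b) v0) ` monomials n)"

lemma app_ev_scale: "app (ev f) (\<lambda>z. c * v z) = (\<lambda>z. c * app (ev f) v z)"
proof -
  have "app (Sc c * ev f) v = app (ev f * Sc c) v" by (simp only: Sc_ev)
  then show ?thesis by (simp add: app_Sc)
qed

lemma ev_v0_Lspan:
  assumes "f \<in> Fr n"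
  shows "app (ev f) v0 \<in> (Lspan n :: ('a::idom, 'r::{finite,linorder}) vec set)"
proof -
  obtain c where c: "cg n f (\<Sum>b\<in>monomials n. scal (c b) * b)" using monomials_span[OF assms] by blast
  have "app (ev f) v0 = (\<Sum>b\<in>monomials n. (\<lambda>z. to_fract (c b) * app (ev b) v0 z) :: ('a, 'r) vec)"
    unfolding ev_cg[OF c] by (simp add: ev_sum ev_mult ev_scal sum_app app_Sc)
  also have "\<dots> \<in> Lspan n"
    unfolding Lspan_def by (intro vs.span_sum vs.span_scale vs.span_base) auto
  finally show ?thesis .
qed

lemma Lspan_closed:
  assumes "g \<in> Fr n" "v \<in> Lspan n"
  shows "app (ev g) v \<in> Lspan n"
  using assms(2) unfolding Lspan_def
proof (induction rule: vs.span_induct)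
  case base
  show ?case
    by (rule vs.subspaceI)
      (auto simp: app_add app_ev_scale intro: vs.span_zero vs.span_add vs.span_scale)
next
  case (step v)
  then obtain b where "b \<in> monomials n" "v = app (ev b) v0" by auto
  then have "app (ev g) v = app (ev (g * b)) v0" by (simp add: ev_mult)
  then show ?case using ev_v0_Lspan[of "g * b" n] assms(1) monomials_Fr[OF \<open>b \<in> monomials n\<close>]
    by (simp add: Lspan_def)
qed

lemma Lspan_scale: "v \<in> Lspan n \<Longrightarrow> (\<lambda>z. c * v z) \<in> Lspan n"
  and Lspan_diff: "v \<in> Lspan n \<Longrightarrow> u \<in> Lspan n \<Longrightarrow> v - u \<in> Lspan n"
  unfolding Lspan_def by (intro vs.span_scale vs.span_diff; simp)+

lemma Lspan_v0: "v0 \<in> Lspan n"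
  using ev_v0_Lspan[of 1 n] by simp

lemma swp_swp [simp]: "swp k (swp k w) = w"
  by (simp add: swp_def fun_eq_iff)

lemma swp_eq_iff: "swp k w = v \<longleftrightarrow> w = swp k v"
  by (metis swp_swp)

lemma swp_transpose: "swp k w = w \<circ> transpose k (Suc k)"
  by (simp add: swp_def fun_eq_iff transpose_def)

text \<open>If the colour at \<open>k + 1\<close> does not matter, the two mixed values in the
  numerator equal the two values that are subtracted, and the divided difference disappears.\<close>

lemma app_tau_independent:
  fixes f :: "('a::idom, 'r::{finite,linorder}) vec"
  assumes "\<And>c w p. f (c(Suc k := p), w) = f (c, w)"
  shows "app (tau k) f (c, w) = f (swp k c, swp k w)"
proof -
  have "f (c(k := c (Suc k)), w) = f (swp k c, w)"
    using assms[of "c(k := c (Suc k))" "c k" w] by (simp add: swp_def)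
  then show ?thesis unfolding tau_def app_To using assms[of c "c k" w] by simp
qed

definition label_fn :: "((nat \<Rightarrow> 'r) \<Rightarrow> ('a::idom, 'r::{finite,linorder}) frac) \<Rightarrow> (nat \<Rightarrow> nat) \<Rightarrow> ('a, 'r) vec" where
  "label_fn H s = (\<lambda>(c, w). H c * of_bool (w = s))"

lemma Lspan_tau:
  assumes "label_fn H (swp k s) \<in> Lspan n" "1 \<le> k" "k < n"
    and "\<And>c p. H (c(Suc k := p)) = H c"
  shows "label_fn (\<lambda>c. H (swp k c)) s \<in> Lspan n"
proof -
  have "app (tau k) (label_fn H (swp k s)) = label_fn (\<lambda>c. H (swp k c)) s"
  proof (rule ext)
    fix z :: "(nat \<Rightarrow> 'a) \<times> (nat \<Rightarrow> nat)"
    obtain c w where z: "z = (c, w)" by force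
    have "app (tau k) (label_fn H (swp k s)) (c, w) = label_fn H (swp k s) (swp k c, swp k w)"
      by (rule app_tau_independent) (simp add: label_fn_def assms(4))
    then show "app (tau k) (label_fn H (swp k s)) z = label_fn (\<lambda>c. H (swp k c)) s z"
      by (simp add: z label_fn_def swp_eq_iff)
  qed
  moreover have "app (ev (taugen k)) (label_fn H (swp k s)) \<in> Lspan n"
    using assms by (intro Lspan_closed) auto
  ultimately show ?thesis by (simp add: ev_taugen)
qed

text \<open>Conjugation by adjacent transpositions reaches an arbitrary transposition; a permutation
  is then reduced by moving its largest point into place.\<close>

lemma adjacent_induct:
  assumes s: "s permutes {1..n}" and Q: "Q id"
    and step: "\<And>s k. Q s \<Longrightarrow> 1 \<le> k \<Longrightarrow> k < n \<Longrightarrow> Q (swp k s)"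
  shows "Q s"
proof -
  have tr: "Q s \<Longrightarrow> Q (s \<circ> transpose a b)" if "1 \<le> a" "a \<le> b" "b \<le> n" for a b s
    using that(2,3)
  proof (induction b arbitrary: s rule: dec_induct)
    case (step b)
    show ?case
    proof (cases "a = b")
      case True
      have "Q (swp b s)" using step that by (intro assms(3)) auto
      then show ?thesis unfolding swp_transpose True .
    next
      case False
      then have e: "transpose a (Suc b) = transpose b (Suc b) \<circ> transpose a b \<circ> transpose b (Suc b)"
        using step by (auto simp: fun_eq_iff transpose_def)
      have "Q (swp b (swp b s \<circ> transpose a b))"
        using step that by (intro assms(3) step.IH) auto
      then show ?thesis unfolding swp_transpose e comp_assoc .
    qed
  qed simp
  have "Q p" if "p permutes {1..m}" "m \<le> n" for p m
    using that
  proof (induction m arbitrary: p)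
    case 0
    then have "p = id" by simp
    then show ?case using Q by (simp only:)
  next
    case (Suc m)
    let ?a = "inv_into UNIV p (Suc m)"
    have pa: "p ?a = Suc m" using Suc.prems(1) by (simp add: permutes_inverses)
    have a: "?a \<in> {1..Suc m}" using Suc.prems(1) permutes_in_image[OF permutes_inv[OF Suc.prems(1)], of "Suc m"] by simp
    have "(p \<circ> transpose ?a (Suc m)) permutes {1..Suc m}"
      using a by (intro permutes_compose[OF _ Suc.prems(1)] permutes_swap_id) auto
    then have "(p \<circ> transpose ?a (Suc m)) permutes {1..m}"
    proof (rule permutes_superset)
      fix x assume "x \<in> {1..Suc m} - {1..m}"
      then have "x = Suc m" by auto
      then show "(p \<circ> transpose ?a (Suc m)) x = x" using pa by simp
    qed
    then have "Q (p \<circ> transpose ?a (Suc m))" using Suc by simp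
    then have "Q ((p \<circ> transpose ?a (Suc m)) \<circ> transpose ?a (Suc m))"
      by (rule tr[rotated 3]) (use a Suc.prems in auto)
    then show ?case by (simp add: comp_assoc)
  qed
  from this[OF s order_refl] show ?thesis .
qed

lemma app_x_op_one: "app (x_op 1) f (c, w) = yf (c 1) * f (c, w)"
  unfolding x_op_def One_nat_def jm.X_one by (simp add: X1_def app_Mu)

text \<open>Lagrange interpolation: the product of the \<open>x_1 - y_q\<close> over all
  \<open>q\<close> other than \<open>p\<close> acts by zero unless the first colour is
  \<open>p\<close>, and then by the nonzero constant \<open>d\<close>.\<close>

lemma Lspan_X1:
  assumes "label_fn H s \<in> Lspan n" "1 \<le> n"
  shows "label_fn (\<lambda>c. of_bool (c 1 = p) * H c) s \<in> (Lspan n :: ('a::idom, 'r::{finite,linorder}) vec set)"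
proof -
  have *: "label_fn (\<lambda>c. (\<Prod>q\<in>S. yf (c 1) - yf q) * H c) s \<in> Lspan n" if "finite S" for S
    using that
  proof (induction S rule: finite_induct)
    case empty
    then show ?case using assms(1) by simp
  next
    case (insert q S)
    let ?G = "label_fn (\<lambda>c. (\<Prod>q\<in>S. yf (c 1) - yf q) * H c) s"
    have "app (ev (xgen 1)) ?G - (\<lambda>z. yf q * ?G z) \<in> Lspan n"
      using insert assms by (intro Lspan_diff Lspan_scale Lspan_closed) auto
    also have "app (ev (xgen 1)) ?G - (\<lambda>z. yf q * ?G z) = label_fn (\<lambda>c. (\<Prod>q\<in>insert q S. yf (c 1) - yf q) * H c) s"
      using insert by (intro ext) (auto simp: ev_xgen app_x_op_one label_fn_def algebra_simps simp del: One_nat_def)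
    finally show ?case .
  qed
  define d where "d = (\<Prod>q\<in>-{p}. yf p - yf q :: ('a, 'r) frac)"
  have d: "d \<noteq> 0" unfolding d_def using inj_yf by (auto dest: injD)
  have "(\<lambda>z. inverse d * label_fn (\<lambda>c. (\<Prod>q\<in>-{p}. yf (c 1) - yf q) * H c) s z) \<in> Lspan n"
    using * by (intro Lspan_scale) auto
  also have "(\<lambda>z. inverse d * label_fn (\<lambda>c. (\<Prod>q\<in>-{p}. yf (c 1) - yf q) * H c) s z) = label_fn (\<lambda>c. of_bool (c 1 = p) * H c) s"
  proof -
    have "(\<Prod>q\<in>-{p}. yf a - yf q) = d * of_bool (a = p)" for a :: 'r
    proof (cases "a = p")
      case False
      then have "(\<Prod>q\<in>-{p}. yf a - yf q :: ('a, 'r) frac) = 0" by (intro prod_zero) auto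
      then show ?thesis using False by simp
    qed (simp add: d_def)
    then show ?thesis using d by (simp add: label_fn_def fun_eq_iff)
  qed
  finally show ?thesis .
qed

lemma Lspan_label_fn_one:
  assumes "s permutes {1..n}"
  shows "label_fn (\<lambda>_. 1) s \<in> (Lspan n :: ('a::idom, 'r::{finite,linorder}) vec set)"
  using assms
proof (rule adjacent_induct)
  have "label_fn (\<lambda>_. 1) id = (v0 :: ('a, 'r) vec)" by (simp add: label_fn_def v0_def)
  then show "label_fn (\<lambda>_. 1) id \<in> (Lspan n :: ('a, 'r) vec set)" using Lspan_v0[of n] by simp
next
  fix s k assume s: "label_fn (\<lambda>_. 1) s \<in> (Lspan n :: ('a, 'r) vec set)" and k: "1 \<le> k" "k < n"
  then show "label_fn (\<lambda>_. 1) (swp k s) \<in> (Lspan n :: ('a, 'r) vec set)"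
    using Lspan_tau[of "\<lambda>_. 1" k "swp k s" n] by simp
qed

text \<open>The indicator is created at position 1 by interpolation and carried to position
  \<open>m\<close> by transpositions. Each step is a pure swap, because neither the indicator nor
  \<open>H\<close> depends on the colour of the position that is about to be exchanged; independence
  of \<open>H\<close> from the first \<open>i\<close> positions also keeps \<open>H\<close>
  unchanged.\<close>

lemma Lspan_label_fn_bool:
  assumes H: "\<And>c j p. j \<le> i \<Longrightarrow> H (c(j := p)) = H c" and i: "i \<le> n"
    and L: "\<And>s. s permutes {1..n} \<Longrightarrow> label_fn H s \<in> (Lspan n :: ('a::idom, 'r::{finite,linorder}) vec set)"
  shows "1 \<le> m \<Longrightarrow> m \<le> i \<Longrightarrow> s permutes {1..n} \<Longrightarrow> label_fn (\<lambda>c. of_bool (c m = p) * H c) s \<in> Lspan n"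
proof (induction m arbitrary: s rule: dec_induct)
  case base
  then show ?case using L[of s] i by (intro Lspan_X1) auto
next
  case (step m)
  have "swp m s permutes {1..n}"
    unfolding swp_transpose using step i by (intro permutes_compose[OF permutes_swap_id]) auto
  then have "label_fn (\<lambda>c. of_bool (c m = p) * H c) (swp m s) \<in> Lspan n"
    using step by auto
  then have "label_fn (\<lambda>c. of_bool (swp m c m = p) * H (swp m c)) s \<in> Lspan n"
    using step i by (intro Lspan_tau[where H = "\<lambda>c. of_bool (c m = p) * H c"]) (auto simp: H)
  moreover have "H (swp m c) = H c" for c
    using step H unfolding swp_def by simp
  ultimately show ?case by (simp add: swp_def)
qed

definition Delta :: "nat \<Rightarrow> (nat \<Rightarrow> 'r) \<Rightarrow> (nat \<Rightarrow> nat) \<Rightarrow> ('a::idom, 'r::{finite,linorder}) vec" where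
  "Delta n d s = label_fn (\<lambda>c. \<Prod>j\<in>{0<..n}. of_bool (c j = d j)) s"

text \<open>Colours are prescribed from position \<open>n\<close> downwards. The part already built
  then depends on later positions only, so the next indicator can travel freely from position 1 to
  its place.\<close>

lemma Lspan_Delta:
  assumes "s permutes {1..n}"
  shows "Delta n d s \<in> (Lspan n :: ('a::idom, 'r::{finite,linorder}) vec set)"
proof -
  have "label_fn (\<lambda>c. \<Prod>j\<in>{n - t<..n}. of_bool (c j = d j)) s \<in> (Lspan n :: ('a, 'r) vec set)"
    if "t \<le> n" "s permutes {1..n}" for t s
    using that
  proof (induction t arbitrary: s)
    case 0
    then show ?case using Lspan_label_fn_one by simp
  next
    case (Suc t)
    let ?i = "n - t"
    have "label_fn (\<lambda>c. of_bool (c ?i = d ?i) * (\<Prod>j\<in>{n - t<..n}. of_bool (c j = d j))) s \<in> (Lspan n :: ('a, 'r) vec set)"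
      by (rule Lspan_label_fn_bool[of ?i]) (use Suc in \<open>auto intro!: prod.cong\<close>)
    moreover have "{n - Suc t<..n} = insert ?i {n - t<..n}" using Suc by auto
    ultimately show ?case by simp
  qed
  from this[of n s] assms show ?thesis by (simp add: Delta_def)
qed

lemma Delta_apply:
  "Delta n d s (c, w) = (of_bool ((\<forall>j\<in>{1..n}. c j = d j) \<and> w = s) :: ('a::idom, 'b::{finite,linorder}) frac)"
proof -
  have "(\<Prod>j\<in>{0<..n}. of_bool (c j = d j) :: ('a, 'b) frac) = of_bool (\<forall>j\<in>{1..n}. c j = d j)"
  proof (cases "\<forall>j\<in>{1..n}. c j = d j")
    case False
    then obtain j where "j \<in> {0<..n}" "c j \<noteq> d j" by force
    then have "(\<Prod>j\<in>{0<..n}. of_bool (c j = d j) :: ('a, 'b) frac) = 0"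
      by (intro prod_zero) auto
    with False show ?thesis by simp
  qed (auto intro!: prod.neutral)
  then show ?thesis by (simp add: Delta_def label_fn_def)
qed

definition label_idx :: "nat \<Rightarrow> ((nat \<Rightarrow> 'r) \<times> (nat \<Rightarrow> nat)) set" where
  "label_idx n = ({1..n} \<rightarrow>\<^sub>E UNIV) \<times> {s. s permutes {1..n}}"

lemma label_idx_card: "finite (label_idx n :: ((nat \<Rightarrow> 'r::finite) \<times> _) set)"
  "card (label_idx n :: ((nat \<Rightarrow> 'r::finite) \<times> _) set) = CARD('r) ^ n * fact n"
  by (simp_all add: label_idx_def finite_PiE finite_permutations card_cartesian_product card_PiE card_permutations)

lemma Delta_label_idx:
  assumes "(d, s) \<in> label_idx n" "(d', s') \<in> label_idx n"
  shows "Delta n d s (d', s') = of_bool ((d, s) = (d', s'))"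
proof -
  have "(\<forall>j\<in>{1..n}. d' j = d j) \<longleftrightarrow> d' = d"
    using assms by (auto simp: label_idx_def intro: PiE_ext)
  then have "((\<forall>j\<in>{1..n}. d' j = d j) \<and> s' = s) \<longleftrightarrow> (d, s) = (d', s')" by auto
  then show ?thesis unfolding Delta_apply by (simp only:)
qed

text \<open>At the points of \<open>label_idx n\<close>, which also index the functions, their
  values form an identity matrix, so evaluating a linear relation at one point isolates one
  coefficient.\<close>

lemma Delta_independent:
  fixes n :: nat
  defines "D \<equiv> (\<lambda>(d, s). Delta n d s) ` label_idx n :: ('a::idom, 'r::{finite,linorder}) vec set"
  shows "vs.independent D" "card D = CARD('r) ^ n * fact n"
proof -
  have inj: "inj_on (\<lambda>(d, s). Delta n d s :: ('a, 'r) vec) (label_idx n)"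
  proof (rule inj_onI, clarify)
    fix d s d' s' assume a: "(d, s) \<in> label_idx n" "(d', s') \<in> label_idx n" "Delta n d s = (Delta n d' s' :: ('a, 'r) vec)"
    then have "Delta n d s (d', s') = (Delta n d' s' (d', s') :: ('a, 'r) frac)" by simp
    have "of_bool ((d, s) = (d', s')) = (Delta n d s (d', s') :: ('a, 'r) frac)"
      by (rule Delta_label_idx[OF a(1,2), symmetric])
    also have "\<dots> = Delta n d' s' (d', s')" by (simp only: a(3))
    also have "\<dots> = 1" by (simp add: Delta_label_idx[OF a(2,2)])
    finally show "d = d' \<and> s = s'" by simp
  qed
  then show "card D = CARD('r) ^ n * fact n"
    unfolding D_def by (simp add: card_image label_idx_card)
  have fin: "finite D" unfolding D_def by (simp add: label_idx_card)
  show "vs.independent D"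
  proof
    assume "vs.dependent D"
    then obtain u v where v: "v \<in> D" "u v \<noteq> 0" and sum: "(\<Sum>v\<in>D. (\<lambda>z. u v * v z)) = 0"
      unfolding vs.dependent_finite[OF fin] by blast
    from v obtain d s where ds: "(d, s) \<in> label_idx n" "v = Delta n d s" by (auto simp: D_def)
    have "(\<Sum>v\<in>D. (\<lambda>z. u v * v z)) (d, s) = (\<Sum>v\<in>D. u v * v (d, s))"
      by (induction D rule: infinite_finite_induct) auto
    also have "\<dots> = (\<Sum>x\<in>label_idx n. u (case x of (d, s) \<Rightarrow> Delta n d s) * (case x of (d, s) \<Rightarrow> Delta n d s) (d, s))"
      unfolding D_def by (subst sum.reindex[OF inj]) simp
    also have "\<dots> = (\<Sum>x\<in>label_idx n. if x = (d, s) then u v else 0)"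
      by (rule sum.cong) (use ds in \<open>auto simp: Delta_label_idx\<close>)
    also have "\<dots> = u v" using ds by (simp add: label_idx_card)
    finally show False using sum v by simp
  qed
qed

text \<open>
  The images of the \<open>r\<^sup>n n!\<close> monomials span a space that contains \<open>r\<^sup>n n!\<close> independent vectors
  \<open>Delta\<close>.
\<close>
lemma monomials_independent:
  shows monomials_card: "card (monomials n :: ('a::idom, 'r::{finite,linorder}) nc_poly set) = CARD('r) ^ n * fact n"
    and monomials_inj: "inj_on (\<lambda>b. app (ev b) v0) (monomials n :: ('a, 'r) nc_poly set)"
    and monomials_indep: "vs.independent ((\<lambda>b. app (ev b) v0) ` (monomials n :: ('a, 'r) nc_poly set))"
proof -
  let ?N = "CARD('r) ^ n * fact n" and ?B = "monomials n :: ('a, 'r) nc_poly set"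
  let ?S = "(\<lambda>b. app (ev b) v0) ` ?B"
  let ?D = "(\<lambda>(d, s). Delta n d s) ` label_idx n :: ('a, 'r) vec set"
  have D: "?D \<subseteq> vs.span ?S"
    using Lspan_Delta[of _ n] by (auto simp: Lspan_def label_idx_def)
  have N: "?N \<le> card S'" if "finite S'" "?D \<subseteq> vs.span S'" for S'
    using vs.independent_span_bound[OF that(1) Delta_independent(1) that(2)] by (simp add: Delta_independent(2))
  have le: "?N \<le> card ?S" "card ?S \<le> card ?B" "card ?B \<le> ?N"
    using N[OF _ D] by (auto intro: card_image_le simp: card_monomials_le)
  then show "card ?B = ?N" by simp
  show "inj_on (\<lambda>b. app (ev b) v0) ?B"
    by (rule eq_card_imp_inj_on) (use le in auto)
  show "vs.independent ?S"
  proof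
    assume "vs.dependent ?S"
    then obtain a where a: "a \<in> ?S" "a \<in> vs.span (?S - {a})" unfolding vs.dependent_def by blast
    then have "vs.span ?S = vs.span (?S - {a})"
      by (metis insert_Diff vs.span_redundant)
    then have "?N \<le> card (?S - {a})" using N[of "?S - {a}"] D by simp
    moreover have "card (?S - {a}) < card ?S" using a by (intro psubset_card_mono) auto
    ultimately show False using le by simp
  qed
qed

lemma monomials_coeff_zero:
  fixes c :: "('a::idom, 'r::{finite,linorder}) nc_poly \<Rightarrow> ('a, 'r) base"
  assumes "ev (\<Sum>b\<in>monomials n. scal (c b) * b) = 0" "b \<in> monomials n"
  shows "c b = 0"
proof (rule ccontr)
  assume c: "c b \<noteq> 0"
  let ?f = "\<lambda>b :: ('a, 'r) nc_poly. app (ev b) v0"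
  let ?u = "\<lambda>v. to_fract (c (inv_into (monomials n) ?f v))"
  have u: "?u (?f b) = to_fract (c b)" if "b \<in> monomials n" for b
    using that by (simp add: inv_into_f_f[OF monomials_inj])
  have "(\<Sum>v\<in>?f ` monomials n. (\<lambda>z. ?u v * v z)) = (\<Sum>b\<in>monomials n. (\<lambda>z. ?u (?f b) * ?f b z))"
    by (subst sum.reindex[OF monomials_inj]) simp
  also have "\<dots> = (\<Sum>b\<in>monomials n. (\<lambda>z. to_fract (c b) * ?f b z))"
    by (rule sum.cong) (auto simp: u)
  also have "\<dots> = app (ev (\<Sum>b\<in>monomials n. scal (c b) * b)) v0"
    by (simp add: ev_sum ev_mult ev_scal sum_app app_Sc)
  also have "\<dots> = 0" using assms(1) by simp
  finally have "(\<Sum>v\<in>?f ` monomials n. (\<lambda>z. ?u v * v z)) = 0" .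
  moreover have "?u (?f b) \<noteq> 0" using c assms(2) u by simp
  ultimately have "vs.dependent (?f ` monomials n)"
    using assms(2) by (subst vs.dependent_finite) (auto intro!: exI[of _ ?u])
  then show False using monomials_indep by blast
qed

text \<open>Modulo relations every word is a combination of monomials, and a vanishing operator
  forces all its coefficients to be zero. This is the faithfulness that lets operators stand for
  elements of the quotient.\<close>

theorem ev_eq_zero_iff:
  assumes "f \<in> Fr n"
  shows "ev f = (0 :: ('a::idom, 'r::{finite,linorder}) opr) \<longleftrightarrow> f \<in> rel_ideal n"
proof
  assume 0: "ev f = 0"
  obtain c where c: "cg n f (\<Sum>b\<in>monomials n. scal (c b) * b)" using monomials_span[OF assms] by blast
  then have "ev (\<Sum>b\<in>monomials n. scal (c b) * b) = 0" using ev_cg[OF c] 0 by simp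
  then have "(\<Sum>b\<in>monomials n. scal (c b) * b) = 0"
    by (intro sum.neutral) (simp add: monomials_coeff_zero scal_zero)
  then show "f \<in> rel_ideal n" using c by (simp add: cg_def)
qed (rule ev_rel_ideal)

text \<open>The exact number of monomials at level \<open>n + 1\<close> is the product of the number
  at level \<open>n\<close> and the number of basis words. Hence products of a monomial with a basis
  word are pairwise distinct, and the coefficients of the \<open>\<alpha> i\<close> can be read off
  one by one.\<close>

theorem basis_word_independent:
  fixes \<alpha> :: "nat \<times> nat \<Rightarrow> ('a::idom, 'r::{finite,linorder}) nc_poly"
  assumes \<alpha>: "\<And>i. i \<in> basis_idx TYPE('r) n \<Longrightarrow> \<alpha> i \<in> Fr n"
    and zero: "(\<Sum>i\<in>basis_idx TYPE('r) n. ev (\<alpha> i) * ev (basis_word n i)) = 0" and i: "i \<in> basis_idx TYPE('r) n"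
  shows "ev (\<alpha> i) = 0"
proof -
  have "\<forall>i. \<exists>c. i \<in> basis_idx TYPE('r) n \<longrightarrow> cg n (\<alpha> i) (\<Sum>b\<in>monomials n. scal (c b) * b)"
    using monomials_span[OF \<alpha>] by simp
  from choice[OF this] obtain c where
    c: "\<And>i. i \<in> basis_idx TYPE('r) n \<Longrightarrow> cg n (\<alpha> i) (\<Sum>b\<in>monomials n. scal (c i b) * b)" by (elim exE) blast
  let ?P = "(monomials n :: ('a, 'r) nc_poly set) \<times> basis_idx TYPE('r) n" and ?g = "\<lambda>(b, i). b * basis_word n i :: ('a, 'r) nc_poly"
  have inj: "inj_on ?g ?P"
  proof (rule eq_card_imp_inj_on)
    show "card (?g ` ?P) = card ?P"
      using monomials_card[of "Suc n", where 'a = 'a and 'r = 'r]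
      by (simp only: monomials.simps(2) card_cartesian_product monomials_card basis_idx_basic) (simp add: algebra_simps)
  qed simp
  define C where "C q = (case inv_into ?P ?g q of (b, i) \<Rightarrow> c i b)" for q
  have "ev (\<Sum>q\<in>monomials (Suc n). scal (C q) * q) = ev (\<Sum>p\<in>?P. scal (C (?g p)) * ?g p)"
    unfolding monomials.simps by (subst sum.reindex[OF inj]) simp
  also have "(\<Sum>p\<in>?P. scal (C (?g p)) * ?g p) = (\<Sum>(b, i)\<in>?P. scal (c i b) * b * basis_word n i)"
    by (rule sum.cong) (auto simp: C_def inv_into_f_f[OF inj] mult.assoc simp del: basis_word.simps)
  also have "\<dots> = (\<Sum>i\<in>basis_idx TYPE('r) n. (\<Sum>b\<in>monomials n. scal (c i b) * b) * basis_word n i)"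
    by (simp add: sum_distrib_right sum.cartesian_product[symmetric] sum.swap[of _ "monomials n"])
  also have "ev \<dots> = (\<Sum>i\<in>basis_idx TYPE('r) n. ev (\<alpha> i) * ev (basis_word n i))"
    by (simp add: ev_sum[of _ "basis_idx TYPE('r) n"] ev_mult) (rule sum.cong, auto simp: ev_cg[OF c])
  finally have Z: "ev (\<Sum>q\<in>monomials (Suc n). scal (C q) * q) = 0" using zero by simp
  have "c i b = 0" if "b \<in> monomials n" for b
  proof -
    have "C (?g (b, i)) = 0"
      by (rule monomials_coeff_zero[OF Z]) (use that i in auto)
    then show ?thesis using inv_into_f_f[OF inj, of "(b, i)"] that i by (simp add: C_def)
  qed
  then have "(\<Sum>b\<in>monomials n. scal (c i b) * b) = 0" by (intro sum.neutral) (simp add: scal_zero)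
  then show ?thesis using ev_cg[OF c[OF i]] by simp
qed

section \<open>Traces of endomorphisms of modules with a dual basis\<close>

definition subring_set :: "'b::ring_1 set \<Rightarrow> bool" where
  "subring_set A \<longleftrightarrow> 1 \<in> A \<and> (\<forall>a\<in>A. \<forall>b\<in>A. a - b \<in> A \<and> a * b \<in> A)"

lemma subrD:
  assumes "subring_set A"
  shows "1 \<in> A" "0 \<in> A" "a \<in> A \<Longrightarrow> b \<in> A \<Longrightarrow> a - b \<in> A" "a \<in> A \<Longrightarrow> b \<in> A \<Longrightarrow> a * b \<in> A"
    "a \<in> A \<Longrightarrow> - a \<in> A" "a \<in> A \<Longrightarrow> b \<in> A \<Longrightarrow> a + b \<in> A"
proof -
  show 1: "1 \<in> A" and d: "a \<in> A \<Longrightarrow> b \<in> A \<Longrightarrow> a - b \<in> A" and "a \<in> A \<Longrightarrow> b \<in> A \<Longrightarrow> a * b \<in> A" for a b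
    using assms by (auto simp: subring_set_def)
  show 0: "0 \<in> A" using d[OF 1 1] by simp
  show n: "a \<in> A \<Longrightarrow> - a \<in> A" for a using d[OF 0, of a] by simp
  show "a \<in> A \<Longrightarrow> b \<in> A \<Longrightarrow> a + b \<in> A" using d[OF _ n, of a b] by simp
qed

lemma subring_set_sum: "subring_set A \<Longrightarrow> (\<And>i. i \<in> I \<Longrightarrow> f i \<in> A) \<Longrightarrow> sum f I \<in> A"
  by (induction I rule: infinite_finite_induct) (auto intro: subrD)

lemma subring_set_power: "subring_set A \<Longrightarrow> a \<in> A \<Longrightarrow> a ^ k \<in> A"
  by (induction k) (auto intro: subrD)

text \<open>An additive span: negatives arise by exchanging the two factors. For
  \<open>Rop n\<close> it is also closed under the base ring, since a scalar can be absorbed into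
  one factor.\<close>

inductive_set Comm :: "'b::ring_1 set \<Rightarrow> 'b set" for A where
  zero: "0 \<in> Comm A"
| add: "f \<in> Comm A \<Longrightarrow> a \<in> A \<Longrightarrow> b \<in> A \<Longrightarrow> f + (a * b - b * a) \<in> Comm A"

lemma Comm_comm: "a \<in> A \<Longrightarrow> b \<in> A \<Longrightarrow> a * b - b * a \<in> Comm A"
  using Comm.add[OF Comm.zero] by fastforce

lemma Comm_plus:
  assumes f: "f \<in> Comm A" and g: "g \<in> Comm A"
  shows "f + g \<in> Comm A"
  using g
proof (induction rule: Comm.induct)
  case (add g a b)
  then show ?case using Comm.add[of "f + g" A a b] by (simp add: add.assoc)
qed (simp add: f)

lemma Comm_uminus: "f \<in> Comm A \<Longrightarrow> - f \<in> Comm A"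
proof (induction f rule: Comm.induct)
  case (add g a b)
  then show ?case using Comm.add[of "- g" A b a] by (simp add: algebra_simps)
qed (simp add: Comm.zero)

lemma Comm_sum: "(\<And>i. i \<in> I \<Longrightarrow> f i \<in> Comm A) \<Longrightarrow> sum f I \<in> Comm A"
  by (induction I rule: infinite_finite_induct) (auto intro: Comm_plus Comm.zero)

lemma Comm_sub:
  assumes "subring_set A" "f \<in> Comm A"
  shows "f \<in> A"
  using assms(2)
proof (induction rule: Comm.induct)
  case (add f a b)
  then show ?case using subrD(3,4,6)[OF assms(1)] by simp
qed (rule subrD[OF assms(1)])

lemma Comm_mult_central:
  assumes "f \<in> Comm A" "z \<in> A" "subring_set A" "\<And>a. a \<in> A \<Longrightarrow> a * z = z * a"
  shows "f * z \<in> Comm A"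
  using assms(1)
proof (induction rule: Comm.induct)
  case (add f a b)
  have "(a * b - b * a) * z = (a * z) * b - b * (a * z)"
  proof -
    have "b * z = z * b" using add assms(4) by blast
    then show ?thesis by (simp add: left_diff_distrib mult.assoc)
  qed
  then show ?case using Comm.add[OF add.IH, of "a * z" b] add.hyps assms(2) subrD[OF assms(3)]
    by (simp add: distrib_right)
qed (simp add: Comm.zero)

lemma Comm_hom:
  assumes "f \<in> Comm A" "\<And>a b. a \<in> A \<Longrightarrow> b \<in> A \<Longrightarrow> \<phi> (a * b - b * a) \<in> Comm B"
    "\<And>a b. a \<in> A \<Longrightarrow> b \<in> A \<Longrightarrow> \<phi> (a + b) = \<phi> a + \<phi> b" "subring_set A" "\<phi> 0 = 0"
  shows "\<phi> f \<in> Comm B"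
  using assms(1)
proof (induction rule: Comm.induct)
  case (add f a b)
  then show ?case
    using assms(2,3) Comm_sub[OF assms(4) add.hyps(1)] Comm_sub[OF assms(4) Comm_comm[of a A b]]
    by (simp add: Comm_plus)
qed (simp add: Comm.zero assms(5))

definition lin :: "'b::ring_1 set \<Rightarrow> 'b set \<Rightarrow> 'b set \<Rightarrow> ('b \<Rightarrow> 'b) \<Rightarrow> bool" where
  "lin A B B' F \<longleftrightarrow> (\<forall>m\<in>B. F m \<in> B') \<and> (\<forall>m\<in>B. \<forall>m'\<in>B. F (m + m') = F m + F m')
     \<and> (\<forall>a\<in>A. \<forall>m\<in>B. F (a * m) = a * F m)"

lemma linD:
  assumes "lin A B B' F"
  shows "m \<in> B \<Longrightarrow> F m \<in> B'" "m \<in> B \<Longrightarrow> m' \<in> B \<Longrightarrow> F (m + m') = F m + F m'"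
    "a \<in> A \<Longrightarrow> m \<in> B \<Longrightarrow> F (a * m) = a * F m"
  using assms by (auto simp: lin_def)

lemma lin_sum:
  assumes "lin A B B' F" "subring_set B" "\<And>i. i \<in> I \<Longrightarrow> g i \<in> B" "subring_set A"
  shows "F (\<Sum>i\<in>I. g i) = (\<Sum>i\<in>I. F (g i))"
proof -
  have 0: "F 0 = 0"
    using linD(3)[OF assms(1) subrD(2)[OF assms(4)] subrD(2)[OF assms(2)]] by simp
  show ?thesis
    using assms(3)
    by (induction I rule: infinite_finite_induct)
      (auto simp: 0 linD(2)[OF assms(1)] subring_set_sum[OF assms(2)])
qed

lemma lin_comp: "lin A B B' F \<Longrightarrow> lin A B' B'' G \<Longrightarrow> lin A B B'' (\<lambda>m. G (F m))"
  by (simp add: lin_def)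

text \<open>The dual basis of a finitely generated projective left module: linear coordinate
  functions that reproduce every element. An actual basis of the module yields one, and so does a
  tower of two.\<close>

definition dual_basis :: "'b::ring_1 set \<Rightarrow> 'b set \<Rightarrow> 'i set \<Rightarrow> ('i \<Rightarrow> 'b) \<Rightarrow> ('i \<Rightarrow> 'b \<Rightarrow> 'b) \<Rightarrow> bool" where
  "dual_basis A B I e p \<longleftrightarrow> subring_set A \<and> subring_set B \<and> A \<subseteq> B \<and> finite I \<and> (\<forall>i\<in>I. e i \<in> B) \<and> (\<forall>i\<in>I. lin A B A (p i))
     \<and> (\<forall>m\<in>B. m = (\<Sum>i\<in>I. p i m * e i))"

definition mod_tr :: "'i set \<Rightarrow> ('i \<Rightarrow> 'b) \<Rightarrow> ('i \<Rightarrow> 'b \<Rightarrow> 'b) \<Rightarrow> ('b::ring_1 \<Rightarrow> 'b) \<Rightarrow> 'b" where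
  "mod_tr I e p F = (\<Sum>i\<in>I. p i (F (e i)))"

text \<open>With \<open>G\<close> the identity this is the independence of the trace of the choice of dual basis.\<close>

lemma mod_tr_cyclic:
  assumes e: "dual_basis A B I e p" and f: "dual_basis A B J f q"
    and F: "lin A B B F" and G: "lin A B B G"
  shows "mod_tr I e p (\<lambda>m. G (F m)) - mod_tr J f q (\<lambda>m. F (G m)) \<in> Comm A"
proof -
  have A: "subring_set A" and B: "subring_set B" and sub: "A \<subseteq> B" and eB: "\<And>i. i \<in> I \<Longrightarrow> e i \<in> B" and fB: "\<And>j. j \<in> J \<Longrightarrow> f j \<in> B"
    and p: "\<And>i. i \<in> I \<Longrightarrow> lin A B A (p i)" and q: "\<And>j. j \<in> J \<Longrightarrow> lin A B A (q j)"
    and ex: "\<And>m. m \<in> B \<Longrightarrow> m = (\<Sum>i\<in>I. p i m * e i)" and fx: "\<And>m. m \<in> B \<Longrightarrow> m = (\<Sum>j\<in>J. q j m * f j)"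
    using e f by (auto simp: dual_basis_def)
  have 1: "p i (G (F (e i))) = (\<Sum>j\<in>J. q j (F (e i)) * p i (G (f j)))" if i: "i \<in> I" for i
  proof -
    have Fe: "F (e i) \<in> B" using linD(1)[OF F eB[OF i]] .
    have pG: "lin A B A (\<lambda>m. p i (G m))" by (rule lin_comp[OF G p[OF i]])
    have "p i (G (F (e i))) = p i (G (\<Sum>j\<in>J. q j (F (e i)) * f j))"
      using fx[OF Fe] by simp
    also have "\<dots> = (\<Sum>j\<in>J. p i (G (q j (F (e i)) * f j)))"
      by (rule lin_sum[OF pG B _ A]) (use fB Fe linD(1)[OF q] sub subrD(4)[OF B] in blast)
    also have "\<dots> = (\<Sum>j\<in>J. q j (F (e i)) * p i (G (f j)))"
      by (rule sum.cong[OF HOL.refl], rule linD(3)[OF pG]) (use fB Fe linD(1)[OF q] in blast)+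
    finally show ?thesis .
  qed
  have 2: "q j (F (G (f j))) = (\<Sum>i\<in>I. p i (G (f j)) * q j (F (e i)))" if j: "j \<in> J" for j
  proof -
    have Gf: "G (f j) \<in> B" using linD(1)[OF G fB[OF j]] .
    have qF: "lin A B A (\<lambda>m. q j (F m))" by (rule lin_comp[OF F q[OF j]])
    have "q j (F (G (f j))) = q j (F (\<Sum>i\<in>I. p i (G (f j)) * e i))"
      using ex[OF Gf] by simp
    also have "\<dots> = (\<Sum>i\<in>I. q j (F (p i (G (f j)) * e i)))"
      by (rule lin_sum[OF qF B _ A]) (use eB Gf linD(1)[OF p] sub subrD(4)[OF B] in blast)
    also have "\<dots> = (\<Sum>i\<in>I. p i (G (f j)) * q j (F (e i)))"
      by (rule sum.cong[OF HOL.refl], rule linD(3)[OF qF]) (use eB Gf linD(1)[OF p] in blast)+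
    finally show ?thesis .
  qed
  \<comment> \<open>Expanding each trace in the other basis yields two double sums over the same
    products, with the factors in opposite order.\<close>
  have "mod_tr I e p (\<lambda>m. G (F m)) - mod_tr J f q (\<lambda>m. F (G m))
      = (\<Sum>i\<in>I. \<Sum>j\<in>J. q j (F (e i)) * p i (G (f j))) - (\<Sum>j\<in>J. \<Sum>i\<in>I. p i (G (f j)) * q j (F (e i)))"
    by (simp add: mod_tr_def 1 2)
  also have "\<dots> = (\<Sum>i\<in>I. \<Sum>j\<in>J. q j (F (e i)) * p i (G (f j)) - p i (G (f j)) * q j (F (e i)))"
    by (subst (2) sum.swap) (simp add: sum_subtractf)
  also have "\<dots> \<in> Comm A"
    by (intro Comm_sum Comm_comm linD(1)[OF p] linD(1)[OF q] linD(1)[OF F] linD(1)[OF G] eB fB)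
  finally show ?thesis .
qed

lemma dual_basis_comp:
  assumes e: "dual_basis A B I e p" and f: "dual_basis B C J f q"
  shows "dual_basis A C (I \<times> J) (\<lambda>(i, j). e i * f j) (\<lambda>(i, j) m. p i (q j m))"
proof -
  have A: "subring_set A" and B: "subring_set B" and C: "subring_set C" and AB: "A \<subseteq> B" and BC: "B \<subseteq> C"
    and eB: "\<And>i. i \<in> I \<Longrightarrow> e i \<in> B" and fC: "\<And>j. j \<in> J \<Longrightarrow> f j \<in> C" and fin: "finite I" "finite J"
    and p: "\<And>i. i \<in> I \<Longrightarrow> lin A B A (p i)" and q: "\<And>j. j \<in> J \<Longrightarrow> lin B C B (q j)"
    and ex: "\<And>m. m \<in> B \<Longrightarrow> m = (\<Sum>i\<in>I. p i m * e i)" and fx: "\<And>m. m \<in> C \<Longrightarrow> m = (\<Sum>j\<in>J. q j m * f j)"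
    using e f by (auto simp: dual_basis_def)
  have "lin A C A (\<lambda>m. p i (q j m))" if "i \<in> I" "j \<in> J" for i j
    using p[OF that(1)] q[OF that(2)] AB unfolding lin_def by (simp add: subset_iff)
  moreover have "m = (\<Sum>(i, j)\<in>I \<times> J. p i (q j m) * (e i * f j))" if m: "m \<in> C" for m
  proof -
    have "m = (\<Sum>j\<in>J. q j m * f j)" by (rule fx[OF m])
    also have "\<dots> = (\<Sum>j\<in>J. (\<Sum>i\<in>I. p i (q j m) * e i) * f j)"
      by (rule sum.cong[OF HOL.refl]) (use ex[OF linD(1)[OF q m]] in simp)
    also have "\<dots> = (\<Sum>j\<in>J. \<Sum>i\<in>I. p i (q j m) * (e i * f j))"
      by (simp add: sum_distrib_right mult.assoc)
    also have "\<dots> = (\<Sum>(i, j)\<in>I \<times> J. p i (q j m) * (e i * f j))"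
      by (subst sum.swap) (simp add: sum.cartesian_product)
    finally show ?thesis .
  qed
  moreover have "e i * f j \<in> C" if "i \<in> I" "j \<in> J" for i j
    using eB[OF that(1)] fC[OF that(2)] BC by (intro subrD(4)[OF C]) auto
  ultimately show ?thesis
    unfolding dual_basis_def using A C AB BC fin
    by (auto simp: case_prod_unfold)
qed

lemma mod_tr_comp: "mod_tr (I \<times> J) (\<lambda>(i, j). e i * f j) (\<lambda>(i, j) m. p i (q j m)) F
    = (\<Sum>i\<in>I. \<Sum>j\<in>J. p i (q j (F (e i * f j))))"
  by (simp add: mod_tr_def sum.cartesian_product case_prod_unfold)


section \<open>The algebras as subalgebras of the operators\<close>

definition Rop :: "nat \<Rightarrow> ('a::idom, 'r::{finite,linorder}) opr set" where
  "Rop n = ev ` Fr n"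

lemma HopI: "f \<in> Fr n \<Longrightarrow> ev f \<in> Rop n"
  by (simp add: Rop_def)

lemma subring_set_Rop [simp]: "subring_set (Rop n :: ('a::idom, 'r::{finite,linorder}) opr set)"
proof -
  have "ev f - ev g \<in> Rop n \<and> ev f * ev g \<in> Rop n" if "f \<in> Fr n" "g \<in> Fr n" for f g :: "('a, 'r) nc_poly"
    using HopI[of "f - g" n] HopI[of "f * g" n] that by (simp add: ev_diff ev_mult)
  moreover have "1 \<in> (Rop n :: ('a, 'r) opr set)" using HopI[of 1 n] by simp
  ultimately show ?thesis by (auto simp: subring_set_def Rop_def)
qed

lemmas Rop_closed [simp, intro] = subrD[OF subring_set_Rop] subring_set_sum[OF subring_set_Rop] subring_set_power[OF subring_set_Rop]

lemma Rop_gens [simp, intro]: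
  "Sc (to_fract c) \<in> Rop n" "1 \<le> k \<Longrightarrow> k \<le> n \<Longrightarrow> x_op k \<in> Rop n" "1 \<le> k \<Longrightarrow> k < n \<Longrightarrow> tau k \<in> Rop n"
  "Sc hf \<in> Rop n"
  using HopI[of "scal c" n] HopI[of "xgen k" n] HopI[of "taugen k" n] HopI[of "scal hbar" n]
  by (simp_all add: ev_scal ev_xgen ev_taugen hf_def)

lemma Rop_mono: "n \<le> m \<Longrightarrow> a \<in> Rop n \<Longrightarrow> a \<in> Rop m"
  unfolding Rop_def using Fr_mono by blast

lemma Rop_Suc: "a \<in> Rop n \<Longrightarrow> a \<in> Rop (Suc n)"
  by (rule Rop_mono[of n]) auto

lemma Sc_Rop: "a \<in> Rop n \<Longrightarrow> Sc c * a = a * Sc c"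
  by (auto simp: Rop_def Sc_ev)

lemma x_op_Suc_comm: "a \<in> Rop n \<Longrightarrow> x_op (Suc n) * a = a * x_op (Suc n)"
  using ev_cg[OF x_comm] by (fastforce simp: Rop_def ev_mult ev_xgen)

lemma tau_Suc_comm: "a \<in> Rop n \<Longrightarrow> tau (Suc n) * a = a * tau (Suc n)"
  using ev_cg[OF t_comm] by (fastforce simp: Rop_def ev_mult ev_taugen)

lemma tau_sq: "1 \<le> k \<Longrightarrow> tau k * tau k = 1"
  by (rule jm.T_sq)

lemma tau_braid: "1 \<le> k \<Longrightarrow> tau k * tau (Suc k) * tau k = tau (Suc k) * tau k * tau (Suc k)"
  by (rule jm.T_braid)

lemma x_op_tau: "1 \<le> k \<Longrightarrow> x_op (Suc k) * tau k = tau k * x_op k + Sc hf"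
  unfolding x_op_def by (rule jm.X_Suc_T)

lemma tau_x_op: "1 \<le> k \<Longrightarrow> tau k * x_op (Suc k) = x_op k * tau k + Sc hf"
  unfolding x_op_def by (rule jm.T_X_Suc)

lemma x_op_comm: "1 \<le> k \<Longrightarrow> 1 \<le> l \<Longrightarrow> x_op k * x_op l = x_op l * x_op k"
  unfolding x_op_def by (rule jm.X_commute)

lemma Rop_Suc_induct [consumes 1, case_names x t add]:
  fixes m :: "('a::idom, 'r::{finite,linorder}) opr"
  assumes m: "m \<in> Rop (Suc n)"
    and x: "\<And>a i. a \<in> Rop n \<Longrightarrow> i < CARD('r) \<Longrightarrow> P (a * x_op (Suc n) ^ i)"
    and t: "\<And>a b. a \<in> Rop n \<Longrightarrow> b \<in> Rop n \<Longrightarrow> 1 \<le> n \<Longrightarrow> P (a * tau n * b)"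
    and add: "\<And>f g. f \<in> Rop (Suc n) \<Longrightarrow> g \<in> Rop (Suc n) \<Longrightarrow> P f \<Longrightarrow> P g \<Longrightarrow> P (f + g)"
  shows "P m"
proof -
  obtain f where f: "f \<in> Fr (Suc n)" "m = ev f" using m by (auto simp: Rop_def)
  then have "f \<in> mackey n" using Fr_subset_mackey by blast
  then have "P (ev f)"
  proof (induction rule: mackey.induct)
    case (x a i)
    then show ?case using assms(2)[OF HopI] by (simp add: ev_mult ev_power ev_xgen)
  next
    case (t a b)
    then show ?case using assms(3)[OF HopI HopI] by (simp add: ev_mult ev_taugen)
  next
    case (add f g)
    then show ?case using assms(4)[OF HopI HopI] by (simp add: ev_add mackey_Fr)
  next
    case (J f)
    then show ?case using assms(2)[of 0 0] ev_rel_ideal[OF J] by simp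
  qed
  then show ?thesis using f by simp
qed

section \<open>Coordinates of one operator algebra over the previous one\<close>

definition basis_op :: "nat \<Rightarrow> nat \<times> nat \<Rightarrow> ('a::idom, 'r::{finite,linorder}) opr" where
  "basis_op n i = ev (basis_word n i)"

lemma basis_op_top: "basis_op n (n, a) = x_op (Suc n) ^ a"
  by (simp add: basis_op_def basis_word_top ev_power ev_xgen)

lemma basis_op_Suc: "m \<le> n \<Longrightarrow> basis_op (Suc n) (m, a) = tau (Suc n) * basis_op n (m, a)"
  by (simp add: basis_op_def ev_mult ev_taugen)

lemma basis_op_Rop: "i \<in> basis_idx R n \<Longrightarrow> basis_op n i \<in> Rop (Suc n)"
  unfolding basis_op_def by (intro HopI basis_word_Fr) (auto simp: basis_idx_def)

text \<open>All coordinates are chosen at once, and the family is required to lie in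
  \<open>Rop n\<close> at every index, so membership holds without a condition on \<open>i\<close>;
  the values are determined on \<open>basis_idx\<close> only.\<close>

definition coord :: "nat \<Rightarrow> nat \<times> nat \<Rightarrow> ('a::idom, 'r::{finite,linorder}) opr \<Rightarrow> ('a, 'r) opr" where
  "coord n i m = (SOME \<alpha>. (\<forall>i. \<alpha> i \<in> Rop n) \<and> m = (\<Sum>i\<in>basis_idx TYPE('r) n. \<alpha> i * basis_op n i)) i"

lemma coord_props:
  fixes m :: "('a::idom, 'r::{finite,linorder}) opr"
  assumes "m \<in> Rop (Suc n)"
  shows coord_Rop: "coord n i m \<in> Rop n" and coord_sum: "m = (\<Sum>i\<in>basis_idx TYPE('r) n. coord n i m * basis_op n i)"
proof -
  obtain f where f: "f \<in> Fr (Suc n)" "m = ev f" using assms by (auto simp: Rop_def)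
  obtain \<alpha> where \<alpha>: "\<forall>i. \<alpha> i \<in> Fr n" "cg (Suc n) f (\<Sum>i\<in>basis_idx TYPE('r) n. \<alpha> i * basis_word n i)"
    using basis_word_span[OF f(1)] by blast
  let ?P = "\<lambda>\<alpha>. (\<forall>i. \<alpha> i \<in> Rop n) \<and> m = (\<Sum>i\<in>basis_idx TYPE('r) n. \<alpha> i * basis_op n i)"
  have "?P (\<lambda>i. ev (\<alpha> i))"
    using \<alpha>(1) ev_cg[OF \<alpha>(2)] f(2) by (auto simp: ev_sum ev_mult basis_op_def intro: HopI)
  then have "\<exists>\<alpha>. ?P \<alpha>" by (rule exI[of ?P])
  then have "?P (SOME \<alpha>. ?P \<alpha>)" by (rule someI_ex)
  then show "coord n i m \<in> Rop n" "m = (\<Sum>i\<in>basis_idx TYPE('r) n. coord n i m * basis_op n i)"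
    unfolding coord_def by blast+
qed

lemma coord_unique:
  fixes \<alpha> :: "nat \<times> nat \<Rightarrow> ('a::idom, 'r::{finite,linorder}) opr"
  assumes \<alpha>: "\<And>i. i \<in> basis_idx TYPE('r) n \<Longrightarrow> \<alpha> i \<in> Rop n"
    and m: "m = (\<Sum>i\<in>basis_idx TYPE('r) n. \<alpha> i * basis_op n i)" and i: "i \<in> basis_idx TYPE('r) n"
  shows "coord n i m = \<alpha> i"
proof -
  have mH: "m \<in> Rop (Suc n)"
    unfolding m by (intro Rop_closed) (auto intro: Rop_Suc \<alpha> basis_op_Rop)
  have "\<forall>i. \<exists>f. i \<in> basis_idx TYPE('r) n \<longrightarrow> f \<in> Fr n \<and> coord n i m - \<alpha> i = ev f"
    using coord_Rop[OF mH] \<alpha> Rop_closed(3) unfolding Rop_def by blast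
  from choice[OF this] obtain f where
    f: "\<And>i. i \<in> basis_idx TYPE('r) n \<Longrightarrow> f i \<in> Fr n \<and> coord n i m - \<alpha> i = ev (f i)" by (elim exE) blast
  have "(\<Sum>i\<in>basis_idx TYPE('r) n. ev (f i) * ev (basis_word n i)) = (\<Sum>i\<in>basis_idx TYPE('r) n. coord n i m * basis_op n i - \<alpha> i * basis_op n i)"
    by (rule sum.cong[OF HOL.refl]) (use f in \<open>simp add: basis_op_def flip: left_diff_distrib\<close>)
  also have "\<dots> = 0" using coord_sum[OF mH] m by (simp add: sum_subtractf)
  finally have "ev (f i) = 0" using basis_word_independent[of n f i] f i by blast
  then show ?thesis using f[OF i] by simp
qed

lemma coord_add:
  fixes m m' :: "('a::idom, 'r::{finite,linorder}) opr"
  assumes "m \<in> Rop (Suc n)" "m' \<in> Rop (Suc n)" "i \<in> basis_idx TYPE('r) n"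
  shows "coord n i (m + m') = coord n i m + coord n i m'"
  by (rule coord_unique[where \<alpha> = "\<lambda>i. coord n i m + coord n i m'"])
    (use assms coord_sum[OF assms(1)] coord_sum[OF assms(2)] in \<open>auto simp: distrib_right sum.distrib intro: coord_Rop\<close>)

lemma coord_left:
  fixes m a :: "('a::idom, 'r::{finite,linorder}) opr"
  assumes "m \<in> Rop (Suc n)" "a \<in> Rop n" "i \<in> basis_idx TYPE('r) n"
  shows "coord n i (a * m) = a * coord n i m"
  by (rule coord_unique[where \<alpha> = "\<lambda>i. a * coord n i m"])
    (use assms in \<open>auto intro: coord_Rop simp: mult.assoc simp flip: sum_distrib_left coord_sum[OF assms(1)]\<close>)

lemma dual_basis_coord: "dual_basis (Rop n) (Rop (Suc n)) (basis_idx TYPE('r) n) (basis_op n) (coord n :: _ \<Rightarrow> ('a::idom, 'r::{finite,linorder}) opr \<Rightarrow> _)"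
  unfolding dual_basis_def lin_def
  by (auto intro: Rop_Suc basis_op_Rop coord_Rop coord_add coord_left coord_sum)

lemma coord_x:
  fixes a :: "('a::idom, 'r::{finite,linorder}) opr"
  assumes a: "a \<in> Rop n" and j: "j < CARD('r)" and i: "i \<in> basis_idx TYPE('r) n"
  shows "coord n i (a * x_op (Suc n) ^ j) = (if i = (n, j) then a else 0)"
proof (rule coord_unique[OF _ _ i])
  have "(\<Sum>i\<in>basis_idx TYPE('r) n. (if i = (n, j) then a else 0) * basis_op n i)
      = (\<Sum>i\<in>basis_idx TYPE('r) n. if i = (n, j) then a * basis_op n i else 0)"
    by (rule sum.cong) auto
  then show "a * x_op (Suc n) ^ j = (\<Sum>i\<in>basis_idx TYPE('r) n. (if i = (n, j) then a else 0) * basis_op n i)"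
    using j by (simp add: basis_op_top basis_idx_def)
qed (use a in auto)

text \<open>The lower basis words are \<open>\<tau>_{n+1}\<close> times those of the level below.
  Expanding \<open>b\<close> there and moving its coordinates, which commute with
  \<open>\<tau>_{n+1}\<close>, to the left gives the coordinates directly; pure powers of the last
  variable do not occur.\<close>

lemma coord_t:
  fixes a b :: "('a::idom, 'r::{finite,linorder}) opr"
  assumes a: "a \<in> Rop (Suc n)" and b: "b \<in> Rop (Suc n)" and i: "i \<in> basis_idx TYPE('r) (Suc n)"
  shows "coord (Suc n) i (a * tau (Suc n) * b) = (if fst i = Suc n then 0 else a * coord n i b)"
proof (rule coord_unique[OF _ _ i])
  have "a * tau (Suc n) * b = a * tau (Suc n) * (\<Sum>i\<in>basis_idx TYPE('r) n. coord n i b * basis_op n i)"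
    using coord_sum[OF b] by simp
  also have "\<dots> = (\<Sum>i\<in>basis_idx TYPE('r) n. a * coord n i b * basis_op (Suc n) i)"
    unfolding sum_distrib_left
  proof (rule sum.cong[OF HOL.refl])
    fix i assume i: "i \<in> basis_idx TYPE('r) n"
    have "tau (Suc n) * coord n i b = coord n i b * tau (Suc n)"
      by (rule tau_Suc_comm[OF coord_Rop[OF b]])
    then have "a * tau (Suc n) * (coord n i b * basis_op n i) = a * coord n i b * (tau (Suc n) * basis_op n i)"
      by (simp add: mult.assoc flip: mult.assoc[of "tau (Suc n)"])
    also have "tau (Suc n) * basis_op n i = (basis_op (Suc n) i :: ('a, 'r) opr)"
      using i by (cases i) (simp add: basis_idx_def basis_op_Suc)
    finally show "a * tau (Suc n) * (coord n i b * basis_op n i) = a * coord n i b * basis_op (Suc n) i" .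
  qed
  also have "\<dots> = (\<Sum>i\<in>basis_idx TYPE('r) (Suc n). (if fst i = Suc n then 0 else a * coord n i b) * basis_op (Suc n) i)"
    unfolding sum_basis_idx by (auto intro!: sum.cong simp: basis_idx_def)
  finally show "a * tau (Suc n) * b = (\<Sum>i\<in>basis_idx TYPE('r) (Suc n). (if fst i = Suc n then 0 else a * coord n i b) * basis_op (Suc n) i)" .
qed (use a b in \<open>auto intro: Rop_Suc coord_Rop\<close>)

section \<open>Cubic and Serre relations\<close>

lemma three_mult: "3 * x = x + x + (x :: 'b::ring_1)"
proof -
  have "(3::'b) = 1 + 1 + 1" by simp
  then show ?thesis by (simp only: distrib_right mult_1_left)
qed

text \<open>
  With \<open>w = v - u\<close> the element is \<open>- (w\<^sup>3 - h\<^sup>2 w)\<close>, where \<open>w \<equiv> h t\<close> modulo commutators, \<open>w\<^sup>2\<close> is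
  central and \<open>w\<^sup>2 t \<equiv> h w\<close>; dividing by 2 is avoided because the characteristic is arbitrary.
\<close>
lemma cubic_commutators:
  fixes u v t h :: "'b::ring_1"
  assumes tt: "t * t = 1" and vt: "v * t = t * u + h" and tv: "t * v = u * t + h"
    and uv: "v * u = u * v" and h: "u * h = h * u" "v * h = h * v" "t * h = h * t"
  defines "w \<equiv> v - u"
  shows "3 * (u * v ^ 2 - u ^ 2 * v) - (v ^ 3 - u ^ 3) + h ^ 2 * (v - u)
    = (t * (t * u * w * w) - (t * u * w * w) * t) + (u * (h * w * t) - (h * w * t) * u)"
proof -
  have tu: "t * u = v * t - h" using vt by simp
  have r: "t * (t * z) = z" "t * (u * z) = v * (t * z) - h * z" "t * (v * z) = u * (t * z) + h * z"
    "v * (u * z) = u * (v * z)" "u * (h * z) = h * (u * z)" "v * (h * z) = h * (v * z)" "t * (h * z) = h * (t * z)" for z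
  proof -
    show "t * (t * z) = z" using tt by (simp flip: mult.assoc)
    show "t * (u * z) = v * (t * z) - h * z" by (simp add: tu left_diff_distrib flip: mult.assoc)
    show "t * (v * z) = u * (t * z) + h * z" by (simp add: tv distrib_right flip: mult.assoc)
    show "v * (u * z) = u * (v * z)" by (simp add: uv flip: mult.assoc)
    show "u * (h * z) = h * (u * z)" "v * (h * z) = h * (v * z)" "t * (h * z) = h * (t * z)"
      by (simp_all add: h flip: mult.assoc)
  qed
  show ?thesis
    unfolding w_def three_mult power2_eq_square power3_eq_cube
    by (simp add: distrib_left distrib_right left_diff_distrib right_diff_distrib mult.assoc tt tu tv uv h r)
qed

text \<open>Since \<open>t x t \<equiv> x\<close> modulo commutators,
  \<open>x2 - x1 \<equiv> h t1\<close> and \<open>x3 - x2 \<equiv> h t2\<close>. The second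
  difference is therefore \<open>h (t2 - t1)\<close>, and \<open>t1\<close> and \<open>t2\<close>
  are conjugate by the braid relation.\<close>

lemma serre_commutators:
  fixes x1 x2 x3 t1 t2 h :: "'b::ring_1"
  assumes tt: "t1 * t1 = 1" "t2 * t2 = 1" and br: "t1 * t2 * t1 = t2 * t1 * t2"
    and x2: "x2 = t1 * x1 * t1 + h * t1" and x3: "x3 = t2 * x2 * t2 + h * t2"
    and h: "t1 * h = h * t1" "t2 * h = h * t2"
  shows "x1 - 2 * x2 + x3 = (t2 * x2 * t2 - t2 * (t2 * x2)) + (t1 * (t1 * x1) - t1 * x1 * t1)
    + (h * t1 * t2 * (t1 * t2 * t1) - t1 * t2 * t1 * (h * t1 * t2))"
proof -
  have s: "t1 * (t1 * z) = z" "t2 * (t2 * z) = z" for z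
    using tt by (simp_all flip: mult.assoc)
  have "h * t1 * t2 * (t1 * t2 * t1) = h * t2"
  proof -
    have "t1 * t2 * (t1 * t2 * t1) = (t1 * t2 * t1) * (t2 * t1)" by (simp add: mult.assoc)
    also have "\<dots> = t2 * (t1 * (t2 * (t2 * t1)))" unfolding br by (simp add: mult.assoc)
    also have "\<dots> = t2" using tt by (simp add: s)
    finally show ?thesis by (simp add: mult.assoc)
  qed
  moreover have "t1 * t2 * t1 * (h * t1 * t2) = h * t1"
  proof -
    have "t1 * t2 * t1 * (h * t1 * t2) = h * (t1 * (t2 * (t1 * (t1 * t2))))"
      by (simp add: mult.assoc h[symmetric] flip: mult.assoc[of _ h])
        (simp add: mult.assoc h flip: mult.assoc[of _ h])
    then show ?thesis using tt by (simp add: s)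
  qed
  moreover have "2 * x2 = x2 + x2" by (simp add: mult_2)
  ultimately show ?thesis by (simp add: s) (simp add: x3 x2)
qed

section \<open>The two relations inside a centralizer\<close>

definition centralizer :: "nat \<Rightarrow> nat \<Rightarrow> ('a::idom, 'r::{finite,linorder}) opr set" where
  "centralizer n m = {z \<in> Rop m. \<forall>a\<in>Rop n. z * a = a * z}"

lemma subring_set_centralizer: "subring_set (centralizer n m :: ('a::idom, 'b::{finite,linorder}) opr set)"
proof -
  have "u * v * a = a * (u * v)" if "u * a = a * u" "v * a = a * v" for u v a :: "('a, 'b) opr"
  proof -
    have "u * v * a = u * a * v" using that(2) by (simp add: mult.assoc)
    then show ?thesis using that(1) by (simp add: mult.assoc)
  qed
  then show ?thesis
    unfolding subring_set_def centralizer_def by (auto simp: left_diff_distrib right_diff_distrib)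
qed

lemma centralizer_gens:
  shows centralizer_x_op: "n < k \<Longrightarrow> k \<le> m \<Longrightarrow> x_op k \<in> (centralizer n m :: ('a::idom, 'r::{finite,linorder}) opr set)"
    and centralizer_tau: "n < k \<Longrightarrow> k < m \<Longrightarrow> tau k \<in> (centralizer n m :: ('a, 'r) opr set)"
    and centralizer_h: "Sc hf \<in> (centralizer n m :: ('a, 'r) opr set)"
proof -
  have H: "a \<in> Rop (k - 1)" if "n < k" "a \<in> Rop n" for k and a :: "('a, 'r) opr"
    using Rop_mono[of n "k - 1" a] that by simp
  show "x_op k \<in> (centralizer n m :: ('a, 'r) opr set)" if "n < k" "k \<le> m"
    using that x_op_Suc_comm[OF H] by (simp add: centralizer_def)
  show "tau k \<in> (centralizer n m :: ('a, 'r) opr set)" if "n < k" "k < m"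
    using that tau_Suc_comm[OF H] by (simp add: centralizer_def)
  show "Sc hf \<in> (centralizer n m :: ('a, 'r) opr set)" by (simp add: centralizer_def Sc_Rop)
qed

text \<open>The set \<open>Z\<close> is left open so that one identity serves both families: for
  \<open>x^-\<close> it consists of the \<open>z\<close> with \<open>f * z\<close> in
  \<open>Comm\<close>, for \<open>x^+\<close> of the \<open>z\<close> for which the trace of
  \<open>m \<mapsto> z m f\<close> is in \<open>Comm\<close>. Both absorb commutators of the
  centralizer.\<close>

lemma cubic_Z:
  fixes Z :: "('a::idom, 'r::{finite,linorder}) opr set" and n :: nat
  assumes add: "\<And>z z'. z \<in> Z \<Longrightarrow> z' \<in> Z \<Longrightarrow> z + z' \<in> Z"
    and comm: "\<And>g g'. g \<in> centralizer n (n + 2) \<Longrightarrow> g' \<in> centralizer n (n + 2) \<Longrightarrow> g * g' - g' * g \<in> Z"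
  defines "u \<equiv> x_op (n + 1)" and "v \<equiv> x_op (n + 2)"
  shows "3 * (u * v ^ 2 - u ^ 2 * v) - (v ^ 3 - u ^ 3) + Sc hf ^ 2 * (v - u) \<in> Z"
proof -
  let ?t = "tau (n + 1) :: ('a, 'r) opr" and ?h = "Sc hf :: ('a, 'r) opr" and ?w = "v - u"
  have K: "u \<in> centralizer n (n + 2)" "v \<in> centralizer n (n + 2)" "?t \<in> centralizer n (n + 2)" "?h \<in> centralizer n (n + 2)"
    unfolding u_def v_def by (auto intro!: centralizer_gens)
  note S = subrD(3,4)[OF subring_set_centralizer]
  have "3 * (u * v ^ 2 - u ^ 2 * v) - (v ^ 3 - u ^ 3) + ?h ^ 2 * (v - u)
      = (?t * (?t * u * ?w * ?w) - (?t * u * ?w * ?w) * ?t) + (u * (?h * ?w * ?t) - (?h * ?w * ?t) * u)"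
  proof (rule cubic_commutators)
    show "?t * ?t = 1" by (rule tau_sq) simp
    show "v * ?t = ?t * u + ?h" "?t * v = u * ?t + ?h"
      using x_op_tau[of "n + 1"] tau_x_op[of "n + 1"] by (simp_all add: u_def v_def)
    show "v * u = u * v" unfolding u_def v_def by (rule x_op_comm) auto
    show "u * ?h = ?h * u" "v * ?h = ?h * v" unfolding u_def v_def by (simp_all add: Sc_x_op)
    show "?t * ?h = ?h * ?t" by (simp add: Sc_tau)
  qed
  also have "\<dots> \<in> Z"
    by (intro add comm S K)
  finally show ?thesis .
qed

lemma serre_Z:
  fixes Z :: "('a::idom, 'r::{finite,linorder}) opr set" and n :: nat
  assumes add: "\<And>z z'. z \<in> Z \<Longrightarrow> z' \<in> Z \<Longrightarrow> z + z' \<in> Z"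
    and comm: "\<And>g g'. g \<in> centralizer n (n + 3) \<Longrightarrow> g' \<in> centralizer n (n + 3) \<Longrightarrow> g * g' - g' * g \<in> Z"
  shows "x_op (n + 1) - 2 * x_op (n + 2) + x_op (n + 3) \<in> Z"
proof -
  let ?t1 = "tau (n + 1) :: ('a, 'r) opr" and ?t2 = "tau (n + 2) :: ('a, 'r) opr" and ?h = "Sc hf :: ('a, 'r) opr"
  let ?x1 = "x_op (n + 1) :: ('a, 'r) opr" and ?x2 = "x_op (n + 2) :: ('a, 'r) opr" and ?x3 = "x_op (n + 3) :: ('a, 'r) opr"
  have K: "?x1 \<in> centralizer n (n + 3)" "?x2 \<in> centralizer n (n + 3)" "?t1 \<in> centralizer n (n + 3)" "?t2 \<in> centralizer n (n + 3)" "?h \<in> centralizer n (n + 3)"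
    by (auto intro!: centralizer_gens)
  note S = subrD(4)[OF subring_set_centralizer]
  have "?x1 - 2 * ?x2 + ?x3 = (?t2 * ?x2 * ?t2 - ?t2 * (?t2 * ?x2)) + (?t1 * (?t1 * ?x1) - ?t1 * ?x1 * ?t1)
    + (?h * ?t1 * ?t2 * (?t1 * ?t2 * ?t1) - ?t1 * ?t2 * ?t1 * (?h * ?t1 * ?t2))"
  proof (rule serre_commutators)
    show "?t1 * ?t1 = 1" "?t2 * ?t2 = 1" by (auto intro!: tau_sq)
    show "?t1 * ?t2 * ?t1 = ?t2 * ?t1 * ?t2" using tau_braid[of "n + 1"] by simp
    show "?x2 = ?t1 * ?x1 * ?t1 + ?h * ?t1" "?x3 = ?t2 * ?x2 * ?t2 + ?h * ?t2"
      unfolding x_op_def using jm.X_Suc[of "n + 1"] jm.X_Suc[of "n + 2"] by (simp_all add: numeral_3_eq_3)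
    show "?t1 * ?h = ?h * ?t1" "?t2 * ?h = ?h * ?t2" by (simp_all add: Sc_tau)
  qed
  also have "\<dots> \<in> Z"
    by (intro add comm S K)
  finally show ?thesis .
qed

text \<open>As \<open>f\<close> commutes with \<open>g'\<close>, the product is the single
  commutator of \<open>f * g\<close> with \<open>g'\<close>.\<close>

lemma Comm_centralizer:
  assumes f: "f \<in> Rop n" and nm: "n \<le> m" and g: "g \<in> centralizer n m" "g' \<in> centralizer n m"
  shows "f * (g * g' - g' * g) \<in> Comm (Rop m)"
proof -
  have "f * (g * g' - g' * g) = (f * g) * g' - g' * (f * g)"
  proof -
    have "g' * f = f * g'" using f g by (simp add: centralizer_def)
    then show ?thesis by (simp add: right_diff_distrib flip: mult.assoc)
  qed
  then show ?thesis
    using Comm_comm[of "f * g" "Rop m" g'] f g Rop_mono[OF nm f] by (simp add: centralizer_def)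
qed

lemma cubic_pos:
  fixes f :: "('a::idom, 'r::{finite,linorder}) opr" and n :: nat
  assumes "f \<in> Rop n"
  defines "u \<equiv> x_op (n + 1)" and "v \<equiv> x_op (n + 2)"
  shows "f * (3 * (u * v ^ 2 - u ^ 2 * v) - (v ^ 3 - u ^ 3) + Sc hf ^ 2 * (v - u)) \<in> Comm (Rop (n + 2))"
proof -
  have "3 * (u * v ^ 2 - u ^ 2 * v) - (v ^ 3 - u ^ 3) + Sc hf ^ 2 * (v - u) \<in> {z. f * z \<in> Comm (Rop (n + 2))}"
    unfolding u_def v_def
    by (rule cubic_Z) (auto simp: distrib_left intro: Comm_plus Comm_centralizer assms(1))
  then show ?thesis by simp
qed

lemma serre_pos:
  fixes f :: "('a::idom, 'r::{finite,linorder}) opr" and n :: nat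
  assumes "f \<in> Rop n"
  shows "f * (x_op (n + 1) - 2 * x_op (n + 2) + x_op (n + 3)) \<in> Comm (Rop (n + 3))"
proof -
  have "x_op (n + 1) - 2 * x_op (n + 2) + x_op (n + 3) \<in> {z. f * z \<in> Comm (Rop (n + 3))}"
    by (rule serre_Z) (auto simp: distrib_left intro: Comm_plus Comm_centralizer assms)
  then show ?thesis by simp
qed

lemma lin_mult:
  assumes "subring_set B" "A \<subseteq> B" "g \<in> B" "f \<in> B" "\<And>a. a \<in> A \<Longrightarrow> g * a = a * g"
  shows "lin A B B (\<lambda>m. g * m * f)"
proof -
  have "g * (a * m) * f = a * (g * m * f)" if "a \<in> A" for a m
    using assms(5)[OF that] by (simp flip: mult.assoc)
  then show ?thesis
    unfolding lin_def using assms subrD[OF assms(1)] by (auto simp: distrib_left distrib_right)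
qed

lemma mod_tr_mult_comm:
  assumes db: "dual_basis A B I e p" and g: "g \<in> B" "g' \<in> B" and f: "f \<in> B"
    and comm: "\<And>a. a \<in> A \<Longrightarrow> g * a = a * g" "\<And>a. a \<in> A \<Longrightarrow> g' * a = a * g'"
  shows "mod_tr I e p (\<lambda>m. g * g' * m * f) - mod_tr I e p (\<lambda>m. g' * g * m * f) \<in> Comm A"
proof -
  have B: "subring_set B" and AB: "A \<subseteq> B" using db by (auto simp: dual_basis_def)
  have F: "lin A B B (\<lambda>m. g' * m * f)" by (rule lin_mult[OF B AB g(2) f comm(2)])
  have G: "lin A B B (\<lambda>m. g * m * 1)" by (rule lin_mult[OF B AB g(1) subrD(1)[OF B] comm(1)])
  show ?thesis using mod_tr_cyclic[OF db db F G] by (simp add: mult.assoc)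
qed

lemma mod_tr_add:
  assumes db: "dual_basis A B I e p" and F: "lin A B B F" and G: "lin A B B G"
  shows "mod_tr I e p (\<lambda>m. F m + G m) = mod_tr I e p F + mod_tr I e p G"
proof -
  have "p i (F (e i) + G (e i)) = p i (F (e i)) + p i (G (e i))" if "i \<in> I" for i
    using db that linD(1)[OF F] linD(1)[OF G] by (auto simp: dual_basis_def intro: linD(2))
  then show ?thesis by (simp add: mod_tr_def sum.distrib)
qed

text \<open>Traces in a tower compose. The factor \<open>g * e i\<close> lies in \<open>B\<close>,
  so it passes through the \<open>B\<close>-linear coordinates of the inner trace, and
  \<open>h\<close> then moves past \<open>e i\<close> because it centralizes
  \<open>B\<close>.\<close>

lemma mod_tr_mod_tr:
  assumes e: "dual_basis A B I e p" and f: "dual_basis B C J f q"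
    and g: "g \<in> B" and h: "h \<in> C" "\<And>b. b \<in> B \<Longrightarrow> h * b = b * h" and c: "c \<in> C"
  shows "mod_tr I e p (\<lambda>m. g * m * mod_tr J f q (\<lambda>m. h * m * c))
    = mod_tr (I \<times> J) (\<lambda>(i, j). e i * f j) (\<lambda>(i, j) m. p i (q j m)) (\<lambda>m. g * h * m * c)"
proof -
  have A: "subring_set A" and B: "subring_set B" and C: "subring_set C" and AB: "A \<subseteq> B" and BC: "B \<subseteq> C"
    and eB: "\<And>i. i \<in> I \<Longrightarrow> e i \<in> B" and fC: "\<And>j. j \<in> J \<Longrightarrow> f j \<in> C"
    and p: "\<And>i. i \<in> I \<Longrightarrow> lin A B A (p i)" and q: "\<And>j. j \<in> J \<Longrightarrow> lin B C B (q j)"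
    using e f by (auto simp: dual_basis_def)
  have y: "h * f j * c \<in> C" if "j \<in> J" for j
    using fC[OF that] h(1) c by (intro subrD(4)[OF C])
  have "p i (g * e i * (\<Sum>j\<in>J. q j (h * f j * c))) = (\<Sum>j\<in>J. p i (q j (g * h * (e i * f j) * c)))"
    if i: "i \<in> I" for i
  proof -
    have ge: "g * e i \<in> B" using g eB[OF i] by (rule subrD(4)[OF B])
    have "p i (g * e i * (\<Sum>j\<in>J. q j (h * f j * c))) = p i (\<Sum>j\<in>J. g * e i * q j (h * f j * c))"
      by (simp add: sum_distrib_left)
    also have "\<dots> = (\<Sum>j\<in>J. p i (g * e i * q j (h * f j * c)))"
      by (rule lin_sum[OF p[OF i] B _ A]) (use ge linD(1)[OF q y] subrD(4)[OF B] in blast)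
    also have "\<dots> = (\<Sum>j\<in>J. p i (q j (g * h * (e i * f j) * c)))"
    proof (rule sum.cong[OF HOL.refl])
      fix j assume j: "j \<in> J"
      have "g * e i * q j (h * f j * c) = q j (g * e i * (h * f j * c))"
        using linD(3)[OF q[OF j] ge y[OF j]] by simp
      also have "g * e i * (h * f j * c) = g * h * (e i * f j) * c"
      proof -
        have "e i * (h * y) = h * (e i * y)" for y using h(2)[OF eB[OF i]] by (simp flip: mult.assoc)
        then show ?thesis by (simp add: mult.assoc)
      qed
      finally show "p i (g * e i * q j (h * f j * c)) = p i (q j (g * h * (e i * f j) * c))" by simp
    qed
    finally show ?thesis .
  qed
  then show ?thesis unfolding mod_tr_comp by (simp add: mod_tr_def)
qed

section \<open>The partial trace on operators\<close>

definition x_plus_op :: "nat \<Rightarrow> nat \<Rightarrow> ('a::idom, 'r::{finite,linorder}) opr \<Rightarrow> ('a, 'r) opr" where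
  "x_plus_op n k f = mod_tr (basis_idx TYPE('r) n) (basis_op n) (coord n) (\<lambda>m. x_op (Suc n) ^ k * m * f)"

lemma x_op_power_comm:
  fixes a :: "('a::idom, 'r::{finite,linorder}) opr"
  assumes "n < k" "a \<in> Rop n"
  shows "x_op k ^ j * a = a * x_op k ^ j"
proof -
  have "x_op k ^ j \<in> (centralizer n k :: ('a, 'r) opr set)"
    by (rule subring_set_power[OF subring_set_centralizer centralizer_x_op[OF assms(1) order_refl]])
  then show ?thesis using assms(2) by (simp add: centralizer_def)
qed

lemma lin_x_plus_op:
  assumes "f \<in> Rop (Suc n)"
  shows "lin (Rop n) (Rop (Suc n)) (Rop (Suc n)) (\<lambda>m. x_op (Suc n) ^ k * m * f)"
  using assms by (intro lin_mult) (auto intro: Rop_Suc x_op_power_comm)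

lemma x_plus_op_add:
  assumes "f \<in> Rop (Suc n)" "g \<in> Rop (Suc n)"
  shows "x_plus_op n k (f + g) = x_plus_op n k f + x_plus_op n k g"
  unfolding x_plus_op_def using mod_tr_add[OF dual_basis_coord lin_x_plus_op[OF assms(1)] lin_x_plus_op[OF assms(2)]]
  by (simp add: distrib_left)

lemma x_plus_op_Rop: "f \<in> Rop (Suc n) \<Longrightarrow> x_plus_op n k f \<in> Rop n"
  unfolding x_plus_op_def mod_tr_def by (intro Rop_closed coord_Rop) (auto intro: basis_op_Rop)

lemma x_plus_op_zero: "x_plus_op n k 0 = 0"
  using x_plus_op_add[of 0 n 0 k] by simp

lemma x_plus_op_uminus: "f \<in> Rop (Suc n) \<Longrightarrow> x_plus_op n k (- f) = - x_plus_op n k f"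
proof -
  assume "f \<in> Rop (Suc n)"
  then have "x_plus_op n k f + x_plus_op n k (- f) = x_plus_op n k 0"
    using x_plus_op_add[of f n "- f" k] by simp
  then show ?thesis unfolding x_plus_op_zero by (simp add: eq_neg_iff_add_eq_0 add.commute)
qed

lemma x_plus_op_diff: "f \<in> Rop (Suc n) \<Longrightarrow> g \<in> Rop (Suc n) \<Longrightarrow> x_plus_op n k (f - g) = x_plus_op n k f - x_plus_op n k g"
  using x_plus_op_add[of f n "- g" k] x_plus_op_uminus[of g n k] by simp

lemma x_plus_op_scale:
  fixes f :: "('a::idom, 'b::{finite,linorder}) opr"
  assumes "f \<in> Rop (Suc n)"
  shows "x_plus_op n k (Sc (to_fract c) * f) = Sc (to_fract c) * x_plus_op n k f"
  unfolding x_plus_op_def mod_tr_def sum_distrib_left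
proof (rule sum.cong[OF HOL.refl])
  fix i assume i: "i \<in> basis_idx TYPE('b) n"
  let ?y = "x_op (Suc n) ^ k * basis_op n i * f"
  have y: "?y \<in> Rop (Suc n)" 
    by (intro Rop_closed(4,8) Rop_gens(2) basis_op_Rop[OF i] assms) auto
  have "x_op (Suc n) ^ k * basis_op n i * (Sc (to_fract c) * f) = Sc (to_fract c) * ?y"
  proof -
    have "x_op (Suc n) ^ k * basis_op n i \<in> Rop (Suc n)"
      by (intro Rop_closed(4,8) Rop_gens(2) basis_op_Rop[OF i]) auto
    from Sc_Rop[OF this, of "to_fract c"] show ?thesis by (simp flip: mult.assoc)
  qed
  then show "coord n i (x_op (Suc n) ^ k * basis_op n i * (Sc (to_fract c) * f)) = Sc (to_fract c) * coord n i ?y"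
    using coord_left[OF y Rop_gens(1) i] by simp
qed

text \<open>The traces belonging to \<open>a * b\<close> and to \<open>b * a\<close> are those of
  the two compositions of \<open>m \<mapsto> m a\<close> with \<open>m \<mapsto> x^k m b\<close>, so
  cyclicity applies.\<close>

lemma x_plus_op_Comm:
  fixes f :: "('a::idom, 'r::{finite,linorder}) opr"
  assumes "f \<in> Comm (Rop (Suc n))"
  shows "x_plus_op n k f \<in> Comm (Rop n)"
proof (rule Comm_hom[OF assms _ x_plus_op_add subring_set_Rop x_plus_op_zero])
  fix a b :: "('a, 'r) opr" assume ab: "a \<in> Rop (Suc n)" "b \<in> Rop (Suc n)"
  have F: "lin (Rop n) (Rop (Suc n)) (Rop (Suc n)) (\<lambda>m. 1 * m * a)"
    using ab by (intro lin_mult) (auto intro: Rop_Suc)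
  have G: "lin (Rop n) (Rop (Suc n)) (Rop (Suc n)) (\<lambda>m. x_op (Suc n) ^ k * m * b)"
    using ab by (intro lin_x_plus_op)
  have "x_plus_op n k (a * b) - x_plus_op n k (b * a) \<in> Comm (Rop n)"
    using mod_tr_cyclic[OF dual_basis_coord dual_basis_coord F G] unfolding x_plus_op_def by (simp add: mult.assoc)
  then show "x_plus_op n k (a * b - b * a) \<in> Comm (Rop n)"
    using ab by (simp add: x_plus_op_diff)
qed auto

lemma x_plus_op_x_plus_op:
  fixes f :: "('a::idom, 'r::{finite,linorder}) opr"
  assumes "f \<in> Rop (Suc (Suc n))"
  shows "x_plus_op n a (x_plus_op (Suc n) b f) = mod_tr (basis_idx TYPE('r) n \<times> basis_idx TYPE('r) (Suc n)) (\<lambda>(i, j). basis_op n i * basis_op (Suc n) j)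
    (\<lambda>(i, j) m. coord n i (coord (Suc n) j m)) (\<lambda>m. x_op (Suc n) ^ a * x_op (Suc (Suc n)) ^ b * m * f)"
  unfolding x_plus_op_def using assms
  by (intro mod_tr_mod_tr[OF dual_basis_coord dual_basis_coord]) (auto intro: x_op_power_comm)

lemma x_plus_op_x_plus_op_x_plus_op:
  fixes f :: "('a::idom, 'r::{finite,linorder}) opr"
  assumes "f \<in> Rop (Suc (Suc (Suc n)))"
  shows "x_plus_op n a (x_plus_op (Suc n) b (x_plus_op (Suc (Suc n)) c f))
    = mod_tr (basis_idx TYPE('r) n \<times> basis_idx TYPE('r) (Suc n) \<times> basis_idx TYPE('r) (Suc (Suc n)))
      (\<lambda>(i, j). basis_op n i * (case j of (j, k) \<Rightarrow> basis_op (Suc n) j * basis_op (Suc (Suc n)) k))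
      (\<lambda>(i, j) m. coord n i ((case j of (j, k) \<Rightarrow> \<lambda>m. coord (Suc n) j (coord (Suc (Suc n)) k m)) m))
      (\<lambda>m. x_op (Suc n) ^ a * (x_op (Suc (Suc n)) ^ b * x_op (Suc (Suc (Suc n))) ^ c) * m * f)"
  unfolding x_plus_op_x_plus_op[OF assms]
  unfolding x_plus_op_def
proof (rule mod_tr_mod_tr[OF dual_basis_coord dual_basis_comp[OF dual_basis_coord dual_basis_coord]])
  show "x_op (Suc (Suc n)) ^ b * x_op (Suc (Suc (Suc n))) ^ c * y = y * (x_op (Suc (Suc n)) ^ b * x_op (Suc (Suc (Suc n))) ^ c)"
    if "y \<in> (Rop (Suc n) :: ('a, 'r) opr set)" for y
  proof -
    have "y * x_op (Suc (Suc n)) ^ b = x_op (Suc (Suc n)) ^ b * y" "y * x_op (Suc (Suc (Suc n))) ^ c = x_op (Suc (Suc (Suc n))) ^ c * y"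
      using that by (auto intro!: x_op_power_comm[of "Suc n", symmetric])
    then show ?thesis by (intro comm_mult[symmetric])
  qed
qed (use assms in auto)

text \<open>These are the hypotheses of \<open>cubic_Z\<close> and \<open>serre_Z\<close> for the
  trace functional. Left multiplication by an element of the centralizer is linear over
  \<open>Rop n\<close>, so cyclicity allows two such multiplications to be exchanged.\<close>

lemma neg_Z:
  fixes f :: "('a::idom, 'r::{finite,linorder}) opr"
  assumes db: "dual_basis (Rop n) (Rop m) I e p" and f: "f \<in> Rop m"
  defines "Z \<equiv> {z \<in> centralizer n m. mod_tr I e p (\<lambda>x. z * x * f) \<in> Comm (Rop n)}"
  shows "z \<in> Z \<Longrightarrow> z' \<in> Z \<Longrightarrow> z + z' \<in> Z"
    and "g \<in> centralizer n m \<Longrightarrow> g' \<in> centralizer n m \<Longrightarrow> g * g' - g' * g \<in> Z"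
proof -
  have B: "Rop n \<subseteq> (Rop m :: ('a, 'r) opr set)" using db by (simp add: dual_basis_def)
  have L: "lin (Rop n) (Rop m) (Rop m) (\<lambda>x. z * x * f)" if "z \<in> centralizer n m" for z
    using that f by (intro lin_mult[OF subring_set_Rop B]) (auto simp: centralizer_def)
  have add: "mod_tr I e p (\<lambda>x. (z + z') * x * f) = mod_tr I e p (\<lambda>x. z * x * f) + mod_tr I e p (\<lambda>x. z' * x * f)"
    if "z \<in> centralizer n m" "z' \<in> centralizer n m" for z z'
    using mod_tr_add[OF db L[OF that(1)] L[OF that(2)]] by (simp add: distrib_right)
  show "z \<in> Z \<Longrightarrow> z' \<in> Z \<Longrightarrow> z + z' \<in> Z"
    unfolding Z_def by (auto simp: add intro: Comm_plus subrD(6)[OF subring_set_centralizer])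
  assume g: "g \<in> centralizer n m" "g' \<in> centralizer n m"
  note S = subrD[OF subring_set_centralizer]
  have "mod_tr I e p (\<lambda>x. (g * g' - g' * g) * x * f) = mod_tr I e p (\<lambda>x. g * g' * x * f) - mod_tr I e p (\<lambda>x. g' * g * x * f)"
    using add[OF S(3)[OF S(4)[OF g] S(4)[OF g(2,1)]] S(4)[OF g(2,1)]] by (simp add: algebra_simps)
  also have "\<dots> \<in> Comm (Rop n)"
    using g f by (intro mod_tr_mult_comm[OF db]) (auto simp: centralizer_def)
  finally show "g * g' - g' * g \<in> Z"
    using S(3)[OF S(4)[OF g] S(4)[OF g(2,1)]] by (simp add: Z_def)
qed

lemma mod_tr_mult_linear:
  fixes f :: "('a::idom, 'r::{finite,linorder}) opr"
  assumes db: "dual_basis (Rop n) (Rop m) I e p" and f: "f \<in> Rop m"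
  defines "tz \<equiv> \<lambda>z. mod_tr I e p (\<lambda>x. z * x * f)"
  shows "z \<in> centralizer n m \<Longrightarrow> z' \<in> centralizer n m \<Longrightarrow> tz (z + z') = tz z + tz z'"
    and "z \<in> centralizer n m \<Longrightarrow> tz (- z) = - tz z"
    and "z \<in> centralizer n m \<Longrightarrow> z' \<in> centralizer n m \<Longrightarrow> tz (z - z') = tz z - tz z'"
    and "z \<in> centralizer n m \<Longrightarrow> a \<in> Rop n \<Longrightarrow> tz (a * z) = a * tz z"
proof -
  have B: "Rop n \<subseteq> (Rop m :: ('a, 'r) opr set)" using db by (simp add: dual_basis_def)
  have L: "lin (Rop n) (Rop m) (Rop m) (\<lambda>x. z * x * f)" if "z \<in> centralizer n m" for z
    using that f by (intro lin_mult[OF subring_set_Rop B]) (auto simp: centralizer_def)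
  show add: "tz (z + z') = tz z + tz z'" if "z \<in> centralizer n m" "z' \<in> centralizer n m" for z z'
    using mod_tr_add[OF db L[OF that(1)] L[OF that(2)]] by (simp add: distrib_right tz_def)
  note S = subrD[OF subring_set_centralizer]
  have "tz 0 = 0" using add[OF S(2) S(2)] by simp
  then show um: "tz (- z) = - tz z" if "z \<in> centralizer n m" for z
    using add[OF that S(5)[OF that]] by (simp add: eq_neg_iff_add_eq_0 add.commute)
  show "tz (z - z') = tz z - tz z'" if "z \<in> centralizer n m" "z' \<in> centralizer n m" for z z'
    using add[OF that(1) S(5)[OF that(2)]] um[OF that(2)] by simp
  assume z: "z \<in> centralizer n m" and a: "a \<in> Rop n"
  show "tz (a * z) = a * tz z"
    unfolding tz_def mod_tr_def sum_distrib_left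
  proof (rule sum.cong[OF HOL.refl])
    fix i assume "i \<in> I"
    then have "lin (Rop n) (Rop m) (Rop n) (p i)" "e i \<in> Rop m" using db by (auto simp: dual_basis_def)
    then show "p i (a * z * e i * f) = a * p i (z * e i * f)"
      using linD(3)[of "Rop n" "Rop m" "Rop n" "p i" a "z * e i * f"] a z f
      by (simp add: centralizer_def mult.assoc Rop_closed(4))
  qed
qed

lemma cubic_neg:
  fixes f :: "('a::idom, 'r::{finite,linorder}) opr"
  assumes f: "f \<in> Rop (Suc (Suc n))"
  defines "t \<equiv> \<lambda>a b. x_plus_op n a (x_plus_op (Suc n) b f)"
  shows "3 * (t 2 1 - t 1 2) - (t 3 0 - t 0 3) + Sc hf ^ 2 * (t 1 0 - t 0 1) \<in> Comm (Rop n)"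
proof -
  let ?u = "x_op (Suc n) :: ('a, 'r) opr" and ?v = "x_op (Suc (Suc n)) :: ('a, 'r) opr" and ?h = "Sc hf :: ('a, 'r) opr"
  note db = dual_basis_comp[OF dual_basis_coord[of n, where 'a = 'a and 'r = 'r] dual_basis_coord[of "Suc n"]]
  define tz where "tz z = mod_tr (basis_idx TYPE('r) n \<times> basis_idx TYPE('r) (Suc n)) (\<lambda>(i, j). basis_op n i * basis_op (Suc n) j)
    (\<lambda>(i, j) m. coord n i (coord (Suc n) j m)) (\<lambda>m. z * m * f)" for z
  note L = mod_tr_mult_linear[OF db f, folded tz_def]
  note Z = neg_Z[OF db f, folded tz_def]
  have t: "t a b = tz (?u ^ a * ?v ^ b)" for a b
    unfolding t_def tz_def by (rule x_plus_op_x_plus_op[OF f])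
  note S = subrD[OF subring_set_centralizer]
  have K: "?u \<in> centralizer n (Suc (Suc n))" "?v \<in> centralizer n (Suc (Suc n))" "?h \<in> centralizer n (Suc (Suc n))"
    by (auto intro!: centralizer_gens)
  have KK: "?u ^ a * ?v ^ b \<in> centralizer n (Suc (Suc n))" for a b
    by (intro S(4) subring_set_power[OF subring_set_centralizer] K)
  have h2: "?h ^ 2 \<in> Rop n" by auto
  have "3 * (?u * ?v ^ 2 - ?u ^ 2 * ?v) - (?v ^ 3 - ?u ^ 3) + ?h ^ 2 * (?v - ?u)
      \<in> {z \<in> centralizer n (Suc (Suc n)). tz z \<in> Comm (Rop n)}"
    using cubic_Z[of "{z \<in> centralizer n (Suc (Suc n)). tz z \<in> Comm (Rop n)}" n] Z by simp
  then have c: "tz (3 * (?u * ?v ^ 2 - ?u ^ 2 * ?v) - (?v ^ 3 - ?u ^ 3) + ?h ^ 2 * (?v - ?u)) \<in> Comm (Rop n)" by simp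
  let ?m = "\<lambda>a b. ?u ^ a * ?v ^ b"
  \<comment> \<open>Of two operators \<open>x^+\<close> the one applied last carries the power of
    the lower variable, whereas for \<open>x^-\<close> it carries that of the upper one. The same
    identity therefore appears with the opposite sign.\<close>
  have e: "3 * (?u * ?v ^ 2 - ?u ^ 2 * ?v) - (?v ^ 3 - ?u ^ 3) + ?h ^ 2 * (?v - ?u)
      = - (((?m 2 1 - ?m 1 2) + (?m 2 1 - ?m 1 2) + (?m 2 1 - ?m 1 2)) - (?m 3 0 - ?m 0 3) + ?h ^ 2 * (?m 1 0 - ?m 0 1))"
    unfolding three_mult by (simp add: algebra_simps)
  have eq: "tz (- (((?m 2 1 - ?m 1 2) + (?m 2 1 - ?m 1 2) + (?m 2 1 - ?m 1 2)) - (?m 3 0 - ?m 0 3) + ?h ^ 2 * (?m 1 0 - ?m 0 1)))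
      = - (3 * (t 2 1 - t 1 2) - (t 3 0 - t 0 3) + ?h ^ 2 * (t 1 0 - t 0 1))"
    using KK h2 S(3,5,6)[of _ n "Suc (Suc n)"] S(4)[OF subring_set_power[OF subring_set_centralizer K(3)]]
    unfolding t three_mult
    by (simp only: L(1-4) S(3-6)[of _ n "Suc (Suc n)"])
  show ?thesis using Comm_uminus[OF c[unfolded e]] unfolding eq minus_minus .
qed

lemma serre_neg:
  fixes f :: "('a::idom, 'r::{finite,linorder}) opr"
  assumes f: "f \<in> Rop (Suc (Suc (Suc n)))"
  defines "t \<equiv> \<lambda>a b c. x_plus_op n a (x_plus_op (Suc n) b (x_plus_op (Suc (Suc n)) c f))"
  shows "t 1 0 0 - 2 * t 0 1 0 + t 0 0 1 \<in> Comm (Rop n)"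
proof -
  let ?x1 = "x_op (Suc n) :: ('a, 'r) opr" and ?x2 = "x_op (Suc (Suc n)) :: ('a, 'r) opr" and ?x3 = "x_op (Suc (Suc (Suc n))) :: ('a, 'r) opr"
  note db = dual_basis_comp[OF dual_basis_coord[of n, where 'a = 'a and 'r = 'r] dual_basis_comp[OF dual_basis_coord[of "Suc n"] dual_basis_coord[of "Suc (Suc n)"]]]
  define tz where "tz z = mod_tr (basis_idx TYPE('r) n \<times> basis_idx TYPE('r) (Suc n) \<times> basis_idx TYPE('r) (Suc (Suc n)))
      (\<lambda>(i, j). basis_op n i * (case j of (j, k) \<Rightarrow> basis_op (Suc n) j * basis_op (Suc (Suc n)) k))
      (\<lambda>(i, j) m. coord n i ((case j of (j, k) \<Rightarrow> \<lambda>m. coord (Suc n) j (coord (Suc (Suc n)) k m)) m))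
      (\<lambda>m. z * m * f)" for z
  note L = mod_tr_mult_linear[OF db f, folded tz_def]
  note Z = neg_Z[OF db f, folded tz_def]
  have t: "t a b c = tz (?x1 ^ a * (?x2 ^ b * ?x3 ^ c))" for a b c
    unfolding t_def tz_def by (rule x_plus_op_x_plus_op_x_plus_op[OF f])
  note S = subrD[OF subring_set_centralizer]
  have K: "?x1 \<in> centralizer n (Suc (Suc (Suc n)))" "?x2 \<in> centralizer n (Suc (Suc (Suc n)))" "?x3 \<in> centralizer n (Suc (Suc (Suc n)))"
    by (auto intro!: centralizer_gens)
  have "?x1 - 2 * ?x2 + ?x3 \<in> {z \<in> centralizer n (Suc (Suc (Suc n))). tz z \<in> Comm (Rop n)}"
    using serre_Z[of "{z \<in> centralizer n (Suc (Suc (Suc n))). tz z \<in> Comm (Rop n)}" n] Z by (simp add: numeral_3_eq_3)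
  then have "tz (?x1 - (?x2 + ?x2) + ?x3) \<in> Comm (Rop n)" by (simp add: mult_2)
  also have "tz (?x1 - (?x2 + ?x2) + ?x3) = tz ?x1 - (tz ?x2 + tz ?x2) + tz ?x3"
    by (simp only: L(1-4) S(3-6)[of _ n "Suc (Suc (Suc n))"] K)
  finally show ?thesis by (simp add: t mult_2)
qed


section \<open>Power sums\<close>

definition psum :: "nat \<Rightarrow> nat \<Rightarrow> ('a::idom, 'r::{finite,linorder}) opr" where
  "psum n l = (\<Sum>i=1..n. x_op i ^ l)"

lemma psum_Suc: "psum (Suc n) l = psum n l + x_op (Suc n) ^ l"
  by (simp add: psum_def)

lemma psum_Rop: "psum n l \<in> Rop n"
  unfolding psum_def by (intro Rop_closed(7,8) Rop_gens) auto

lemma x_op_power_tau: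
  assumes "1 \<le> n"
  shows "x_op (Suc n) ^ l * tau n = tau n * x_op n ^ l
    + Sc hf * (\<Sum>u<l. x_op n ^ u * (x_op (Suc n) :: ('a::idom, 'r::{finite,linorder}) opr) ^ (l - Suc u))"
  using ev_cg[OF x_pow_t[OF assms, of l, where 'a = 'a and 'r = 'r]]
  by (simp add: ev_mult ev_power ev_xgen ev_taugen ev_add ev_sum ev_scal hf_def)

lemma tau_x_op_power:
  assumes n: "1 \<le> n"
  shows "tau n * x_op (Suc n) ^ l = x_op n ^ l * tau n
    + Sc hf * (\<Sum>u<l. x_op n ^ u * (x_op (Suc n) :: ('a::idom, 'r::{finite,linorder}) opr) ^ (l - Suc u))"
proof (induction l)
  case (Suc l)
  let ?X = "x_op (Suc n) :: ('a, 'r) opr" and ?x = "x_op n :: ('a, 'r) opr" and ?T = "tau n :: ('a, 'r) opr" and ?h = "Sc hf :: ('a, 'r) opr"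
  have "?T * ?X ^ Suc l = (?T * ?X ^ l) * ?X" by (simp add: power_commutes mult.assoc)
  also have "\<dots> = ?x ^ l * (?T * ?X) + ?h * (\<Sum>u<l. ?x ^ u * ?X ^ (l - Suc u)) * ?X"
    unfolding Suc by (simp add: distrib_right mult.assoc)
  also have "?x ^ l * (?T * ?X) = ?x ^ Suc l * ?T + ?h * ?x ^ l"
  proof -
    have "?h * ?x ^ l = ?x ^ l * ?h" using Sc_Rop[of "?x ^ l" n hf] n by auto
    then show ?thesis unfolding tau_x_op[OF n] by (simp add: distrib_left mult.assoc power_commutes flip: mult.assoc[of "?x ^ l" ?x])
  qed
  also have "?h * (\<Sum>u<l. ?x ^ u * ?X ^ (l - Suc u)) * ?X = ?h * (\<Sum>u<l. ?x ^ u * ?X ^ (l - u))"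
  proof -
    have "?X ^ (l - Suc u) * ?X = ?X ^ (l - u)" if "u < l" for u
      using that by (metis Suc_diff_Suc power_Suc2)
    then show ?thesis by (simp add: mult.assoc sum_distrib_right)
  qed
  finally show ?case by (simp add: distrib_left add.assoc add.commute)
qed simp

text \<open>Moving \<open>\<tau>_n\<close> past the power of \<open>x_{n+1}\<close> from either side
  produces the same divided difference.\<close>

lemma tau_x_op_power_sum:
  assumes "1 \<le> n"
  shows "tau n * (x_op n ^ l + x_op (Suc n) ^ l) = (x_op n ^ l + x_op (Suc n) ^ l) * (tau n :: ('a::idom, 'r::{finite,linorder}) opr)"
  by (simp add: distrib_left distrib_right x_op_power_tau[OF assms] tau_x_op_power[OF assms] ac_simps)

lemma psum_tau:
  assumes k: "1 \<le> k" "k < n"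
  shows "psum n l * tau k = tau k * (psum n l :: ('a::idom, 'r::{finite,linorder}) opr)"
proof -
  let ?R = "{1..n} - {k, Suc k}"
  have e: "psum n l = (x_op k ^ l + x_op (Suc k) ^ l) + (\<Sum>i\<in>?R. (x_op i :: ('a, 'r) opr) ^ l)"
  proof -
    have "(\<Sum>i\<in>{1..n}. (x_op i :: ('a, 'r) opr) ^ l) = (\<Sum>i\<in>{k, Suc k}. x_op i ^ l) + (\<Sum>i\<in>?R. x_op i ^ l)"
      using k by (subst sum.subset_diff[of "{k, Suc k}"]) (auto simp: add.commute)
    then show ?thesis by (simp add: psum_def)
  qed
  have "x_op i ^ l * tau k = tau k * (x_op i :: ('a, 'r) opr) ^ l" if "i \<in> ?R" for i
  proof -
    have "x_op i * tau k = tau k * (x_op i :: ('a, 'r) opr)"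
    proof (cases "i < k")
      case True
      then show ?thesis unfolding x_op_def using that by (intro jm.X_T_less) auto
    next
      case False
      then show ?thesis unfolding x_op_def using that k by (intro jm.X_T_greater) auto
    qed
    then show ?thesis
      by (rule power_commuting_commutes)
  qed
  then have "(\<Sum>i\<in>?R. (x_op i :: ('a, 'r) opr) ^ l) * tau k = tau k * (\<Sum>i\<in>?R. x_op i ^ l)"
    by (simp add: sum_distrib_left sum_distrib_right)
  then show ?thesis unfolding e distrib_left[of "tau k" "x_op k ^ l + x_op (Suc k) ^ l"] tau_x_op_power_sum[OF k(1), of l]
    by (simp add: distrib_right)
qed

lemma psum_central:
  assumes "a \<in> Rop n"
  shows "psum n l * a = a * (psum n l :: ('a::idom, 'r::{finite,linorder}) opr)"
proof -
  obtain f where f: "f \<in> Fr n" "a = ev f" using assms by (auto simp: Rop_def)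
  have "psum n l * ev f = ev f * (psum n l :: ('a, 'r) opr)"
    using f(1)
  proof (induction rule: Fr_induct)
    case (scal c)
    show ?case unfolding ev_scal using Sc_Rop[OF psum_Rop, of "to_fract c"] by simp
  next
    case (add f g)
    then show ?case by (simp add: ev_add distrib_left distrib_right)
  next
    case (x f k)
    have "psum n l * x_op k = x_op k * (psum n l :: ('a, 'r) opr)"
    proof -
      have "x_op i ^ l * x_op k = x_op k * (x_op i :: ('a, 'r) opr) ^ l" if "i \<in> {1..n}" for i
        using x that by (intro power_commuting_commutes x_op_comm) auto
      then show ?thesis by (simp add: psum_def sum_distrib_left sum_distrib_right)
    qed
    from comm_mult[OF x.IH this] show ?case by (simp add: ev_mult ev_xgen)
  next
    case (tau f k)
    from comm_mult[OF tau.IH psum_tau[of k n l]] tau show ?case by (simp add: ev_mult ev_taugen)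
  qed
  then show ?thesis using f by simp
qed

text \<open>The power sum of level \<open>n + 1\<close> is central there and may be moved to the
  front. Its part of level \<open>n\<close> is central in \<open>Rop n\<close> and leaves the trace,
  while the remaining power of \<open>x_{n+1}\<close> raises the exponent from \<open>k\<close> to
  \<open>l + k\<close>.\<close>

lemma x_plus_op_psum:
  fixes f :: "('a::idom, 'r::{finite,linorder}) opr"
  assumes f: "f \<in> Rop (Suc n)"
  shows "x_plus_op n k (f * psum (Suc n) l) = x_plus_op n k f * psum n l + x_plus_op n (l + k) f"
proof -
  have "coord n i (x_op (Suc n) ^ k * basis_op n i * (f * psum (Suc n) l))
      = coord n i (x_op (Suc n) ^ k * basis_op n i * f) * psum n l + coord n i (x_op (Suc n) ^ (l + k) * basis_op n i * f)"
    if i: "i \<in> basis_idx TYPE('r) n" for i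
  proof -
    let ?y = "x_op (Suc n) ^ k * basis_op n i * f"
    have y: "?y \<in> Rop (Suc n)" by (intro Rop_closed(4,8) Rop_gens(2) basis_op_Rop[OF i] f) auto
    have Xy: "x_op (Suc n) ^ l * ?y \<in> Rop (Suc n)" by (intro Rop_closed(4,8) Rop_gens(2) y) auto
    have py: "psum n l * ?y \<in> Rop (Suc n)" by (intro Rop_closed(4) Rop_Suc psum_Rop y)
    have "x_op (Suc n) ^ k * basis_op n i * (f * psum (Suc n) l) = psum (Suc n) l * ?y"
      using psum_central[OF y, of l] by (simp add: mult.assoc)
    also have "\<dots> = psum n l * ?y + x_op (Suc n) ^ l * ?y" by (simp add: psum_Suc distrib_right)
    finally have "coord n i (x_op (Suc n) ^ k * basis_op n i * (f * psum (Suc n) l)) = psum n l * coord n i ?y + coord n i (x_op (Suc n) ^ l * ?y)"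
      using coord_add[OF py Xy i] coord_left[OF y psum_Rop i] by simp
    also have "psum n l * coord n i ?y = coord n i ?y * psum n l" by (rule psum_central[OF coord_Rop[OF y]])
    finally show ?thesis by (simp add: power_add mult.assoc)
  qed
  then show ?thesis by (simp add: x_plus_op_def mod_tr_def sum.distrib sum_distrib_right)
qed

unbundle fps_syntax

section \<open>Logarithmic derivatives of power series over a noncommutative ring\<close>

text \<open>The derivation \<open>X d/dX\<close>. As the coefficients need not commute, a
  logarithmic derivative \<open>e\<close> of \<open>f\<close> is expressed by
  \<open>theta f = e * f\<close>, and each lemma lists the commutations it uses.\<close>

definition theta :: "'b::ring_1 fps \<Rightarrow> 'b fps" where
  "theta f = Abs_fps (\<lambda>m. of_nat m * f $ m)"

text \<open>The polynomial \<open>1 - a X\<close>; its inverse is the geometric series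
  \<open>geo_fps a\<close>.\<close>

definition lin_fps :: "'b::ring_1 \<Rightarrow> 'b fps" where
  "lin_fps a = Abs_fps (\<lambda>k. if k = 0 then 1 else if k = 1 then - a else 0)"

definition geo_fps :: "'b::ring_1 \<Rightarrow> 'b fps" where
  "geo_fps a = Abs_fps (\<lambda>k. a ^ k)"

lemma of_nat_commutes: "of_nat m * (x :: 'b::ring_1) = x * of_nat m"
  by (rule mult_of_nat_commute)

lemma theta_mult: "theta (f * g) = theta f * g + f * theta g"
proof (rule fps_ext)
  fix m
  have "of_nat i * f $ i * g $ (m - i) + f $ i * (of_nat (m - i) * g $ (m - i)) = of_nat m * (f $ i * g $ (m - i))"
    if "i \<le> m" for i
  proof -
    have "f $ i * (of_nat (m - i) * g $ (m - i)) = of_nat (m - i) * (f $ i * g $ (m - i))"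
      using of_nat_commutes[of "m - i" "f $ i"] by (simp flip: mult.assoc)
    then have "of_nat i * f $ i * g $ (m - i) + f $ i * (of_nat (m - i) * g $ (m - i))
        = (of_nat i + of_nat (m - i)) * (f $ i * g $ (m - i))"
      by (simp add: distrib_right mult.assoc)
    also have "of_nat i + of_nat (m - i) = (of_nat m :: 'a)" using that by (simp flip: of_nat_add)
    finally show ?thesis .
  qed
  then show "theta (f * g) $ m = (theta f * g + f * theta g) $ m"
    by (simp add: theta_def fps_mult_nth sum_distrib_left flip: sum.distrib)
qed

lemma fps_commute:
  fixes f g :: "'b::ring_1 fps"
  assumes "\<And>i j. f $ i * g $ j = g $ j * f $ i"
  shows "f * g = g * f"
proof (rule fps_ext)
  fix m
  have "(f * g) $ m = (\<Sum>i=0..m. g $ (m - i) * f $ i)"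
    by (simp add: fps_mult_nth assms)
  also have "\<dots> = (g * f) $ m"
    by (simp add: fps_mult_nth sum.atLeastAtMost_rev[of "\<lambda>i. g $ (m - i) * f $ i" 0 m])
  finally show "(f * g) $ m = (g * f) $ m" .
qed

lemma lin_fps_mult_nth:
  "(lin_fps a * f) $ 0 = f $ 0" "(lin_fps a * f) $ Suc m = f $ Suc m - a * f $ m"
proof -
  show "(lin_fps a * f) $ 0 = f $ 0" by (simp add: fps_mult_nth lin_fps_def)
  have "(lin_fps a * f) $ Suc m = (\<Sum>i\<in>{0, 1}. lin_fps a $ i * f $ (Suc m - i))"
    unfolding fps_mult_nth by (rule sum.mono_neutral_right) (auto simp: lin_fps_def)
  then show "(lin_fps a * f) $ Suc m = f $ Suc m - a * f $ m" by (simp add: lin_fps_def)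
qed

lemma lin_fps_nth_0 [simp]: "lin_fps a $ 0 = 1"
  by (simp add: lin_fps_def)

lemma lin_fps_geo_fps: "lin_fps a * geo_fps a = 1"
proof (rule fps_ext)
  show "(lin_fps a * geo_fps a) $ m = 1 $ m" for m
    by (cases m) (simp_all only: lin_fps_mult_nth, simp_all add: geo_fps_def)
qed

lemma geo_fps_lin_fps: "geo_fps a * lin_fps a = 1"
proof -
  have "a ^ i * lin_fps a $ j = lin_fps a $ j * a ^ i" for i j
    by (simp add: lin_fps_def power_commutes)
  then have "geo_fps a * lin_fps a = lin_fps a * geo_fps a" by (intro fps_commute) (simp add: geo_fps_def)
  then show ?thesis by (simp add: lin_fps_geo_fps)
qed

text \<open>From \<open>- a X = (1 - a X) - 1\<close>, dividing by \<open>1 - a X\<close> gives the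
  logarithmic derivative.\<close>

lemma theta_lin_fps: "theta (lin_fps a) = (1 - geo_fps a) * lin_fps a"
proof -
  have "theta (lin_fps a) = lin_fps a - 1" by (rule fps_ext) (auto simp: theta_def lin_fps_def)
  then show ?thesis by (simp add: left_diff_distrib geo_fps_lin_fps)
qed

lemma lin_fps_cancel: "lin_fps a * f = lin_fps a * g \<Longrightarrow> f = g"
  by (metis geo_fps_lin_fps mult.assoc mult_1_left)

lemma theta_lin_fps_mult:
  assumes "theta g = e * g" "e * lin_fps a = lin_fps a * e"
  shows "theta (lin_fps a * g) = (1 - geo_fps a + e) * (lin_fps a * g)"
proof -
  have "lin_fps a * (e * g) = e * (lin_fps a * g)" using assms(2) by (simp flip: mult.assoc)
  then show ?thesis by (simp add: theta_mult theta_lin_fps assms(1) distrib_right left_diff_distrib mult.assoc)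
qed

lemma theta_lin_fps_cancel:
  assumes "theta (lin_fps a * g) = (1 - geo_fps a + e) * (lin_fps a * g)" "e * lin_fps a = lin_fps a * e"
  shows "theta g = e * g"
proof (rule lin_fps_cancel)
  have "lin_fps a * (e * g) = e * (lin_fps a * g)" using assms(2) by (simp flip: mult.assoc)
  then show "lin_fps a * theta g = lin_fps a * (e * g)"
    using assms(1) by (simp add: theta_mult theta_lin_fps distrib_right left_diff_distrib mult.assoc)
qed

lemma fps_commute_lin_fps:
  assumes "\<And>i. f $ i * a = a * f $ i"
  shows "f * lin_fps a = lin_fps a * f"
  using assms by (intro fps_commute) (simp add: lin_fps_def)


section \<open>Coefficients of the top power\<close>

text \<open>The component along \<open>x_{n+1}^a\<close> in the Mackey decomposition: an index with
  first entry \<open>n\<close> belongs to a basis word without transpositions.\<close>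

definition top_coeff :: "nat \<Rightarrow> nat \<Rightarrow> ('a::idom, 'r::{finite,linorder}) opr \<Rightarrow> ('a, 'r) opr" where
  "top_coeff n a m = coord n (n, a) m"

lemma basis_idx_top: "a < CARD('r) \<Longrightarrow> (n, a) \<in> basis_idx TYPE('r::{finite,linorder}) n"
  by (simp add: basis_idx_def)

lemma top_coeff_x:
  fixes \<alpha> :: "('a::idom, 'r::{finite,linorder}) opr"
  assumes "\<alpha> \<in> Rop n" "j < CARD('r)" "a < CARD('r)"
  shows "top_coeff n a (\<alpha> * x_op (Suc n) ^ j) = (if a = j then \<alpha> else 0)"
  unfolding top_coeff_def coord_x[OF assms(1,2) basis_idx_top[OF assms(3)]] by simp

lemma top_coeff_t:
  fixes \<alpha> \<beta> :: "('a::idom, 'r::{finite,linorder}) opr"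
  assumes "\<alpha> \<in> Rop n" "\<beta> \<in> Rop n" "1 \<le> n" "a < CARD('r)"
  shows "top_coeff n a (\<alpha> * tau n * \<beta>) = 0"
  using assms coord_t[of \<alpha> "n - 1" \<beta> "(n, a)"] basis_idx_top[OF assms(4), of n] by (simp add: top_coeff_def)

lemma top_coeff_add:
  fixes m m' :: "('a::idom, 'r::{finite,linorder}) opr"
  shows "m \<in> Rop (Suc n) \<Longrightarrow> m' \<in> Rop (Suc n) \<Longrightarrow> a < CARD('r) \<Longrightarrow> top_coeff n a (m + m') = top_coeff n a m + top_coeff n a m'"
  unfolding top_coeff_def by (rule coord_add) (auto intro: basis_idx_top)

lemma top_coeff_left:
  fixes m b :: "('a::idom, 'r::{finite,linorder}) opr"
  shows "m \<in> Rop (Suc n) \<Longrightarrow> b \<in> Rop n \<Longrightarrow> a < CARD('r) \<Longrightarrow> top_coeff n a (b * m) = b * top_coeff n a m"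
  unfolding top_coeff_def by (rule coord_left) (auto intro: basis_idx_top)

lemma top_coeff_Rop: "m \<in> Rop (Suc n) \<Longrightarrow> top_coeff n a m \<in> Rop n"
  unfolding top_coeff_def by (rule coord_Rop)

lemma top_coeff_lin:
  assumes "a < CARD('r)"
  shows "lin (Rop n) (Rop (Suc n)) (Rop n) (top_coeff n a :: ('a::idom, 'r::{finite,linorder}) opr \<Rightarrow> _)"
  using assms by (auto simp: lin_def intro: top_coeff_Rop top_coeff_add top_coeff_left)

lemma top_coeff_sum:
  fixes f :: "'i \<Rightarrow> ('a::idom, 'r::{finite,linorder}) opr"
  assumes "a < CARD('r)" "\<And>i. i \<in> I \<Longrightarrow> f i \<in> Rop (Suc n)"
  shows "top_coeff n a (\<Sum>i\<in>I. f i) = (\<Sum>i\<in>I. top_coeff n a (f i))"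
  by (rule lin_sum[OF top_coeff_lin[OF assms(1)] subring_set_Rop assms(2) subring_set_Rop])

lemma top_coeff_diff:
  fixes m m' :: "('a::idom, 'r::{finite,linorder}) opr"
  assumes "m \<in> Rop (Suc n)" "m' \<in> Rop (Suc n)" "a < CARD('r)"
  shows "top_coeff n a (m - m') = top_coeff n a m - top_coeff n a m'"
  using top_coeff_add[of "m - m'" n m' a] assms by simp

text \<open>The Mackey decomposition is one of bimodules: powers of \<open>x_{n+1}\<close> commute
  with \<open>Rop n\<close>, and a term \<open>c \<tau>_n d\<close> keeps its form under right
  multiplication by \<open>Rop n\<close>.\<close>

lemma top_coeff_right:
  fixes m b :: "('a::idom, 'r::{finite,linorder}) opr"
  assumes "m \<in> Rop (Suc n)" "b \<in> Rop n" "a < CARD('r)"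
  shows "top_coeff n a (m * b) = top_coeff n a m * b"
  using assms(1)
proof (induction rule: Rop_Suc_induct)
  case (x c i)
  have "c * x_op (Suc n) ^ i * b = c * b * x_op (Suc n) ^ i"
    using x_op_power_comm[of n "Suc n" b i] assms(2) by (simp add: mult.assoc)
  then show ?case using top_coeff_x[of "c * b" n i a] top_coeff_x[of c n i a] x assms by simp
next
  case (t c d)
  then show ?case using top_coeff_t[of c n "d * b" a] top_coeff_t[of c n d a] assms by (simp add: mult.assoc)
next
  case (add f g)
  then show ?case using assms
    by (simp add: distrib_right top_coeff_add Rop_Suc Rop_closed(4))
qed

lemma x_op_pow_Rop: "x_op (Suc n) ^ k \<in> Rop (Suc n)"
  by (intro Rop_closed(8) Rop_gens) auto

definition moment :: "nat \<Rightarrow> nat \<Rightarrow> ('a::idom, 'r::{finite,linorder}) opr" where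
  "moment n m = top_coeff n (CARD('r) - 1) (x_op (Suc n) ^ m)"

lemma top_coeff_pow_central:
  fixes b :: "('a::idom, 'r::{finite,linorder}) opr"
  assumes "b \<in> Rop n" "a < CARD('r)"
  shows "b * top_coeff n a (x_op (Suc n) ^ m) = top_coeff n a (x_op (Suc n) ^ m) * b"
  using top_coeff_left[OF x_op_pow_Rop assms, of m] top_coeff_right[OF x_op_pow_Rop assms, of m]
    x_op_power_comm[OF _ assms(1), of "Suc n" m] by simp

lemma top_coeff_pow_small:
  assumes "j < CARD('r)" "a < CARD('r)"
  shows "top_coeff n a (x_op (Suc n) ^ j) = (if a = j then 1 else (0 :: ('a::idom, 'r::{finite,linorder}) opr))"
  using top_coeff_x[of "1 :: ('a, 'r) opr" n j a] assms by simp

lemma moment_small: "m < CARD('r) \<Longrightarrow> moment n m = (if m = CARD('r) - 1 then 1 else (0 :: ('a::idom, 'r::{finite,linorder}) opr))"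
  unfolding moment_def using top_coeff_pow_small[of m "CARD('r) - 1" n, where 'r = 'r and 'a = 'a] by auto

lemma moment_central: "b \<in> Rop n \<Longrightarrow> b * moment n m = moment n m * b"
  unfolding moment_def by (rule top_coeff_pow_central) auto

text \<open>\<open>tau_coeff n s\<close> sends \<open>\<alpha> \<tau>\<^sub>n \<beta>\<close> to \<open>\<alpha> x\<^sub>n\<^sup>s \<beta>\<close> and the powers of \<open>x\<^sub>n\<^sub>+\<^sub>1\<close> below \<open>r\<close> to 0.\<close>

definition tau_coeff :: "nat \<Rightarrow> nat \<Rightarrow> ('a::idom, 'r::{finite,linorder}) opr \<Rightarrow> ('a, 'r) opr" where
  "tau_coeff n s m = (if n = 0 then 0 else \<Sum>j\<in>basis_idx TYPE('r) (n - 1). coord n j m * x_op n ^ s * basis_op (n - 1) j)"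

lemma basis_idx_Suc_mem: "i \<in> basis_idx R n \<Longrightarrow> i \<in> basis_idx R (Suc n)" "i \<in> basis_idx R n \<Longrightarrow> fst i \<noteq> Suc n"
  by (auto simp: basis_idx_def)

lemma tau_coeff_x:
  fixes \<alpha> :: "('a::idom, 'r::{finite,linorder}) opr"
  assumes "\<alpha> \<in> Rop n" "j < CARD('r)"
  shows "tau_coeff n s (\<alpha> * x_op (Suc n) ^ j) = 0"
proof (cases n)
  case (Suc n')
  then have "coord n i (\<alpha> * x_op (Suc n) ^ j) = 0" if "i \<in> basis_idx TYPE('r) n'" for i
    using coord_x[OF assms basis_idx_Suc_mem(1)[OF that, folded Suc]] basis_idx_Suc_mem(2)[OF that] by auto
  then show ?thesis by (simp add: tau_coeff_def Suc)
qed (simp add: tau_coeff_def)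

lemma tau_coeff_t:
  fixes \<alpha> \<beta> :: "('a::idom, 'r::{finite,linorder}) opr"
  assumes "\<alpha> \<in> Rop n" "\<beta> \<in> Rop n" "1 \<le> n"
  shows "tau_coeff n s (\<alpha> * tau n * \<beta>) = \<alpha> * x_op n ^ s * \<beta>"
proof -
  obtain n' where n: "n = Suc n'" using assms(3) by (cases n) auto
  have "coord n j (\<alpha> * tau n * \<beta>) * x_op n ^ s * basis_op n' j = \<alpha> * x_op n ^ s * (coord n' j \<beta> * basis_op n' j)"
    if j: "j \<in> basis_idx TYPE('r) n'" for j
  proof -
    have "coord n j (\<alpha> * tau n * \<beta>) = \<alpha> * coord n' j \<beta>"
      using coord_t[of \<alpha> n' \<beta> j] assms n basis_idx_Suc_mem[OF j] by simp
    moreover have "coord n' j \<beta> * x_op n ^ s = x_op n ^ s * coord n' j \<beta>"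
      using x_op_power_comm[of n' n "coord n' j \<beta>" s] coord_Rop[of \<beta> n' j] assms n by simp
    ultimately show ?thesis by (simp add: mult.assoc flip: mult.assoc[of "coord n' j \<beta>"])
  qed
  then have "tau_coeff n s (\<alpha> * tau n * \<beta>) = \<alpha> * x_op n ^ s * (\<Sum>j\<in>basis_idx TYPE('r) n'. coord n' j \<beta> * basis_op n' j)"
    by (simp add: tau_coeff_def n sum_distrib_left)
  also have "(\<Sum>j\<in>basis_idx TYPE('r) n'. coord n' j \<beta> * basis_op n' j) = \<beta>"
    using coord_sum[of \<beta> n'] assms n by simp
  finally show ?thesis .
qed

lemma tau_coeff_add:
  fixes m m' :: "('a::idom, 'r::{finite,linorder}) opr"
  assumes "m \<in> Rop (Suc n)" "m' \<in> Rop (Suc n)"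
  shows "tau_coeff n s (m + m') = tau_coeff n s m + tau_coeff n s m'"
proof (cases n)
  case (Suc n')
  have "coord n j (m + m') = coord n j m + coord n j m'" if "j \<in> basis_idx TYPE('r) n'" for j
    using coord_add[OF assms] basis_idx_Suc_mem(1)[OF that] Suc by simp
  then show ?thesis by (simp add: tau_coeff_def Suc distrib_right sum.distrib)
qed (simp add: tau_coeff_def)

text \<open>When \<open>\<tau>_n\<close> is moved to the front, the main term
  \<open>\<tau>_n x_n^v\<close> has no component along powers of \<open>x_{n+1}\<close>; only the
  divided difference contributes.\<close>

lemma top_coeff_pow_tau:
  assumes "1 \<le> n" "a < CARD('r)"
  shows "top_coeff n a (x_op (Suc n) ^ v * tau n)
    = Sc hf * (\<Sum>u<v. x_op n ^ u * (top_coeff n a (x_op (Suc n) ^ (v - Suc u)) :: ('a::idom, 'r::{finite,linorder}) opr))"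
proof -
  have h: "Sc hf \<in> (Rop n :: ('a, 'r) opr set)" and x: "x_op n ^ u \<in> (Rop n :: ('a, 'r) opr set)" for u
    using assms by auto
  have m: "x_op n ^ u * x_op (Suc n) ^ k \<in> (Rop (Suc n) :: ('a, 'r) opr set)" for u k
    by (intro Rop_closed(4) x_op_pow_Rop Rop_Suc x)
  have T: "tau n * x_op n ^ v \<in> (Rop (Suc n) :: ('a, 'r) opr set)"
    using assms by (intro Rop_closed(4) Rop_Suc x Rop_gens) auto
  have "top_coeff n a (tau n * x_op n ^ v :: ('a, 'r) opr) = 0"
    using top_coeff_t[of 1 n "x_op n ^ v" a] x assms by simp
  moreover have "top_coeff n a (Sc hf * (\<Sum>u<v. x_op n ^ u * x_op (Suc n) ^ (v - Suc u)) :: ('a, 'r) opr)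
      = Sc hf * (\<Sum>u<v. x_op n ^ u * top_coeff n a (x_op (Suc n) ^ (v - Suc u)))"
    using assms by (simp add: top_coeff_left[OF Rop_closed(7)[OF m] h] top_coeff_sum[OF _ m] top_coeff_left[OF x_op_pow_Rop x])
  ultimately show ?thesis
    unfolding x_op_power_tau[OF assms(1)]
    by (subst top_coeff_add[OF T Rop_closed(4)[OF Rop_Suc[OF h] Rop_closed(7)[OF m]] assms(2)]) simp
qed

text \<open>For \<open>a = \<alpha> x^j\<close> with \<open>j < r\<close>, the corrections in the
  conjugate of \<open>x^j\<close>, after the second \<open>\<tau>\<close> is moved through, contain
  only powers below \<open>r - 1\<close>, so just \<open>x_{n+2}^j\<close> is seen. For
  \<open>a = \<alpha> \<tau>_n \<beta>\<close> the braid relation leads to a term around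
  \<open>\<tau>_{n+1}\<close>, which has no top component.\<close>

lemma top_coeff_tau_tau:
  fixes a :: "('a::idom, 'r::{finite,linorder}) opr"
  assumes "a \<in> Rop (Suc n)"
  defines "s \<equiv> CARD('r) - 1"
  shows "top_coeff (Suc n) s (tau (Suc n) * a * tau (Suc n)) = top_coeff n s a"
  using assms(1)
proof (induction rule: Rop_Suc_induct)
  case (x \<alpha> j)
  let ?T = "tau (Suc n) :: ('a, 'r) opr" and ?x = "x_op (Suc n) :: ('a, 'r) opr" and ?X = "x_op (Suc (Suc n)) :: ('a, 'r) opr" and ?h = "Sc hf :: ('a, 'r) opr"
  have s: "s < CARD('r)" by (simp add: s_def)
  have \<alpha>: "\<alpha> \<in> Rop (Suc n)" using x(1) by (rule Rop_Suc)
  have TH: "?T \<in> Rop (Suc (Suc n))" and xH: "?x ^ u \<in> Rop (Suc n)" and hH: "?h \<in> Rop (Suc n)" for u by auto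
  have sm: "?x ^ u * (?X ^ k * ?T) \<in> Rop (Suc (Suc n))" for u k
    by (intro Rop_closed(4) x_op_pow_Rop Rop_Suc[OF xH] TH)
  have sumH: "(\<Sum>u<j. ?x ^ u * (?X ^ (j - Suc u) * ?T)) \<in> Rop (Suc (Suc n))"
    by (intro Rop_closed(7) sm)
  have "?T * (\<alpha> * ?x ^ j) * ?T = \<alpha> * (?T * ?x ^ j * ?T)"
    using tau_Suc_comm[of \<alpha> n] x by (simp flip: mult.assoc)
  also have "?T * ?x ^ j = ?X ^ j * ?T - ?h * (\<Sum>u<j. ?x ^ u * ?X ^ (j - Suc u))"
    using x_op_power_tau[of "Suc n" j, where 'a = 'a and 'r = 'r] by simp
  also have "\<dots> * ?T = 1 * ?X ^ j - ?h * (\<Sum>u<j. ?x ^ u * (?X ^ (j - Suc u) * ?T))"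
    by (simp add: left_diff_distrib mult.assoc sum_distrib_right tau_sq)
  finally have e: "?T * (\<alpha> * ?x ^ j) * ?T = \<alpha> * (1 * ?X ^ j - ?h * (\<Sum>u<j. ?x ^ u * (?X ^ (j - Suc u) * ?T)))" .
  have z: "top_coeff (Suc n) s (?x ^ u * (?X ^ (j - Suc u) * ?T)) = 0" if "u < j" for u
  proof -
    have "top_coeff (Suc n) s (?X ^ (j - Suc u) * ?T) = 0"
    proof -
      have "(\<Sum>v<j - Suc u. ?x ^ v * top_coeff (Suc n) s (?X ^ (j - Suc u - Suc v))) = 0"
      proof (intro sum.neutral ballI)
        fix v assume "v \<in> {..<j - Suc u}"
        then have "top_coeff (Suc n) s (?X ^ (j - Suc u - Suc v)) = 0"
          using x by (subst top_coeff_pow_small[OF _ s]) (auto simp: s_def)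
        then show "?x ^ v * top_coeff (Suc n) s (?X ^ (j - Suc u - Suc v)) = 0" by (simp only: mult_zero_right)
      qed
      moreover have "top_coeff (Suc n) s (?X ^ (j - Suc u) * ?T)
          = ?h * (\<Sum>v<j - Suc u. ?x ^ v * top_coeff (Suc n) s (?X ^ (j - Suc u - Suc v)))"
        by (rule top_coeff_pow_tau[OF _ s]) simp
      ultimately show ?thesis by (simp only: mult_zero_right)
    qed
    then show ?thesis using top_coeff_left[OF Rop_closed(4)[OF x_op_pow_Rop TH] xH s] by simp
  qed
  have "top_coeff (Suc n) s (?h * (\<Sum>u<j. ?x ^ u * (?X ^ (j - Suc u) * ?T))) = 0"
    by (simp add: top_coeff_left[OF sumH hH s] top_coeff_sum[OF s sm] z)
  then have "top_coeff (Suc n) s (1 * ?X ^ j - ?h * (\<Sum>u<j. ?x ^ u * (?X ^ (j - Suc u) * ?T))) = (if s = j then 1 else 0)"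
    using top_coeff_diff[OF x_op_pow_Rop Rop_closed(4)[OF Rop_Suc[OF hH] sumH] s, of j] top_coeff_pow_small[OF x(2) s, of "Suc n"] by simp
  moreover have "1 * ?X ^ j - ?h * (\<Sum>u<j. ?x ^ u * (?X ^ (j - Suc u) * ?T)) \<in> Rop (Suc (Suc n))"
    by (intro Rop_closed(1,3,4) x_op_pow_Rop Rop_Suc[OF hH] sumH)
  ultimately show ?case
    unfolding e top_coeff_x[OF x s] using top_coeff_left[OF _ \<alpha> s] by simp
next
  case (t \<alpha> \<beta>)
  let ?T = "tau (Suc n) :: ('a, 'r) opr" and ?U = "tau n :: ('a, 'r) opr"
  have s: "s < CARD('r)" by (simp add: s_def)
  have "?T * (\<alpha> * ?U * \<beta>) * ?T = \<alpha> * (?T * ?U * ?T) * \<beta>"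
  proof -
    have "?T * (\<alpha> * ?U * \<beta>) * ?T = (?T * \<alpha>) * ?U * (\<beta> * ?T)" by (simp add: mult.assoc)
    also have "\<dots> = (\<alpha> * ?T) * ?U * (?T * \<beta>)"
      by (simp only: tau_Suc_comm[OF t(1)] tau_Suc_comm[OF t(2)])
    finally show ?thesis by (simp add: mult.assoc)
  qed
  also have "?T * ?U * ?T = ?U * ?T * ?U" by (rule tau_braid[OF t(3), symmetric])
  also have "\<alpha> * (?U * ?T * ?U) * \<beta> = (\<alpha> * ?U) * ?T * (?U * \<beta>)" by (simp add: mult.assoc)
  finally show ?case
    using top_coeff_t[of "\<alpha> * ?U" "Suc n" "?U * \<beta>" s] top_coeff_t[OF t s] t s
    by (simp add: Rop_Suc Rop_closed(4) Rop_gens(3))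
next
  case (add f g)
  have "tau (Suc n) * f * tau (Suc n) \<in> Rop (Suc (Suc n))" "tau (Suc n) * g * tau (Suc n) \<in> Rop (Suc (Suc n))"
    using add by (auto intro!: Rop_closed(4) Rop_gens intro: Rop_Suc)
  then show ?case using add
    by (simp add: distrib_left distrib_right top_coeff_add s_def)
qed


section \<open>The commutator of the two families of operators\<close>

abbreviation "rtop (_ :: 'r::{finite,linorder} itself) \<equiv> CARD('r) - 1"

text \<open>Both sides are additive in \<open>m\<close>, so it suffices to test the two kinds of
  Mackey terms: a power contributes one shifted moment, and a term around \<open>\<tau>_n\<close>
  contributes through the divided difference of the \<open>i\<close>-th power.\<close>

lemma top_coeff_pow_mult:
  fixes m :: "('a::idom, 'r::{finite,linorder}) opr"
  assumes "m \<in> Rop (Suc n)"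
  shows "top_coeff n (rtop TYPE('r)) (x_op (Suc n) ^ i * m) = (\<Sum>a<CARD('r). top_coeff n a m * moment n (i + a))
    + Sc hf * (\<Sum>u<i. tau_coeff n u m * moment n (i - Suc u))"
  using assms
proof (induction rule: Rop_Suc_induct)
  case (x \<alpha> b)
  have s: "rtop TYPE('r) < CARD('r)" by simp
  have "x_op (Suc n) ^ i * (\<alpha> * x_op (Suc n) ^ b) = \<alpha> * x_op (Suc n) ^ (i + b)"
    using x_op_power_comm[of n "Suc n" \<alpha> i] x by (simp add: power_add flip: mult.assoc)
  then have "top_coeff n (rtop TYPE('r)) (x_op (Suc n) ^ i * (\<alpha> * x_op (Suc n) ^ b)) = \<alpha> * moment n (i + b)"
    using top_coeff_left[OF x_op_pow_Rop x(1) s] by (simp add: moment_def)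
  moreover have "(\<Sum>a<CARD('r). top_coeff n a (\<alpha> * x_op (Suc n) ^ b) * moment n (i + a))
      = (\<Sum>a<CARD('r). if a = b then \<alpha> * moment n (i + b) else 0)"
    using x by (intro sum.cong) (auto simp: top_coeff_x)
  ultimately show ?case using x by (simp add: tau_coeff_x)
next
  case (t \<alpha> \<beta>)
  have s: "rtop TYPE('r) < CARD('r)" by simp
  have XT: "x_op (Suc n) ^ i * tau n \<in> (Rop (Suc n) :: ('a, 'r) opr set)"
    using t by (intro Rop_closed(4) x_op_pow_Rop Rop_gens) auto
  have "x_op (Suc n) ^ i * (\<alpha> * tau n * \<beta>) = \<alpha> * (x_op (Suc n) ^ i * tau n * \<beta>)"
    using x_op_power_comm[of n "Suc n" \<alpha> i] t by (simp flip: mult.assoc)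
  then have "top_coeff n (rtop TYPE('r)) (x_op (Suc n) ^ i * (\<alpha> * tau n * \<beta>))
      = \<alpha> * (Sc hf * (\<Sum>u<i. x_op n ^ u * moment n (i - Suc u)) * \<beta>)"
    using top_coeff_left[OF Rop_closed(4)[OF XT Rop_Suc[OF t(2)]] t(1) s] top_coeff_right[OF XT t(2) s] t(3)
    by (simp add: top_coeff_pow_tau moment_def)
  also have "\<dots> = Sc hf * (\<Sum>u<i. \<alpha> * x_op n ^ u * \<beta> * moment n (i - Suc u))"
  proof -
    have "moment n k * \<beta> = \<beta> * moment n k" for k using moment_central[OF t(2), of k] by simp
    moreover have "\<alpha> * (Sc hf * z) = Sc hf * (\<alpha> * z)" for z
      using Sc_Rop[OF t(1), of hf] by (simp flip: mult.assoc)
    ultimately show ?thesis by (simp add: mult.assoc sum_distrib_left sum_distrib_right)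
  qed
  finally show ?case using t by (simp add: top_coeff_t tau_coeff_t)
next
  case (add f g)
  have "x_op (Suc n) ^ i * f \<in> Rop (Suc n)" "x_op (Suc n) ^ i * g \<in> Rop (Suc n)"
    using add by (auto intro!: Rop_closed(4) x_op_pow_Rop)
  moreover have "(\<Sum>a<CARD('r). top_coeff n a (f + g) * moment n (i + a))
      = (\<Sum>a<CARD('r). top_coeff n a f * moment n (i + a)) + (\<Sum>a<CARD('r). top_coeff n a g * moment n (i + a))"
    using add by (simp add: top_coeff_add distrib_right sum.distrib)
  ultimately show ?case using add
    by (simp add: distrib_left top_coeff_add tau_coeff_add distrib_right sum.distrib)
qed

text \<open>The value that the trace computation produces for the bracket of \<open>x^+_k\<close>
  and \<open>x^-_l\<close> with \<open>k + l = K\<close>: the first sum comes from the basis words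
  that are powers, the second from the corrections at the words with a transposition.\<close>

definition comm_op :: "nat \<Rightarrow> nat \<Rightarrow> ('a::idom, 'r::{finite,linorder}) opr" where
  "comm_op n K = (\<Sum>a<CARD('r). top_coeff n a (x_op (Suc n) ^ (a + K))) + Sc hf * (\<Sum>u<K. tau_coeff n u (x_op (Suc n) ^ (K - Suc u)))"

lemma sum_shift_left:
  fixes f g :: "nat \<Rightarrow> 'b::ring_1"
  assumes "\<And>p. p < a \<Longrightarrow> g p = 0"
  shows "(\<Sum>i\<le>m. f (m - i) * g (i + a)) = (\<Sum>p\<le>m + a. f (m + a - p) * g p)"
proof -
  have "(\<Sum>p\<le>m + a. f (m + a - p) * g p) = (\<Sum>p\<in>{a..m + a}. f (m + a - p) * g p)"
    using assms by (intro sum.mono_neutral_right) auto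
  also have "\<dots> = (\<Sum>i\<le>m. f (m - i) * g (i + a))"
    by (rule sum.reindex_bij_witness[of _ "\<lambda>i. i + a" "\<lambda>p. p - a"]) (auto simp: algebra_simps)
  finally show ?thesis by simp
qed

lemma sum_shift_right:
  fixes f g :: "nat \<Rightarrow> 'b::ring_1"
  assumes "\<And>p. p < a \<Longrightarrow> f p = 0"
  shows "(\<Sum>i\<le>m. f (a + (m - i)) * g i) = (\<Sum>p\<le>m + a. f (m + a - p) * g p)"
proof -
  have "(\<Sum>p\<le>m + a. f (m + a - p) * g p) = (\<Sum>p\<le>m. f (m + a - p) * g p)"
  proof (rule sum.mono_neutral_right)
    show "\<forall>i\<in>{..m + a} - {..m}. f (m + a - i) * g i = 0"
    proof
      fix i assume "i \<in> {..m + a} - {..m}"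
      then have "f (m + a - i) = 0" by (intro assms) auto
      then show "f (m + a - i) * g i = 0" by simp
    qed
  qed auto
  also have "\<dots> = (\<Sum>i\<le>m. f (a + (m - i)) * g i)"
    by (intro sum.cong) (auto simp: algebra_simps)
  finally show ?thesis by simp
qed

text \<open>The factor \<open>m + 1\<close> counts the ways of writing \<open>x^m\<close> as
  \<open>x^i x^(m-i)\<close>. The top coefficient of each such product is expanded by
  \<open>top_coeff_pow_mult\<close>, and the double sums are regrouped by the index of the
  moment.\<close>

lemma comm_op_newton:
  "(\<Sum>i\<le>m. comm_op n (m - i) * moment n i) = of_nat (Suc m) * (moment n m :: ('a::idom, 'r::{finite,linorder}) opr)"
proof -
  let ?X = "x_op (Suc n) :: ('a, 'r) opr"
  \<comment> \<open>The top coefficients of index \<open>a\<close> and the moments both vanish at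
    exponents below \<open>a\<close>. Either sum is thus the full convolution of total exponent
    \<open>m + a\<close>, with vanishing terms left out at one end or the other.\<close>
  have A: "(\<Sum>i\<le>m. top_coeff n a (?X ^ (m - i)) * moment n (i + a)) = (\<Sum>i\<le>m. top_coeff n a (?X ^ (a + (m - i))) * moment n i)"
    if a: "a < CARD('r)" for a
  proof -
    have "moment n p = (0 :: ('a, 'r) opr)" if "p < a" for p using a that by (subst moment_small) auto
    moreover have "top_coeff n a (?X ^ p) = 0" if "p < a" for p using a that by (subst top_coeff_pow_small) auto
    ultimately show ?thesis
      using sum_shift_left[where a = a and g = "moment n" and m = m and f = "\<lambda>p. top_coeff n a (?X ^ p)"]
        sum_shift_right[where a = a and f = "\<lambda>p. top_coeff n a (?X ^ p)" and m = m and g = "moment n"]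
      by simp
  qed
  let ?F = "\<lambda>u q v. tau_coeff n u (?X ^ q) * moment n v"
  \<comment> \<open>The substitution sends \<open>(i, u)\<close> to \<open>(i - 1 - u, u)\<close>,
    which makes the exponent of the moment the outer index.\<close>
  have B: "(\<Sum>i\<le>m. \<Sum>u<i. ?F u (m - i) (i - Suc u)) = (\<Sum>i\<le>m. \<Sum>u<m - i. ?F u (m - i - Suc u) i)"
    unfolding sum.Sigma[OF finite_atMost ballI[OF finite_lessThan]]
    by (rule sum.reindex_bij_witness[where i = "\<lambda>(i, u). (i + u + 1, u)" and j = "\<lambda>(i, u). (i - Suc u, u)"])
      (auto simp: algebra_simps)
  have "of_nat (Suc m) * (moment n m :: ('a, 'r) opr) = (\<Sum>i\<le>m. top_coeff n (rtop TYPE('r)) (?X ^ i * ?X ^ (m - i)))"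
    by (simp add: moment_def flip: power_add)
  also have "\<dots> = (\<Sum>i\<le>m. \<Sum>a<CARD('r). top_coeff n a (?X ^ (m - i)) * moment n (i + a))
      + Sc hf * (\<Sum>i\<le>m. \<Sum>u<i. ?F u (m - i) (i - Suc u))"
    by (simp only: top_coeff_pow_mult[OF x_op_pow_Rop] sum.distrib sum_distrib_left)
  also have "(\<Sum>i\<le>m. \<Sum>a<CARD('r). top_coeff n a (?X ^ (m - i)) * moment n (i + a))
      = (\<Sum>i\<le>m. \<Sum>a<CARD('r). top_coeff n a (?X ^ (a + (m - i))) * moment n i)"
    by (subst (1 2) sum.swap) (simp add: A)
  finally show ?thesis
    unfolding B by (simp add: comm_op_def distrib_right sum.distrib sum_distrib_right sum_distrib_left mult.assoc)
qed

section \<open>The moments as a power series and the expected central element\<close>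

definition E_op :: "nat \<Rightarrow> nat \<Rightarrow> ('a::idom, 'r::{finite,linorder}) opr" where
  "E_op n K = (\<Sum>i=1..n. (x_op i + Sc hf) ^ K + (x_op i - Sc hf) ^ K - 2 * x_op i ^ K) + (\<Sum>p\<in>UNIV. Sc (yf p) ^ K)"

lemma E_op_Suc: "E_op (Suc n) K = E_op n K + ((x_op (Suc n) + Sc hf) ^ K + (x_op (Suc n) - Sc hf) ^ K - 2 * x_op (Suc n) ^ K)"
  by (simp add: E_op_def algebra_simps)

lemma Sc_yf_Rop: "Sc (yf p) \<in> Rop n"
  using Rop_gens(1)[of "yvar p" n] by (simp add: yf_def)

lemma numeral_Rop: "numeral k \<in> (Rop n :: ('a::idom, 'b::{finite,linorder}) opr set)"
proof -
  have "of_nat m \<in> (Rop n :: ('a, 'b) opr set)" for m by (induction m) auto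
  from this[of "numeral k"] show ?thesis by simp
qed

lemma E_op_Rop: "E_op n K \<in> Rop n"
  unfolding E_op_def
  by (intro Rop_closed(3,4,6) Rop_closed(7) Rop_closed(8) Rop_gens Sc_yf_Rop numeral_Rop) auto

definition moment_fps :: "nat \<Rightarrow> ('a::idom, 'r::{finite,linorder}) opr fps" where
  "moment_fps n = Abs_fps (moment n)"

text \<open>Write \<open>x^m = x^m \<tau> \<tau>\<close> for the last variable and move the first
  \<open>\<tau>\<close> to the left. The conjugated term gives the moment of the previous level by
  \<open>top_coeff_tau_tau\<close>; the remaining terms still end in \<open>\<tau>\<close> and
  contribute a second divided difference.\<close>

lemma moment_Suc:
  "moment (Suc n) m = moment n m + Sc hf * (\<Sum>u<m. x_op (Suc n) ^ u *
     (Sc hf * (\<Sum>v<m - Suc u. x_op (Suc n) ^ v * (moment (Suc n) (m - Suc u - Suc v) :: ('a::idom, 'r::{finite,linorder}) opr))))"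
proof -
  let ?T = "tau (Suc n) :: ('a, 'r) opr" and ?x = "x_op (Suc n) :: ('a, 'r) opr" and ?X = "x_op (Suc (Suc n)) :: ('a, 'r) opr" and ?h = "Sc hf :: ('a, 'r) opr"
  let ?s = "rtop TYPE('r)"
  have s: "?s < CARD('r)" by simp
  have TH: "?T \<in> Rop (Suc (Suc n))" and xH: "?x ^ u \<in> Rop (Suc n)" and hH: "?h \<in> Rop (Suc n)" for u by auto
  have sm: "?x ^ u * (?X ^ k * ?T) \<in> Rop (Suc (Suc n))" for u k
    by (intro Rop_closed(4) x_op_pow_Rop Rop_Suc[OF xH] TH)
  have sumH: "(\<Sum>u<m. ?x ^ u * (?X ^ (m - Suc u) * ?T)) \<in> Rop (Suc (Suc n))"
    by (intro Rop_closed(7) sm)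
  have TxT: "?T * ?x ^ m * ?T \<in> Rop (Suc (Suc n))"
    by (intro Rop_closed(4) Rop_Suc[OF xH] TH)
  have hs: "?h * (\<Sum>u<m. ?x ^ u * (?X ^ (m - Suc u) * ?T)) \<in> Rop (Suc (Suc n))"
    by (intro Rop_closed(4) Rop_Suc[OF hH] sumH)
  have XT: "?X ^ m * ?T = ?T * ?x ^ m + ?h * (\<Sum>u<m. ?x ^ u * ?X ^ (m - Suc u))"
    by (rule x_op_power_tau) simp
  have "?X ^ m = ?X ^ m * ?T * ?T" by (simp add: mult.assoc tau_sq)
  also have "\<dots> = ?T * ?x ^ m * ?T + ?h * (\<Sum>u<m. ?x ^ u * (?X ^ (m - Suc u) * ?T))"
    unfolding XT by (simp add: distrib_right mult.assoc sum_distrib_right)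
  finally have "moment (Suc n) m = top_coeff (Suc n) ?s (?T * ?x ^ m * ?T + ?h * (\<Sum>u<m. ?x ^ u * (?X ^ (m - Suc u) * ?T)))"
    by (simp add: moment_def)
  also have "\<dots> = moment n m + ?h * (\<Sum>u<m. ?x ^ u * top_coeff (Suc n) ?s (?X ^ (m - Suc u) * ?T))"
    by (simp only: top_coeff_add[OF TxT hs s] top_coeff_tau_tau[OF xH] top_coeff_left[OF sumH hH s] top_coeff_sum[OF s sm]
      top_coeff_left[OF Rop_closed(4)[OF x_op_pow_Rop TH] xH s] moment_def)
  finally have m: "moment (Suc n) m = moment n m + ?h * (\<Sum>u<m. ?x ^ u * top_coeff (Suc n) ?s (?X ^ (m - Suc u) * ?T))" .
  have "top_coeff (Suc n) ?s (?X ^ k * ?T) = ?h * (\<Sum>v<k. ?x ^ v * moment (Suc n) (k - Suc v))" for k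
    unfolding moment_def by (rule top_coeff_pow_tau[OF _ s]) simp
  then show ?thesis unfolding m by (simp only:)
qed

lemma X_mult_nth: "(fps_X * f) $ 0 = 0" "(fps_X * f) $ Suc m = (f $ m :: 'b::ring_1)"
  by simp_all

lemma X_geo_fps_nth: "(fps_X * (geo_fps a * f)) $ m = (\<Sum>u<m. a ^ u * f $ (m - Suc u))"
proof (cases m)
  case (Suc k)
  show ?thesis unfolding Suc X_mult_nth
    by (simp add: fps_mult_nth geo_fps_def atLeast0AtMost lessThan_Suc_atMost)
qed simp

lemma X_commutes: "fps_X * f = f * (fps_X :: 'b::ring_1 fps)"
  by (rule fps_commute) (simp add: fps_X_def)

lemma const_commutes: "(\<And>i. f $ i * c = c * f $ i) \<Longrightarrow> f * fps_const c = fps_const c * (f :: 'b::ring_1 fps)"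
  by (rule fps_ext) simp

lemma lin_fps_lin_fps:
  fixes a h :: "'b::ring_1"
  assumes "a * h = h * a"
  shows "lin_fps (a + h) * (lin_fps (a - h) * f) = lin_fps a * (lin_fps a * f) - fps_const h * (fps_X * (fps_const h * (fps_X * f)))"
proof (rule fps_ext)
  fix m
  have r: "(fps_const h * (fps_X * (fps_const h * (fps_X * f)))) $ 0 = 0"
    "(fps_const h * (fps_X * (fps_const h * (fps_X * f)))) $ Suc 0 = 0"
    "(fps_const h * (fps_X * (fps_const h * (fps_X * f)))) $ Suc (Suc k) = h * (h * f $ k)" for k
    by simp_all
  have ah: "a * (h * z) = h * (a * z)" for z using assms by (simp flip: mult.assoc)
  consider "m = 0" | "m = Suc 0" | k where "m = Suc (Suc k)" by (metis not0_implies_Suc)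
  then show "(lin_fps (a + h) * (lin_fps (a - h) * f)) $ m
      = (lin_fps a * (lin_fps a * f) - fps_const h * (fps_X * (fps_const h * (fps_X * f)))) $ m"
    by cases (simp_all only: fps_sub_nth lin_fps_mult_nth r, simp_all add: algebra_simps ah)
qed

text \<open>The recursion says that the new series is the old one plus
  \<open>h^2 X^2 / (1 - x X)^2\<close> times the new one. Multiplying by \<open>(1 - x X)^2\<close>
  turns the left factor into \<open>(1 - x X)^2 - h^2 X^2\<close>, a product of two linear
  factors.\<close>

lemma moment_fps_Suc:
  defines "x \<equiv> \<lambda>n. x_op (Suc n) :: ('a::idom, 'r::{finite,linorder}) opr" and "h \<equiv> Sc hf :: ('a, 'r) opr"
  shows "lin_fps (x n + h) * (lin_fps (x n - h) * moment_fps (Suc n)) = lin_fps (x n) * (lin_fps (x n) * moment_fps n)"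
proof -
  let ?x = "x n" and ?c = "fps_const h" and ?s = "moment_fps (Suc n) :: ('a, 'r) opr fps"
  have xh: "?x * h = h * ?x" unfolding x_def h_def by (simp add: Sc_x_op)
  have s: "?s = moment_fps n + ?c * (fps_X * (geo_fps ?x * (?c * (fps_X * (geo_fps ?x * ?s)))))"
  proof (rule fps_ext)
    fix m
    show "?s $ m = (moment_fps n + ?c * (fps_X * (geo_fps ?x * (?c * (fps_X * (geo_fps ?x * ?s)))))) $ m"
      unfolding fps_add_nth fps_mult_left_const_nth X_geo_fps_nth moment_fps_def fps_nth_Abs_fps x_def h_def by (rule moment_Suc)
  qed
  have c: "lin_fps ?x * (?c * f) = ?c * (lin_fps ?x * f)" for f
  proof -
    have "lin_fps ?x * ?c = ?c * lin_fps ?x" by (rule const_commutes) (simp add: lin_fps_def xh)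
    then show ?thesis by (simp flip: mult.assoc)
  qed
  have w: "lin_fps ?x * (fps_X * f) = fps_X * (lin_fps ?x * f)" for f
    using X_commutes[of "lin_fps ?x"] by (simp flip: mult.assoc)
  have g: "lin_fps ?x * (geo_fps ?x * f) = f" for f using lin_fps_geo_fps[of ?x] by (simp flip: mult.assoc)
  have "lin_fps ?x * (lin_fps ?x * ?s) = lin_fps ?x * (lin_fps ?x * moment_fps n) + ?c * (fps_X * (?c * (fps_X * ?s)))"
    by (subst s) (simp add: distrib_left c w g)
  then show ?thesis by (simp add: lin_fps_lin_fps[OF xh])
qed

definition E_fps :: "nat \<Rightarrow> ('a::idom, 'r::{finite,linorder}) opr fps" where
  "E_fps n = Abs_fps (E_op n)"

primrec pole_prod :: "'r list \<Rightarrow> ('a::idom, 'r::{finite,linorder}) opr fps \<Rightarrow> ('a, 'r) opr fps" where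
  "pole_prod [] f = f"
| "pole_prod (p # ps) f = lin_fps (Sc (yf p)) * pole_prod ps f"

lemma pole_prod_cancel:
  fixes f :: "('a::idom, 'r::{finite,linorder}) opr fps"
  assumes "theta (pole_prod ps f) = ((\<Sum>p\<leftarrow>ps. 1 - geo_fps (Sc (yf p))) + e) * pole_prod ps f"
    and e: "\<And>i p. e $ i * Sc (yf p) = Sc (yf p) * e $ i"
  shows "theta f = e * f"
  using assms(1)
proof (induction ps)
  case (Cons p ps)
  have "((\<Sum>p\<leftarrow>ps. 1 - geo_fps (Sc (yf p))) + e) $ i * Sc (yf p) = Sc (yf p) * ((\<Sum>p\<leftarrow>ps. 1 - geo_fps (Sc (yf p))) + e) $ i" for i
  proof -
    have "(\<Sum>p\<leftarrow>ps. 1 - geo_fps (Sc (yf p))) $ i * Sc (yf p) = Sc (yf p) * ((\<Sum>p\<leftarrow>ps. 1 - geo_fps (Sc (yf p))) $ i :: ('a, 'r) opr)"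
    proof (induction ps)
      case (Cons q ps)
      have "Sc (yf q) ^ i * Sc (yf p) = Sc (yf p) * (Sc (yf q) :: ('a, 'r) opr) ^ i"
        by (rule power_commuting_commutes) (rule Sc_comm)
      with Cons show ?case by (simp add: geo_fps_def distrib_left distrib_right left_diff_distrib right_diff_distrib)
    qed simp
    then show ?thesis by (simp add: distrib_left distrib_right e)
  qed
  then have "((\<Sum>p\<leftarrow>ps. 1 - geo_fps (Sc (yf p))) + e) * lin_fps (Sc (yf p)) = lin_fps (Sc (yf p)) * ((\<Sum>p\<leftarrow>ps. 1 - geo_fps (Sc (yf p))) + e)"
    by (rule fps_commute_lin_fps)
  moreover have "theta (lin_fps (Sc (yf p)) * pole_prod ps f) = (1 - geo_fps (Sc (yf p)) + ((\<Sum>p\<leftarrow>ps. 1 - geo_fps (Sc (yf p))) + e)) * (lin_fps (Sc (yf p)) * pole_prod ps f)"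
    using Cons.prems by (simp add: add.assoc)
  ultimately show ?case by (intro Cons.IH) (rule theta_lin_fps_cancel)
qed simp

text \<open>The moments vanish below exponent \<open>r - 1\<close>, and factors with constant term 1
  do not change the lowest coefficient.\<close>

lemma pole_prod_low:
  assumes "m \<le> rtop TYPE('r)"
  shows "pole_prod ps (moment_fps n) $ m = (if m = rtop TYPE('r) then 1 else (0 :: ('a::idom, 'r::{finite,linorder}) opr))"
  using assms
proof (induction ps arbitrary: m)
  case Nil
  then show ?case by (simp add: moment_fps_def moment_small)
next
  case (Cons p ps)
  show ?case
    using Cons.prems Cons.IH[of m] Cons.IH[of "m - 1"] by (cases m) (simp_all add: lin_fps_mult_nth)
qed

text \<open>Multiplying the series by \<open>1 - y X\<close> replaces \<open>x^(m+1)\<close> under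
  the top coefficient by \<open>x^m (x - y)\<close>. For \<open>n = 0\<close> all factors together
  give the cyclotomic polynomial, so these coefficients vanish.\<close>

lemma pole_prod_high:
  "pole_prod ps (moment_fps n) $ (m + length ps)
    = top_coeff n (rtop TYPE('r)) (x_op (Suc n) ^ m * (prod_list (map (\<lambda>p. x_op (Suc n) - Sc (yf p)) ps) :: ('a::idom, 'r::{finite,linorder}) opr))"
proof (induction ps arbitrary: m)
  case Nil
  then show ?case by (simp add: moment_fps_def moment_def)
next
  case (Cons p ps)
  let ?X = "x_op (Suc n) :: ('a, 'r) opr" and ?y = "Sc (yf p) :: ('a, 'r) opr"
  let ?P = "prod_list (map (\<lambda>p. ?X - Sc (yf p)) ps)"
  have P: "?P \<in> Rop (Suc n)"
    by (induction ps) (auto intro!: Rop_closed(1,3,4) Rop_gens Sc_yf_Rop)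
  have XP: "?X ^ k * ?P \<in> Rop (Suc n)" for k by (intro Rop_closed(4) x_op_pow_Rop P)
  have s: "rtop TYPE('r) < CARD('r)" by simp
  have "?y * ?X ^ m = ?X ^ m * ?y" by (rule Sc_Rop[OF x_op_pow_Rop])
  then have "?X ^ m * ((?X - ?y) * ?P) = ?X ^ Suc m * ?P - ?y * (?X ^ m * ?P)"
    by (simp add: left_diff_distrib right_diff_distrib power_commutes flip: mult.assoc)
  then have "top_coeff n (rtop TYPE('r)) (?X ^ m * ((?X - ?y) * ?P))
      = top_coeff n (rtop TYPE('r)) (?X ^ Suc m * ?P) - ?y * top_coeff n (rtop TYPE('r)) (?X ^ m * ?P)"
    by (simp only: top_coeff_diff[OF XP Rop_closed(4)[OF Sc_yf_Rop XP] s] top_coeff_left[OF XP Sc_yf_Rop s])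
  then show ?case using Cons.IH[of "Suc m"] Cons.IH[of m] by (simp add: lin_fps_mult_nth)
qed

lemma E_op_commute:
  assumes "n < k"
  shows "E_op n i * x_op k = x_op k * (E_op n i :: ('a::idom, 'r::{finite,linorder}) opr)"
  by (rule x_op_power_comm[OF assms E_op_Rop, of 1, simplified, symmetric])

lemma E_op_Sc: "E_op n i * Sc c = Sc c * (E_op n i :: ('a::idom, 'r::{finite,linorder}) opr)"
  by (rule Sc_Rop[OF E_op_Rop, symmetric])

text \<open>
  For \<open>n = 0\<close> the series is \<open>X\<^sup>r\<^sup>-\<^sup>1\<close> divided by the product of the \<open>1 - y\<^sub>p X\<close>; each step multiplies it
  by \<open>(1 - x X)\<^sup>2 / ((1 - (x + \<hbar>) X) (1 - (x - \<hbar>) X))\<close> with \<open>x = x\<^sub>n\<^sub>+\<^sub>1\<close>.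
\<close>
lemma theta_moment_fps: "theta (moment_fps n) = (E_fps n - 1) * (moment_fps n :: ('a::idom, 'r::{finite,linorder}) opr fps)"
proof (induction n)
  case 0
  let ?ps = "sorted_list_of_set (UNIV :: 'r set)" and ?X = "x_op (Suc 0) :: ('a, 'r) opr" and ?s = "rtop TYPE('r)"
  have len: "length ?ps = CARD('r)" by simp
  have X: "x_op (Suc 0) = (X1 yf :: ('a, 'r) opr)" by (simp add: x_op_def jm.X_one)
  have z: "prod_list (map (\<lambda>p. ?X - Sc (yf p)) ?ps) = 0"
    unfolding X by (rule X1_cyclotomic) simp
  have nth: "pole_prod ?ps (moment_fps 0) $ m = (if m = ?s then 1 else (0 :: ('a, 'r) opr))" for m
  proof (cases "m \<le> ?s")
    case False
    then have "m = (m - CARD('r)) + length ?ps" unfolding len by simp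
    then have "pole_prod ?ps (moment_fps 0) $ m = pole_prod ?ps (moment_fps 0) $ ((m - CARD('r)) + length ?ps)" by simp
    also have "\<dots> = (0 :: ('a, 'r) opr)"
      unfolding pole_prod_high z by (simp add: top_coeff_diff[of 0 0 0, simplified])
    finally show ?thesis using False by simp
  qed (rule pole_prod_low)
  \<comment> \<open>At level 0 the series \<open>E_fps\<close> is the sum of the geometric series,
    so they cancel and \<open>r - 1\<close> remains, the logarithmic derivative of the series
    \<open>X^(r-1)\<close> just found.\<close>
  have "(\<Sum>p\<leftarrow>?ps. 1 - geo_fps (Sc (yf p))) + (E_fps 0 - 1) = (of_nat ?s :: ('a, 'r) opr fps)"
  proof -
    have "(\<Sum>p\<leftarrow>?ps. 1 - geo_fps (Sc (yf p))) = (\<Sum>p\<in>UNIV. 1 - geo_fps (Sc (yf p)) :: ('a, 'r) opr fps)"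
      by (simp add: sum_list_distinct_conv_sum_set)
    also have "\<dots> = of_nat CARD('r) - (\<Sum>p\<in>UNIV. geo_fps (Sc (yf p)))" by (simp add: sum_subtractf)
    also have "(\<Sum>p\<in>UNIV. geo_fps (Sc (yf p))) = (E_fps 0 :: ('a, 'r) opr fps)"
      by (rule fps_ext) (simp add: E_fps_def E_op_def geo_fps_def fps_sum_nth)
    finally show ?thesis by (simp add: of_nat_diff)
  qed
  moreover have "theta (pole_prod ?ps (moment_fps 0)) = (of_nat ?s :: ('a, 'r) opr fps) * pole_prod ?ps (moment_fps 0)"
    by (rule fps_ext) (simp add: theta_def nth fps_of_nat[symmetric])
  ultimately have "theta (pole_prod ?ps (moment_fps 0)) = ((\<Sum>p\<leftarrow>?ps. 1 - geo_fps (Sc (yf p))) + (E_fps 0 - 1)) * pole_prod ?ps (moment_fps 0 :: ('a, 'r) opr fps)"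
    by (simp only:)
  then show ?case
    by (rule pole_prod_cancel) (simp add: E_fps_def left_diff_distrib right_diff_distrib E_op_Sc)
next
  case (Suc n)
  let ?x = "x_op (Suc n) :: ('a, 'r) opr" and ?h = "Sc hf :: ('a, 'r) opr"
  let ?e = "E_fps n - 1 :: ('a, 'r) opr fps" and ?e' = "E_fps (Suc n) - 1 :: ('a, 'r) opr fps"
  let ?W = "lin_fps ?x * (lin_fps ?x * moment_fps n)"
  have c1: "?e * lin_fps ?x = lin_fps ?x * ?e"
    by (rule fps_commute_lin_fps) (simp add: E_fps_def left_diff_distrib right_diff_distrib E_op_commute)
  have g: "geo_fps a * lin_fps a = lin_fps a * geo_fps a" for a :: "('a, 'r) opr" by (simp add: geo_fps_lin_fps lin_fps_geo_fps)
  have c2: "(1 - geo_fps ?x + ?e) * lin_fps ?x = lin_fps ?x * (1 - geo_fps ?x + ?e)"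
    using c1 g[of ?x] by (simp add: distrib_left distrib_right left_diff_distrib right_diff_distrib)
  have W: "theta ?W = (1 - geo_fps ?x + (1 - geo_fps ?x + ?e)) * ?W"
    by (rule theta_lin_fps_mult[OF theta_lin_fps_mult[OF Suc c1] c2])
  have e': "?e' = ?e + geo_fps (?x + ?h) + geo_fps (?x - ?h) - 2 * geo_fps ?x"
  proof -
    have "2 * geo_fps ?x = geo_fps ?x + geo_fps ?x" by (simp add: mult_2)
    moreover have "2 * ?x ^ K = ?x ^ K + ?x ^ K" for K by (simp add: mult_2)
    ultimately show ?thesis by (intro fps_ext) (simp add: E_fps_def E_op_Suc geo_fps_def)
  qed
  have xh: "?x * ?h = ?h * ?x" by (simp add: Sc_x_op)
  have ce: "?e' $ i * (?x + b) = (?x + b) * ?e' $ i" if b: "b = ?h \<or> b = - ?h" for i b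
  proof -
    have comm: "(?x + b) * ?x = ?x * (?x + b)" "(?x + b) * (?x + ?h) = (?x + ?h) * (?x + b)" "(?x + b) * (?x - ?h) = (?x - ?h) * (?x + b)"
      using b xh by (auto simp: algebra_simps)
    note central_char = power_commuting_commutes[OF comm(1)[symmetric]] power_commuting_commutes[OF comm(2)[symmetric]] power_commuting_commutes[OF comm(3)[symmetric]]
    have "E_op n i * (?x + b) = (?x + b) * E_op n i"
    proof -
      have "E_op n i * ?x = ?x * E_op n i" by (rule E_op_commute) simp
      moreover have "E_op n i * ?h = ?h * E_op n i" by (rule E_op_Sc)
      ultimately show ?thesis using b by (auto simp: distrib_left distrib_right)
    qed
    moreover have "(2 * ?x ^ i) * (?x + b) = (?x + b) * (2 * ?x ^ i)"
      unfolding mult_2 distrib_right[of "?x ^ i"] distrib_left[of "?x + b"] by (simp only: central_char(1))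
    ultimately have "E_op (Suc n) i * (?x + b) = (?x + b) * E_op (Suc n) i"
      using central_char(2,3)[of i] unfolding E_op_Suc
      by (simp only: distrib_left[of "?x + b"] distrib_right[of _ _ "?x + b"] left_diff_distrib[of _ _ "?x + b"] right_diff_distrib[of "?x + b"])
    then show ?thesis by (simp add: E_fps_def left_diff_distrib right_diff_distrib)
  qed
  have k1: "?e' * lin_fps (?x - ?h) = lin_fps (?x - ?h) * ?e'"
    using ce[of "- ?h"] by (intro fps_commute_lin_fps) simp
  have k2: "(1 - geo_fps (?x - ?h) + ?e') * lin_fps (?x + ?h) = lin_fps (?x + ?h) * (1 - geo_fps (?x - ?h) + ?e')"
  proof -
    have "?e' * lin_fps (?x + ?h) = lin_fps (?x + ?h) * ?e'" using ce[of ?h] by (intro fps_commute_lin_fps) simp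
    moreover have "geo_fps (?x - ?h) * lin_fps (?x + ?h) = lin_fps (?x + ?h) * geo_fps (?x - ?h)"
    proof (rule fps_commute_lin_fps)
      have "(?x - ?h) * (?x + ?h) = (?x + ?h) * (?x - ?h)" using xh by (simp add: algebra_simps)
      from power_commuting_commutes[OF this] show "geo_fps (?x - ?h) $ i * (?x + ?h) = (?x + ?h) * geo_fps (?x - ?h) $ i" for i
        by (simp add: geo_fps_def)
    qed
    ultimately show ?thesis by (simp add: distrib_left distrib_right left_diff_distrib right_diff_distrib)
  qed
  have "theta (lin_fps (?x + ?h) * (lin_fps (?x - ?h) * moment_fps (Suc n)))
      = (1 - geo_fps (?x + ?h) + (1 - geo_fps (?x - ?h) + ?e')) * (lin_fps (?x + ?h) * (lin_fps (?x - ?h) * moment_fps (Suc n)))"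
  proof -
    \<comment> \<open>The change of \<open>E_fps\<close> from level \<open>n\<close> to
      \<open>n + 1\<close> is exactly what the four linear factors in \<open>moment_fps_Suc\<close>
      contribute to the logarithmic derivative.\<close>
    have "1 - geo_fps (?x + ?h) + (1 - geo_fps (?x - ?h) + ?e') = 1 - geo_fps ?x + (1 - geo_fps ?x + ?e)"
      unfolding e' by (simp add: mult_2)
    then show ?thesis unfolding moment_fps_Suc by (simp only: W)
  qed
  from theta_lin_fps_cancel[OF theta_lin_fps_cancel[OF this k2] k1] show ?case .
qed

lemma E_op_newton:
  "(\<Sum>i\<le>m. E_op n (m - i) * moment n i) = of_nat (Suc m) * (moment n m :: ('a::idom, 'r::{finite,linorder}) opr)"
proof -
  have "theta (moment_fps n) $ m = ((E_fps n - 1) * moment_fps n) $ m" by (simp add: theta_moment_fps)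
  then have "of_nat m * moment n m = (E_fps n * moment_fps n) $ m - (moment n m :: ('a, 'r) opr)"
    by (simp add: theta_def moment_fps_def left_diff_distrib)
  moreover have "(E_fps n * moment_fps n) $ m = (\<Sum>i\<le>m. E_op n (m - i) * (moment n i :: ('a, 'r) opr))"
    by (simp add: fps_mult_nth E_fps_def moment_fps_def atLeast0AtMost sum.atLeastAtMost_rev[of "\<lambda>i. E_op n i * moment n (m - i)" 0 m, unfolded atLeast0AtMost])
  ultimately show ?thesis by (simp add: distrib_right)
qed

text \<open>
  Both sides satisfy the same recursion against the moments, of which the first nonzero one,
  \<open>moment n (r - 1)\<close>, is 1; no division by integers is needed.
\<close>
theorem comm_op_eq_E_op: "comm_op n K = (E_op n K :: ('a::idom, 'r::{finite,linorder}) opr)"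
proof (induction K rule: less_induct)
  case (less K)
  let ?s = "rtop TYPE('r)" and ?D = "\<lambda>K. comm_op n K - E_op n K :: ('a, 'r) opr"
  have "(\<Sum>i\<le>K + ?s. ?D (K + ?s - i) * moment n i) = 0"
    unfolding left_diff_distrib sum_subtractf comm_op_newton E_op_newton by simp
  also have "(\<Sum>i\<le>K + ?s. ?D (K + ?s - i) * moment n i) = (\<Sum>i\<in>{?s}. ?D (K + ?s - i) * moment n i)"
  proof (rule sum.mono_neutral_right)
    show "\<forall>i\<in>{..K + ?s} - {?s}. ?D (K + ?s - i) * moment n i = 0"
    proof
      fix i assume i: "i \<in> {..K + ?s} - {?s}"
      show "?D (K + ?s - i) * moment n i = 0"
      proof (cases "i < ?s")
        case True
        then have "moment n i = (0 :: ('a, 'r) opr)" by (subst moment_small) auto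
        then show ?thesis by simp
      next
        case False
        then have "K + ?s - i < K" using i by auto
        then show ?thesis using less by simp
      qed
    qed
  qed auto
  also have "\<dots> = ?D K" by (simp add: moment_small)
  finally show ?case by simp
qed

text \<open>Moving \<open>x_{n+1}^k\<close> to the right yields corrections whose exponents of
  \<open>x_n\<close> run from 0 to \<open>k - 1\<close>; moving \<open>x_{n+1}^l\<close> to the left
  yields those from \<open>k\<close> to \<open>k + l - 1\<close>. Together they form one divided
  difference, and this is why the bracket depends on \<open>k + l\<close> only.\<close>

lemma x_op_tau_x_op:
  assumes n: "1 \<le> n"
  shows "x_op (Suc n) ^ k * tau n * x_op (Suc n) ^ l = x_op n ^ l * tau n * x_op n ^ k
    + Sc hf * (\<Sum>u<k + l. x_op n ^ u * (x_op (Suc n) :: ('a::idom, 'r::{finite,linorder}) opr) ^ (k + l - Suc u))"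
proof -
  let ?x = "x_op n :: ('a, 'r) opr" and ?X = "x_op (Suc n) :: ('a, 'r) opr" and ?h = "Sc hf :: ('a, 'r) opr"
  have xX: "?X ^ a * ?x ^ b = ?x ^ b * ?X ^ a" for a b
    using n by (intro x_op_power_comm[of n]) auto
  have hx: "?x ^ l * ?h = ?h * ?x ^ l"
    using n by (intro Sc_Rop[symmetric, of _ n]) auto
  have "?X ^ k * tau n * ?X ^ l = tau n * ?x ^ k * ?X ^ l + ?h * (\<Sum>u<k. ?x ^ u * ?X ^ (k - Suc u)) * ?X ^ l"
    unfolding x_op_power_tau[OF n] by (simp add: distrib_right)
  also have "tau n * ?x ^ k * ?X ^ l = tau n * ?X ^ l * ?x ^ k" by (simp add: mult.assoc xX)
  also have "\<dots> = ?x ^ l * tau n * ?x ^ k + ?h * (\<Sum>u<l. ?x ^ u * ?X ^ (l - Suc u)) * ?x ^ k"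
    unfolding tau_x_op_power[OF n] by (simp add: distrib_right)
  also have "?h * (\<Sum>u<l. ?x ^ u * ?X ^ (l - Suc u)) * ?x ^ k = ?h * (\<Sum>u<l. ?x ^ (u + k) * ?X ^ (l - Suc u))"
    by (simp add: sum_distrib_right mult.assoc xX power_add)
  also have "(\<Sum>u<l. ?x ^ (u + k) * ?X ^ (l - Suc u)) = (\<Sum>u\<in>{k..<k + l}. ?x ^ u * ?X ^ (k + l - Suc u))"
    by (rule sum.reindex_bij_witness[of _ "\<lambda>u. u - k" "\<lambda>u. u + k"]) (auto simp: algebra_simps)
  also have "?h * (\<Sum>u<k. ?x ^ u * ?X ^ (k - Suc u)) * ?X ^ l = ?h * (\<Sum>u<k. ?x ^ u * ?X ^ (k + l - Suc u))"
    unfolding mult.assoc sum_distrib_right by (simp add: mult.assoc flip: power_add)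
  also have "?x ^ l * tau n * ?x ^ k + ?h * (\<Sum>u\<in>{k..<k + l}. ?x ^ u * ?X ^ (k + l - Suc u))
        + ?h * (\<Sum>u<k. ?x ^ u * ?X ^ (k + l - Suc u))
      = ?x ^ l * tau n * ?x ^ k + ?h * ((\<Sum>u\<in>{..<k}. ?x ^ u * ?X ^ (k + l - Suc u)) + (\<Sum>u\<in>{k..<k + l}. ?x ^ u * ?X ^ (k + l - Suc u)))"
    by (simp add: distrib_left)
  also have "(\<Sum>u\<in>{..<k}. ?x ^ u * ?X ^ (k + l - Suc u)) + (\<Sum>u\<in>{k..<k + l}. ?x ^ u * ?X ^ (k + l - Suc u))
      = (\<Sum>u<k + l. ?x ^ u * ?X ^ (k + l - Suc u))"
    unfolding lessThan_atLeast0 by (rule sum.atLeastLessThan_concat) auto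
  finally show ?thesis .
qed

text \<open>The trace is split along the basis. Powers of \<open>x_{n+1}\<close> give the first sum
  of \<open>comm_op\<close>. At a word with \<open>\<tau>_n\<close> in front, the main term of
  \<open>x_op_tau_x_op\<close> reproduces the trace one level lower, which is \<open>x^+\<close>
  followed by \<open>x^-\<close>; the corrections become the second sum of \<open>comm_op\<close>
  after a cyclic rearrangement.\<close>

theorem x_plus_op_x_op_power:
  fixes f :: "('a::idom, 'r::{finite,linorder}) opr"
  assumes f: "f \<in> Rop n"
  shows "x_plus_op n k (f * x_op (Suc n) ^ l) - (case n of 0 \<Rightarrow> 0 | Suc n' \<Rightarrow> x_plus_op n' k f * x_op n ^ l) - f * E_op n (k + l)
    \<in> Comm (Rop n)"
proof -
  let ?X = "x_op (Suc n) :: ('a, 'r) opr" and ?h = "Sc hf :: ('a, 'r) opr"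
  define G where "G i = coord n i (?X ^ k * basis_op n i * (f * ?X ^ l))" for i
  define A where "A = (\<Sum>a<CARD('r). top_coeff n a (?X ^ (a + (k + l))))"
  have "G (n, a) = f * top_coeff n a (?X ^ (a + (k + l)))" if a: "a < CARD('r)" for a
  proof -
    have "?X ^ k * basis_op n (n, a) * (f * ?X ^ l) = ?X ^ (k + a) * f * ?X ^ l" by (simp add: basis_op_top power_add mult.assoc)
    also have "?X ^ (k + a) * f = f * ?X ^ (k + a)" using f by (intro x_op_power_comm[of n]) auto
    also have "f * ?X ^ (k + a) * ?X ^ l = f * ?X ^ (a + (k + l))" by (simp add: mult.assoc ac_simps flip: power_add)
    finally have "G (n, a) = top_coeff n a (f * ?X ^ (a + (k + l)))" by (simp add: G_def top_coeff_def)
    then show ?thesis using top_coeff_left[OF x_op_pow_Rop f a] by simp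
  qed
  then have top: "(\<Sum>a<CARD('r). G (n, a)) = f * A" by (simp add: A_def sum_distrib_left)
  have tr: "x_plus_op n k (f * ?X ^ l) = sum G (basis_idx TYPE('r) n)" by (simp add: x_plus_op_def mod_tr_def G_def)
  have E: "E_op n (k + l) = A + ?h * (\<Sum>u<k + l. tau_coeff n u (?X ^ (k + l - Suc u)))"
    unfolding comm_op_eq_E_op[symmetric] comm_op_def A_def ..
  show ?thesis
  proof (cases n)
    case 0
    then have "x_plus_op n k (f * ?X ^ l) = f * A" using tr top by (simp add: sum_basis_idx_0)
    moreover have "(\<Sum>u<k + l. tau_coeff n u (?X ^ (k + l - Suc u))) = 0" using 0 by (simp add: tau_coeff_def)
    ultimately show ?thesis unfolding E using 0 by (simp add: Comm.zero)
  next
    case (Suc n')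
    let ?x = "x_op n :: ('a, 'r) opr" and ?T = "tau n :: ('a, 'r) opr"
    have xH: "?x ^ u \<in> Rop n" for u unfolding Suc by (rule x_op_pow_Rop)
    have TH: "?T \<in> Rop (Suc n)" using Suc by auto
    have hH: "?h \<in> Rop m" for m by auto
    define t where "t u = k + l - Suc u" for u
    define z where "z = ?h * f"
    have z: "z \<in> Rop n" unfolding z_def by (intro Rop_closed(4) hH f)
    \<comment> \<open>The basis word is \<open>\<tau>_n\<close> times the word
      \<open>basis_op n' j\<close>. By \<open>coord_t\<close> the main term has a coordinate of the
      lower level; in the corrections everything except the power of \<open>x_{n+1}\<close> lies in
      \<open>Rop n\<close> and leaves the coordinate function on the left.\<close>
    have G: "G j = ?x ^ l * coord n' j (?x ^ k * basis_op n' j * f)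
        + (\<Sum>u<k + l. ?h * ?x ^ u * basis_op n' j * f * coord n j (?X ^ t u))"
      if j: "j \<in> basis_idx TYPE('r) n'" for j
    proof -
      have j': "j \<in> basis_idx TYPE('r) n" and jn: "fst j \<noteq> n" using basis_idx_Suc_mem[OF j] Suc by auto
      have e: "basis_op n j = ?T * basis_op n' j" using j unfolding Suc by (cases j) (auto simp: basis_idx_def intro: basis_op_Suc)
      have eH: "basis_op n' j \<in> Rop n" using basis_op_Rop[OF j] Suc by simp
      define b where "b = basis_op n' j * f"
      have b: "b \<in> Rop n" unfolding b_def by (intro Rop_closed(4) eH f)
      have c: "?X ^ a * b = b * ?X ^ a" for a using b by (intro x_op_power_comm[of n]) auto
      have "?X ^ k * basis_op n j * (f * ?X ^ l) = ?X ^ k * ?T * (b * ?X ^ l)" by (simp add: e b_def mult.assoc)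
      also have "\<dots> = ?X ^ k * ?T * ?X ^ l * b" by (simp add: c mult.assoc)
      also have "\<dots> = ?x ^ l * ?T * (?x ^ k * b) + ?h * (\<Sum>u<k + l. ?x ^ u * ?X ^ t u) * b"
        using x_op_tau_x_op[of n k l, where 'a = 'a and 'r = 'r] Suc by (simp add: t_def distrib_right mult.assoc)
      also have "?h * (\<Sum>u<k + l. ?x ^ u * ?X ^ t u) * b = (\<Sum>u<k + l. (?h * ?x ^ u * b) * ?X ^ t u)"
        by (simp add: sum_distrib_left sum_distrib_right mult.assoc c)
      finally have eq: "?X ^ k * basis_op n j * (f * ?X ^ l)
          = ?x ^ l * ?T * (?x ^ k * b) + (\<Sum>u<k + l. (?h * ?x ^ u * b) * ?X ^ t u)" .
      have hb: "?h * ?x ^ u * b \<in> Rop n" for u by (intro Rop_closed(4) hH xH b)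
      have kb: "?x ^ k * b \<in> Rop n" by (intro Rop_closed(4) xH b)
      have sH: "(?h * ?x ^ u * b) * ?X ^ v \<in> Rop (Suc n)" for u v by (intro Rop_closed(4) x_op_pow_Rop Rop_Suc[OF hb] Rop_Suc[OF hb, unfolded mult.assoc]) 
      have s2: "?x ^ l * ?T * (?x ^ k * b) \<in> Rop (Suc n)" by (intro Rop_closed(4) TH Rop_Suc[OF xH] Rop_Suc[OF b])
      have lin: "lin (Rop n) (Rop (Suc n)) (Rop n) (coord n j :: ('a, 'r) opr \<Rightarrow> _)"
        using dual_basis_coord[of n, where 'a = 'a and 'r = 'r] j' by (simp add: dual_basis_def)
      have "coord n j (\<Sum>u<k + l. (?h * ?x ^ u * b) * ?X ^ t u) = (\<Sum>u<k + l. coord n j ((?h * ?x ^ u * b) * ?X ^ t u))"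
        by (rule lin_sum[OF lin subring_set_Rop sH subring_set_Rop])
      also have "\<dots> = (\<Sum>u<k + l. (?h * ?x ^ u * b) * coord n j (?X ^ t u))"
        by (intro sum.cong HOL.refl coord_left[OF x_op_pow_Rop hb j'])
      finally have p2: "coord n j (\<Sum>u<k + l. (?h * ?x ^ u * b) * ?X ^ t u) = (\<Sum>u<k + l. (?h * ?x ^ u * b) * coord n j (?X ^ t u))" .
      have p1: "coord n j (?x ^ l * ?T * (?x ^ k * b)) = ?x ^ l * coord n' j (?x ^ k * b)"
        using coord_t[of "?x ^ l" n' "?x ^ k * b" j] xH kb j' jn Suc by auto
      have "G j = coord n j (?x ^ l * ?T * (?x ^ k * b)) + coord n j (\<Sum>u<k + l. (?h * ?x ^ u * b) * ?X ^ t u)"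
        unfolding G_def eq by (rule coord_add[OF s2 Rop_closed(7)[OF sH] j'])
      then show ?thesis unfolding p1 p2 by (simp add: b_def mult.assoc)
    qed
    define M where "M = (\<lambda>u j. coord n j (?X ^ t u) * (?x ^ u * basis_op n' j))"
    have MH: "?x ^ u * basis_op n' j \<in> Rop n" "coord n j (?X ^ t u) \<in> Rop n" if "j \<in> basis_idx TYPE('r) n'" for u j
      using basis_op_Rop[OF that] Suc xH by (auto intro!: Rop_closed(4) coord_Rop x_op_pow_Rop)
    \<comment> \<open>The factor \<open>x_n^u\<close> times the basis word moves from the front to
      the end at the price of one commutator, which brings \<open>f\<close> and the coordinate into
      the order required by \<open>tau_coeff\<close>.\<close>
    have cyc: "?h * ?x ^ u * basis_op n' j * f * coord n j (?X ^ t u) - z * M u j \<in> Comm (Rop n)"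
      if j: "j \<in> basis_idx TYPE('r) n'" for u j
    proof -
      let ?p = "?x ^ u * basis_op n' j" and ?q = "z * coord n j (?X ^ t u)"
      have q: "?q \<in> Rop n" by (intro Rop_closed(4) z MH(2)[OF j])
      have "?h * ?x ^ u * basis_op n' j * f * coord n j (?X ^ t u) = (?h * ?p) * (f * coord n j (?X ^ t u))"
        by (simp only: mult.assoc)
      also have "?h * ?p = ?p * ?h" by (rule Sc_Rop[OF MH(1)[OF j]])
      also have "?p * ?h * (f * coord n j (?X ^ t u)) = ?p * ?q" by (simp only: z_def mult.assoc)
      finally have "?h * ?x ^ u * basis_op n' j * f * coord n j (?X ^ t u) = ?p * ?q" .
      moreover have "z * M u j = ?q * ?p" by (simp add: M_def mult.assoc)
      ultimately show ?thesis using Comm_comm[OF MH(1)[OF j] q] by simp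
    qed
    have mu: "(\<Sum>j\<in>basis_idx TYPE('r) n'. M u j) = tau_coeff n u (?X ^ t u)" for u
      by (simp add: tau_coeff_def M_def Suc mult.assoc)
    have trn': "(\<Sum>j\<in>basis_idx TYPE('r) n'. ?x ^ l * coord n' j (?x ^ k * basis_op n' j * f)) = ?x ^ l * x_plus_op n' k f"
      by (simp add: x_plus_op_def mod_tr_def Suc sum_distrib_left)
    have "x_plus_op n k (f * ?X ^ l) = f * A + sum G (basis_idx TYPE('r) n')"
      unfolding tr top[symmetric] unfolding Suc by (rule sum_basis_idx)
    also have "sum G (basis_idx TYPE('r) n') = ?x ^ l * x_plus_op n' k f
        + (\<Sum>j\<in>basis_idx TYPE('r) n'. \<Sum>u<k + l. ?h * ?x ^ u * basis_op n' j * f * coord n j (?X ^ t u))"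
      by (simp add: G sum.distrib trn')
    finally have 1: "x_plus_op n k (f * ?X ^ l) = f * A + (?x ^ l * x_plus_op n' k f
        + (\<Sum>j\<in>basis_idx TYPE('r) n'. \<Sum>u<k + l. ?h * ?x ^ u * basis_op n' j * f * coord n j (?X ^ t u)))" .
    have "f * E_op n (k + l) = f * A + z * (\<Sum>u<k + l. \<Sum>j\<in>basis_idx TYPE('r) n'. M u j)"
    proof -
      have "f * (?h * w) = z * w" for w unfolding z_def using Sc_Rop[OF f, of hf] by (simp flip: mult.assoc)
      then show ?thesis unfolding E mu by (simp add: distrib_left t_def)
    qed
    also have "(\<Sum>u<k + l. \<Sum>j\<in>basis_idx TYPE('r) n'. M u j) = (\<Sum>j\<in>basis_idx TYPE('r) n'. \<Sum>u<k + l. M u j)"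
      by (rule sum.swap)
    finally have 2: "f * E_op n (k + l) = f * A + (\<Sum>j\<in>basis_idx TYPE('r) n'. \<Sum>u<k + l. z * M u j)"
      by (simp add: sum_distrib_left)
    \<comment> \<open>The lower trace comes out with \<open>x_n^l\<close> on its left, whereas
      \<open>x^-\<close> multiplies on the right; the difference is again a commutator.\<close>
    have "x_plus_op n k (f * ?X ^ l) - x_plus_op n' k f * ?x ^ l - f * E_op n (k + l)
      = (?x ^ l * x_plus_op n' k f - x_plus_op n' k f * ?x ^ l)
        + (\<Sum>j\<in>basis_idx TYPE('r) n'. \<Sum>u<k + l. ?h * ?x ^ u * basis_op n' j * f * coord n j (?X ^ t u) - z * M u j)"
      unfolding 1 2 by (simp add: sum_subtractf)
    moreover have "x_plus_op n' k f \<in> Rop n"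
      using x_plus_op_Rop[of f n' k] f Suc by (auto intro: Rop_Suc)
    then have "?x ^ l * x_plus_op n' k f - x_plus_op n' k f * ?x ^ l \<in> Comm (Rop n)"
      by (intro Comm_comm xH)
    moreover have "(\<Sum>j\<in>basis_idx TYPE('r) n'. \<Sum>u<k + l. ?h * ?x ^ u * basis_op n' j * f * coord n j (?X ^ t u) - z * M u j) \<in> Comm (Rop n)"
      by (intro Comm_sum cyc)
    ultimately have "x_plus_op n k (f * ?X ^ l) - x_plus_op n' k f * ?x ^ l - f * E_op n (k + l) \<in> Comm (Rop n)"
      by (simp only: Comm_plus)
    then show ?thesis using Suc by simp
  qed
qed

section \<open>Expansion of the central element in power sums\<close>

lemma binomial_commuting:
  fixes h x :: "'b::ring_1"
  assumes hx: "h * x = x * h"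
  shows "(x + h) ^ K = (\<Sum>p\<le>K. of_nat (K choose p) * (h ^ p * x ^ (K - p)))"
proof (induction K)
  case (Suc K)
  let ?c = "\<lambda>p. of_nat (K choose p) :: 'b"
  have c: "x * (of_nat m * (h ^ p * z)) = of_nat m * (h ^ p * (x * z))" for m p z
  proof -
    have "x * (of_nat m * (h ^ p * z)) = of_nat m * (x * h ^ p * z)"
      using of_nat_commutes[of m x] by (simp flip: mult.assoc)
    also have "x * h ^ p = h ^ p * x" using power_commuting_commutes[OF hx, of p] by simp
    finally show ?thesis by (simp add: mult.assoc)
  qed
  have d: "h * (of_nat m * (h ^ p * z)) = of_nat m * (h ^ Suc p * z)" for m p z
    using of_nat_commutes[of m h] by (simp flip: mult.assoc)
  have "(x + h) ^ Suc K = x * (\<Sum>p\<le>K. ?c p * (h ^ p * x ^ (K - p))) + h * (\<Sum>p\<le>K. ?c p * (h ^ p * x ^ (K - p)))"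
    unfolding power_Suc Suc.IH distrib_right ..
  also have "h * (\<Sum>p\<le>K. ?c p * (h ^ p * x ^ (K - p))) = (\<Sum>p\<le>K. ?c p * (h ^ Suc p * x ^ (K - p)))"
    unfolding sum_distrib_left d ..
  also have "x * (\<Sum>p\<le>K. ?c p * (h ^ p * x ^ (K - p))) = (\<Sum>p\<le>K. ?c p * (h ^ p * x ^ (Suc K - p)))"
    unfolding sum_distrib_left c by (intro sum.cong) (simp_all add: Suc_diff_le)
  also have "\<dots> = (\<Sum>p\<le>Suc K. ?c p * (h ^ p * x ^ (Suc K - p)))" by (simp add: binomial_eq_0)
  also have "\<dots> = x ^ Suc K + (\<Sum>p\<le>K. ?c (Suc p) * (h ^ Suc p * x ^ (K - p)))"
    by (subst sum.atMost_Suc_shift) simp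
  also have "x ^ Suc K + (\<Sum>p\<le>K. ?c (Suc p) * (h ^ Suc p * x ^ (K - p))) + (\<Sum>p\<le>K. ?c p * (h ^ Suc p * x ^ (K - p)))
      = (\<Sum>p\<le>Suc K. of_nat (Suc K choose p) * (h ^ p * x ^ (Suc K - p)))"
    by (subst sum.atMost_Suc_shift) (simp add: add.assoc distrib_right add.commute flip: sum.distrib)
  finally show ?case .
qed simp

lemma sum_atMost_eq: "(\<Sum>p\<le>K. g p) = g 0 + (\<Sum>p=1..K. (g (p :: nat) :: 'b::comm_monoid_add))"
proof -
  have "{..K} = insert 0 {1..K}" by auto
  then show ?thesis by simp
qed

lemma Sc_power: "Sc c ^ p = Sc (c ^ p)"
  by (induction p) (simp_all add: Sc_hom)

lemma Sc_sum: "(\<Sum>i\<in>I. Sc (g i)) = Sc (\<Sum>i\<in>I. g i)"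
  by (induction I rule: infinite_finite_induct) (simp_all add: Sc_hom)

lemma to_fract_power: "to_fract (c ^ K) = to_fract c ^ K"
  by (induction K) simp_all

text \<open>The two binomial expansions have equal terms at \<open>p = 0\<close>, and these cancel
  against \<open>2 * x_i^K\<close>, so the sum starts at 1; summation over \<open>i\<close> turns
  the remaining powers into power sums.\<close>

lemma E_op_psum:
  "E_op n K = (\<Sum>p=1..K. of_nat (K choose p) * (Sc (hf ^ p + (- hf) ^ p) * psum n (K - p)))
    + (Sc (to_fract (\<Sum>p\<in>UNIV. yvar p ^ K)) :: ('a::idom, 'r::{finite,linorder}) opr)"
proof -
  let ?h = "Sc hf :: ('a, 'r) opr"
  have e: "(x + ?h) ^ K + (x - ?h) ^ K - 2 * x ^ K
      = (\<Sum>p=1..K. of_nat (K choose p) * (Sc (hf ^ p + (- hf) ^ p) * x ^ (K - p)))"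
    if x: "?h * x = x * ?h" for x
  proof -
    have b1: "(x + ?h) ^ K = x ^ K + (\<Sum>p=1..K. of_nat (K choose p) * (Sc (hf ^ p) * x ^ (K - p)))"
      unfolding binomial_commuting[OF x] sum_atMost_eq by (simp add: Sc_power)
    have n: "(- ?h) ^ p = Sc ((- hf) ^ p)" for p by (simp only: Sc_power flip: Sc_hom(6))
    have "(- ?h) * x = x * (- ?h)" using x by simp
    from binomial_commuting[OF this, of K]
    have b2: "(x - ?h) ^ K = x ^ K + (\<Sum>p=1..K. of_nat (K choose p) * (Sc ((- hf) ^ p) * x ^ (K - p)))"
      unfolding sum_atMost_eq n by (simp add: Sc_hom)
    show ?thesis unfolding b1 b2 by (simp add: Sc_hom(1) distrib_left distrib_right sum.distrib mult_2)
  qed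
  have "(\<Sum>i=1..n. (x_op i + ?h) ^ K + (x_op i - ?h) ^ K - 2 * x_op i ^ K)
      = (\<Sum>i=1..n. \<Sum>p=1..K. of_nat (K choose p) * (Sc (hf ^ p + (- hf) ^ p) * x_op i ^ (K - p)))"
    by (intro sum.cong HOL.refl e) (simp add: Sc_x_op)
  also have "\<dots> = (\<Sum>p=1..K. of_nat (K choose p) * (Sc (hf ^ p + (- hf) ^ p) * psum n (K - p)))"
    unfolding psum_def sum_distrib_left by (rule sum.swap)
  finally have 1: "(\<Sum>i=1..n. (x_op i + ?h) ^ K + (x_op i - ?h) ^ K - 2 * x_op i ^ K)
    = (\<Sum>p=1..K. of_nat (K choose p) * (Sc (hf ^ p + (- hf) ^ p) * psum n (K - p)))" .
  have "(\<Sum>p\<in>UNIV. Sc (yf p) ^ K :: ('a, 'r) opr) = Sc (\<Sum>p\<in>UNIV. to_fract (yvar p) ^ K)"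
    by (simp add: Sc_power Sc_sum yf_def)
  also have "(\<Sum>p\<in>UNIV. to_fract (yvar p) ^ K) = to_fract (\<Sum>p\<in>UNIV. yvar p ^ K :: ('a, 'r) base)"
    by (simp add: to_fract_sum to_fract_power)
  finally show ?thesis unfolding E_op_def 1 by simp
qed

section \<open>Presented modules\<close>

definition subg :: "'g::ab_group_add set \<Rightarrow> bool" where
  "subg S \<longleftrightarrow> 0 \<in> S \<and> (\<forall>a\<in>S. \<forall>b\<in>S. a - b \<in> S)"

lemma subgD:
  assumes "subg S"
  shows "0 \<in> S" "a \<in> S \<Longrightarrow> b \<in> S \<Longrightarrow> a - b \<in> S" "a \<in> S \<Longrightarrow> - a \<in> S" "a \<in> S \<Longrightarrow> b \<in> S \<Longrightarrow> a + b \<in> S"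
proof -
  show 0: "0 \<in> S" and d: "a \<in> S \<Longrightarrow> b \<in> S \<Longrightarrow> a - b \<in> S" for a b
    using assms by (auto simp: subg_def)
  show n: "a \<in> S \<Longrightarrow> - a \<in> S" for a using d[OF 0, of a] by simp
  show "a \<in> S \<Longrightarrow> b \<in> S \<Longrightarrow> a + b \<in> S" using d[OF _ n, of a b] by simp
qed

lemma subg_sum: "subg S \<Longrightarrow> (\<And>i. i \<in> I \<Longrightarrow> f i \<in> S) \<Longrightarrow> sum f I \<in> S"
  by (induction I rule: infinite_finite_induct) (auto intro: subgD)

definition msc :: "'g::ab_group_add set \<Rightarrow> ('k::comm_ring_1 \<Rightarrow> 'g \<Rightarrow> 'g) \<Rightarrow> bool" where
  "msc S sc \<longleftrightarrow> subg S \<and> (\<forall>c. \<forall>a\<in>S. sc c a \<in> S) \<and> (\<forall>c. \<forall>a\<in>S. \<forall>b\<in>S. sc c (a + b) = sc c a + sc c b)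
     \<and> (\<forall>c d. \<forall>a\<in>S. sc (c + d) a = sc c a + sc d a) \<and> (\<forall>c d. \<forall>a\<in>S. sc c (sc d a) = sc (c * d) a)
     \<and> (\<forall>a\<in>S. sc 1 a = a)"

lemma mscD:
  assumes "msc S sc"
  shows "subg S" "a \<in> S \<Longrightarrow> sc c a \<in> S" "a \<in> S \<Longrightarrow> b \<in> S \<Longrightarrow> sc c (a + b) = sc c a + sc c b"
    "a \<in> S \<Longrightarrow> sc (c + d) a = sc c a + sc d a" "a \<in> S \<Longrightarrow> sc c (sc d a) = sc (c * d) a" "a \<in> S \<Longrightarrow> sc 1 a = a"
  using assms by (auto simp: msc_def)

lemma msc_zero:
  assumes "msc S sc"
  shows "sc c 0 = 0" "a \<in> S \<Longrightarrow> sc 0 a = 0" "a \<in> S \<Longrightarrow> sc (- c) a = - sc c a"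
proof -
  show "sc c 0 = 0" using mscD(3)[OF assms, of 0 0 c] subgD(1)[OF mscD(1)[OF assms]] by simp
  show z: "sc 0 a = 0" if "a \<in> S" for a using mscD(4)[OF assms that, of 0 0] by simp
  show "sc (- c) a = - sc c a" if "a \<in> S"
    using mscD(4)[OF assms that, of "- c" c] z[OF that] by (simp add: eq_neg_iff_add_eq_0)
qed

text \<open>
  The module record \<open>M\<close> is presented as the quotient \<open>S / T\<close>, for subgroups of an abelian group type,
  by the map \<open>\<pi>\<close>.
\<close>

definition mrep ::
    "('k::comm_ring_1, 'm) module \<Rightarrow> 'g::ab_group_add set \<Rightarrow> 'g set \<Rightarrow> ('k \<Rightarrow> 'g \<Rightarrow> 'g) \<Rightarrow> ('g \<Rightarrow> 'm) \<Rightarrow> bool" where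
  "mrep M S T sc \<pi> \<longleftrightarrow> msc S sc \<and> subg T \<and> T \<subseteq> S \<and> (\<forall>c. \<forall>a\<in>T. sc c a \<in> T) \<and> carrier M = \<pi> ` S
     \<and> (\<forall>a\<in>S. \<forall>b\<in>S. \<pi> a = \<pi> b \<longleftrightarrow> a - b \<in> T) \<and> (\<forall>a\<in>S. \<forall>b\<in>S. \<pi> a \<oplus>\<^bsub>M\<^esub> \<pi> b = \<pi> (a + b)) \<and> \<zero>\<^bsub>M\<^esub> = \<pi> 0
     \<and> (\<forall>c. \<forall>a\<in>S. c \<odot>\<^bsub>M\<^esub> \<pi> a = \<pi> (sc c a))"

lemma mrepD:
  assumes "mrep M S T sc \<pi>"
  shows "msc S sc" "subg T" "T \<subseteq> S" "a \<in> T \<Longrightarrow> sc c a \<in> T" "carrier M = \<pi> ` S"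
    "a \<in> S \<Longrightarrow> b \<in> S \<Longrightarrow> \<pi> a = \<pi> b \<longleftrightarrow> a - b \<in> T" "a \<in> S \<Longrightarrow> b \<in> S \<Longrightarrow> \<pi> a \<oplus>\<^bsub>M\<^esub> \<pi> b = \<pi> (a + b)"
    "\<zero>\<^bsub>M\<^esub> = \<pi> 0" "a \<in> S \<Longrightarrow> c \<odot>\<^bsub>M\<^esub> \<pi> a = \<pi> (sc c a)"
  using assms unfolding mrep_def by blast+

lemma mrep_carrier: "mrep M S T sc \<pi> \<Longrightarrow> a \<in> S \<Longrightarrow> \<pi> a \<in> carrier M"
  by (simp add: mrep_def)

lemma mrep_inv:
  assumes M: "mrep M S T sc \<pi>" and a: "a \<in> S"
  shows "inv\<^bsub>add_monoid M\<^esub> (\<pi> a) = \<pi> (- a)"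
proof -
  have S: "subg S" by (rule mscD(1)[OF mrepD(1)[OF M]])
  have "y = \<pi> (- a)" if y: "y \<in> carrier M" "\<pi> a \<oplus>\<^bsub>M\<^esub> y = \<zero>\<^bsub>M\<^esub>" for y
  proof -
    obtain b where b: "b \<in> S" "y = \<pi> b" using y mrepD(5)[OF M] by auto
    then have "\<pi> (a + b) = \<pi> 0" using y mrepD(7,8)[OF M] a by auto
    then have "a + b \<in> T" using mrepD(6)[OF M, of "a + b" 0] subgD[OF S] a b by auto
    then have "b - (- a) \<in> T" by (simp add: add.commute)
    then show ?thesis using mrepD(6)[OF M b(1) subgD(3)[OF S a]] b by simp
  qed
  note u = this
  have e: "\<pi> (- a) \<in> carrier M" "\<pi> a \<oplus>\<^bsub>M\<^esub> \<pi> (- a) = \<zero>\<^bsub>M\<^esub>" "\<pi> (- a) \<oplus>\<^bsub>M\<^esub> \<pi> a = \<zero>\<^bsub>M\<^esub>"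
    using mrepD(5,7,8)[OF M] a subgD(3)[OF S a] by auto
  show ?thesis
    unfolding m_inv_def monoid.simps partial_object.simps
    by (rule the_equality) (use u e in blast)+
qed

lemma mrep_minus:
  assumes M: "mrep M S T sc \<pi>" and "a \<in> S" "b \<in> S"
  shows "\<pi> a \<ominus>\<^bsub>M\<^esub> \<pi> b = \<pi> (a - b)"
  unfolding a_minus_def a_inv_def mrep_inv[OF M assms(3)]
  using mrepD(7)[OF M assms(2), of "- b"] subgD(3)[OF mscD(1)[OF mrepD(1)[OF M]] assms(3)] by simp

lemma mrep_coset:
  assumes M: "mrep M S T sc \<pi>" and T': "T' \<subseteq> S" and a: "a \<in> S"
  shows "(\<pi> ` T') +>\<^bsub>M\<^esub> \<pi> a = \<pi> ` ((\<lambda>t. t + a) ` T')"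
proof -
  have "\<pi> t \<oplus>\<^bsub>M\<^esub> \<pi> a = \<pi> (t + a)" if "t \<in> T'" for t using mrepD(7)[OF M _ a] T' that by blast
  then show ?thesis unfolding a_r_coset_def' by auto
qed

text \<open>A further quotient keeps the presenting group \<open>S\<close> and merely enlarges the
  subgroup of relations. Iterated cosets can thus be handled through representatives in one abelian
  group type.\<close>

lemma mrep_quot:
  assumes M: "mrep M S T sc \<pi>" and T': "subg T'" "T \<subseteq> T'" "T' \<subseteq> S" "\<And>c a. a \<in> T' \<Longrightarrow> sc c a \<in> T'"
  shows "mrep (quot_module M (\<pi> ` T')) S T' sc (\<lambda>a. (\<pi> ` T') +>\<^bsub>M\<^esub> \<pi> a)"
proof -
  have sc: "msc S sc" and S: "subg S" using mrepD(1)[OF M] mscD(1) by auto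
  let ?N = "\<pi> ` T'"
  have co: "?N +>\<^bsub>M\<^esub> \<pi> a = (\<lambda>t. \<pi> (t + a)) ` T'" if "a \<in> S" for a
    unfolding mrep_coset[OF M T'(3) that] by auto
  have eq: "?N +>\<^bsub>M\<^esub> \<pi> a = ?N +>\<^bsub>M\<^esub> \<pi> b \<longleftrightarrow> a - b \<in> T'" if a: "a \<in> S" and b: "b \<in> S" for a b
  proof
    assume "?N +>\<^bsub>M\<^esub> \<pi> a = ?N +>\<^bsub>M\<^esub> \<pi> b"
    then have "\<pi> (0 + a) \<in> ?N +>\<^bsub>M\<^esub> \<pi> b" using co[OF a] subgD(1)[OF T'(1)] by blast
    then obtain t where t: "t \<in> T'" "\<pi> a = \<pi> (t + b)" using co[OF b] by auto
    then have "a - (t + b) \<in> T" using mrepD(6)[OF M a subgD(4)[OF S _ b]] T'(3) by blast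
    then have "(a - (t + b)) + t \<in> T'" using T'(2) by (intro subgD(4)[OF T'(1)] t) blast
    then show "a - b \<in> T'" by simp
  next
    have sub: "?N +>\<^bsub>M\<^esub> \<pi> a \<subseteq> ?N +>\<^bsub>M\<^esub> \<pi> b" if "a \<in> S" "b \<in> S" "a - b \<in> T'" for a b
      unfolding co[OF that(1)] co[OF that(2)]
    proof (rule image_subsetI)
      fix t assume "t \<in> T'"
      then have "t + (a - b) \<in> T'" using that by (intro subgD(4)[OF T'(1)])
      moreover have "\<pi> (t + a) = \<pi> (t + (a - b) + b)" by simp
      ultimately show "\<pi> (t + a) \<in> (\<lambda>t. \<pi> (t + b)) ` T'" by (intro image_eqI)
    qed
    assume d: "a - b \<in> T'"
    then have "b - a \<in> T'" using subgD(3)[OF T'(1) d] by simp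
    then show "?N +>\<^bsub>M\<^esub> \<pi> a = ?N +>\<^bsub>M\<^esub> \<pi> b" using sub[OF a b d] sub[OF b a] by blast
  qed
  have add: "(?N +>\<^bsub>M\<^esub> \<pi> a) <+>\<^bsub>M\<^esub> (?N +>\<^bsub>M\<^esub> \<pi> b) = ?N +>\<^bsub>M\<^esub> \<pi> (a + b)" if a: "a \<in> S" and b: "b \<in> S" for a b
  proof -
    have p: "\<pi> (t + a) \<oplus>\<^bsub>M\<^esub> \<pi> (t' + b) = \<pi> ((t + t') + (a + b))" if "t \<in> T'" "t' \<in> T'" for t t'
    proof -
      have "t + a \<in> S" "t' + b \<in> S" using that T'(3) a b by (auto intro: subgD(4)[OF S])
      then show ?thesis using mrepD(7)[OF M] by (simp add: ac_simps)
    qed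
    have "(?N +>\<^bsub>M\<^esub> \<pi> a) <+>\<^bsub>M\<^esub> (?N +>\<^bsub>M\<^esub> \<pi> b) = (\<Union>t\<in>T'. \<Union>t'\<in>T'. {\<pi> ((t + t') + (a + b))})"
      unfolding set_add_def' co[OF a] co[OF b] using p by auto
    also have "\<dots> = (\<lambda>t. \<pi> (t + (a + b))) ` T'"
    proof (intro equalityI subsetI)
      fix z assume "z \<in> (\<lambda>t. \<pi> (t + (a + b))) ` T'"
      then obtain t where "t \<in> T'" "z = \<pi> ((t + 0) + (a + b))" by auto
      then show "z \<in> (\<Union>t\<in>T'. \<Union>t'\<in>T'. {\<pi> ((t + t') + (a + b))})" using subgD(1)[OF T'(1)] by blast
    qed (use subgD(4)[OF T'(1)] in blast)
    finally show ?thesis using co[OF subgD(4)[OF S a b]] by simp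
  qed
  have sm: "(\<Union>m\<in>?N +>\<^bsub>M\<^esub> \<pi> a. ?N +>\<^bsub>M\<^esub> (c \<odot>\<^bsub>M\<^esub> m)) = ?N +>\<^bsub>M\<^esub> \<pi> (sc c a)" if a: "a \<in> S" for a c
  proof -
    have "?N +>\<^bsub>M\<^esub> (c \<odot>\<^bsub>M\<^esub> \<pi> (t + a)) = ?N +>\<^bsub>M\<^esub> \<pi> (sc c a)" if t: "t \<in> T'" for t
    proof -
      have tS: "t \<in> S" using t T'(3) by blast
      have "sc c (t + a) - sc c a = sc c t" using mscD(3)[OF sc tS a] by simp
      then have "sc c (t + a) - sc c a \<in> T'" using T'(4)[OF t] by simp
      then have "?N +>\<^bsub>M\<^esub> \<pi> (sc c (t + a)) = ?N +>\<^bsub>M\<^esub> \<pi> (sc c a)"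
        using eq[OF mscD(2)[OF sc subgD(4)[OF S tS a]] mscD(2)[OF sc a]] by blast
      then show ?thesis using mrepD(9)[OF M subgD(4)[OF S tS a]] by simp
    qed
    then show ?thesis unfolding co[OF a] using subgD(1)[OF T'(1)] by auto
  qed
  have z: "?N = ?N +>\<^bsub>M\<^esub> \<pi> 0" unfolding co[OF subgD(1)[OF S]] by simp
  show ?thesis
    unfolding mrep_def
    using sc T' eq add sm z mrepD(5)[OF M]
    by (simp add: quot_module_def A_RCOSETS_def') blast
qed

inductive_set lin_span :: "('k \<Rightarrow> 'g \<Rightarrow> 'g) \<Rightarrow> 'g set \<Rightarrow> 'g::ab_group_add set" for sc G where
  zero: "0 \<in> lin_span sc G"
| add: "s \<in> lin_span sc G \<Longrightarrow> g \<in> G \<Longrightarrow> s + sc c g \<in> lin_span sc G"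

lemma lin_span_props:
  assumes sc: "msc S sc" and G: "G \<subseteq> S"
  shows lin_span_sub: "lin_span sc G \<subseteq> S" and lin_span_sc: "s \<in> lin_span sc G \<Longrightarrow> sc c s \<in> lin_span sc G" and subg_lin_span: "subg (lin_span sc G)"
    and lin_span_gen: "g \<in> G \<Longrightarrow> g \<in> lin_span sc G"
proof -
  have S: "subg S" by (rule mscD(1)[OF sc])
  have sub: "s \<in> S" if "s \<in> lin_span sc G" for s
    using that by (induction rule: lin_span.induct) (use G in \<open>auto intro!: subgD(1)[OF S] subgD(4)[OF S] mscD(2)[OF sc]\<close>)
  then show "lin_span sc G \<subseteq> S" by blast
  show scl: "sc c s \<in> lin_span sc G" if "s \<in> lin_span sc G" for c s
    using that
  proof (induction rule: lin_span.induct)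
    case (add s g d)
    have "sc c (s + sc d g) = sc c s + sc (c * d) g"
      using add sub G by (simp add: mscD(3)[OF sc _ mscD(2)[OF sc]] mscD(5)[OF sc] subsetD)
    then show ?case using lin_span.add[OF add.IH] add by simp
  qed (simp add: msc_zero[OF sc] lin_span.zero)
  have pl: "s + t \<in> lin_span sc G" if s: "s \<in> lin_span sc G" and t: "t \<in> lin_span sc G" for s t
    using t
  proof (induction rule: lin_span.induct)
    case (add t g d)
    then show ?case using lin_span.add[of "s + t" sc G g d] by (simp add: add.assoc)
  qed (simp add: s)
  show "subg (lin_span sc G)"
    unfolding subg_def
  proof (intro conjI ballI)
    fix a b assume a: "a \<in> lin_span sc G" and b: "b \<in> lin_span sc G"
    have "sc (- 1) b = - b" using msc_zero(3)[OF sc sub[OF b], of 1] mscD(6)[OF sc sub[OF b]] by simp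
    then show "a - b \<in> lin_span sc G" using pl[OF a scl[OF b, of "- 1"]] by simp
  qed (rule lin_span.zero)
  show "g \<in> lin_span sc G" if "g \<in> G"
    using lin_span.add[OF lin_span.zero that, where sc = sc and c = 1] mscD(6)[OF sc, of g] that G by auto
qed

lemma mrep_span:
  assumes M: "mrep M S T sc \<pi>" and G: "G \<subseteq> S"
  shows "module_span M (\<pi> ` G) = \<pi> ` lin_span sc G"
proof
  have sc: "msc S sc" and S: "subg S" using mrepD(1)[OF M] mscD(1) by auto
  note P = lin_span_props[OF sc G]
  have "submodule (\<pi> ` lin_span sc G) ring_of_type M"
  proof (intro submodule.intro subgroup.intro submodule_axioms.intro)
    show "\<pi> ` lin_span sc G \<subseteq> carrier (add_monoid M)" using P(1) mrepD(5)[OF M] by auto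
    show "x \<otimes>\<^bsub>add_monoid M\<^esub> y \<in> \<pi> ` lin_span sc G" if xy: "x \<in> \<pi> ` lin_span sc G" "y \<in> \<pi> ` lin_span sc G" for x y
    proof -
      obtain a b where ab: "a \<in> lin_span sc G" "b \<in> lin_span sc G" "x = \<pi> a" "y = \<pi> b" using xy by blast
      then have "x \<otimes>\<^bsub>add_monoid M\<^esub> y = \<pi> (a + b)" using mrepD(7)[OF M, of a b] P(1) by auto
      then show ?thesis using subgD(4)[OF P(3) ab(1,2)] by simp
    qed
    show "\<one>\<^bsub>add_monoid M\<^esub> \<in> \<pi> ` lin_span sc G" using mrepD(8)[OF M] subgD(1)[OF P(3)] by simp
    show "inv\<^bsub>add_monoid M\<^esub> x \<in> \<pi> ` lin_span sc G" if "x \<in> \<pi> ` lin_span sc G" for x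
    proof -
      obtain a where a: "a \<in> lin_span sc G" "x = \<pi> a" using \<open>x \<in> _\<close> by blast
      then show ?thesis using mrep_inv[OF M, of a] P(1) subgD(3)[OF P(3) a(1)] by auto
    qed
    show "a \<odot>\<^bsub>M\<^esub> x \<in> \<pi> ` lin_span sc G" if x: "x \<in> \<pi> ` lin_span sc G" for a x
    proof -
      obtain b where b: "b \<in> lin_span sc G" "x = \<pi> b" using x by blast
      then show ?thesis using mrepD(9)[OF M, of b a] P(1) P(2)[OF b(1), of a] by auto
    qed
  qed
  then show "module_span M (\<pi> ` G) \<subseteq> \<pi> ` lin_span sc G"
    unfolding module_span_def using P(4) by blast
  have "\<pi> s \<in> H" if s: "s \<in> lin_span sc G" and H: "submodule H ring_of_type M" and GH: "\<pi> ` G \<subseteq> H" for s H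
    using s
  proof (induction rule: lin_span.induct)
    case zero
    show ?case using subgroup.one_closed[OF submodule.axioms(1)[OF H]] mrepD(8)[OF M] by simp
  next
    case (add s g c)
    have g: "g \<in> S" and s: "s \<in> S" using add G P(1) by auto
    have "c \<odot>\<^bsub>M\<^esub> \<pi> g \<in> H"
      using add GH by (intro submodule.smult_closed[OF H]) (auto simp: ring_of_type_def)
    then have "\<pi> s \<oplus>\<^bsub>M\<^esub> \<pi> (sc c g) \<in> H"
      using subgroup.m_closed[OF submodule.axioms(1)[OF H] add.IH] mrepD(9)[OF M g] by simp
    then show ?case using mrepD(7)[OF M s mscD(2)[OF sc g]] by simp
  qed
  then show "\<pi> ` lin_span sc G \<subseteq> module_span M (\<pi> ` G)" unfolding module_span_def by blast
qed

lemma mrep_quot_span: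
  assumes M: "mrep M S {0} sc \<pi>" and G: "G \<subseteq> S"
  shows "mrep (quot_module M (module_span M (\<pi> ` G))) S (lin_span sc G) sc (\<lambda>a. module_span M (\<pi> ` G) +>\<^bsub>M\<^esub> \<pi> a)"
  unfolding mrep_span[OF M G]
  using lin_span_props[OF mrepD(1)[OF M] G] by (intro mrep_quot[OF M]) (auto intro: lin_span.zero)

section \<open>Free modules, extension of scalars and direct sums\<close>

lemma lookup_map_times: "Poly_Mapping.lookup (Poly_Mapping.map ((*) c) f) k = c * (Poly_Mapping.lookup f k :: 'l::comm_ring_1)"
  by (simp add: Poly_Mapping.map.rep_eq when_def)

lemma mrep_free:
  "mrep (free_module B) {f. Poly_Mapping.keys f \<subseteq> B} {0} (\<lambda>c. Poly_Mapping.map ((*) c)) (\<lambda>f. f)"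
proof -
  have keys: "Poly_Mapping.keys (Poly_Mapping.map ((*) c) f) \<subseteq> Poly_Mapping.keys f" for c and f :: "'a \<Rightarrow>\<^sub>0 'b"
    by (auto simp: in_keys_iff Poly_Mapping.map.rep_eq when_def)
  have "Poly_Mapping.map ((*) c) (f + g) = Poly_Mapping.map ((*) c) f + Poly_Mapping.map ((*) c) g"
    "Poly_Mapping.map ((*) (c + d)) f = Poly_Mapping.map ((*) c) f + Poly_Mapping.map ((*) d) f"
    "Poly_Mapping.map ((*) c) (Poly_Mapping.map ((*) d) f) = Poly_Mapping.map ((*) (c * d)) f"
    "Poly_Mapping.map ((*) 1) f = f" for c d and f g :: "'a \<Rightarrow>\<^sub>0 'b"
    by (rule poly_mapping_eqI; simp add: lookup_map_times lookup_add distrib_left distrib_right mult.assoc)+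
  note eqs = this
  have kd: "Poly_Mapping.keys (f - g) \<subseteq> B" if "Poly_Mapping.keys f \<subseteq> B" "Poly_Mapping.keys g \<subseteq> B" for f g :: "'a \<Rightarrow>\<^sub>0 'b"
    using keys_diff[of f g] that by blast
  have km: "Poly_Mapping.keys (Poly_Mapping.map ((*) c) f) \<subseteq> B" if "Poly_Mapping.keys f \<subseteq> B" for c and f :: "'a \<Rightarrow>\<^sub>0 'b"
    using keys[of c f] that by blast
  have z: "Poly_Mapping.map ((*) c) 0 = (0 :: 'a \<Rightarrow>\<^sub>0 'b)" for c
    by (rule poly_mapping_eqI) (simp add: lookup_map_times)
  show ?thesis
    unfolding mrep_def msc_def subg_def free_module_def by (simp add: eqs kd km z)
qed

lemma mrep_tensor:
  fixes \<phi> :: "'k::comm_ring_1 \<Rightarrow> 'l::comm_ring_1" and M :: "('k, 'm) module"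
  assumes M: "mrep M S T sc \<pi>"
  defines "N \<equiv> lin_span (\<lambda>c. Poly_Mapping.map ((*) c)) (tensor_relations \<phi> M)"
  shows "mrep (extend_scalars \<phi> M) {f. Poly_Mapping.keys f \<subseteq> carrier M} N (\<lambda>c. Poly_Mapping.map ((*) c))
      (\<lambda>f. tensor_kernel \<phi> M +>\<^bsub>free_module (carrier M) :: ('l, 'm \<Rightarrow>\<^sub>0 'l) module\<^esub> f)"
    and "tensor_relations \<phi> M \<subseteq> {f. Poly_Mapping.keys f \<subseteq> carrier M}"
proof -
  have "m \<oplus>\<^bsub>M\<^esub> m' \<in> carrier M" "a \<odot>\<^bsub>M\<^esub> m \<in> carrier M" if "m \<in> carrier M" "m' \<in> carrier M" for m m' a
    using that mrepD(5,7,9)[OF M] mscD(2)[OF mrepD(1)[OF M]] subgD(4)[OF mscD(1)[OF mrepD(1)[OF M]]] by auto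
  note car = this
  let ?S = "{f :: 'm \<Rightarrow>\<^sub>0 'l. Poly_Mapping.keys f \<subseteq> carrier M}"
  have single: "Poly_Mapping.single m c \<in> ?S" if "m \<in> carrier M" for m c using that by simp
  have diff: "f - g \<in> ?S" if "f \<in> ?S" "g \<in> ?S" for f g using keys_diff[of f g] that by blast
  show sub: "tensor_relations \<phi> M \<subseteq> ?S"
  proof
    fix f :: "'m \<Rightarrow>\<^sub>0 'l" assume "f \<in> tensor_relations \<phi> M"
    then consider m m' where "m \<in> carrier M" "m' \<in> carrier M"
        "f = Poly_Mapping.single (m \<oplus>\<^bsub>M\<^esub> m') 1 - Poly_Mapping.single m 1 - Poly_Mapping.single m' 1"
      | a m where "m \<in> carrier M" "f = Poly_Mapping.single (a \<odot>\<^bsub>M\<^esub> m) 1 - Poly_Mapping.single m (\<phi> a)"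
      unfolding tensor_relations_def by blast
    then show "f \<in> ?S" by cases (simp_all only: diff single car)
  qed
  show "mrep (extend_scalars \<phi> M) {f. Poly_Mapping.keys f \<subseteq> carrier M} N (\<lambda>c. Poly_Mapping.map ((*) c))
      (\<lambda>f. tensor_kernel \<phi> M +>\<^bsub>free_module (carrier M) :: ('l, 'm \<Rightarrow>\<^sub>0 'l) module\<^esub> f)"
    using mrep_quot_span[OF mrep_free[of "carrier M"] sub]
    unfolding extend_scalars_def tensor_kernel_def N_def image_ident .
qed

lemma mrep_direct_sum:
  fixes S :: "nat \<Rightarrow> 'g::ab_group_add set"
  assumes M: "\<And>n. mrep (M n) (S n) (T n) (sc n) (\<pi> n)"
  shows "mrep (direct_sum M) {g. (\<forall>n. g n \<in> S n) \<and> finite {n. g n \<noteq> 0}}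
      {g. (\<forall>n. g n \<in> T n) \<and> finite {n. g n \<noteq> 0}} (\<lambda>c g n. sc n c (g n)) (\<lambda>g n. \<pi> n (g n))"
proof -
  have sc: "msc (S n) (sc n)" and S: "subg (S n)" and T: "subg (T n)" for n
    using mrepD(1,2)[OF M] mscD(1) by auto
  have fin: "finite {n. f n (g n) (g' n) \<noteq> 0}" if "finite {n. g n \<noteq> 0}" "finite {n. g' n \<noteq> 0}" "\<And>n. f n 0 0 = 0"
    for f :: "nat \<Rightarrow> 'g \<Rightarrow> 'g \<Rightarrow> 'g" and g g'
  proof (rule finite_subset[OF _ finite_UnI[OF that(1,2)]], rule subsetI, rule ccontr)
    fix n assume "n \<in> {n. f n (g n) (g' n) \<noteq> 0}" "n \<notin> {n. g n \<noteq> 0} \<union> {n. g' n \<noteq> 0}"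
    then show False using that(3)[of n] by simp
  qed
  have fsc: "finite {n. sc n c (g n) \<noteq> 0}" if "finite {n. g n \<noteq> 0}" for c g
    using fin[OF that that, of "\<lambda>n a b. sc n c a"] msc_zero(1)[OF sc] by simp
  have fd: "finite {n. g n - g' n \<noteq> 0}" if "finite {n. g n \<noteq> 0}" "finite {n. g' n \<noteq> 0}" for g g' :: "nat \<Rightarrow> 'g"
    using fin[OF that, of "\<lambda>n a b. a - b"] by simp
  have car: "carrier (direct_sum M) = (\<lambda>g n. \<pi> n (g n)) ` {g. (\<forall>n. g n \<in> S n) \<and> finite {n. g n \<noteq> 0}}"
  proof (intro equalityI subsetI)
    fix v assume "v \<in> carrier (direct_sum M)"
    then have v: "\<And>n. v n \<in> carrier (M n)" "finite {n. v n \<noteq> \<zero>\<^bsub>M n\<^esub>}" by (auto simp: direct_sum_def)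
    have "\<forall>n. \<exists>a\<in>S n. \<pi> n a = v n" using v(1) mrepD(5)[OF M] by (metis imageE)
    then obtain f where f: "\<And>n. f n \<in> S n" "\<And>n. \<pi> n (f n) = v n" by metis
    \<comment> \<open>The representative is taken to be 0 wherever \<open>v\<close> is zero, so that
      finite support passes from the vector to its representatives.\<close>
    let ?g = "\<lambda>n. if v n = \<zero>\<^bsub>M n\<^esub> then 0 else f n"
    have "v = (\<lambda>n. \<pi> n (?g n))" using f mrepD(8)[OF M] by (auto simp: fun_eq_iff)
    moreover have "finite {n. ?g n \<noteq> 0}" by (rule finite_subset[OF _ v(2)]) auto
    ultimately show "v \<in> (\<lambda>g n. \<pi> n (g n)) ` {g. (\<forall>n. g n \<in> S n) \<and> finite {n. g n \<noteq> 0}}"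
      using f subgD(1)[OF S] by (intro image_eqI[of _ _ ?g]) auto
  next
    fix v assume "v \<in> (\<lambda>g n. \<pi> n (g n)) ` {g. (\<forall>n. g n \<in> S n) \<and> finite {n. g n \<noteq> 0}}"
    then obtain g where g: "v = (\<lambda>n. \<pi> n (g n))" "\<And>n. g n \<in> S n" "finite {n. g n \<noteq> 0}" by auto
    have "finite {n. v n \<noteq> \<zero>\<^bsub>M n\<^esub>}" by (rule finite_subset[OF _ g(3)]) (use g mrepD(8)[OF M] in auto)
    then show "v \<in> carrier (direct_sum M)" using g mrep_carrier[OF M] by (simp add: direct_sum_def)
  qed
  have "msc {g. (\<forall>n. g n \<in> S n) \<and> finite {n. g n \<noteq> 0}} (\<lambda>c g n. sc n c (g n))"
    unfolding msc_def subg_def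
    using mscD[OF sc] subgD(1,2)[OF S] fd fsc by (simp add: fun_eq_iff)
  moreover have "subg {g. (\<forall>n. g n \<in> T n) \<and> finite {n. g n \<noteq> 0}}"
    unfolding subg_def using subgD(1,2)[OF T] fd by simp
  ultimately show ?thesis
    unfolding mrep_def using car subsetD[OF mrepD(3)[OF M]] mrepD(4,6-9)[OF M] fd fsc
    by (auto simp: direct_sum_def fun_eq_iff)
qed

section \<open>Transfer to the cyclotomic quotients\<close>

lemma mrep_abelian_monoid:
  assumes M: "mrep M S T sc \<pi>"
  shows "abelian_monoid M"
proof -
  have S: "subg S" by (rule mscD(1)[OF mrepD(1)[OF M]])
  note D = mrepD(5,7,8)[OF M] and C = subgD[OF S]
  show ?thesis
    by (rule abelian_monoidI) (use D C in \<open>auto simp: ac_simps\<close>)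
qed

lemma mrep_finsum:
  assumes M: "mrep M S T sc \<pi>" and fin: "finite I" and g: "\<And>i. i \<in> I \<Longrightarrow> g i \<in> S"
  shows "(\<Oplus>\<^bsub>M\<^esub>i\<in>I. \<pi> (g i)) = \<pi> (\<Sum>i\<in>I. g i)"
proof -
  interpret abelian_monoid M by (rule mrep_abelian_monoid[OF M])
  have S: "subg S" by (rule mscD(1)[OF mrepD(1)[OF M]])
  show ?thesis using fin g
  proof (induction I)
    case empty
    then show ?case using mrepD(8)[OF M] by simp
  next
    case (insert i I)
    have "(\<Oplus>\<^bsub>M\<^esub>j\<in>insert i I. \<pi> (g j)) = \<pi> (g i) \<oplus>\<^bsub>M\<^esub> (\<Oplus>\<^bsub>M\<^esub>j\<in>I. \<pi> (g j))"
      using insert mrep_carrier[OF M] by (intro finsum_insert) auto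
    then show ?case
      using insert mrepD(7)[OF M, of "g i" "\<Sum>j\<in>I. g j"] subg_sum[OF S, of I g] by simp
  qed
qed

definition base_scale :: "('a::idom, 'r::{finite,linorder}) base \<Rightarrow> ('a, 'r) opr \<Rightarrow> ('a, 'r) opr" where
  "base_scale c u = Sc (to_fract c) * u"

lemma subg_Rop: "subg (Rop n)"
  by (simp add: subg_def)

lemma base_scale_Rop: "u \<in> Rop n \<Longrightarrow> base_scale c u \<in> Rop n"
  by (simp add: base_scale_def)

lemma msc_Rop: "msc (Rop n) base_scale"
  unfolding msc_def using subg_Rop
  by (auto simp: base_scale_def distrib_left distrib_right Sc_hom mult.assoc to_fract_def[of 1] One_fract_def[symmetric])

text \<open>A word representing the operator is chosen; by faithfulness its class does not depend on
  the choice, and this inverts the evaluation map on the quotient.\<close>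

definition iso_R :: "nat \<Rightarrow> ('a::idom, 'r::{finite,linorder}) opr \<Rightarrow> ('a, 'r) nc_poly set set" where
  "iso_R n u = cyclotomic_class n (SOME f. f \<in> Fr n \<and> ev f = u)"

lemma iso_R_ev:
  fixes f :: "('a::idom, 'r::{finite,linorder}) nc_poly"
  assumes f: "f \<in> Fr n"
  shows "iso_R n (ev f) = cyclotomic_class n f"
proof -
  let ?P = "\<lambda>g. g \<in> Fr n \<and> ev g = ev f"
  have "?P (SOME g. ?P g)" by (rule someI[of ?P f]) (use f in simp)
  moreover have "cyclotomic_class n g = cyclotomic_class n f" if "?P g" for g
    using that f class_eq_iff[of g n f] ev_eq_zero_iff[of "g - f" n] by (simp add: ev_diff)
  ultimately show ?thesis unfolding iso_R_def by blast
qed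

lemma Rop_cases:
  assumes "u \<in> Rop n"
  obtains f where "f \<in> Fr n" "u = ev f"
  using assms by (auto simp: Rop_def)

lemma iso_R_eq_iff:
  assumes "u \<in> Rop n" "v \<in> Rop n"
  shows "iso_R n u = iso_R n v \<longleftrightarrow> u = v"
proof -
  obtain f g where fg: "f \<in> Fr n" "u = ev f" "g \<in> Fr n" "v = ev g" using assms by (elim Rop_cases)
  then show ?thesis
    using class_eq_iff[of f n g] ev_eq_zero_iff[of "f - g" n] by (simp add: iso_R_ev ev_diff)
qed

lemma iso_R_hom:
  assumes "u \<in> Rop n" "v \<in> Rop n"
  shows "iso_R n u \<oplus>\<^bsub>R_cyclotomic n\<^esub> iso_R n v = iso_R n (u + v)" "iso_R n u \<otimes>\<^bsub>R_cyclotomic n\<^esub> iso_R n v = iso_R n (u * v)"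
    "c \<odot>\<^bsub>R_cyclotomic n\<^esub> iso_R n u = iso_R n (base_scale c u)"
proof -
  obtain f g where fg: "f \<in> Fr n" "u = ev f" "g \<in> Fr n" "v = ev g" using assms by (elim Rop_cases)
  then show "iso_R n u \<oplus>\<^bsub>R_cyclotomic n\<^esub> iso_R n v = iso_R n (u + v)" "iso_R n u \<otimes>\<^bsub>R_cyclotomic n\<^esub> iso_R n v = iso_R n (u * v)"
    using iso_R_ev[of "f + g" n] iso_R_ev[of "f * g" n] class_simps[of f n g]
    by (simp_all add: iso_R_ev R_cyclotomic_simps ev_add ev_mult)
  show "c \<odot>\<^bsub>R_cyclotomic n\<^esub> iso_R n u = iso_R n (base_scale c u)"
    using fg iso_R_ev[of "scal c * f" n] class_simps(3)[of "scal c" n f]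
    by (simp add: iso_R_ev R_cyclotomic_simps base_scale_def ev_mult ev_scal)
qed

lemma carrier_R: "carrier (R_cyclotomic n) = iso_R n ` Rop n"
proof -
  have "cyclotomic_class n ` Fr n = iso_R n ` Rop n"
    unfolding Rop_def image_image by (rule image_cong) (auto simp: iso_R_ev)
  then show ?thesis by (simp add: R_cyclotomic_simps carrier_Rcyc)
qed

lemma mrep_R: "mrep (R_cyclotomic n) (Rop n) {0} base_scale (iso_R n :: ('a::idom, 'r::{finite,linorder}) opr \<Rightarrow> _)"
proof -
  have ev0: "ev (0 :: ('a, 'r) nc_poly) = 0" using ev_diff[of "0 :: ('a, 'r) nc_poly" 0] by simp
  have "\<zero>\<^bsub>R_cyclotomic n\<^esub> = iso_R n (0 :: ('a, 'r) opr)"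
    using iso_R_ev[of "0 :: ('a, 'r) nc_poly" n] by (simp add: R_cyclotomic_simps ev0 class_zero_one(2))
  then show ?thesis
    unfolding mrep_def carrier_R using msc_Rop
    by (auto simp: iso_R_hom iso_R_eq_iff subg_def base_scale_def)
qed

lemma iso_R_xgen_pow: "1 \<le> k \<Longrightarrow> k \<le> n \<Longrightarrow> cyclotomic_class n (xgen k ^ l) = iso_R n (x_op k ^ l :: ('a::idom, 'r::{finite,linorder}) opr)"
  using iso_R_ev[of "xgen k ^ l :: ('a, 'r) nc_poly" n] by (simp add: ev_power ev_xgen)

definition tr_op :: "nat \<Rightarrow> ('a::idom, 'r::{finite,linorder}) opr \<Rightarrow> ('a, 'r) nc_poly set set set" where
  "tr_op n u = tr_class (R_cyclotomic n) (iso_R n u)"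

text \<open>A scalar in front of a commutator is absorbed into its first factor, because scalars
  commute with \<open>Rop n\<close>. The linear span is therefore no larger than the additive
  one.\<close>

lemma lin_span_Comm: "lin_span base_scale {a * b - b * a | a b. a \<in> Rop n \<and> b \<in> Rop n} = Comm (Rop n)"
proof (intro equalityI subsetI)
  fix s assume "s \<in> lin_span base_scale {a * b - b * a | a b. a \<in> Rop n \<and> b \<in> Rop n}"
  then show "s \<in> Comm (Rop n)"
  proof (induction rule: lin_span.induct)
    case (add s g c)
    then obtain a b where ab: "g = a * b - b * a" "a \<in> Rop n" "b \<in> Rop n" by blast
    have cb: "Sc (to_fract c) * b = b * Sc (to_fract c)" using ab by (intro Sc_Rop)
    have "base_scale c g = base_scale c a * b - (Sc (to_fract c) * b) * a"
      by (simp add: ab base_scale_def right_diff_distrib mult.assoc)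
    also have "\<dots> = base_scale c a * b - b * base_scale c a" unfolding cb base_scale_def mult.assoc ..
    finally have "base_scale c g = base_scale c a * b - b * base_scale c a" .
    then show ?case using Comm.add[OF add.IH base_scale_Rop[OF ab(2)] ab(3)] by simp
  qed (rule Comm.zero)
next
  fix s assume "s \<in> Comm (Rop n)"
  then show "s \<in> lin_span base_scale {a * b - b * a | a b. a \<in> Rop n \<and> b \<in> Rop n}"
  proof (induction rule: Comm.induct)
    case (add s a b)
    then have "s + base_scale 1 (a * b - b * a) \<in> lin_span base_scale {a * b - b * a | a b. a \<in> Rop n \<and> b \<in> Rop n}"
      by (intro lin_span.add) blast+
    moreover have "base_scale 1 (a * b - b * a) = a * b - b * a"
      using add by (intro mscD(6)[OF msc_Rop[of n]]) simp
    ultimately show ?case by simp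
  qed (rule lin_span.zero)
qed

lemma commutator_span_R:
  "commutator_span (R_cyclotomic n)
    = module_span (R_cyclotomic n) (iso_R n ` {a * b - b * a | a b. a \<in> Rop n \<and> b \<in> (Rop n :: ('a::idom, 'r::{finite,linorder}) opr set)})"
proof -
  let ?R = "R_cyclotomic n :: (('a, 'r) base, ('a, 'r) nc_poly set set) module" and ?H = "Rop n :: ('a, 'r) opr set"
  have c: "(iso_R n a \<otimes>\<^bsub>?R\<^esub> iso_R n b) \<ominus>\<^bsub>?R\<^esub> (iso_R n b \<otimes>\<^bsub>?R\<^esub> iso_R n a) = iso_R n (a * b - b * a)"
    if "a \<in> ?H" "b \<in> ?H" for a b
    using that by (simp add: iso_R_hom mrep_minus[OF mrep_R])
  have "{(a \<otimes>\<^bsub>?R\<^esub> b) \<ominus>\<^bsub>?R\<^esub> (b \<otimes>\<^bsub>?R\<^esub> a) | a b. a \<in> carrier ?R \<and> b \<in> carrier ?R}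
    = iso_R n ` {a * b - b * a | a b. a \<in> ?H \<and> b \<in> ?H}"
    unfolding carrier_R
  proof (intro equalityI subsetI)
    fix z assume "z \<in> {(a \<otimes>\<^bsub>?R\<^esub> b) \<ominus>\<^bsub>?R\<^esub> (b \<otimes>\<^bsub>?R\<^esub> a) | a b. a \<in> iso_R n ` ?H \<and> b \<in> iso_R n ` ?H}"
    then obtain a b where ab: "a \<in> ?H" "b \<in> ?H" "z = (iso_R n a \<otimes>\<^bsub>?R\<^esub> iso_R n b) \<ominus>\<^bsub>?R\<^esub> (iso_R n b \<otimes>\<^bsub>?R\<^esub> iso_R n a)" by blast
    then show "z \<in> iso_R n ` {a * b - b * a | a b. a \<in> ?H \<and> b \<in> ?H}"
      unfolding ab(3) c[OF ab(1,2)] by blast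
  next
    fix z assume "z \<in> iso_R n ` {a * b - b * a | a b. a \<in> ?H \<and> b \<in> ?H}"
    then obtain a b where ab: "a \<in> ?H" "b \<in> ?H" "z = iso_R n (a * b - b * a)" by blast
    show "z \<in> {(a \<otimes>\<^bsub>?R\<^esub> b) \<ominus>\<^bsub>?R\<^esub> (b \<otimes>\<^bsub>?R\<^esub> a) | a b. a \<in> iso_R n ` ?H \<and> b \<in> iso_R n ` ?H}"
      unfolding mem_Collect_eq
      by (intro exI[of _ "iso_R n a"] exI[of _ "iso_R n b"] conjI imageI ab) (simp only: ab(3) c[OF ab(1,2)])
  qed
  then show ?thesis unfolding commutator_span_def by (rule arg_cong)
qed

lemma mrep_tr: "mrep (tr_R n) (Rop n) (Comm (Rop n)) base_scale (tr_op n)"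
proof -
  have "{a * b - b * a | a b. a \<in> Rop n \<and> b \<in> Rop n} \<subseteq> Rop n" by auto
  from mrep_quot_span[OF mrep_R this] show ?thesis
    unfolding lin_span_Comm commutator_span_R[symmetric] tr_R_def tr_module_def tr_op_def[abs_def] tr_class_def .
qed

lemma tr_op_mem: "u \<in> Rop n \<Longrightarrow> tr_op n u = iso_R n ` ((\<lambda>s. s + u) ` Comm (Rop n))"
proof -
  assume u: "u \<in> Rop n"
  have G: "{a * b - b * a | a b. a \<in> Rop n \<and> b \<in> Rop n} \<subseteq> Rop n" by auto
  have "Comm (Rop n) \<subseteq> Rop n" using Comm_sub[OF subring_set_Rop] by blast
  from mrep_coset[OF mrep_R this u] show ?thesis
    unfolding tr_op_def tr_class_def commutator_span_R mrep_span[OF mrep_R G] lin_span_Comm .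
qed

text \<open>The maps on traces are given as the single element of the image of a coset. It suffices
  that the formula takes one value on all representatives differing by \<open>Comm\<close>.\<close>

lemma tr_op_the_elem:
  assumes u: "u \<in> Rop n" and F: "\<And>v. v \<in> Rop n \<Longrightarrow> v - u \<in> Comm (Rop n) \<Longrightarrow> F (iso_R n v) = w"
  shows "the_elem (F ` tr_op n u) = w"
proof -
  have "F z = w" if "z \<in> tr_op n u" for z
    using that unfolding tr_op_mem[OF u] image_image
  proof (rule imageE)
    fix s assume s: "z = iso_R n (s + u)" "s \<in> Comm (Rop n)"
    then show ?thesis using F[of "s + u"] Comm_sub[OF subring_set_Rop s(2)] u by simp
  qed
  moreover have "iso_R n (0 + u) \<in> tr_op n u" unfolding tr_op_mem[OF u] by (intro imageI Comm.zero)
  ultimately have "F ` tr_op n u = {w}" by blast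
  then show ?thesis by simp
qed

text \<open>A word evaluates to the same operator at level \<open>n\<close> and at level
  \<open>n + 1\<close>, so any two words with equal class at level \<open>n\<close> have equal class
  at level \<open>n + 1\<close>, and the canonical map becomes the inclusion of operator
  rings.\<close>

lemma R_incl_iso_R:
  fixes u :: "('a::idom, 'r::{finite,linorder}) opr"
  assumes "u \<in> Rop n"
  shows "R_incl n (iso_R n u) = iso_R (Suc n) u"
proof -
  obtain f where f: "f \<in> Fr n" "u = ev f" using assms by (rule Rop_cases)
  show ?thesis
    unfolding R_incl_def
  proof (rule the_equality)
    show "\<exists>f\<in>carrier (free_algebra n). iso_R n u = cyclotomic_class n f \<and> iso_R (Suc n) u = cyclotomic_class (n + 1) f"
      using f Fr_Suc[of f n] by (intro bexI[of _ f]) (auto simp: iso_R_ev)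
    fix b assume "\<exists>f\<in>carrier (free_algebra n). iso_R n u = cyclotomic_class n f \<and> b = cyclotomic_class (n + 1) f"
    then obtain g where g: "g \<in> Fr n" "iso_R n u = cyclotomic_class n g" "b = cyclotomic_class (Suc n) g" by auto
    then have "u = ev g" using iso_R_eq_iff[OF assms HopI[OF g(1)]] iso_R_ev[OF g(1)] by simp
    then show "b = iso_R (Suc n) u" using g iso_R_ev[OF Fr_Suc[OF g(1)]] by simp
  qed
qed

lemma tr_op_eq_iff: "u \<in> Rop n \<Longrightarrow> v \<in> Rop n \<Longrightarrow> tr_op n u = tr_op n v \<longleftrightarrow> u - v \<in> Comm (Rop n)"
  by (rule mrepD(6)[OF mrep_tr])

text \<open>\<open>x_{n+1}\<close> commutes with \<open>Rop n\<close>, so its power can be attached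
  to the first factor of each commutator. This makes \<open>x^-\<close> well defined on
  traces.\<close>

lemma Comm_Suc_mult:
  fixes s :: "('a::idom, 'r::{finite,linorder}) opr"
  assumes "s \<in> Comm (Rop n)"
  shows "s * x_op (Suc n) ^ k \<in> Comm (Rop (Suc n))"
  using assms
proof (induction rule: Comm.induct)
  case (add s a b)
  have "x_op (Suc n) ^ k * b = b * x_op (Suc n) ^ k" using add by (intro x_op_power_comm[of n]) auto
  then have "(a * b - b * a) * x_op (Suc n) ^ k = (a * x_op (Suc n) ^ k) * b - b * (a * x_op (Suc n) ^ k)"
    by (simp add: left_diff_distrib mult.assoc)
  moreover have "a * x_op (Suc n) ^ k \<in> Rop (Suc n)"
    using add by (intro Rop_closed(4) x_op_pow_Rop) (rule Rop_Suc)
  ultimately show ?case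
    using Comm.add[OF add.IH, of "a * x_op (Suc n) ^ k" b] Rop_Suc[OF add.hyps(3)] by (simp add: distrib_right)
qed (simp add: Comm.zero)

lemma x_minus_tr_op:
  fixes u :: "('a::idom, 'r::{finite,linorder}) opr"
  assumes u: "u \<in> Rop n"
  shows "x_minus k n (tr_op n u) = tr_op (Suc n) (u * x_op (Suc n) ^ k)"
  unfolding x_minus_def Suc_eq_plus1[symmetric]
proof (rule tr_op_the_elem[OF u])
  fix v :: "('a, 'r) opr" assume v: "v \<in> Rop n" "v - u \<in> Comm (Rop n)"
  have m: "w * x_op (Suc n) ^ k \<in> Rop (Suc n)" if "w \<in> Rop n" for w :: "('a, 'r) opr"
    using that by (intro Rop_closed(4) x_op_pow_Rop) (rule Rop_Suc)
  have x: "cyclotomic_class (Suc n) (xgen (Suc n) ^ k) = iso_R (Suc n) (x_op (Suc n) ^ k :: ('a, 'r) opr)"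
    by (rule iso_R_xgen_pow) auto
  have "tr_op (Suc n) (v * x_op (Suc n) ^ k) = tr_op (Suc n) (u * x_op (Suc n) ^ k)"
    using Comm_Suc_mult[OF v(2), of k] by (subst tr_op_eq_iff) (simp_all add: m v u left_diff_distrib)
  then show "tr_class (R_cyclotomic (Suc n)) (R_incl n (iso_R n v) \<otimes>\<^bsub>R_cyclotomic (Suc n)\<^esub> cyclotomic_class (Suc n) (xgen (Suc n) ^ k))
    = tr_op (Suc n) (u * x_op (Suc n) ^ k)"
    unfolding R_incl_iso_R[OF v(1)] x iso_R_hom(2)[OF Rop_Suc[OF v(1)] x_op_pow_Rop] tr_op_def .
qed

lemma power_sum_mult_tr_op:
  fixes u :: "('a::idom, 'r::{finite,linorder}) opr"
  assumes u: "u \<in> Rop n"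
  shows "power_sum_mult l n (tr_op n u) = tr_op n (u * psum n l)"
  unfolding power_sum_mult_def
proof (rule tr_op_the_elem[OF u])
  fix v :: "('a, 'r) opr" assume v: "v \<in> Rop n" "v - u \<in> Comm (Rop n)"
  have p: "psum n l \<in> (Rop n :: ('a, 'r) opr set)" by (rule psum_Rop)
  have m: "w * psum n l \<in> Rop n" if "w \<in> Rop n" for w :: "('a, 'r) opr"
    using that by (intro Rop_closed(4) p)
  have F: "(\<Sum>i=1..n. xgen i ^ l) \<in> (Fr n :: ('a, 'r) nc_poly set)" by (intro Fr_sum Fr_power) auto
  have "ev (\<Sum>i=1..n. xgen i ^ l) = (psum n l :: ('a, 'r) opr)"
    by (simp add: ev_sum ev_power ev_xgen psum_def)
  then have x: "cyclotomic_class n (\<Sum>i=1..n. xgen i ^ l) = iso_R n (psum n l :: ('a, 'r) opr)"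
    using iso_R_ev[OF F] by simp
  have "(v - u) * psum n l \<in> Comm (Rop n)"
    by (rule Comm_mult_central[OF v(2) p subring_set_Rop]) (rule psum_central[symmetric])
  then have "tr_op n (v * psum n l) = tr_op n (u * psum n l)"
    by (subst tr_op_eq_iff) (simp_all add: m v u left_diff_distrib)
  then show "tr_class (R_cyclotomic n) (iso_R n v \<otimes>\<^bsub>R_cyclotomic n\<^esub> cyclotomic_class n (\<Sum>i=1..n. xgen i ^ l)) = tr_op n (u * psum n l)"
    unfolding x iso_R_hom(2)[OF v(1) p] tr_op_def .
qed


section \<open>The trace of an endomorphism\<close>

lemma coordinates_iso_R:
  fixes b :: "nat \<Rightarrow> ('a::idom, 'r::{finite,linorder}) opr"
  assumes b: "\<And>i. i < length bs \<Longrightarrow> b i \<in> Rop (Suc n) \<and> bs ! i = iso_R (Suc n) (b i)"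
    and m: "m \<in> Rop (Suc n)" and \<alpha>: "\<And>i. i < length bs \<Longrightarrow> \<alpha> i \<in> Rop n"
  shows "coordinates (R_cyclotomic n) (R_incl n) (R_cyclotomic (Suc n)) bs (iso_R (Suc n) m) (restrict (\<lambda>i. iso_R n (\<alpha> i)) {..<length bs})
    \<longleftrightarrow> m = (\<Sum>i<length bs. \<alpha> i * b i)"
proof -
  interpret abelian_monoid "R_cyclotomic (Suc n) :: (('a, 'r) base, _) module"
    by (rule mrep_abelian_monoid[OF mrep_R])
  have ab: "\<alpha> i * b i \<in> Rop (Suc n)" if "i \<in> {..<length bs}" for i
    using b \<alpha> that by (auto intro!: Rop_closed(4) intro: Rop_Suc)
  have "(\<Oplus>\<^bsub>R_cyclotomic (Suc n)\<^esub> i\<in>{..<length bs}. R_incl n (restrict (\<lambda>i. iso_R n (\<alpha> i)) {..<length bs} i) \<otimes>\<^bsub>R_cyclotomic (Suc n)\<^esub> (bs ! i))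
      = (\<Oplus>\<^bsub>R_cyclotomic (Suc n)\<^esub> i\<in>{..<length bs}. iso_R (Suc n) (\<alpha> i * b i))"
  proof (rule finsum_cong')
    show "(\<lambda>i. iso_R (Suc n) (\<alpha> i * b i)) \<in> {..<length bs} \<rightarrow> carrier (R_cyclotomic (Suc n))"
      using ab by (auto simp: carrier_R)
  qed (use b \<alpha> in \<open>auto simp: R_incl_iso_R iso_R_hom Rop_Suc\<close>)
  also have "\<dots> = iso_R (Suc n) (\<Sum>i<length bs. \<alpha> i * b i)"
    by (rule mrep_finsum[OF mrep_R]) (use ab in auto)
  finally have e: "(\<Oplus>\<^bsub>R_cyclotomic (Suc n)\<^esub> i\<in>{..<length bs}. R_incl n (restrict (\<lambda>i. iso_R n (\<alpha> i)) {..<length bs} i) \<otimes>\<^bsub>R_cyclotomic (Suc n)\<^esub> (bs ! i))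
      = iso_R (Suc n) (\<Sum>i<length bs. \<alpha> i * b i)" .
  have "restrict (\<lambda>i. iso_R n (\<alpha> i)) {..<length bs} \<in> {..<length bs} \<rightarrow>\<^sub>E carrier (R_cyclotomic n)"
    using \<alpha> by (auto simp: carrier_R)
  moreover have "(\<Sum>i<length bs. \<alpha> i * b i) \<in> Rop (Suc n)" by (rule Rop_closed(7)) (rule ab)
  ultimately show ?thesis
    unfolding coordinates_def e by (simp only: iso_R_eq_iff[OF m] simp_thms)
qed

lemma PiE_iso_R:
  assumes "cs \<in> {..<N} \<rightarrow>\<^sub>E carrier (R_cyclotomic n)"
  obtains \<alpha> where "\<And>i. i < N \<Longrightarrow> \<alpha> i \<in> Rop n" "cs = restrict (\<lambda>i. iso_R n (\<alpha> i)) {..<N}"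
proof -
  have "\<forall>i. \<exists>a. i < N \<longrightarrow> a \<in> Rop n \<and> cs i = iso_R n a"
    using assms by (auto simp: carrier_R PiE_iff)
  then obtain \<alpha> where \<alpha>: "\<And>i. i < N \<Longrightarrow> \<alpha> i \<in> Rop n \<and> cs i = iso_R n (\<alpha> i)" by metis
  moreover have "cs = restrict (\<lambda>i. iso_R n (\<alpha> i)) {..<N}"
    using assms \<alpha> by (intro ext) (auto simp: PiE_iff extensional_def)
  ultimately show ?thesis using that by blast
qed

lemma restrict_iso_R_eq:
  assumes "\<And>i. i < N \<Longrightarrow> \<alpha> i \<in> Rop n" "\<And>i. i < N \<Longrightarrow> \<beta> i \<in> Rop n"
    "restrict (\<lambda>i. iso_R n (\<alpha> i)) {..<N} = restrict (\<lambda>i. iso_R n (\<beta> i)) {..<N}" "i < N"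
  shows "\<alpha> i = \<beta> i"
  using fun_cong[OF assms(3), of i] assms(4) iso_R_eq_iff[OF assms(1,2)[OF assms(4)]] by simp

lemma left_basis_iso_R:
  fixes b :: "nat \<Rightarrow> ('a::idom, 'r::{finite,linorder}) opr"
  assumes b: "\<And>i. i < length bs \<Longrightarrow> b i \<in> Rop (Suc n) \<and> bs ! i = iso_R (Suc n) (b i)"
  shows "left_basis (R_cyclotomic n) (R_incl n) (R_cyclotomic (Suc n)) bs \<longleftrightarrow>
    (\<forall>m\<in>Rop (Suc n). \<exists>\<alpha>. (\<forall>i<length bs. \<alpha> i \<in> Rop n) \<and> m = (\<Sum>i<length bs. \<alpha> i * b i)
      \<and> (\<forall>\<beta>. (\<forall>i<length bs. \<beta> i \<in> Rop n) \<and> m = (\<Sum>i<length bs. \<beta> i * b i) \<longrightarrow> (\<forall>i<length bs. \<alpha> i = \<beta> i)))"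
    (is "?L \<longleftrightarrow> (\<forall>m\<in>_. ?R m)")
proof -
  let ?C = "coordinates (R_cyclotomic n) (R_incl n) (R_cyclotomic (Suc n)) bs"
  let ?r = "\<lambda>\<alpha>. restrict (\<lambda>i. iso_R n (\<alpha> i)) {..<length bs}"
  have "set bs \<subseteq> carrier (R_cyclotomic (Suc n))"
    using b by (auto simp: carrier_R in_set_conv_nth)
  moreover have "(\<exists>!cs. ?C (iso_R (Suc n) m) cs) \<longleftrightarrow> ?R m" if m: "m \<in> Rop (Suc n)" for m
  proof
    assume ex: "\<exists>!cs. ?C (iso_R (Suc n) m) cs"
    then obtain cs where cs: "?C (iso_R (Suc n) m) cs" by blast
    then obtain \<alpha> where \<alpha>: "\<And>i. i < length bs \<Longrightarrow> \<alpha> i \<in> Rop n" "cs = ?r \<alpha>"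
      using PiE_iso_R[of cs "length bs" n] unfolding coordinates_def by blast
    have "\<alpha> i = \<beta> i" if \<beta>: "\<forall>i<length bs. \<beta> i \<in> Rop n" "m = (\<Sum>i<length bs. \<beta> i * b i)" and i: "i < length bs" for \<beta> i
    proof -
      have "?C (iso_R (Suc n) m) (?r \<beta>)" using coordinates_iso_R[where b = b and \<alpha> = \<beta>, OF b m] \<beta> by blast
      then have "?r \<alpha> = ?r \<beta>" using ex cs \<alpha>(2) by blast
      then show ?thesis
        using \<alpha>(1) \<beta>(1) i by (intro restrict_iso_R_eq[where \<alpha> = \<alpha> and \<beta> = \<beta> and N = "length bs"]) simp_all
    qed
    moreover have "m = (\<Sum>i<length bs. \<alpha> i * b i)"
      using coordinates_iso_R[where b = b and \<alpha> = \<alpha>, OF b m \<alpha>(1)] cs \<alpha>(2) by blast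
    ultimately show "?R m" using \<alpha>(1) by blast
  next
    assume "?R m"
    then obtain \<alpha> where \<alpha>: "\<And>i. i < length bs \<Longrightarrow> \<alpha> i \<in> Rop n" "m = (\<Sum>i<length bs. \<alpha> i * b i)"
      and u: "\<And>\<beta> i. (\<forall>i<length bs. \<beta> i \<in> Rop n) \<Longrightarrow> m = (\<Sum>i<length bs. \<beta> i * b i) \<Longrightarrow> i < length bs \<Longrightarrow> \<alpha> i = \<beta> i"
      by blast
    show "\<exists>!cs. ?C (iso_R (Suc n) m) cs"
    proof (rule ex1I)
      show "?C (iso_R (Suc n) m) (?r \<alpha>)" using coordinates_iso_R[where b = b and \<alpha> = \<alpha>, OF b m \<alpha>(1)] \<alpha>(2) by blast
      fix cs assume cs: "?C (iso_R (Suc n) m) cs"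
      then obtain \<beta> where \<beta>: "\<And>i. i < length bs \<Longrightarrow> \<beta> i \<in> Rop n" "cs = ?r \<beta>"
        using PiE_iso_R[of cs "length bs" n] unfolding coordinates_def by blast
      then have "m = (\<Sum>i<length bs. \<beta> i * b i)"
        using coordinates_iso_R[where b = b and \<alpha> = \<beta>, OF b m \<beta>(1)] cs by blast
      then have "\<alpha> i = \<beta> i" if "i < length bs" for i using u \<beta>(1) that by blast
      then show "cs = ?r \<alpha>" unfolding \<beta>(2) by (intro restrict_ext) simp
    qed
  qed
  ultimately show ?thesis unfolding left_basis_def by (simp add: carrier_R)
qed

text \<open>\<open>endo_tr\<close> selects a basis by choice; its existence gives the selected list
  the defining property. The explicit basis, enumerated as a list, is the witness.\<close>

lemma left_basis_exists:
  "\<exists>bs. left_basis (R_cyclotomic n) (R_incl n) (R_cyclotomic (Suc n) :: (('a::idom, 'r::{finite,linorder}) base, _) module) bs"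
proof -
  have fin: "finite (basis_idx TYPE('r) n)" by (simp add: basis_idx_def)
  define N where "N = card (basis_idx TYPE('r) n)"
  obtain h where h: "bij_betw h {0..<N} (basis_idx TYPE('r) n)"
    unfolding N_def using ex_bij_betw_nat_finite[OF fin] by blast
  let ?N = N
  let ?b = "\<lambda>j. basis_op n (h j) :: ('a, 'r) opr"
  let ?bs = "map (\<lambda>j. iso_R (Suc n) (?b j)) [0..<?N]"
  have hE: "h j \<in> basis_idx TYPE('r) n" if "j < ?N" for j using h that by (auto simp: bij_betw_def)
  have sum: "(\<Sum>i\<in>basis_idx TYPE('r) n. g i) = (\<Sum>j<?N. g (h j))" for g :: "_ \<Rightarrow> ('a, 'r) opr"
    using sum.reindex_bij_betw[OF h, of g] by (simp add: lessThan_atLeast0)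
  have "left_basis (R_cyclotomic n) (R_incl n) (R_cyclotomic (Suc n)) ?bs"
  proof (subst left_basis_iso_R[where b = ?b])
    show "?b i \<in> Rop (Suc n) \<and> ?bs ! i = iso_R (Suc n) (?b i)" if "i < length ?bs" for i
      using that basis_op_Rop[OF hE] by simp
    show "\<forall>m\<in>Rop (Suc n). \<exists>\<alpha>. (\<forall>i<length ?bs. \<alpha> i \<in> Rop n) \<and> m = (\<Sum>i<length ?bs. \<alpha> i * ?b i)
      \<and> (\<forall>\<beta>. (\<forall>i<length ?bs. \<beta> i \<in> Rop n) \<and> m = (\<Sum>i<length ?bs. \<beta> i * ?b i) \<longrightarrow> (\<forall>i<length ?bs. \<alpha> i = \<beta> i))"
    proof (intro ballI exI conjI allI impI)
      fix m :: "('a, 'r) opr" assume m: "m \<in> Rop (Suc n)"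
      show "coord n (h i) m \<in> Rop n" for i by (rule coord_Rop[OF m])
      show "m = (\<Sum>i<length ?bs. coord n (h i) m * ?b i)" using coord_sum[OF m] sum by simp
      fix \<beta> i assume "(\<forall>i<length ?bs. \<beta> i \<in> Rop n) \<and> m = (\<Sum>i<length ?bs. \<beta> i * ?b i)" and "i < length ?bs"
      then have \<beta>: "\<And>i. i < ?N \<Longrightarrow> \<beta> i \<in> Rop n" "m = (\<Sum>i<?N. \<beta> i * ?b i)" and i: "i < ?N" by auto
      define k where "k = inv_into {0..<?N} h"
      have kh: "k (h j) = j" if "j < ?N" for j
        unfolding k_def using h that by (intro inv_into_f_f) (auto simp: bij_betw_def)
      have "coord n (h i) m = \<beta> (k (h i))"
      proof (rule coord_unique[where \<alpha> = "\<lambda>i. \<beta> (k i)"])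
        show "\<beta> (k i) \<in> Rop n" if "i \<in> basis_idx TYPE('r) n" for i
        proof -
          have "i \<in> h ` {0..<N}" using that bij_betw_imp_surj_on[OF h] by simp
          then obtain j where "j < ?N" "i = h j" by auto
          then show ?thesis using kh \<beta>(1) by simp
        qed
        show "m = (\<Sum>i\<in>basis_idx TYPE('r) n. \<beta> (k i) * basis_op n i)" unfolding sum \<beta>(2) by (simp add: kh)
      qed (rule hE[OF i])
      then show "coord n (h i) m = \<beta> i" using kh[OF i] by simp
    qed
  qed
  then show ?thesis by blast
qed

text \<open>Nothing is known about the basis selected in \<open>endo_tr\<close> except that it is
  one. Its coordinate functions form a dual basis, and independence of the trace from the dual basis
  allows a comparison with the explicit \<open>basis_op\<close>.\<close>

lemma endo_tr_iso_R:
  fixes F' :: "('a::idom, 'r::{finite,linorder}) opr \<Rightarrow> ('a, 'r) opr"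
  assumes lin: "lin (Rop n) (Rop (Suc n)) (Rop (Suc n)) F'"
    and F: "\<And>m. m \<in> Rop (Suc n) \<Longrightarrow> F (iso_R (Suc n) m) = iso_R (Suc n) (F' m)"
  shows "endo_tr (R_cyclotomic n) (R_incl n) (R_cyclotomic (Suc n)) F = tr_op n (mod_tr (basis_idx TYPE('r) n) (basis_op n) (coord n) F')"
proof -
  define bs where "bs = (SOME bs. left_basis (R_cyclotomic n) (R_incl n) (R_cyclotomic (Suc n) :: (('a, 'r) base, _) module) bs)"
  let ?C = "coordinates (R_cyclotomic n) (R_incl n) (R_cyclotomic (Suc n)) bs"
  let ?r = "\<lambda>\<alpha>. restrict (\<lambda>i. iso_R n (\<alpha> i)) {..<length bs}"
  have lb: "left_basis (R_cyclotomic n) (R_incl n) (R_cyclotomic (Suc n)) bs"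
    unfolding bs_def by (rule someI_ex[OF left_basis_exists])
  have "\<forall>i\<in>{..<length bs}. \<exists>b. b \<in> Rop (Suc n) \<and> bs ! i = iso_R (Suc n) b"
  proof
    fix i assume "i \<in> {..<length bs}"
    then have "bs ! i \<in> carrier (R_cyclotomic (Suc n))"
      using lb nth_mem[of i bs] unfolding left_basis_def by blast
    then show "\<exists>b. b \<in> Rop (Suc n) \<and> bs ! i = iso_R (Suc n) b" unfolding carrier_R by blast
  qed
  from bchoice[OF this] obtain b where b: "\<And>i. i < length bs \<Longrightarrow> b i \<in> Rop (Suc n) \<and> bs ! i = iso_R (Suc n) (b i)"
    by auto
  have "\<forall>m\<in>Rop (Suc n). \<exists>\<alpha>. (\<forall>i<length bs. \<alpha> i \<in> Rop n) \<and> m = (\<Sum>i<length bs. \<alpha> i * b i)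
      \<and> (\<forall>\<beta>. (\<forall>i<length bs. \<beta> i \<in> Rop n) \<and> m = (\<Sum>i<length bs. \<beta> i * b i) \<longrightarrow> (\<forall>i<length bs. \<alpha> i = \<beta> i))"
    by (rule iffD1[OF left_basis_iso_R lb]) (rule b)
  from bchoice[OF this] obtain q where qq: "\<forall>m\<in>Rop (Suc n). (\<forall>i<length bs. q m i \<in> Rop n) \<and> m = (\<Sum>i<length bs. q m i * b i)
      \<and> (\<forall>\<beta>. (\<forall>i<length bs. \<beta> i \<in> Rop n) \<and> m = (\<Sum>i<length bs. \<beta> i * b i) \<longrightarrow> (\<forall>i<length bs. q m i = \<beta> i))"
    by (rule exE)
  have q1: "q m i \<in> Rop n" if "m \<in> Rop (Suc n)" "i < length bs" for m i
    using bspec[OF qq that(1)] that(2) by simp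
  have q3: "q m i = \<beta> i" if "m \<in> Rop (Suc n)" "\<And>i. i < length bs \<Longrightarrow> \<beta> i \<in> Rop n" "m = (\<Sum>i<length bs. \<beta> i * b i)" "i < length bs"
    for m \<beta> i
  proof -
    have "(\<forall>i<length bs. \<beta> i \<in> Rop n) \<and> m = (\<Sum>i<length bs. \<beta> i * b i) \<longrightarrow> (\<forall>i<length bs. q m i = \<beta> i)"
      using spec[OF conjunct2[OF conjunct2[OF bspec[OF qq that(1)]]], of \<beta>] .
    then show ?thesis using that(2-4) by blast
  qed
  have q2: "m = (\<Sum>i<length bs. q m i * b i)" if "m \<in> Rop (Suc n)" for m
    using bspec[OF qq that] by (elim conjE)
  have db: "dual_basis (Rop n) (Rop (Suc n)) {..<length bs} b (\<lambda>i m. q m i)"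
    unfolding dual_basis_def
  proof (intro conjI ballI)
    fix i assume i: "i \<in> {..<length bs}"
    show "b i \<in> Rop (Suc n)" using i b by auto
    show "lin (Rop n) (Rop (Suc n)) (Rop n) (\<lambda>m. q m i)"
      unfolding lin_def
    proof (intro conjI ballI)
      fix m :: "('a, 'r) opr" assume m: "m \<in> Rop (Suc n)"
      show "q m i \<in> Rop n" using q1[OF m] i by simp
      show "q (m + m') i = q m i + q m' i" if m': "m' \<in> Rop (Suc n)" for m'
        by (rule q3) (use m m' i q1 q2[OF m] q2[OF m'] in \<open>auto simp: distrib_right sum.distrib\<close>)
    next
      fix a m :: "('a, 'r) opr" assume a: "a \<in> Rop n" and m: "m \<in> Rop (Suc n)"
      have "a * m = a * (\<Sum>i<length bs. q m i * b i)" using q2[OF m] by simp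
      then have e: "a * m = (\<Sum>i<length bs. (a * q m i) * b i)" by (simp add: sum_distrib_left mult.assoc)
      show "q (a * m) i = a * q m i"
      proof (rule q3[OF _ _ e])
        show "a * m \<in> Rop (Suc n)" by (intro Rop_closed(4) Rop_Suc[OF a] m)
      qed (use a i q1[OF m] in auto)
    qed
  qed (use q2 in \<open>auto intro: Rop_Suc\<close>)
  have Fb: "F' (b i) \<in> Rop (Suc n)" if "i < length bs" for i using linD(1)[OF lin] b that by blast
  have the: "(THE cs. ?C (F (bs ! i)) cs) = ?r (q (F' (b i)))" if i: "i < length bs" for i
  proof -
    have Fi: "F (bs ! i) = iso_R (Suc n) (F' (b i))" using b[OF i] F by simp
    have "?C (F (bs ! i)) (?r (q (F' (b i))))"
      unfolding Fi using coordinates_iso_R[where b = b and \<alpha> = "q (F' (b i))", OF b Fb[OF i] q1[OF Fb[OF i]]] q2[OF Fb[OF i]]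
      by blast
    moreover have "\<exists>!cs. ?C (F (bs ! i)) cs"
      unfolding Fi using lb Fb[OF i] by (auto simp: left_basis_def carrier_R)
    ultimately show ?thesis by (intro the1_equality)
  qed
  interpret A: abelian_monoid "R_cyclotomic n :: (('a, 'r) base, _) module"
    by (rule mrep_abelian_monoid[OF mrep_R])
  have "(\<Oplus>\<^bsub>R_cyclotomic n\<^esub> i\<in>{..<length bs}. (THE cs. ?C (F (bs ! i)) cs) i)
      = (\<Oplus>\<^bsub>R_cyclotomic n\<^esub> i\<in>{..<length bs}. iso_R n (q (F' (b i)) i))"
    by (rule A.finsum_cong') (use the q1[OF Fb] in \<open>auto simp: carrier_R\<close>)
  also have "\<dots> = iso_R n (\<Sum>i<length bs. q (F' (b i)) i)"
    by (rule mrep_finsum[OF mrep_R]) (use q1[OF Fb] in auto)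
  also have "(\<Sum>i<length bs. q (F' (b i)) i) = mod_tr {..<length bs} b (\<lambda>i m. q m i) F'" by (simp add: mod_tr_def)
  finally have "endo_tr (R_cyclotomic n) (R_incl n) (R_cyclotomic (Suc n)) F = tr_op n (mod_tr {..<length bs} b (\<lambda>i m. q m i) F')"
    unfolding endo_tr_def Let_def bs_def[symmetric] tr_op_def by (rule arg_cong)
  also have "\<dots> = tr_op n (mod_tr (basis_idx TYPE('r) n) (basis_op n) (coord n) F')"
  proof (subst tr_op_eq_iff)
    have id: "lin (Rop n) (Rop (Suc n)) (Rop (Suc n)) (\<lambda>m. m :: ('a, 'r) opr)" by (simp add: lin_def Rop_Suc)
    show "mod_tr {..<length bs} b (\<lambda>i m. q m i) F' - mod_tr (basis_idx TYPE('r) n) (basis_op n) (coord n) F' \<in> Comm (Rop n)"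
      using mod_tr_cyclic[OF db dual_basis_coord id lin] by simp
    show "mod_tr {..<length bs} b (\<lambda>i m. q m i) F' \<in> Rop n"
      unfolding mod_tr_def by (intro Rop_closed(7)) (use q1[OF Fb] in auto)
    show "mod_tr (basis_idx TYPE('r) n) (basis_op n) (coord n) F' \<in> Rop n"
      unfolding mod_tr_def by (intro Rop_closed(7) coord_Rop linD(1)[OF lin] basis_op_Rop)
  qed
  finally show ?thesis .
qed

lemma x_plus_tr_op:
  fixes u :: "('a::idom, 'r::{finite,linorder}) opr"
  assumes u: "u \<in> Rop (Suc n)"
  shows "x_plus k n (tr_op (Suc n) u) = tr_op n (x_plus_op n k u)"
  unfolding x_plus_def Suc_eq_plus1[symmetric]
proof (rule tr_op_the_elem[OF u])
  fix v :: "('a, 'r) opr" assume v: "v \<in> Rop (Suc n)" "v - u \<in> Comm (Rop (Suc n))"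
  have x: "cyclotomic_class (Suc n) (xgen (Suc n) ^ k) = iso_R (Suc n) (x_op (Suc n) ^ k :: ('a, 'r) opr)"
    by (rule iso_R_xgen_pow) auto
  have "endo_tr (R_cyclotomic n) (R_incl n) (R_cyclotomic (Suc n))
      (\<lambda>m. cyclotomic_class (Suc n) (xgen (Suc n) ^ k) \<otimes>\<^bsub>R_cyclotomic (Suc n)\<^esub> m \<otimes>\<^bsub>R_cyclotomic (Suc n)\<^esub> iso_R (Suc n) v)
      = tr_op n (x_plus_op n k v)"
    unfolding x_plus_op_def
  proof (rule endo_tr_iso_R[OF lin_x_plus_op[OF v(1)]])
    fix m :: "('a, 'r) opr" assume m: "m \<in> Rop (Suc n)"
    show "cyclotomic_class (Suc n) (xgen (Suc n) ^ k) \<otimes>\<^bsub>R_cyclotomic (Suc n)\<^esub> iso_R (Suc n) m \<otimes>\<^bsub>R_cyclotomic (Suc n)\<^esub> iso_R (Suc n) v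
      = iso_R (Suc n) (x_op (Suc n) ^ k * m * v)"
      unfolding x iso_R_hom(2)[OF x_op_pow_Rop m] by (rule iso_R_hom(2)) (intro Rop_closed(4) x_op_pow_Rop m v)+
  qed
  also have "\<dots> = tr_op n (x_plus_op n k u)"
    using x_plus_op_Comm[OF v(2), of k] by (simp add: tr_op_eq_iff x_plus_op_Rop u v x_plus_op_diff)
  finally show "endo_tr (R_cyclotomic n) (R_incl n) (R_cyclotomic (Suc n))
      (\<lambda>m. cyclotomic_class (Suc n) (xgen (Suc n) ^ k) \<otimes>\<^bsub>R_cyclotomic (Suc n)\<^esub> m \<otimes>\<^bsub>R_cyclotomic (Suc n)\<^esub> iso_R (Suc n) v)
      = tr_op n (x_plus_op n k u)" .
qed

section \<open>The sum of the traces as an abelian group type\<close>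

abbreviation smf :: "'l::comm_ring_1 \<Rightarrow> ('m \<Rightarrow>\<^sub>0 'l) \<Rightarrow> 'm \<Rightarrow>\<^sub>0 'l" where
  "smf c \<equiv> Poly_Mapping.map ((*) c)"

definition Sf :: "nat \<Rightarrow> ('a::idom, 'r::{finite,linorder}) tr_frac set" where
  "Sf n = {f. Poly_Mapping.keys f \<subseteq> carrier (tr_R n)}"

definition Tf :: "nat \<Rightarrow> ('a::idom, 'r::{finite,linorder}) tr_frac set" where
  "Tf n = lin_span smf (tensor_relations to_fract (tr_R n))"

definition pf :: "nat \<Rightarrow> ('a::idom, 'r::{finite,linorder}) tr_frac \<Rightarrow> ('a, 'r) tr_frac set" where
  "pf n f = tensor_kernel to_fract (tr_R n) +>\<^bsub>free_module (carrier (tr_R n)) :: (('a, 'r) frac, ('a, 'r) tr_frac) module\<^esub> f"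

lemma mrep_tr_frac: "mrep (tr_R_frac n) (Sf n) (Tf n) smf (pf n)"
  using mrep_tensor(1)[OF mrep_tr[of n], of to_fract]
  unfolding tr_R_frac_def Sf_def[symmetric] Tf_def[symmetric] pf_def[symmetric] .

lemma tensor_relations_Sf: "tensor_relations to_fract (tr_R n) \<subseteq> Sf n"
  using mrep_tensor(2)[OF mrep_tr[of n], of to_fract] unfolding Sf_def .

definition SS :: "(nat \<Rightarrow> ('a::idom, 'r::{finite,linorder}) tr_frac) set" where
  "SS = {g. (\<forall>n. g n \<in> Sf n) \<and> finite {n. g n \<noteq> 0}}"

definition TT :: "(nat \<Rightarrow> ('a::idom, 'r::{finite,linorder}) tr_frac) set" where
  "TT = {g. (\<forall>n. g n \<in> Tf n) \<and> finite {n. g n \<noteq> 0}}"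

definition sS :: "('a::idom, 'r::{finite,linorder}) frac \<Rightarrow> (nat \<Rightarrow> ('a, 'r) tr_frac) \<Rightarrow> nat \<Rightarrow> ('a, 'r) tr_frac" where
  "sS c g n = smf c (g n)"

definition PP :: "(nat \<Rightarrow> ('a::idom, 'r::{finite,linorder}) tr_frac) \<Rightarrow> nat \<Rightarrow> ('a, 'r) tr_frac set" where
  "PP g n = pf n (g n)"

lemma mrep_cat: "mrep tr_category_frac SS TT sS PP"
  using mrep_direct_sum[of tr_R_frac Sf Tf "\<lambda>_. smf" pf, OF mrep_tr_frac]
  unfolding tr_category_frac_def SS_def TT_def sS_def[abs_def] PP_def[abs_def] .

text \<open>The carrier of the module record becomes an abelian group type, so that the type
  \<open>endo\<close> of additive maps with its ring operations applies to the operators on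
  traces.\<close>

typedef (overloaded) ('a, 'r) tv = "carrier (tr_category_frac :: (('a::idom, 'r::{finite,linorder}) frac, nat \<Rightarrow> ('a, 'r) tr_frac set) module)"
  morphisms rep_tv abs_tv
  using mrep_carrier[OF mrep_cat subgD(1)[OF mscD(1)[OF mrepD(1)[OF mrep_cat]]]] by blast

definition tv_class :: "(nat \<Rightarrow> ('a::idom, 'r::{finite,linorder}) tr_frac) \<Rightarrow> ('a, 'r) tv" where
  "tv_class g = abs_tv (PP g)"

lemma msc_SS: "msc SS sS"
  by (rule mrepD(1)[OF mrep_cat])

lemmas SS_closed = subgD[OF mscD(1)[OF msc_SS]]

lemma rep_tv_tv_class: "g \<in> SS \<Longrightarrow> rep_tv (tv_class g) = PP g"
  unfolding tv_class_def by (rule abs_tv_inverse) (rule mrep_carrier[OF mrep_cat])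

lemma tv_cases:
  fixes v :: "('a::idom, 'r::{finite,linorder}) tv"
  obtains g where "g \<in> SS" "v = tv_class g"
proof -
  have "rep_tv v \<in> PP ` SS" using rep_tv[of v] unfolding mrepD(5)[OF mrep_cat] .
  then obtain g where g: "g \<in> SS" "rep_tv v = PP g" by blast
  then have "v = tv_class g" unfolding tv_class_def by (metis rep_tv_inverse)
  then show ?thesis using that g by blast
qed

instantiation tv :: (idom, "{finite,linorder}") ab_group_add
begin
definition zero_tv :: "('a, 'b) tv" where "zero_tv = tv_class 0"
definition plus_tv :: "('a, 'b) tv \<Rightarrow> ('a, 'b) tv \<Rightarrow> ('a, 'b) tv" where
  "plus_tv v w = abs_tv (rep_tv v \<oplus>\<^bsub>tr_category_frac\<^esub> rep_tv w)"
definition minus_tv :: "('a, 'b) tv \<Rightarrow> ('a, 'b) tv \<Rightarrow> ('a, 'b) tv" where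
  "minus_tv v w = abs_tv (rep_tv v \<ominus>\<^bsub>tr_category_frac\<^esub> rep_tv w)"
definition uminus_tv :: "('a, 'b) tv \<Rightarrow> ('a, 'b) tv" where "uminus_tv v = 0 - v"

lemma tv_class_add: "g \<in> SS \<Longrightarrow> g' \<in> SS \<Longrightarrow> tv_class g + tv_class g' = (tv_class (g + g') :: ('a, 'b) tv)"
  unfolding plus_tv_def by (simp add: rep_tv_tv_class mrepD(7)[OF mrep_cat]) (simp add: tv_class_def)

lemma tv_class_diff: "g \<in> SS \<Longrightarrow> g' \<in> SS \<Longrightarrow> tv_class g - tv_class g' = (tv_class (g - g') :: ('a, 'b) tv)"
  unfolding minus_tv_def by (simp add: rep_tv_tv_class mrep_minus[OF mrep_cat]) (simp add: tv_class_def)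

instance
proof
  fix a b c :: "('a, 'b) tv"
  obtain x y z where xyz: "x \<in> SS" "a = tv_class x" "y \<in> SS" "b = tv_class y" "z \<in> SS" "c = tv_class z"
    using tv_cases[of a] tv_cases[of b] tv_cases[of c] by metis
  show "a + b + c = a + (b + c)" using xyz by (simp add: tv_class_add SS_closed add.assoc)
  show "a + b = b + a" using xyz by (simp add: tv_class_add add.commute)
  show "0 + a = a" using xyz by (simp add: zero_tv_def tv_class_add SS_closed(1))
  show "- a + a = 0" using xyz by (simp add: uminus_tv_def zero_tv_def tv_class_diff tv_class_add SS_closed)
  show "a - b = a + - b" using xyz by (simp add: uminus_tv_def zero_tv_def tv_class_diff tv_class_add SS_closed)
qed
end

lemma rep_tv_hom:
  fixes v w :: "('a::idom, 'b::{finite,linorder}) tv"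
  shows "rep_tv (v + w) = rep_tv v \<oplus>\<^bsub>tr_category_frac\<^esub> rep_tv w" "rep_tv (v - w) = rep_tv v \<ominus>\<^bsub>tr_category_frac\<^esub> rep_tv w"
  "rep_tv (0 :: ('a, 'b) tv) = \<zero>\<^bsub>tr_category_frac\<^esub>"
proof -
  obtain x y where xy: "x \<in> SS" "v = tv_class x" "y \<in> SS" "w = tv_class y" using tv_cases[of v] tv_cases[of w] by metis
  then show "rep_tv (v + w) = rep_tv v \<oplus>\<^bsub>tr_category_frac\<^esub> rep_tv w" "rep_tv (v - w) = rep_tv v \<ominus>\<^bsub>tr_category_frac\<^esub> rep_tv w"
    by (simp_all add: tv_class_add tv_class_diff rep_tv_tv_class SS_closed mrepD(7)[OF mrep_cat] mrep_minus[OF mrep_cat])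
  show "rep_tv (0 :: ('a, 'b) tv) = \<zero>\<^bsub>tr_category_frac\<^esub>"
    by (simp add: zero_tv_def rep_tv_tv_class SS_closed(1) mrepD(8)[OF mrep_cat])
qed

definition tv_scale :: "('a::idom, 'r::{finite,linorder}) frac \<Rightarrow> ('a, 'r) tv \<Rightarrow> ('a, 'r) tv" where
  "tv_scale c v = abs_tv (c \<odot>\<^bsub>tr_category_frac\<^esub> rep_tv v)"

lemma tv_scale_tv_class: "g \<in> SS \<Longrightarrow> tv_scale c (tv_class g) = tv_class (sS c g)"
  unfolding tv_scale_def by (simp add: rep_tv_tv_class mrepD(9)[OF mrep_cat]) (simp add: tv_class_def)

lemma rep_tv_tv_scale: "rep_tv (tv_scale c v) = c \<odot>\<^bsub>tr_category_frac\<^esub> rep_tv v"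
proof -
  obtain x where "x \<in> SS" "v = tv_class x" using tv_cases by metis
  then show ?thesis by (simp add: tv_scale_tv_class rep_tv_tv_class mscD(2)[OF msc_SS] mrepD(9)[OF mrep_cat])
qed

lemma tv_scale_props: "tv_scale c (v + w) = tv_scale c v + tv_scale c w" "tv_scale (c + d) v = tv_scale c v + tv_scale d v"
  "tv_scale c (tv_scale d v) = tv_scale (c * d) v" "tv_scale 1 v = v"
proof -
  obtain x y where xy: "x \<in> SS" "v = tv_class x" "y \<in> SS" "w = tv_class y" using tv_cases[of v] tv_cases[of w] by metis
  then show "tv_scale c (v + w) = tv_scale c v + tv_scale c w" "tv_scale (c + d) v = tv_scale c v + tv_scale d v"
    "tv_scale c (tv_scale d v) = tv_scale (c * d) v" "tv_scale 1 v = v"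
    by (simp_all add: tv_scale_tv_class tv_class_add SS_closed mscD(2-6)[OF msc_SS])
qed

lemma tv_scale_zero: "tv_scale c 0 = 0" "tv_scale 0 v = 0"
  using tv_scale_props(1)[of c 0 0] tv_scale_props(2)[of 0 0 v] by simp_all

lemma tv_scale_diff: "tv_scale c (v - w) = tv_scale c v - tv_scale c w" "tv_scale (c - d) v = tv_scale c v - tv_scale d v" "tv_scale (- c) v = - tv_scale c v"
proof -
  show "tv_scale c (v - w) = tv_scale c v - tv_scale c w" using tv_scale_props(1)[of c "v - w" w] by simp
  show d: "tv_scale (c - d) v = tv_scale c v - tv_scale d v" for c d using tv_scale_props(2)[of "c - d" d v] by simp
  show "tv_scale (- c) v = - tv_scale c v" using d[of 0 c] by (simp add: tv_scale_zero)
qed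

lemma tv_scale_sum: "tv_scale c (\<Sum>i\<in>I. f i) = (\<Sum>i\<in>I. tv_scale c (f i))"
  by (induction I rule: infinite_finite_induct) (simp_all add: tv_scale_zero tv_scale_props)

lemma tv_class_sum: "(\<And>i. i \<in> I \<Longrightarrow> h i \<in> SS) \<Longrightarrow> tv_class (\<Sum>i\<in>I. h i) = (\<Sum>i\<in>I. tv_class (h i))"
proof (induction I rule: infinite_finite_induct)
  case (insert i I)
  then have "(\<Sum>i\<in>I. h i) \<in> SS" by (intro subg_sum[OF mscD(1)[OF msc_SS]]) simp
  then have "tv_class (h i + sum h I) = tv_class (h i) + tv_class (sum h I)" using insert by (intro tv_class_add[symmetric]) simp_all
  also have "tv_class (sum h I) = (\<Sum>i\<in>I. tv_class (h i))" using insert by simp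
  finally show ?case unfolding sum.insert[OF insert.hyps] .
qed (simp_all add: zero_tv_def)

definition at_idx :: "nat \<Rightarrow> 'g::zero \<Rightarrow> nat \<Rightarrow> 'g" where
  "at_idx n f = (\<lambda>i. if i = n then f else 0)"

definition tv_pure :: "nat \<Rightarrow> ('a::idom, 'r::{finite,linorder}) frac \<Rightarrow> ('a, 'r) opr \<Rightarrow> ('a, 'r) tv" where
  "tv_pure n c u = abs_tv (at_degree n c (tr_op n u))"

lemma carrier_tr: "carrier (tr_R n) = tr_op n ` Rop n"
  by (rule mrepD(5)[OF mrep_tr])

lemma zero_Sf: "0 \<in> Sf n"
  by (simp add: Sf_def)

lemma at_idx_SS: "f \<in> Sf n \<Longrightarrow> at_idx n f \<in> SS"
  unfolding SS_def by (auto simp: at_idx_def zero_Sf intro: finite_subset[of _ "{n}"])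

lemma single_Sf: "u \<in> Rop n \<Longrightarrow> Poly_Mapping.single (tr_op n u) c \<in> Sf n"
  by (simp add: Sf_def carrier_tr)

lemma at_degree_PP: "at_degree n c t = PP (at_idx n (Poly_Mapping.single t c))"
  unfolding at_degree_def summand_def pure_tensor_def
  by (rule ext) (simp add: PP_def pf_def[symmetric] at_idx_def mrepD(8)[OF mrep_tr_frac])

lemma tv_pure_tv_class: "tv_pure n c u = tv_class (at_idx n (Poly_Mapping.single (tr_op n u) c))"
  by (simp add: tv_pure_def tv_class_def at_degree_PP)

lemma rep_tv_tv_pure: "u \<in> Rop n \<Longrightarrow> rep_tv (tv_pure n c u) = at_degree n c (tr_op n u)"
  by (simp add: tv_pure_tv_class rep_tv_tv_class at_idx_SS single_Sf at_degree_PP)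

lemma tv_class_eqI:
  assumes "g \<in> SS" "g' \<in> SS" "g - g' \<in> TT"
  shows "tv_class g = tv_class g'"
  unfolding tv_class_def using mrepD(6)[OF mrep_cat assms(1,2)] assms(3) by simp

lemma Tf_smf: "f \<in> Tf n \<Longrightarrow> smf c f \<in> Tf n"
  by (rule mrepD(4)[OF mrep_tr_frac])

lemma Tf_gen: "f \<in> tensor_relations to_fract (tr_R n) \<Longrightarrow> smf c f \<in> Tf n"
  using lin_span_gen[OF mrepD(1)[OF mrep_tr_frac] tensor_relations_Sf] Tf_smf unfolding Tf_def by blast

lemma at_idx_TT:
  fixes f :: "('a::idom, 'b::{finite,linorder}) tr_frac"
  assumes "f \<in> Tf n"
  shows "at_idx n f \<in> TT"
proof -
  have "0 \<in> (Tf m :: ('a, 'b) tr_frac set)" for m unfolding Tf_def by (rule lin_span.zero)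
  then show ?thesis using assms unfolding TT_def by (auto simp: at_idx_def intro: finite_subset[of _ "{n}"])
qed

lemma at_idx_hom: "at_idx n f + at_idx n g = at_idx n (f + g)" "at_idx n f - at_idx n g = at_idx n (f - g :: 'g::ab_group_add)"
  by (auto simp: at_idx_def fun_eq_iff)

lemma smf_single: "smf c (Poly_Mapping.single t d) = Poly_Mapping.single t (c * d)"
  by (rule poly_mapping_eqI) (simp add: lookup_map_times lookup_single when_def)

lemma smf_diff: "smf c (f - g) = smf c f - smf c (g :: 'm \<Rightarrow>\<^sub>0 'l::comm_ring_1)"
  by (rule poly_mapping_eqI) (simp add: lookup_map_times lookup_minus right_diff_distrib)

lemma smf_add: "smf c (f + g) = smf c f + smf c (g :: 'm \<Rightarrow>\<^sub>0 'l::comm_ring_1)"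
  by (rule poly_mapping_eqI) (simp add: lookup_map_times lookup_add distrib_left)

lemma smf_zero: "smf c (0 :: 'm \<Rightarrow>\<^sub>0 'l::comm_ring_1) = 0"
  by (rule poly_mapping_eqI) (simp add: lookup_map_times)

lemma tv_pure_add:
  fixes u v :: "('a::idom, 'r::{finite,linorder}) opr"
  assumes "u \<in> Rop n" "v \<in> Rop n"
  shows "tv_pure n c (u + v) = tv_pure n c u + tv_pure n c v"
proof -
  let ?s = "\<lambda>u d. Poly_Mapping.single (tr_op n u) (d :: ('a, 'r) frac)"
  have "tr_op n (u + v) = tr_op n u \<oplus>\<^bsub>tr_R n\<^esub> tr_op n v" using mrepD(7)[OF mrep_tr assms] by simp
  then have "?s (u + v) 1 - ?s u 1 - ?s v 1 \<in> tensor_relations to_fract (tr_R n)"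
    unfolding tensor_relations_def using assms by (auto simp: carrier_tr)
  from Tf_gen[OF this, of c] have "?s (u + v) c - (?s u c + ?s v c) \<in> Tf n"
    by (simp add: smf_diff smf_add smf_single diff_diff_eq)
  from at_idx_TT[OF this] have "at_idx n (?s (u + v) c) - (at_idx n (?s u c) + at_idx n (?s v c)) \<in> TT" by (simp add: at_idx_hom)
  then have "tv_class (at_idx n (?s (u + v) c)) = tv_class (at_idx n (?s u c) + at_idx n (?s v c))"
    by (rule tv_class_eqI[rotated 2]) (use assms in \<open>auto intro!: SS_closed(4) at_idx_SS single_Sf Rop_closed(6)\<close>)
  then show ?thesis using assms by (simp add: tv_pure_tv_class tv_class_add at_idx_SS single_Sf)
qed

lemma tv_pure_base_scale:
  fixes u :: "('a::idom, 'r::{finite,linorder}) opr"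
  assumes "u \<in> Rop n"
  shows "tv_pure n c (base_scale b u) = tv_pure n (c * to_fract b) u"
proof -
  let ?s = "\<lambda>u d. Poly_Mapping.single (tr_op n u) (d :: ('a, 'r) frac)"
  have "tr_op n (base_scale b u) = b \<odot>\<^bsub>tr_R n\<^esub> tr_op n u" using mrepD(9)[OF mrep_tr assms] by simp
  then have "?s (base_scale b u) 1 - ?s u (to_fract b) \<in> tensor_relations to_fract (tr_R n)"
    unfolding tensor_relations_def
    by (intro UnI2 CollectI exI[of _ b] exI[of _ "tr_op n u"]) (use assms in \<open>simp add: carrier_tr\<close>)
  from Tf_gen[OF this, of c] have "?s (base_scale b u) c - ?s u (c * to_fract b) \<in> Tf n"
    by (simp add: smf_diff smf_single)
  from at_idx_TT[OF this] have "at_idx n (?s (base_scale b u) c) - at_idx n (?s u (c * to_fract b)) \<in> TT" by (simp add: at_idx_hom)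
  then have "tv_class (at_idx n (?s (base_scale b u) c)) = tv_class (at_idx n (?s u (c * to_fract b)))"
    by (rule tv_class_eqI[rotated 2]) (use assms in \<open>auto intro!: at_idx_SS single_Sf base_scale_Rop\<close>)
  then show ?thesis by (simp add: tv_pure_tv_class)
qed

lemma tv_pure_diff:
  fixes u v :: "('a::idom, 'r::{finite,linorder}) opr"
  shows "u \<in> Rop n \<Longrightarrow> v \<in> Rop n \<Longrightarrow> tv_pure n c (u - v) = tv_pure n c u - tv_pure n c v"
  using tv_pure_add[of "u - v" n v c] by simp

lemma tv_pure_Comm:
  fixes u :: "('a::idom, 'r::{finite,linorder}) opr"
  assumes "u \<in> Comm (Rop n)"
  shows "tv_pure n c u = 0"
proof -
  have "tr_op n u = tr_op n 0" using assms Comm_sub[OF subring_set_Rop assms] by (simp add: tr_op_eq_iff)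
  then have "tv_pure n c u = tv_pure n c 0" by (simp add: tv_pure_def)
  also have "tv_pure n c 0 = 0" using tv_pure_diff[of 0 n 0 c] by simp
  finally show ?thesis .
qed

lemma tv_pure_cong:
  fixes u v :: "('a::idom, 'r::{finite,linorder}) opr"
  assumes "u \<in> Rop n" "v \<in> Rop n" "u - v \<in> Comm (Rop n)"
  shows "tv_pure n c u = tv_pure n c v"
  using tv_pure_Comm[OF assms(3), of c] tv_pure_diff[OF assms(1,2), of c] by simp

lemma tv_pure_sum:
  fixes f :: "'i \<Rightarrow> ('a::idom, 'r::{finite,linorder}) opr"
  assumes "\<And>i. i \<in> I \<Longrightarrow> f i \<in> Rop n"
  shows "tv_pure n c (\<Sum>i\<in>I. f i) = (\<Sum>i\<in>I. tv_pure n c (f i))"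
  using assms
proof (induction I rule: infinite_finite_induct)
  case (insert i I)
  then show ?case by (simp add: tv_pure_add Rop_closed(7))
qed (simp_all add: tv_pure_Comm Comm.zero)

lemma tv_scale_tv_pure: "u \<in> Rop n \<Longrightarrow> tv_scale c (tv_pure n d u) = tv_pure n (c * d) u"
proof -
  assume u: "u \<in> Rop n"
  have "sS c (at_idx n (Poly_Mapping.single (tr_op n u) d)) = at_idx n (Poly_Mapping.single (tr_op n u) (c * d))"
    by (rule ext) (simp add: sS_def at_idx_def smf_single smf_zero)
  then show ?thesis using u by (simp add: tv_pure_tv_class tv_scale_tv_class at_idx_SS single_Sf)
qed

lemma tv_class_expand:
  fixes g :: "nat \<Rightarrow> ('a::idom, 'b::{finite,linorder}) tr_frac"
  assumes g: "g \<in> SS"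
  shows "tv_class g = (\<Sum>n | g n \<noteq> 0. \<Sum>t\<in>Poly_Mapping.keys (g n). tv_class (at_idx n (Poly_Mapping.single t (Poly_Mapping.lookup (g n) t))))"
proof -
  have fin: "finite {n. g n \<noteq> 0}" and Sf: "g n \<in> Sf n" for n using g by (auto simp: SS_def)
  let ?h = "\<lambda>n t. at_idx n (Poly_Mapping.single t (Poly_Mapping.lookup (g n) t))"
  have h: "?h n t \<in> SS" if "t \<in> Poly_Mapping.keys (g n)" for n t
    using Sf[of n] that by (intro at_idx_SS) (auto simp: Sf_def)
  have "(\<Sum>t\<in>A. at_idx n (f t)) = at_idx n (\<Sum>t\<in>A. f t)" for n A and f :: "('a, 'b) nc_poly set set set \<Rightarrow> ('a, 'b) tr_frac"
    by (induction A rule: infinite_finite_induct) (auto simp: at_idx_def fun_eq_iff)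
  then have "(\<Sum>t\<in>Poly_Mapping.keys (g n). ?h n t) = at_idx n (g n)" for n
    by (simp only: poly_mapping_sum_single[of "g n", symmetric])
  moreover have "g = (\<Sum>n | g n \<noteq> 0. at_idx n (g n))"
  proof (rule ext)
    fix m
    have "(\<Sum>n\<in>A. at_idx n (g n)) m = (\<Sum>n\<in>A. at_idx n (g n) m)" for A
      by (induction A rule: infinite_finite_induct) simp_all
    then have "(\<Sum>n | g n \<noteq> 0. at_idx n (g n)) m = (\<Sum>n | g n \<noteq> 0. at_idx n (g n) m)" .
    also have "\<dots> = g m" using fin by (auto simp: at_idx_def)
    finally show "g m = (\<Sum>n | g n \<noteq> 0. at_idx n (g n)) m" by simp
  qed
  ultimately have "g = (\<Sum>n | g n \<noteq> 0. \<Sum>t\<in>Poly_Mapping.keys (g n). ?h n t)" by simp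
  moreover have "(\<Sum>t\<in>Poly_Mapping.keys (g n). ?h n t) \<in> SS" for n
    by (intro subg_sum[OF mscD(1)[OF msc_SS]] h)
  ultimately have "tv_class g = (\<Sum>n | g n \<noteq> 0. tv_class (\<Sum>t\<in>Poly_Mapping.keys (g n). ?h n t))"
    using tv_class_sum[of "{n. g n \<noteq> 0}" "\<lambda>n. \<Sum>t\<in>Poly_Mapping.keys (g n). ?h n t"] by simp
  then show ?thesis using h by (simp add: tv_class_sum)
qed

text \<open>Pure tensors generate the group: a class is the finite sum of its entries in each
  degree, and each entry is supported on classes of operators. Relations between operators need to
  be checked on these generators only.\<close>

lemma endo_tv_pure_eqI:
  fixes F G :: "('a::idom, 'r::{finite,linorder}) tv endo"
  assumes "\<And>n c u. u \<in> Rop n \<Longrightarrow> app F (tv_pure n c u) = app G (tv_pure n c u)"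
  shows "F = G"
proof (rule endo_eqI)
  fix v :: "('a, 'r) tv"
  obtain g where g: "g \<in> SS" "v = tv_class g" by (rule tv_cases)
  have "app F (tv_class (at_idx n (Poly_Mapping.single t c))) = app G (tv_class (at_idx n (Poly_Mapping.single t c)))"
    if "t \<in> Poly_Mapping.keys (g n)" for n t c
  proof -
    have "t \<in> carrier (tr_R n)" using g that by (auto simp: SS_def Sf_def)
    then obtain u where "u \<in> Rop n" "t = tr_op n u" unfolding carrier_tr by blast
    then show ?thesis using assms[of u n c] by (simp add: tv_pure_tv_class)
  qed
  then show "app F v = app G v" unfolding g(2) tv_class_expand[OF g(1)] by (simp add: app_sum)
qed


section \<open>Linear extension from the traces\<close>

definition lin_ext :: "('m \<Rightarrow> ('a::idom, 'r::{finite,linorder}) tv) \<Rightarrow> ('m \<Rightarrow>\<^sub>0 ('a, 'r) frac) \<Rightarrow> ('a, 'r) tv" where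
  "lin_ext \<psi> f = (\<Sum>t\<in>Poly_Mapping.keys f. tv_scale (Poly_Mapping.lookup f t) (\<psi> t))"

lemma lin_ext_superset:
  assumes "finite A" "Poly_Mapping.keys f \<subseteq> A"
  shows "lin_ext \<psi> f = (\<Sum>t\<in>A. tv_scale (Poly_Mapping.lookup f t) (\<psi> t))"
  unfolding lin_ext_def using assms by (intro sum.mono_neutral_left) (auto simp: in_keys_iff tv_scale_zero)

lemma lin_ext_hom:
  shows lin_ext_add: "lin_ext \<psi> (f + g) = lin_ext \<psi> f + lin_ext \<psi> g" and lin_ext_diff: "lin_ext \<psi> (f - g) = lin_ext \<psi> f - lin_ext \<psi> g"
    and lin_ext_smf: "lin_ext \<psi> (smf c f) = tv_scale c (lin_ext \<psi> f)" and lin_ext_single: "lin_ext \<psi> (Poly_Mapping.single t c) = tv_scale c (\<psi> t)"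
    and lin_ext_zero: "lin_ext \<psi> 0 = 0"
proof -
  let ?A = "Poly_Mapping.keys f \<union> Poly_Mapping.keys g"
  have A: "finite ?A" "Poly_Mapping.keys f \<subseteq> ?A" "Poly_Mapping.keys g \<subseteq> ?A" by auto
  show "lin_ext \<psi> (f + g) = lin_ext \<psi> f + lin_ext \<psi> g"
    unfolding lin_ext_superset[OF A(1) keys_add] lin_ext_superset[OF A(1,2)] lin_ext_superset[OF A(1,3)]
    by (simp add: lookup_add tv_scale_props sum.distrib)
  show "lin_ext \<psi> (f - g) = lin_ext \<psi> f - lin_ext \<psi> g"
    unfolding lin_ext_superset[OF A(1) keys_diff] lin_ext_superset[OF A(1,2)] lin_ext_superset[OF A(1,3)]
    by (simp add: lookup_minus tv_scale_diff sum_subtractf)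
  have "Poly_Mapping.keys (smf c f) \<subseteq> Poly_Mapping.keys f"
    by (auto simp: in_keys_iff lookup_map_times)
  from lin_ext_superset[OF _ this] show "lin_ext \<psi> (smf c f) = tv_scale c (lin_ext \<psi> f)"
    by (simp add: lin_ext_def lookup_map_times tv_scale_sum tv_scale_props)
  show "lin_ext \<psi> (Poly_Mapping.single t c) = tv_scale c (\<psi> t)"
    using lin_ext_superset[of "{t}" "Poly_Mapping.single t c" \<psi>] by simp
  show "lin_ext \<psi> 0 = 0" by (simp add: lin_ext_def)
qed

text \<open>One universal property for three constructions: vanishing on \<open>Comm\<close> takes
  care of the trace, additivity and compatibility with \<open>base_scale\<close> kill the tensor
  relations, and the degrees are independent in the direct sum.\<close>

theorem tv_pure_extension:
  fixes \<phi> :: "nat \<Rightarrow> ('a::idom, 'r::{finite,linorder}) opr \<Rightarrow> ('a, 'r) tv"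
  assumes add: "\<And>n u v. u \<in> Rop n \<Longrightarrow> v \<in> Rop n \<Longrightarrow> \<phi> n (u + v) = \<phi> n u + \<phi> n v"
    and base_scale: "\<And>n u b. u \<in> Rop n \<Longrightarrow> \<phi> n (base_scale b u) = tv_scale (to_fract b) (\<phi> n u)"
    and Comm: "\<And>n u. u \<in> Comm (Rop n) \<Longrightarrow> \<phi> n u = 0"
  obtains F :: "('a, 'r) tv endo" where "\<And>n c u. u \<in> Rop n \<Longrightarrow> app F (tv_pure n c u) = tv_scale c (\<phi> n u)"
proof -
  define \<psi> where "\<psi> n t = \<phi> n (SOME u. u \<in> Rop n \<and> tr_op n u = t)" for n t
  have \<psi>: "\<psi> n (tr_op n u) = \<phi> n u" if u: "u \<in> Rop n" for n u
  proof -
    let ?v = "SOME v. v \<in> Rop n \<and> tr_op n v = tr_op n u"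
    have v: "?v \<in> Rop n \<and> tr_op n ?v = tr_op n u" by (rule someI[of _ u]) (simp add: u)
    then have "?v - u \<in> Comm (Rop n)" using tr_op_eq_iff u by blast
    then have "\<phi> n (?v - u) = 0" by (rule Comm)
    moreover have "\<phi> n ?v = \<phi> n (?v - u) + \<phi> n u" using add[of "?v - u" n u] u v by simp
    ultimately show ?thesis by (simp add: \<psi>_def)
  qed
  have rel: "lin_ext (\<psi> n) f = 0" if f: "f \<in> tensor_relations to_fract (tr_R n)" for n f
  proof -
    consider m m' where "m \<in> carrier (tr_R n)" "m' \<in> carrier (tr_R n)"
        "f = Poly_Mapping.single (m \<oplus>\<^bsub>tr_R n\<^esub> m') 1 - Poly_Mapping.single m 1 - Poly_Mapping.single m' 1"
      | a m where "m \<in> carrier (tr_R n)" "f = Poly_Mapping.single (a \<odot>\<^bsub>tr_R n\<^esub> m) 1 - Poly_Mapping.single m (to_fract a)"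
      using f unfolding tensor_relations_def by blast
    then show ?thesis
    proof cases
      case 1
      then obtain u v where uv: "u \<in> Rop n" "m = tr_op n u" "v \<in> Rop n" "m' = tr_op n v" unfolding carrier_tr by blast
      then have "m \<oplus>\<^bsub>tr_R n\<^esub> m' = tr_op n (u + v)" using mrepD(7)[OF mrep_tr] by simp
      then show ?thesis using 1 uv by (simp add: lin_ext_diff lin_ext_single tv_scale_props \<psi> add)
    next
      case 2
      then obtain u where u: "u \<in> Rop n" "m = tr_op n u" unfolding carrier_tr by blast
      then have "a \<odot>\<^bsub>tr_R n\<^esub> m = tr_op n (base_scale a u)" using mrepD(9)[OF mrep_tr] by simp
      then show ?thesis using 2 u by (simp add: lin_ext_diff lin_ext_single tv_scale_props \<psi> base_scale base_scale_Rop)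
    qed
  qed
  have Tf: "lin_ext (\<psi> n) f = 0" if "f \<in> Tf n" for n f
    using that unfolding Tf_def
    by (induction rule: lin_span.induct) (simp_all add: lin_ext_zero lin_ext_add lin_ext_smf rel tv_scale_zero)
  define L where "L g = (\<Sum>n | g n \<noteq> 0. lin_ext (\<psi> n) (g n))" for g
  have L_sup: "L g = (\<Sum>n\<in>A. lin_ext (\<psi> n) (g n))" if "finite A" "{n. g n \<noteq> 0} \<subseteq> A" for g A
    unfolding L_def using that by (intro sum.mono_neutral_left) (auto simp: lin_ext_zero)
  have L_hom: "L (g + g') = L g + L g'" "L (g - g') = L g - L g'" if "g \<in> SS" "g' \<in> SS" for g g'
  proof -
    let ?A = "{n. g n \<noteq> 0} \<union> {n. g' n \<noteq> 0}"
    have A: "finite ?A" using that by (simp add: SS_def)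
    show "L (g + g') = L g + L g'"
      by (subst (1 2 3) L_sup[OF A]) (auto simp: lin_ext_add sum.distrib)
    show "L (g - g') = L g - L g'"
      by (subst (1 2 3) L_sup[OF A]) (auto simp: lin_ext_diff sum_subtractf)
  qed
  have L_TT: "L g = 0" if "g \<in> TT" for g using that unfolding L_def TT_def by (simp add: Tf)
  define F where "F v = L (SOME g. g \<in> SS \<and> tv_class g = v)" for v
  \<comment> \<open>Two representatives of one class differ by an element of \<open>TT\<close>, on
    which the extension vanishes, so the choice made in \<open>F\<close> does not matter.\<close>
  have F: "F (tv_class g) = L g" if g: "g \<in> SS" for g
  proof -
    let ?h = "SOME h. h \<in> SS \<and> tv_class h = tv_class g"
    have h: "?h \<in> SS \<and> tv_class ?h = tv_class g" by (rule someI[of _ g]) (simp add: g)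
    have "PP ?h = rep_tv (tv_class ?h)" by (rule rep_tv_tv_class[symmetric]) (use h in blast)
    also have "rep_tv (tv_class ?h) = rep_tv (tv_class g)" by (rule arg_cong[OF conjunct2[OF h]])
    also have "\<dots> = PP g" by (rule rep_tv_tv_class[OF g])
    finally have "?h - g \<in> TT" using mrepD(6)[OF mrep_cat _ g] h by blast
    then have "L (?h - g) = 0" by (rule L_TT)
    then show ?thesis using L_hom(2)[of ?h g] h g by (simp add: F_def)
  qed
  have "F (v + w) = F v + F w" for v w
  proof -
    obtain x y where xy: "x \<in> SS" "v = tv_class x" "y \<in> SS" "w = tv_class y" using tv_cases[of v] tv_cases[of w] by metis
    then show ?thesis by (simp add: tv_class_add F SS_closed L_hom)
  qed
  then have appF: "app (Endo F) = F" by (intro Endo_inverse) simp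
  have "F (tv_pure n c u) = tv_scale c (\<phi> n u)" if u: "u \<in> Rop n" for n c u
  proof -
    have "F (tv_pure n c u) = L (at_idx n (Poly_Mapping.single (tr_op n u) c))"
      unfolding tv_pure_tv_class by (intro F at_idx_SS single_Sf u)
    also have "\<dots> = (\<Sum>m\<in>{n}. lin_ext (\<psi> m) (at_idx n (Poly_Mapping.single (tr_op n u) c) m))"
      by (rule L_sup) (auto simp: at_idx_def)
    finally show ?thesis using u by (simp add: at_idx_def lin_ext_single \<psi>)
  qed
  then show ?thesis using that[of "Endo F"] by (simp add: appF)
qed

section \<open>Operators on the sum of the traces\<close>

definition scale_endo :: "('a::idom, 'r::{finite,linorder}) frac \<Rightarrow> ('a, 'r) tv endo" where
  "scale_endo c = Endo (tv_scale c)"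

lemma app_scale_endo: "app (scale_endo c) v = tv_scale c v"
  unfolding scale_endo_def by (subst Endo_inverse) (simp_all add: tv_scale_props)

lemma scale_endo_hom: "scale_endo (c + d) = scale_endo c + scale_endo d" "scale_endo c * scale_endo d = scale_endo (c * d)" "scale_endo 1 * F = F" "scale_endo (- c) = - scale_endo c" "scale_endo 0 = 0"
  by (rule endo_eqI; simp add: app_scale_endo tv_scale_props tv_scale_diff tv_scale_zero)+

lemma top_mult_Rop: "u \<in> Rop n \<Longrightarrow> u * x_op (Suc n) ^ k \<in> Rop (Suc n)"
  by (intro Rop_closed(4) x_op_pow_Rop Rop_Suc)

lemma psum_mult_Rop: "u \<in> Rop n \<Longrightarrow> u * psum n l \<in> Rop n"
  by (intro Rop_closed(4) psum_Rop)

text \<open>Specified by its values on pure tensors. These generate, so at most one operator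
  qualifies; existence is established in \<open>app_pos_endo\<close> through the universal property.
  The same pattern is used for the other two families.\<close>

definition pos_endo :: "nat \<Rightarrow> ('a::idom, 'r::{finite,linorder}) tv endo" where
  "pos_endo k = (SOME F. \<forall>n c u. u \<in> Rop n \<longrightarrow> app F (tv_pure n c u) = tv_pure (Suc n) c (u * x_op (Suc n) ^ k))"

definition neg_endo :: "nat \<Rightarrow> ('a::idom, 'r::{finite,linorder}) tv endo" where
  "neg_endo k = (SOME F. (\<forall>c u. u \<in> Rop 0 \<longrightarrow> app F (tv_pure 0 c u) = 0)
     \<and> (\<forall>n c u. u \<in> Rop (Suc n) \<longrightarrow> app F (tv_pure (Suc n) c u) = tv_pure n c (x_plus_op n k u)))"

definition cartan_endo :: "nat \<Rightarrow> ('a::idom, 'r::{finite,linorder}) tv endo" where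
  "cartan_endo l = (SOME F. \<forall>n c u. u \<in> Rop n \<longrightarrow> app F (tv_pure n c u) = tv_pure n (hf * c) (u * psum n l))"

lemma base_scale_mult: "base_scale b u * v = base_scale b (u * v)"
  by (simp add: base_scale_def mult.assoc)

lemma app_pos_endo:
  fixes u :: "('a::idom, 'r::{finite,linorder}) opr"
  assumes "u \<in> Rop n"
  shows "app (pos_endo k) (tv_pure n c u) = tv_pure (Suc n) c (u * x_op (Suc n) ^ k)"
proof -
  obtain F :: "('a, 'r) tv endo" where F: "\<And>n c u. u \<in> Rop n \<Longrightarrow> app F (tv_pure n c u) = tv_scale c (tv_pure (Suc n) 1 (u * x_op (Suc n) ^ k))"
  proof (rule tv_pure_extension[where \<phi> = "\<lambda>n u. tv_pure (Suc n) 1 (u * x_op (Suc n) ^ k)"])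
    fix n :: nat and u v :: "('a, 'r) opr" assume "u \<in> Rop n" "v \<in> Rop n"
    then show "tv_pure (Suc n) 1 ((u + v) * x_op (Suc n) ^ k) = tv_pure (Suc n) 1 (u * x_op (Suc n) ^ k) + tv_pure (Suc n) 1 (v * x_op (Suc n) ^ k)"
      by (simp only: distrib_right tv_pure_add top_mult_Rop)
  next
    fix n :: nat and u :: "('a, 'r) opr" and b assume "u \<in> Rop n"
    then show "tv_pure (Suc n) 1 (base_scale b u * x_op (Suc n) ^ k) = tv_scale (to_fract b) (tv_pure (Suc n) 1 (u * x_op (Suc n) ^ k))"
      by (simp only: base_scale_mult tv_pure_base_scale top_mult_Rop tv_scale_tv_pure mult_1_left mult_1_right)
  qed (auto intro: tv_pure_Comm Comm_Suc_mult)
  let ?P = "\<lambda>F :: ('a, 'r) tv endo. \<forall>n c u. u \<in> Rop n \<longrightarrow> app F (tv_pure n c u) = tv_pure (Suc n) c (u * x_op (Suc n) ^ k)"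
  have "?P F" using F by (simp add: tv_scale_tv_pure top_mult_Rop)
  then have "?P (SOME F. ?P F)" by (rule someI[of ?P])
  then show ?thesis using assms unfolding pos_endo_def by blast
qed

lemma app_cartan_endo:
  fixes u :: "('a::idom, 'r::{finite,linorder}) opr"
  assumes "u \<in> Rop n"
  shows "app (cartan_endo l) (tv_pure n c u) = tv_pure n (hf * c) (u * psum n l)"
proof -
  obtain F :: "('a, 'r) tv endo" where F: "\<And>n c u. u \<in> Rop n \<Longrightarrow> app F (tv_pure n c u) = tv_scale c (tv_pure n hf (u * psum n l))"
  proof (rule tv_pure_extension[where \<phi> = "\<lambda>n u. tv_pure n hf (u * psum n l)"])
    fix n :: nat and u v :: "('a, 'r) opr" assume "u \<in> Rop n" "v \<in> Rop n"
    then show "tv_pure n hf ((u + v) * psum n l) = tv_pure n hf (u * psum n l) + tv_pure n hf (v * psum n l)"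
      by (simp only: distrib_right tv_pure_add psum_mult_Rop)
  next
    fix n :: nat and u :: "('a, 'r) opr" and b assume "u \<in> Rop n"
    then show "tv_pure n hf (base_scale b u * psum n l) = tv_scale (to_fract b) (tv_pure n hf (u * psum n l))"
      by (simp only: base_scale_mult tv_pure_base_scale psum_mult_Rop tv_scale_tv_pure mult.commute)
  next
    fix n :: nat and u :: "('a, 'r) opr" assume "u \<in> Comm (Rop n)"
    then have "u * psum n l \<in> Comm (Rop n)"
      by (rule Comm_mult_central[OF _ psum_Rop subring_set_Rop]) (rule psum_central[symmetric])
    then show "tv_pure n hf (u * psum n l) = 0" by (rule tv_pure_Comm)
  qed blast
  let ?P = "\<lambda>F :: ('a, 'r) tv endo. \<forall>n c u. u \<in> Rop n \<longrightarrow> app F (tv_pure n c u) = tv_pure n (hf * c) (u * psum n l)"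
  have "?P F" using F by (simp add: tv_scale_tv_pure psum_mult_Rop mult.commute)
  then have "?P (SOME F. ?P F)" by (rule someI[of ?P])
  then show ?thesis using assms unfolding cartan_endo_def by blast
qed

lemma app_neg_endo:
  shows "u \<in> Rop 0 \<Longrightarrow> app (neg_endo k) (tv_pure 0 c u) = (0 :: ('a::idom, 'r::{finite,linorder}) tv)"
    and "v \<in> Rop (Suc n) \<Longrightarrow> app (neg_endo k) (tv_pure (Suc n) c v) = (tv_pure n c (x_plus_op n k v) :: ('a, 'r) tv)"
proof -
  let ?\<phi> = "\<lambda>n u. case n of 0 \<Rightarrow> 0 | Suc m \<Rightarrow> tv_pure m 1 (x_plus_op m k (u :: ('a, 'r) opr))"
  obtain F :: "('a, 'r) tv endo" where F: "\<And>n c u. u \<in> Rop n \<Longrightarrow> app F (tv_pure n c u) = tv_scale c (?\<phi> n u)"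
  proof (rule tv_pure_extension[where \<phi> = ?\<phi>])
    fix n :: nat and u v :: "('a, 'r) opr" assume "u \<in> Rop n" "v \<in> Rop n"
    then show "?\<phi> n (u + v) = ?\<phi> n u + ?\<phi> n v"
      by (cases n) (simp_all add: x_plus_op_add tv_pure_add x_plus_op_Rop)
  next
    fix n :: nat and u :: "('a, 'r) opr" and b assume u: "u \<in> Rop n"
    show "?\<phi> n (base_scale b u) = tv_scale (to_fract b) (?\<phi> n u)"
    proof (cases n)
      case (Suc m)
      have "x_plus_op m k (base_scale b u) = base_scale b (x_plus_op m k u)" using u Suc unfolding base_scale_def by (intro x_plus_op_scale) simp
      then show ?thesis using Suc u by (simp add: tv_pure_base_scale x_plus_op_Rop tv_scale_tv_pure)
    qed (simp add: tv_scale_zero)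
  next
    fix n :: nat and u :: "('a, 'r) opr" assume "u \<in> Comm (Rop n)"
    then show "?\<phi> n u = 0" by (cases n) (simp_all add: tv_pure_Comm x_plus_op_Comm)
  qed blast
  let ?P = "\<lambda>F :: ('a, 'r) tv endo. (\<forall>c u. u \<in> Rop 0 \<longrightarrow> app F (tv_pure 0 c u) = (0 :: ('a, 'r) tv))
     \<and> (\<forall>n c u. u \<in> Rop (Suc n) \<longrightarrow> app F (tv_pure (Suc n) c u) = tv_pure n c (x_plus_op n k u))"
  have "?P F" using F[where n = 0] F[where n = "Suc _"] by (simp add: tv_scale_tv_pure x_plus_op_Rop tv_scale_zero)
  then have "?P (SOME F. ?P F)" by (rule someI[of ?P])
  then show "u \<in> Rop 0 \<Longrightarrow> app (neg_endo k) (tv_pure 0 c u) = (0 :: ('a::idom, 'r::{finite,linorder}) tv)"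
    and "v \<in> Rop (Suc n) \<Longrightarrow> app (neg_endo k) (tv_pure (Suc n) c v) = (tv_pure n c (x_plus_op n k v) :: ('a, 'r) tv)"
    unfolding neg_endo_def by blast+
qed

lemma app_scale_endo_tv_pure: "u \<in> Rop n \<Longrightarrow> app (scale_endo c) (tv_pure n d u) = tv_pure n (c * d) u"
  by (simp add: app_scale_endo tv_scale_tv_pure)

lemma scale_endo_commute:
  "scale_endo c * pos_endo k = pos_endo k * (scale_endo c :: ('a::idom, 'r::{finite,linorder}) tv endo)"
  "scale_endo c * cartan_endo l = cartan_endo l * (scale_endo c :: ('a, 'r) tv endo)"
  "scale_endo c * neg_endo k = neg_endo k * (scale_endo c :: ('a, 'r) tv endo)"
proof -
  show "scale_endo c * pos_endo k = pos_endo k * (scale_endo c :: ('a, 'r) tv endo)"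
    by (rule endo_tv_pure_eqI) (simp add: app_pos_endo app_scale_endo_tv_pure top_mult_Rop)
  show "scale_endo c * cartan_endo l = cartan_endo l * (scale_endo c :: ('a, 'r) tv endo)"
    by (rule endo_tv_pure_eqI) (simp add: app_cartan_endo app_scale_endo_tv_pure psum_mult_Rop mult.left_commute)
  show "scale_endo c * neg_endo k = neg_endo k * (scale_endo c :: ('a, 'r) tv endo)"
  proof (rule endo_tv_pure_eqI)
    fix n d and u :: "('a, 'r) opr" assume "u \<in> Rop n"
    then show "app (scale_endo c * neg_endo k) (tv_pure n d u) = app (neg_endo k * scale_endo c) (tv_pure n d u)"
      by (cases n) (simp_all add: app_neg_endo app_scale_endo_tv_pure x_plus_op_Rop app_scale_endo tv_scale_zero tv_scale_tv_pure)
  qed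
qed


section \<open>The relations on pure tensors\<close>

lemma cartan_endo_cartan_endo: "cartan_endo l * cartan_endo k = cartan_endo k * (cartan_endo l :: ('a::idom, 'r::{finite,linorder}) tv endo)"
proof (rule endo_tv_pure_eqI)
  fix n c and u :: "('a, 'r) opr" assume u: "u \<in> Rop n"
  have "u * psum n k * psum n l = u * psum n l * psum n k"
    using psum_central[OF psum_Rop, of n l k, where 'a = 'a and 'r = 'r] by (simp add: mult.assoc)
  then show "app (cartan_endo l * cartan_endo k) (tv_pure n c u) = app (cartan_endo k * cartan_endo l) (tv_pure n c u)"
    using u by (simp add: app_cartan_endo psum_mult_Rop)
qed

lemma cartan_endo_pos_endo: "cartan_endo l * pos_endo k - pos_endo k * cartan_endo l = scale_endo hf * (pos_endo (l + k) :: ('a::idom, 'r::{finite,linorder}) tv endo)"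
proof (rule endo_tv_pure_eqI)
  fix n c and u :: "('a, 'r) opr" assume u: "u \<in> Rop n"
  have "x_op (Suc n) ^ k * psum n l = psum n l * (x_op (Suc n) :: ('a, 'r) opr) ^ k"
    by (rule x_op_power_comm[of n]) (simp_all add: psum_Rop)
  then have "u * x_op (Suc n) ^ k * psum (Suc n) l = u * psum n l * x_op (Suc n) ^ k + u * x_op (Suc n) ^ (l + k)"
    by (simp add: psum_Suc distrib_left mult.assoc add.commute flip: power_add)
  then show "app (cartan_endo l * pos_endo k - pos_endo k * cartan_endo l) (tv_pure n c u) = app (scale_endo hf * pos_endo (l + k)) (tv_pure n c u)"
    using u by (simp add: app_cartan_endo app_pos_endo top_mult_Rop psum_mult_Rop tv_pure_add app_scale_endo_tv_pure)
qed

lemma cartan_endo_neg_endo: "cartan_endo l * neg_endo k - neg_endo k * cartan_endo l = scale_endo (- hf) * (neg_endo (l + k) :: ('a::idom, 'r::{finite,linorder}) tv endo)"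
proof (rule endo_tv_pure_eqI)
  fix n c and u :: "('a, 'r) opr" assume u: "u \<in> Rop n"
  show "app (cartan_endo l * neg_endo k - neg_endo k * cartan_endo l) (tv_pure n c u) = app (scale_endo (- hf) * neg_endo (l + k)) (tv_pure n c u)"
  proof (cases n)
    case 0
    then show ?thesis using u by (simp add: app_neg_endo app_cartan_endo psum_mult_Rop app_scale_endo tv_scale_zero)
  next
    case (Suc m)
    then show ?thesis
      using u by (simp add: app_neg_endo app_cartan_endo psum_mult_Rop x_plus_op_psum x_plus_op_Rop tv_pure_add app_scale_endo tv_scale_diff tv_scale_tv_pure)
  qed
qed

text \<open>The coefficients 3 and \<open>\<hbar>^2\<close> are elements of the operator ring here;
  they are first recognized as images of the base ring, so that they can leave the pure tensor as
  scalars.\<close>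

lemma tv_pure_cubic:
  fixes A B C :: "('a::idom, 'r::{finite,linorder}) opr"
  assumes "A \<in> Rop n" "B \<in> Rop n" "C \<in> Rop n" "3 * A - B + Sc hf ^ 2 * C \<in> Comm (Rop n)"
  shows "tv_scale 3 (tv_pure n c A) - tv_pure n c B + tv_scale (hf ^ 2) (tv_pure n c C) = 0"
proof -
  have "to_fract 3 = (3 :: ('a, 'r) frac)"
  proof -
    have "to_fract (1 + 1 + 1) = (1 + 1 + 1 :: ('a, 'r) frac)" by (simp only: to_fract_add to_fract_1)
    then show ?thesis by simp
  qed
  moreover have "Sc 3 = (3 :: ('a, 'r) opr)"
  proof -
    have "Sc (1 + 1 + 1) = (1 + 1 + 1 :: ('a, 'r) opr)" by (simp only: Sc_hom)
    then show ?thesis by simp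
  qed
  ultimately have "3 * A = base_scale 3 A" by (simp add: base_scale_def)
  moreover have "Sc hf ^ 2 * C = base_scale (hbar ^ 2) C" by (simp add: base_scale_def to_fract_power Sc_power hf_def)
  ultimately have "tv_pure n c (base_scale 3 A - B + base_scale (hbar ^ 2) C) = 0" using tv_pure_Comm[OF assms(4)] by simp
  then show ?thesis
    using assms \<open>to_fract 3 = _\<close> by (simp add: tv_pure_add tv_pure_diff base_scale_Rop tv_pure_base_scale tv_scale_tv_pure to_fract_power hf_def mult.commute)
qed

lemma bracket_cubic_pos:
  "scale_endo 3 * (pos_endo 2 * pos_endo 1 - pos_endo 1 * pos_endo 2) - (pos_endo 3 * pos_endo 0 - pos_endo 0 * pos_endo 3) + scale_endo (hf ^ 2) * (pos_endo 1 * pos_endo 0 - pos_endo 0 * pos_endo 1)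
    = (0 :: ('a::idom, 'r::{finite,linorder}) tv endo)"
proof (rule endo_tv_pure_eqI)
  fix n c and u :: "('a, 'r) opr" assume u: "u \<in> Rop n"
  let ?N = "Suc (Suc n)" and ?x = "x_op (Suc n) :: ('a, 'r) opr" and ?y = "x_op (Suc (Suc n)) :: ('a, 'r) opr"
  let ?t = "\<lambda>a b. u * ?x ^ a * ?y ^ b"
  have t: "?t a b \<in> Rop ?N" for a b using u by (intro top_mult_Rop)
  have D: "app (pos_endo b) (app (pos_endo a) (tv_pure n c u)) = tv_pure ?N c (?t a b)" for a b
    using u by (simp add: app_pos_endo top_mult_Rop)
  have "3 * (?t 1 2 - ?t 2 1) - (?t 0 3 - ?t 3 0) + Sc hf ^ 2 * (?t 0 1 - ?t 1 0)
      = u * (3 * (?x * ?y ^ 2 - ?x ^ 2 * ?y) - (?y ^ 3 - ?x ^ 3) + Sc hf ^ 2 * (?y - ?x))"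
  proof -
    have "u * (3 * z) = 3 * (u * z)" for z by (simp add: three_mult distrib_left)
    moreover have "u * (Sc hf ^ 2 * z) = Sc hf ^ 2 * (u * z)" for z
      using Sc_Rop[OF u, of "hf ^ 2"] by (simp add: Sc_power flip: mult.assoc)
    ultimately show ?thesis by (simp add: distrib_left right_diff_distrib mult.assoc)
  qed
  then have m: "3 * (?t 1 2 - ?t 2 1) - (?t 0 3 - ?t 3 0) + Sc hf ^ 2 * (?t 0 1 - ?t 1 0) \<in> Comm (Rop ?N)"
    using cubic_pos[OF u] by simp
  have d: "?t a b - ?t a' b' \<in> Rop ?N" for a b a' b' using t by (intro Rop_closed(3))
  show "app (scale_endo 3 * (pos_endo 2 * pos_endo 1 - pos_endo 1 * pos_endo 2) - (pos_endo 3 * pos_endo 0 - pos_endo 0 * pos_endo 3) + scale_endo (hf ^ 2) * (pos_endo 1 * pos_endo 0 - pos_endo 0 * pos_endo 1)) (tv_pure n c u)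
    = app 0 (tv_pure n c u)"
    unfolding app_simps app_scale_endo D tv_pure_diff[OF t t, symmetric] by (rule tv_pure_cubic[OF d d d m])
qed

lemma bracket_cubic_neg:
  "scale_endo 3 * (neg_endo 2 * neg_endo 1 - neg_endo 1 * neg_endo 2) - (neg_endo 3 * neg_endo 0 - neg_endo 0 * neg_endo 3) + scale_endo (hf ^ 2) * (neg_endo 1 * neg_endo 0 - neg_endo 0 * neg_endo 1)
    = (0 :: ('a::idom, 'r::{finite,linorder}) tv endo)"
proof (rule endo_tv_pure_eqI)
  fix n c and u :: "('a, 'r) opr" assume u: "u \<in> Rop n"
  consider "n = 0" | "n = Suc 0" | m where "n = Suc (Suc m)" by (metis not0_implies_Suc)
  then show "app (scale_endo 3 * (neg_endo 2 * neg_endo 1 - neg_endo 1 * neg_endo 2) - (neg_endo 3 * neg_endo 0 - neg_endo 0 * neg_endo 3) + scale_endo (hf ^ 2) * (neg_endo 1 * neg_endo 0 - neg_endo 0 * neg_endo 1)) (tv_pure n c u)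
    = app 0 (tv_pure n c u)"
  \<comment> \<open>In degrees 0 and 1 each product of two operators \<open>x^+\<close> passes
    through degree 0, where \<open>x^+\<close> is zero; only from degree 2 on is there something to
    check.\<close>
  proof cases
    case 1
    then show ?thesis using u by (simp add: app_neg_endo app_scale_endo tv_scale_zero)
  next
    case 2
    then show ?thesis using u by (simp add: app_neg_endo x_plus_op_Rop app_scale_endo tv_scale_zero)
  next
    case (3 m)
    then have u: "u \<in> Rop (Suc (Suc m))" using u by simp
    let ?t = "\<lambda>a b. x_plus_op m a (x_plus_op (Suc m) b u)"
    have t: "?t a b \<in> Rop m" for a b using u by (intro x_plus_op_Rop)
    have D: "app (neg_endo a) (app (neg_endo b) (tv_pure n c u)) = tv_pure m c (?t a b)" for a b
      using u 3 by (simp add: app_neg_endo x_plus_op_Rop)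
    have d: "?t a b - ?t a' b' \<in> Rop m" for a b a' b' using t by (intro Rop_closed(3))
    show ?thesis
      unfolding app_simps app_scale_endo D tv_pure_diff[OF t t, symmetric] by (rule tv_pure_cubic[OF d d d cubic_neg[OF u]])
  qed
qed

lemma tv_pure_serre:
  fixes A B C :: "('a::idom, 'r::{finite,linorder}) opr"
  assumes "A \<in> Rop n" "B \<in> Rop n" "C \<in> Rop n" "A - 2 * B + C \<in> Comm (Rop n)"
  shows "tv_pure n c A - tv_pure n c B - (tv_pure n c B - tv_pure n c C) = 0"
proof -
  have "tv_pure n c (A - B - (B - C)) = 0" using assms(4) by (intro tv_pure_Comm) (simp add: mult_2 algebra_simps)
  then show ?thesis using assms by (simp add: tv_pure_diff)
qed

lemma bracket_serre_pos:
  "pos_endo 0 * (pos_endo 0 * pos_endo 1 - pos_endo 1 * pos_endo 0) - (pos_endo 0 * pos_endo 1 - pos_endo 1 * pos_endo 0) * pos_endo 0 = (0 :: ('a::idom, 'r::{finite,linorder}) tv endo)"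
proof (rule endo_tv_pure_eqI)
  fix n c and u :: "('a, 'r) opr" assume u: "u \<in> Rop n"
  let ?N = "Suc (Suc (Suc n))"
  let ?t = "\<lambda>i j k. u * x_op (Suc n) ^ i * x_op (Suc (Suc n)) ^ j * x_op ?N ^ k"
  have t: "?t i j k \<in> Rop ?N" for i j k using u by (intro top_mult_Rop)
  have D: "app (pos_endo k) (app (pos_endo j) (app (pos_endo i) (tv_pure n c u))) = tv_pure ?N c (?t i j k)" for i j k
    using u by (simp add: app_pos_endo top_mult_Rop del: power_0 power_one_right)
  have "?t 1 0 0 - 2 * ?t 0 1 0 + ?t 0 0 1 = u * (x_op (n + 1) - 2 * x_op (n + 2) + x_op (n + 3))"
  proof -
    have "u * (2 * z) = 2 * (u * z)" for z by (simp add: mult_2 distrib_left)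
    then show ?thesis by (simp add: distrib_left right_diff_distrib numeral_3_eq_3)
  qed
  then have m: "?t 1 0 0 - 2 * ?t 0 1 0 + ?t 0 0 1 \<in> Comm (Rop ?N)"
    using serre_pos[OF u] by (simp add: numeral_3_eq_3)
  show "app (pos_endo 0 * (pos_endo 0 * pos_endo 1 - pos_endo 1 * pos_endo 0) - (pos_endo 0 * pos_endo 1 - pos_endo 1 * pos_endo 0) * pos_endo 0) (tv_pure n c u) = app 0 (tv_pure n c u)"
    unfolding app_simps app_diff D by (rule tv_pure_serre[OF t t t m])
qed

lemma bracket_serre_neg:
  "neg_endo 0 * (neg_endo 0 * neg_endo 1 - neg_endo 1 * neg_endo 0) - (neg_endo 0 * neg_endo 1 - neg_endo 1 * neg_endo 0) * neg_endo 0 = (0 :: ('a::idom, 'r::{finite,linorder}) tv endo)"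
proof (rule endo_tv_pure_eqI)
  fix n c and u :: "('a, 'r) opr" assume u: "u \<in> Rop n"
  consider "n = 0" | "n = Suc 0" | "n = Suc (Suc 0)" | m where "n = Suc (Suc (Suc m))" by (metis not0_implies_Suc)
  then show "app (neg_endo 0 * (neg_endo 0 * neg_endo 1 - neg_endo 1 * neg_endo 0) - (neg_endo 0 * neg_endo 1 - neg_endo 1 * neg_endo 0) * neg_endo 0) (tv_pure n c u) = app 0 (tv_pure n c u)"
  proof cases
    case 1
    then show ?thesis using u by (simp add: app_neg_endo)
  next
    case 2
    then show ?thesis using u by (simp add: app_neg_endo x_plus_op_Rop)
  next
    case 3
    then show ?thesis using u by (simp add: app_neg_endo x_plus_op_Rop app_diff)
  next
    case (4 m)
    then have u: "u \<in> Rop (Suc (Suc (Suc m)))" using u by simp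
    let ?t = "\<lambda>i j k. x_plus_op m i (x_plus_op (Suc m) j (x_plus_op (Suc (Suc m)) k u))"
    have t: "?t i j k \<in> Rop m" for i j k using u by (intro x_plus_op_Rop)
    have D: "app (neg_endo i) (app (neg_endo j) (app (neg_endo k) (tv_pure n c u))) = tv_pure m c (?t i j k)" for i j k
      using u 4 by (simp add: app_neg_endo x_plus_op_Rop)
    have m: "?t 0 0 1 - 2 * ?t 0 1 0 + ?t 1 0 0 \<in> Comm (Rop m)"
      using serre_neg[OF u] by (simp add: algebra_simps)
    show ?thesis unfolding app_simps app_diff D by (rule tv_pure_serre[OF t t t m])
  qed
qed

definition central_char :: "nat \<Rightarrow> ('a::idom, 'r::{finite,linorder}) frac" where
  "central_char k = to_fract (\<Sum>p\<in>UNIV. yvar p ^ k)"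

lemma neg_endo_pos_endo:
  "neg_endo k * pos_endo l - pos_endo l * neg_endo k = (\<Sum>p=1..k + l. scale_endo (of_nat (k + l choose p) * (hf ^ (p - 1) - (- hf) ^ (p - 1))) * cartan_endo (k + l - p))
    + (scale_endo (central_char (k + l)) :: ('a::idom, 'r::{finite,linorder}) tv endo)"
proof (rule endo_tv_pure_eqI)
  fix n c and u :: "('a, 'r) opr" assume u: "u \<in> Rop n"
  let ?K = "k + l"
  \<comment> \<open>In degree 0 the operator \<open>x^+\<close> is zero, so the product with
    \<open>x^+\<close> applied first is zero; \<open>rest\<close> covers this case together with the
    higher degrees.\<close>
  define rest where "rest = (case n of 0 \<Rightarrow> 0 | Suc n' \<Rightarrow> x_plus_op n' k u * x_op n ^ l)"
  have restH: "rest \<in> Rop n"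
    using u by (cases n) (auto simp: rest_def intro!: top_mult_Rop x_plus_op_Rop)
  have B: "app (pos_endo l) (app (neg_endo k) (tv_pure n c u)) = tv_pure n c rest"
  proof (cases n)
    case 0
    have "tv_pure 0 c 0 = 0" by (rule tv_pure_Comm[OF Comm.zero])
    then show ?thesis using 0 u by (simp add: app_neg_endo rest_def)
  next
    case (Suc m)
    then show ?thesis using u by (simp add: app_neg_endo app_pos_endo x_plus_op_Rop rest_def)
  qed
  have A: "app (neg_endo k) (app (pos_endo l) (tv_pure n c u)) = tv_pure n c (x_plus_op n k (u * x_op (Suc n) ^ l))"
    using u by (simp add: app_pos_endo app_neg_endo top_mult_Rop)
  have tH: "x_plus_op n k (u * x_op (Suc n) ^ l) \<in> Rop n" by (intro x_plus_op_Rop top_mult_Rop u)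
  have uE: "u * E_op n ?K \<in> Rop n" by (intro Rop_closed(4) E_op_Rop u)
  have "app (neg_endo k * pos_endo l - pos_endo l * neg_endo k) (tv_pure n c u) = tv_pure n c (x_plus_op n k (u * x_op (Suc n) ^ l) - rest)"
    using tH restH by (simp add: A B tv_pure_diff)
  also have "\<dots> = tv_pure n c (u * E_op n ?K)"
    using x_plus_op_x_op_power[OF u, of k l] unfolding rest_def[symmetric] by (intro tv_pure_cong Rop_closed(3) tH restH uE)
  also have "u * E_op n ?K = (\<Sum>p=1..?K. base_scale (of_nat (?K choose p) * (hbar ^ p + (- hbar) ^ p)) (u * psum n (?K - p)))
      + base_scale (\<Sum>p\<in>UNIV. yvar p ^ ?K) u"
  proof -
    have "of_nat m = (Sc (of_nat m) :: ('a, 'r) opr)" for m by (induction m) (simp_all add: Sc_hom)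
    moreover have "of_nat m = (to_fract (of_nat m) :: ('a, 'r) frac)" for m by (induction m) simp_all
    ultimately have e: "of_nat m * (Sc (hf ^ p + (- hf) ^ p) * z) = base_scale (of_nat m * (hbar ^ p + (- hbar) ^ p)) z"
      for m p and z :: "('a, 'r) opr"
      by (simp add: base_scale_def Sc_hom hf_def to_fract_power mult.assoc)
    have c: "u * base_scale b z = base_scale b (u * z)" for b z
      using Sc_Rop[OF u, of "to_fract b"] by (simp add: base_scale_def flip: mult.assoc)
    have s: "u * Sc (to_fract b) = base_scale b u" for b using Sc_Rop[OF u, of "to_fract b"] by (simp add: base_scale_def)
    show ?thesis unfolding E_op_psum e distrib_left s sum_distrib_left c ..
  qed
  also have "tv_pure n c \<dots> = (\<Sum>p=1..?K. tv_pure n (c * to_fract (of_nat (?K choose p) * (hbar ^ p + (- hbar) ^ p))) (u * psum n (?K - p)))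
      + tv_pure n (c * central_char ?K) u"
    using u by (simp add: tv_pure_add tv_pure_sum base_scale_Rop psum_mult_Rop Rop_closed(7) tv_pure_base_scale central_char_def)
  also have "(\<Sum>p=1..?K. tv_pure n (c * to_fract (of_nat (?K choose p) * (hbar ^ p + (- hbar) ^ p))) (u * psum n (?K - p)))
      = (\<Sum>p=1..?K. app (scale_endo (of_nat (?K choose p) * (hf ^ (p - 1) - (- hf) ^ (p - 1))) * cartan_endo (?K - p)) (tv_pure n c u))"
  proof (rule sum.cong[OF HOL.refl])
    fix p assume p: "p \<in> {1..?K}"
    have "of_nat m = (to_fract (of_nat m) :: ('a, 'r) frac)" for m by (induction m) simp_all
    moreover obtain q where q: "p = Suc q" using p by (cases p) auto
    \<comment> \<open>For \<open>p \<ge> 1\<close> one has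
      \<open>h^p + (- h)^p = h (h^(p-1) - (- h)^(p-1))\<close>. The factor \<open>h\<close> split
      off is the one in the action of \<open>D_{0,l+1}\<close>, and the rest is the coefficient in
      the difference of the two \<open>\<gamma>\<close>.\<close>
    ultimately have co: "c * to_fract (of_nat (?K choose p) * (hbar ^ p + (- hbar) ^ p))
        = of_nat (?K choose p) * (hf ^ (p - 1) - (- hf) ^ (p - 1)) * (hf * c :: ('a, 'r) frac)"
      by (simp add: hf_def to_fract_power algebra_simps)
    show "tv_pure n (c * to_fract (of_nat (?K choose p) * (hbar ^ p + (- hbar) ^ p))) (u * psum n (?K - p))
        = app (scale_endo (of_nat (?K choose p) * (hf ^ (p - 1) - (- hf) ^ (p - 1))) * cartan_endo (?K - p)) (tv_pure n c u)"
      unfolding co app_simps app_cartan_endo[OF u] app_scale_endo_tv_pure[OF psum_mult_Rop[OF u]] ..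
  qed
  also have "(\<Sum>p=1..?K. app (scale_endo (of_nat (?K choose p) * (hf ^ (p - 1) - (- hf) ^ (p - 1))) * cartan_endo (?K - p)) (tv_pure n c u)) + tv_pure n (c * central_char ?K) u
    = app ((\<Sum>p=1..?K. scale_endo (of_nat (?K choose p) * (hf ^ (p - 1) - (- hf) ^ (p - 1))) * cartan_endo (?K - p)) + scale_endo (central_char ?K)) (tv_pure n c u)"
    using u by (simp add: sum_app app_scale_endo_tv_pure mult.commute)
  finally show "app (neg_endo k * pos_endo l - pos_endo l * neg_endo k) (tv_pure n c u)
    = app ((\<Sum>p=1..?K. scale_endo (of_nat (?K choose p) * (hf ^ (p - 1) - (- hf) ^ (p - 1))) * cartan_endo (?K - p)) + scale_endo (central_char ?K)) (tv_pure n c u)" .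
qed

section \<open>The action of the Lie algebra\<close>

primrec gen_endo :: "wgen \<Rightarrow> ('a::idom, 'r::{finite,linorder}) tv endo" where
  "gen_endo (C_gen k) = scale_endo (central_char k)"
| "gen_endo (D_neg k) = neg_endo k"
| "gen_endo (D0_Suc k) = cartan_endo k"
| "gen_endo (D_pos k) = pos_endo k"

primrec act :: "(('a::idom, 'r::{finite,linorder}) frac, wgen) lie_term \<Rightarrow> ('a, 'r) tv endo" where
  "act (Gen g) = gen_endo g"
| "act LZero = 0"
| "act (LAdd s t) = act s + act t"
| "act (LScale c s) = scale_endo c * act s"
| "act (LBr s t) = act s * act t - act t * act s"

text \<open>Elements of \<open>endo\<close> are merely additive, so linearity over the fraction
  field is a separate fact. It makes the images of the \<open>C_k\<close> central and the commutator
  bilinear over the scalars.\<close>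

lemma scale_endo_act: "scale_endo c * act s = act s * scale_endo c"
proof (induction s)
  case (Gen g)
  have "scale_endo c * scale_endo d = scale_endo d * scale_endo c" for c d :: "('a, 'b) frac" by (simp add: scale_endo_hom mult.commute)
  then show ?case by (cases g) (simp_all add: scale_endo_commute)
next
  case (LScale d s)
  have "scale_endo c * (scale_endo d * act s) = scale_endo d * (scale_endo c * act s)" by (simp add: scale_endo_hom mult.commute flip: mult.assoc)
  then show ?case by (simp add: LScale mult.assoc)
next
  case (LBr s t)
  have "scale_endo c * (act s * act t) = act s * act t * scale_endo c" "scale_endo c * (act t * act s) = act t * act s * scale_endo c"
    by (simp_all only: mult.assoc[symmetric] LBr) (simp_all only: mult.assoc LBr)
  then show ?case by (simp add: left_diff_distrib right_diff_distrib)
qed (simp_all add: distrib_left distrib_right)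

lemma scale_endo_neg_one: "scale_endo (- 1) * F = - F"
  by (rule endo_eqI) (simp add: app_scale_endo tv_scale_diff tv_scale_props)

lemma act_LDiff: "act (LDiff s t) = act s - act t"
  by (simp add: scale_endo_neg_one)

lemma act_LSum: "act (LSum ts) = (\<Sum>t\<leftarrow>ts. act t)"
  by (induction ts) (simp_all add: LSum_def)

lemma act_gamma_D: "act (gamma_D t k) = (\<Sum>p=1..k. scale_endo (of_nat (k choose p) * t ^ (p - 1)) * cartan_endo (k - p))"
proof -
  have "(\<Sum>p\<leftarrow>[1..<k + 1]. scale_endo (of_nat (k choose p) * t ^ (p - 1)) * cartan_endo (k - p))
      = (\<Sum>p\<in>set [1..<k + 1]. scale_endo (of_nat (k choose p) * t ^ (p - 1)) * cartan_endo (k - p))"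
    by (rule sum_list_distinct_conv_sum_set) simp
  also have "set [1..<k + 1] = {1..k}" by auto
  finally show ?thesis by (simp add: gamma_D_def act_LSum comp_def)
qed

lemma act_E_term: "act (E_term hf k)
  = (\<Sum>p=1..k. scale_endo (of_nat (k choose p) * (hf ^ (p - 1) - (- hf) ^ (p - 1))) * cartan_endo (k - p)) + scale_endo (central_char k)"
proof (cases "k = 0")
  case False
  have "scale_endo (c - d) = scale_endo c - scale_endo d" for c d :: "('a, 'b) frac" using scale_endo_hom(1)[of "c - d" d] by simp
  then have "act (gamma_D hf k) - act (gamma_D (- hf) k)
      = (\<Sum>p=1..k. scale_endo (of_nat (k choose p) * (hf ^ (p - 1) - (- hf) ^ (p - 1))) * (cartan_endo (k - p) :: ('a, 'b) tv endo))"
    unfolding act_gamma_D sum_subtractf[symmetric] by (simp add: right_diff_distrib left_diff_distrib)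
  then show ?thesis using False by (simp only: E_term_def if_False act.simps gen_endo.simps scale_endo_neg_one add_uminus_conv_diff)
qed (simp add: E_term_def)

lemma act_rel:
  assumes "(s, t) \<in> W_relations (hf :: ('a::idom, 'r::{finite,linorder}) frac)"
  shows "act s = act t"
proof -
  consider k u where "s = LBr (Gen (C_gen k)) u" "t = LZero"
    | k l where "s = LBr (Gen (D0_Suc l)) (Gen (D0_Suc k))" "t = LZero"
    | k l where "s = LBr (Gen (D0_Suc l)) (Gen (D_pos k))" "t = LScale hf (Gen (D_pos (l + k)))"
    | k l where "s = LBr (Gen (D0_Suc l)) (Gen (D_neg k))" "t = LScale (- hf) (Gen (D_neg (l + k)))"
    | "(s, t) = cubic_relation hf D_pos" | "(s, t) = cubic_relation hf D_neg"
    | "(s, t) = serre_relation D_pos" | "(s, t) = serre_relation D_neg"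
    | k l where "s = LBr (Gen (D_neg k)) (Gen (D_pos l))" "t = E_term hf (k + l)"
    using assms unfolding W_relations_def by blast
  then show ?thesis
  proof cases
    case 1
    then show ?thesis by (simp add: scale_endo_act)
  next
    case 2
    then show ?thesis using cartan_endo_cartan_endo by simp
  next
    case 3
    then show ?thesis using cartan_endo_pos_endo by simp
  next
    case 4
    then show ?thesis using cartan_endo_neg_endo by simp
  next
    case 5
    note st = this[unfolded cubic_relation_def prod.inject]
    show ?thesis
      unfolding conjunct1[OF st] conjunct2[OF st]
      by (simp only: act.simps gen_endo.simps scale_endo_neg_one add_uminus_conv_diff bracket_cubic_pos)
  next
    case 6
    note st = this[unfolded cubic_relation_def prod.inject]
    show ?thesis
      unfolding conjunct1[OF st] conjunct2[OF st]
      by (simp only: act.simps gen_endo.simps scale_endo_neg_one add_uminus_conv_diff bracket_cubic_neg)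
  next
    case 7
    then show ?thesis using bracket_serre_pos[where 'a = 'a and 'r = 'r] by (simp add: serre_relation_def)
  next
    case 8
    then show ?thesis using bracket_serre_neg[where 'a = 'a and 'r = 'r] by (simp add: serre_relation_def)
  next
    case 9
    then show ?thesis unfolding 9 act_E_term by (simp only: act.simps gen_endo.simps neg_endo_pos_endo)
  qed
qed

text \<open>The congruence is generated by the defining relations, checked in
  \<open>act_rel\<close>, and by the Lie algebra axioms, which hold for commutators in a ring; the
  scaling axioms also use that scalars commute with the action.\<close>

lemma act_lie_eq:
  assumes "lie_eq (W_relations (hf :: ('a::idom, 'r::{finite,linorder}) frac)) s t"
  shows "act s = act t"
  using assms
proof (induction rule: lie_eq.induct)
  case (rel s t)
  then show ?case by (rule act_rel)
next
  case (br_scale_left c s t)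
  have "act t * (scale_endo c * act s) = scale_endo c * (act t * act s)" using scale_endo_act[of c t] by (simp flip: mult.assoc)
  then show ?case by (simp add: right_diff_distrib mult.assoc)
next
  case (br_scale_right s c t)
  have "act s * (scale_endo c * act t) = scale_endo c * (act s * act t)" using scale_endo_act[of c s] by (simp flip: mult.assoc)
  then show ?case by (simp add: right_diff_distrib mult.assoc)
next
  case (add_inverse s)
  then show ?case using act_LDiff[of s s] by simp
next
  case (jacobi s t u)
  then show ?case by (simp add: algebra_simps)
qed (simp_all add: algebra_simps scale_endo_hom flip: scale_endo_hom(2))


section \<open>Presented Lie algebras\<close>

lemma lie_class_eq: "lie_eq Rel s t \<Longrightarrow> lie_class Rel s = lie_class Rel t"
  unfolding lie_class_def by (auto intro: lie_eq.trans lie_eq.sym)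

lemma lie_class_self: "s \<in> lie_class Rel s"
  unfolding lie_class_def by (simp add: lie_eq.refl)

lemma presented_simps:
  shows "carrier (presented_lie_algebra Rel) = range (lie_class Rel)"
    "lie_class Rel s \<oplus>\<^bsub>presented_lie_algebra Rel\<^esub> lie_class Rel t = lie_class Rel (LAdd s t)"
    "c \<odot>\<^bsub>presented_lie_algebra Rel\<^esub> lie_class Rel s = lie_class Rel (LScale c s)"
    "bracket (presented_lie_algebra Rel) (lie_class Rel s) (lie_class Rel t) = lie_class Rel (LBr s t)"
proof -
  show "carrier (presented_lie_algebra Rel) = range (lie_class Rel)" by (simp add: presented_lie_algebra_def)
  have m: "u \<in> lie_class Rel s \<longleftrightarrow> lie_eq Rel s u" for s u by (simp add: lie_class_def)
  have 2: "(\<Union>s'\<in>lie_class Rel s. \<Union>t'\<in>lie_class Rel t. lie_class Rel (f s' t')) = lie_class Rel (f s t)"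
    if c: "\<And>s' t'. lie_eq Rel s s' \<Longrightarrow> lie_eq Rel t t' \<Longrightarrow> lie_eq Rel (f s t) (f s' t')" for f
  proof -
    have "lie_class Rel (f s' t') = lie_class Rel (f s t)" if "s' \<in> lie_class Rel s" "t' \<in> lie_class Rel t" for s' t'
      using c[of s' t'] that unfolding m by (intro lie_class_eq[symmetric])
    then have "(\<Union>s'\<in>lie_class Rel s. \<Union>t'\<in>lie_class Rel t. lie_class Rel (f s' t'))
        = (\<Union>s'\<in>lie_class Rel s. \<Union>t'\<in>lie_class Rel t. lie_class Rel (f s t))"
      by (intro SUP_cong HOL.refl)
    also have "\<dots> = lie_class Rel (f s t)" using lie_class_self[of s Rel] lie_class_self[of t Rel] by blast
    finally show ?thesis .
  qed
  show "lie_class Rel s \<oplus>\<^bsub>presented_lie_algebra Rel\<^esub> lie_class Rel t = lie_class Rel (LAdd s t)"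
    unfolding presented_lie_algebra_def ring.simps by (rule 2, rule lie_eq.cong_add)
  show "bracket (presented_lie_algebra Rel) (lie_class Rel s) (lie_class Rel t) = lie_class Rel (LBr s t)"
    unfolding presented_lie_algebra_def lie_algebra.simps by (rule 2, rule lie_eq.cong_br)
  have e: "lie_class Rel (LScale c s') = lie_class Rel (LScale c s)" if "s' \<in> lie_class Rel s" for s'
    using that unfolding m by (intro lie_class_eq[symmetric] lie_eq.cong_scale)
  have "(\<Union>s'\<in>lie_class Rel s. lie_class Rel (LScale c s')) = (\<Union>s'\<in>lie_class Rel s. lie_class Rel (LScale c s))"
    by (rule SUP_cong[OF HOL.refl]) (rule e)
  also have "\<dots> = lie_class Rel (LScale c s)" using lie_class_self[of s Rel] by blast
  finally show "c \<odot>\<^bsub>presented_lie_algebra Rel\<^esub> lie_class Rel s = lie_class Rel (LScale c s)"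
    by (simp add: presented_lie_algebra_def)
qed

abbreviation cl :: "(('a::idom, 'r::{finite,linorder}) frac, wgen) lie_term \<Rightarrow> (('a, 'r) frac, wgen) lie_term set" where
  "cl \<equiv> lie_class (W_relations hf)"

lemma W_simps:
  shows "carrier W_algebra = range cl"
    "cl s \<oplus>\<^bsub>W_algebra\<^esub> cl t = cl (LAdd s t)" "c \<odot>\<^bsub>W_algebra\<^esub> cl s = cl (LScale c s)"
    "bracket W_algebra (cl s) (cl t) = cl (LBr s t)" "W_gen g = cl (Gen g)"
  unfolding W_algebra_def W_gen_def hf_def[symmetric] by (simp_all only: presented_simps)

text \<open>The map is restricted to the carriers on both levels, as the spaces of extensional
  functions in \<open>lie_representation\<close> and \<open>linear_endos\<close> demand; otherwise
  values outside the carriers would spoil uniqueness.\<close>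

definition rho :: "(('a::idom, 'r::{finite,linorder}) frac, wgen) lie_term set
    \<Rightarrow> (nat \<Rightarrow> ('a, 'r) tr_frac set) \<Rightarrow> nat \<Rightarrow> ('a, 'r) tr_frac set" where
  "rho = (\<lambda>S\<in>carrier W_algebra. \<lambda>v\<in>carrier tr_category_frac. rep_tv (app (act (SOME s. s \<in> S)) (abs_tv v)))"

lemma rho_cl: "rho (cl s) (rep_tv v) = rep_tv (app (act s) v)"
proof -
  have "(SOME t. t \<in> cl s) \<in> cl s" by (rule someI) (rule lie_class_self)
  then have "act (SOME t. t \<in> cl s) = act s" using act_lie_eq[of s "SOME t. t \<in> cl s"] by (simp add: lie_class_def)
  then show ?thesis using rep_tv[of v] by (simp add: rho_def W_simps rep_tv_inverse)
qed

lemma carrier_rep_tv: "v \<in> carrier tr_category_frac \<Longrightarrow> \<exists>w. v = rep_tv w"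
  by (metis abs_tv_inverse)

lemma rho_endos: "rho \<in> carrier W_algebra \<rightarrow>\<^sub>E linear_endos (tr_category_frac :: (('a::idom, 'r::{finite,linorder}) frac, _) module)"
proof (rule PiE_I)
  fix S :: "(('a, 'r) frac, wgen) lie_term set" assume "S \<in> carrier W_algebra"
  then obtain s where s: "S = cl s" by (auto simp: W_simps)
  show "rho S \<in> linear_endos tr_category_frac"
    unfolding linear_endos_def
  proof (intro CollectI conjI PiE_I ballI allI)
    fix v :: "nat \<Rightarrow> ('a, 'r) tr_frac set" assume v: "v \<in> carrier tr_category_frac"
    then obtain w :: "('a, 'r) tv" where w: "v = rep_tv w" using carrier_rep_tv by blast
    show "rho S v \<in> carrier tr_category_frac" unfolding s w rho_cl by (rule rep_tv)
    show "rho S (c \<odot>\<^bsub>tr_category_frac\<^esub> v) = c \<odot>\<^bsub>tr_category_frac\<^esub> rho S v" for c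
    proof -
      have "app (act s) (tv_scale c w) = tv_scale c (app (act s) w)"
        using arg_cong[OF scale_endo_act[of c s], of "\<lambda>F. app F w"] by (simp add: app_scale_endo)
      then show ?thesis unfolding s w by (simp add: rho_cl flip: rep_tv_tv_scale)
    qed
    fix v' :: "nat \<Rightarrow> ('a, 'r) tr_frac set" assume "v' \<in> carrier tr_category_frac"
    then obtain w' :: "('a, 'r) tv" where w': "v' = rep_tv w'" using carrier_rep_tv by blast
    show "rho S (v \<oplus>\<^bsub>tr_category_frac\<^esub> v') = rho S v \<oplus>\<^bsub>tr_category_frac\<^esub> rho S v'"
      unfolding s w w' by (simp add: rho_cl app_add flip: rep_tv_hom)
  next
    fix v :: "nat \<Rightarrow> ('a, 'r) tr_frac set" assume "v \<notin> carrier tr_category_frac"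
    then show "rho S v = undefined" by (simp add: rho_def s W_simps)
  qed
qed (simp add: rho_def)

lemma rho_representation: "lie_representation W_algebra tr_category_frac (rho :: (('a::idom, 'r::{finite,linorder}) frac, wgen) lie_term set \<Rightarrow> _)"
  unfolding lie_representation_def
proof (intro conjI rho_endos ballI allI)
  fix S T :: "(('a, 'r) frac, wgen) lie_term set" and v :: "nat \<Rightarrow> ('a, 'r) tr_frac set" and c
  assume S: "S \<in> carrier W_algebra" and v: "v \<in> carrier tr_category_frac"
  obtain s where s: "S = cl s" using S by (auto simp: W_simps)
  obtain w :: "('a, 'r) tv" where w: "v = rep_tv w" using v carrier_rep_tv by blast
  show "rho (c \<odot>\<^bsub>W_algebra\<^esub> S) v = c \<odot>\<^bsub>tr_category_frac\<^esub> rho S v"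
    unfolding s w W_simps by (simp add: rho_cl app_scale_endo flip: rep_tv_tv_scale)
  assume T: "T \<in> carrier W_algebra"
  obtain t where t: "T = cl t" using T by (auto simp: W_simps)
  show "rho (S \<oplus>\<^bsub>W_algebra\<^esub> T) v = rho S v \<oplus>\<^bsub>tr_category_frac\<^esub> rho T v"
    unfolding s t w W_simps by (simp add: rho_cl flip: rep_tv_hom)
  show "rho (bracket W_algebra S T) v = rho S (rho T v) \<ominus>\<^bsub>tr_category_frac\<^esub> rho T (rho S v)"
    unfolding s t w W_simps by (simp add: rho_cl flip: rep_tv_hom)
qed

text \<open>The Lie algebra consists of classes of terms, so induction over terms reduces the claim
  to generators. There the given values on pure tensors decide, once the map is turned into an
  element of \<open>endo\<close>.\<close>

lemma rho_unique:
  fixes \<rho> :: "(('a::idom, 'r::{finite,linorder}) frac, wgen) lie_term set \<Rightarrow> (nat \<Rightarrow> ('a, 'r) tr_frac set) \<Rightarrow> nat \<Rightarrow> ('a, 'r) tr_frac set"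
  assumes rep: "lie_representation W_algebra tr_category_frac \<rho>"
    and C: "\<And>k v. v \<in> carrier tr_category_frac \<Longrightarrow> \<rho> (W_gen (C_gen k)) v = central_char k \<odot>\<^bsub>tr_category_frac\<^esub> v"
    and gen: "\<And>g n c u. u \<in> Rop n \<Longrightarrow> g \<notin> range C_gen \<Longrightarrow> \<rho> (W_gen g) (rep_tv (tv_pure n c u)) = rep_tv (app (gen_endo g) (tv_pure n c u))"
  shows "\<rho> = rho"
proof -
  note rp = rep[unfolded lie_representation_def]
  have ccl: "cl s \<in> carrier W_algebra" for s :: "(('a, 'r) frac, wgen) lie_term" by (simp add: W_simps)
  note rA = bspec[OF bspec[OF bspec[OF conjunct1[OF conjunct2[OF rp]] ccl] ccl] rep_tv]
    and rS = bspec[OF bspec[OF spec[OF conjunct1[OF conjunct2[OF conjunct2[OF rp]]]] ccl] rep_tv]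
    and rB = bspec[OF bspec[OF bspec[OF conjunct2[OF conjunct2[OF conjunct2[OF rp]]] ccl] ccl] rep_tv]
  have E: "\<rho> \<in> carrier W_algebra \<rightarrow>\<^sub>E linear_endos tr_category_frac" using rep by (simp add: lie_representation_def)
  have E': "\<rho> (cl s) \<in> linear_endos tr_category_frac" for s
    using E by (auto simp: W_simps)
  have car: "\<rho> (cl s) (rep_tv v) \<in> carrier tr_category_frac" for s v
    using E'[of s] rep_tv[of v] by (auto simp: linear_endos_def)
  have add: "\<rho> (cl s) (rep_tv (v + w)) = \<rho> (cl s) (rep_tv v) \<oplus>\<^bsub>tr_category_frac\<^esub> \<rho> (cl s) (rep_tv w)" for s v w
    using E'[of s] rep_tv[of v] rep_tv[of w] unfolding linear_endos_def rep_tv_hom by blast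
  have main: "\<rho> (cl s) (rep_tv v) = rep_tv (app (act s) v)" for s v
  proof (induction s arbitrary: v)
    case (Gen g)
    show ?case
    proof (cases "g \<in> range C_gen")
      case True
      then obtain k where "g = C_gen k" by blast
      then show ?thesis using C[OF rep_tv[of v], of k] by (simp add: W_simps app_scale_endo rep_tv_tv_scale)
    next
      case False
      define F where "F w = abs_tv (\<rho> (cl (Gen g)) (rep_tv w))" for w
      have rF: "rep_tv (F w) = \<rho> (cl (Gen g)) (rep_tv w)" for w unfolding F_def by (rule abs_tv_inverse[OF car])
      have "F (v + w) = F v + F w" for v w
      proof -
        have "rep_tv (F (v + w)) = rep_tv (F v + F w)" unfolding rep_tv_hom(1)[of "F v"] rF by (rule add)
        then show ?thesis by (simp add: rep_tv_inject)
      qed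
      then have appF: "app (Endo F) = F" by (intro Endo_inverse) simp
      have "Endo F = gen_endo g"
      proof (rule endo_tv_pure_eqI)
        fix n c and u :: "('a, 'r) opr" assume u: "u \<in> Rop n"
        have "rep_tv (F (tv_pure n c u)) = rep_tv (app (gen_endo g) (tv_pure n c u))"
          unfolding rF using gen[OF u False] by (simp add: W_simps)
        then show "app (Endo F) (tv_pure n c u) = app (gen_endo g) (tv_pure n c u)" by (simp add: appF rep_tv_inject)
      qed
      then show ?thesis using rF[of v] appF by (simp flip: \<open>Endo F = gen_endo g\<close>)
    qed
  next
    case LZero
    obtain w where w: "\<rho> (cl LZero) (rep_tv v) = rep_tv w" using car carrier_rep_tv by blast
    \<comment> \<open>The definition of a representation does not speak of zero; the equation
      \<open>0 + 0 = 0\<close> and additivity give \<open>w = w + w\<close>.\<close>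
    have "cl (LAdd LZero LZero) = cl (LZero :: (('a, 'r) frac, wgen) lie_term)" by (rule lie_class_eq) (rule lie_eq.add_zero)
    then have "cl LZero \<oplus>\<^bsub>W_algebra\<^esub> cl LZero = cl (LZero :: (('a, 'r) frac, wgen) lie_term)" by (simp add: W_simps)
    moreover have "\<rho> (cl LZero \<oplus>\<^bsub>W_algebra\<^esub> cl LZero) (rep_tv v) = \<rho> (cl LZero) (rep_tv v) \<oplus>\<^bsub>tr_category_frac\<^esub> \<rho> (cl LZero) (rep_tv v)"
      by (rule rA)
    ultimately have "rep_tv w = rep_tv (w + w)" using w by (simp add: rep_tv_hom)
    then have "w = 0" by (simp add: rep_tv_inject)
    then show ?case using w by simp
  next
    case (LAdd s t)
    have "\<rho> (cl s \<oplus>\<^bsub>W_algebra\<^esub> cl t) (rep_tv v) = \<rho> (cl s) (rep_tv v) \<oplus>\<^bsub>tr_category_frac\<^esub> \<rho> (cl t) (rep_tv v)"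
      by (rule rA)
    then show ?case by (simp add: W_simps LAdd rep_tv_hom)
  next
    case (LScale c s)
    have "\<rho> (c \<odot>\<^bsub>W_algebra\<^esub> cl s) (rep_tv v) = c \<odot>\<^bsub>tr_category_frac\<^esub> \<rho> (cl s) (rep_tv v)"
      by (rule rS)
    then show ?case by (simp add: W_simps LScale rep_tv_tv_scale app_scale_endo)
  next
    case (LBr s t)
    have "\<rho> (bracket W_algebra (cl s) (cl t)) (rep_tv v)
        = \<rho> (cl s) (\<rho> (cl t) (rep_tv v)) \<ominus>\<^bsub>tr_category_frac\<^esub> \<rho> (cl t) (\<rho> (cl s) (rep_tv v))"
      by (rule rB)
    then show ?case by (simp add: W_simps LBr rep_tv_hom)
  qed
  show ?thesis
  proof (rule PiE_ext[OF E rho_endos])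
    fix S :: "(('a, 'r) frac, wgen) lie_term set" assume "S \<in> carrier W_algebra"
    then obtain s where s: "S = cl s" by (auto simp: W_simps)
    have 1: "\<rho> S \<in> carrier tr_category_frac \<rightarrow>\<^sub>E carrier tr_category_frac" using E'[of s] s by (simp add: linear_endos_def)
    have 2: "rho S \<in> carrier tr_category_frac \<rightarrow>\<^sub>E carrier tr_category_frac"
      using rho_endos \<open>S \<in> _\<close> by (auto simp: linear_endos_def PiE_iff)
    show "\<rho> S = rho S"
    proof (rule PiE_ext[OF 1 2])
      fix v :: "nat \<Rightarrow> ('a, 'r) tr_frac set" assume "v \<in> carrier tr_category_frac"
      then obtain w :: "('a, 'r) tv" where "v = rep_tv w" using carrier_rep_tv by blast
      then show "\<rho> S v = rho S v" by (simp add: s main rho_cl)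
    qed
  qed
qed

theorem theorem4p3:
  assumes noetherian: "noetherian_domain (ring_of_type :: 'a::idom ring)"
  shows "\<exists>!\<rho> :: (('a, 'r::{finite,linorder}) frac, wgen) lie_term set
                \<Rightarrow> (nat \<Rightarrow> ('a, 'r) tr_frac set) \<Rightarrow> nat \<Rightarrow> ('a, 'r) tr_frac set.
    lie_representation W_algebra tr_category_frac \<rho> \<and>
    has_level \<rho> CARD('r) \<and>
    (\<forall>k. \<forall>v\<in>carrier tr_category_frac.
       \<rho> (W_gen (C_gen k)) v = to_fract (\<Sum>p\<in>UNIV. yvar p ^ k) \<odot>\<^bsub>tr_category_frac\<^esub> v) \<and>
    (\<forall>k n c. \<forall>t\<in>carrier (tr_R n).
       \<rho> (W_gen (D_neg k)) (at_degree n c t) =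
         (case n of 0 \<Rightarrow> \<zero>\<^bsub>tr_category_frac\<^esub> | Suc m \<Rightarrow> at_degree m c (x_plus k m t)) \<and>
       \<rho> (W_gen (D_pos k)) (at_degree n c t) = at_degree (n + 1) c (x_minus k n t) \<and>
       \<rho> (W_gen (D0_Suc k)) (at_degree n c t) =
         at_degree n (to_fract hbar * c) (power_sum_mult k n t))"
proof -
  have neg: "rep_tv (app (gen_endo (D_neg k)) (tv_pure n c u) :: ('a, 'r) tv)
      = (case n of 0 \<Rightarrow> \<zero>\<^bsub>tr_category_frac\<^esub> | Suc m \<Rightarrow> at_degree m c (x_plus k m (tr_op n u)))" if "u \<in> Rop n" for k n c u
    using that by (cases n) (simp_all add: app_neg_endo rep_tv_hom rep_tv_tv_pure x_plus_op_Rop x_plus_tr_op)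
  have pos: "rep_tv (app (gen_endo (D_pos k)) (tv_pure n c u) :: ('a, 'r) tv) = at_degree (n + 1) c (x_minus k n (tr_op n u))"
    if "u \<in> Rop n" for k n c u
    using that by (simp add: app_pos_endo rep_tv_tv_pure top_mult_Rop x_minus_tr_op)
  have zer: "rep_tv (app (gen_endo (D0_Suc k)) (tv_pure n c u) :: ('a, 'r) tv) = at_degree n (to_fract hbar * c) (power_sum_mult k n (tr_op n u))"
    if "u \<in> Rop n" for k n c u
    using that by (simp add: app_cartan_endo rep_tv_tv_pure psum_mult_Rop power_sum_mult_tr_op hf_def)
  have C: "rho (W_gen (C_gen k)) v = central_char k \<odot>\<^bsub>tr_category_frac\<^esub> v" if v: "v \<in> carrier tr_category_frac"
    for k and v :: "nat \<Rightarrow> ('a, 'r) tr_frac set"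
  proof -
    obtain w :: "('a, 'r) tv" where "v = rep_tv w" using v carrier_rep_tv by blast
    then show ?thesis by (simp add: W_simps rho_cl app_scale_endo rep_tv_tv_scale)
  qed
  have rho_tv_pure: "rho (W_gen g) (at_degree n c (tr_op n u)) = rep_tv (app (gen_endo g) (tv_pure n c u) :: ('a, 'r) tv)" if "u \<in> Rop n" for g n c u
    using that rho_cl[of "Gen g" "tv_pure n c u"] by (simp add: W_simps rep_tv_tv_pure)
  \<comment> \<open>The level is the power sum of the \<open>y_p\<close> with exponent 0, which
    counts the colours.\<close>
  have "of_nat m = (to_fract (of_nat m) :: ('a, 'r) frac)" for m by (induction m) simp_all
  then have "central_char 0 = (of_nat CARD('r) :: ('a, 'r) frac)" by (simp add: central_char_def)
  then have lvl: "has_level (rho :: (('a, 'r) frac, wgen) lie_term set \<Rightarrow> _) CARD('r)" unfolding has_level_def using C[of _ 0] by simp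
  have cen: "\<forall>k. \<forall>v\<in>carrier tr_category_frac.
       (rho :: (('a, 'r) frac, wgen) lie_term set \<Rightarrow> _) (W_gen (C_gen k)) v = to_fract (\<Sum>p\<in>UNIV. yvar p ^ k) \<odot>\<^bsub>tr_category_frac\<^esub> v"
    by (intro allI ballI) (rule C[unfolded central_char_def])
  have gens: "\<forall>k n. \<forall>c :: ('a, 'r) frac. \<forall>t\<in>carrier (tr_R n).
     rho (W_gen (D_neg k)) (at_degree n c t) =
       (case n of 0 \<Rightarrow> \<zero>\<^bsub>tr_category_frac\<^esub> | Suc m \<Rightarrow> at_degree m c (x_plus k m t)) \<and>
     rho (W_gen (D_pos k)) (at_degree n c t) = at_degree (n + 1) c (x_minus k n t) \<and>
     rho (W_gen (D0_Suc k)) (at_degree n c t) = at_degree n (to_fract hbar * c) (power_sum_mult k n t)"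
  proof (intro allI ballI)
    fix k n and c :: "('a, 'r) frac" and t :: "('a, 'r) nc_poly set set set"
    assume "t \<in> carrier (tr_R n)"
    then obtain u where u: "u \<in> Rop n" "t = tr_op n u" unfolding carrier_tr by blast
    show "rho (W_gen (D_neg k)) (at_degree n c t) =
       (case n of 0 \<Rightarrow> \<zero>\<^bsub>tr_category_frac\<^esub> | Suc m \<Rightarrow> at_degree m c (x_plus k m t)) \<and>
     rho (W_gen (D_pos k)) (at_degree n c t) = at_degree (n + 1) c (x_minus k n t) \<and>
     rho (W_gen (D0_Suc k)) (at_degree n c t) = at_degree n (to_fract hbar * c) (power_sum_mult k n t)"
      unfolding u(2) rho_tv_pure[OF u(1)] neg[OF u(1)] pos[OF u(1)] zer[OF u(1)] by (intro conjI HOL.refl)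
  qed
  show ?thesis
  proof (rule ex1I[of _ rho], rule conjI[OF rho_representation conjI[OF lvl conjI[OF cen gens]]])
    fix \<rho> :: "(('a, 'r) frac, wgen) lie_term set \<Rightarrow> (nat \<Rightarrow> ('a, 'r) tr_frac set) \<Rightarrow> nat \<Rightarrow> ('a, 'r) tr_frac set"
    assume H: "lie_representation W_algebra tr_category_frac \<rho> \<and>
      has_level \<rho> CARD('r) \<and>
      (\<forall>k. \<forall>v\<in>carrier tr_category_frac.
         \<rho> (W_gen (C_gen k)) v = to_fract (\<Sum>p\<in>UNIV. yvar p ^ k) \<odot>\<^bsub>tr_category_frac\<^esub> v) \<and>
      (\<forall>k n c. \<forall>t\<in>carrier (tr_R n).
         \<rho> (W_gen (D_neg k)) (at_degree n c t) =
           (case n of 0 \<Rightarrow> \<zero>\<^bsub>tr_category_frac\<^esub> | Suc m \<Rightarrow> at_degree m c (x_plus k m t)) \<and>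
         \<rho> (W_gen (D_pos k)) (at_degree n c t) = at_degree (n + 1) c (x_minus k n t) \<and>
         \<rho> (W_gen (D0_Suc k)) (at_degree n c t) =
           at_degree n (to_fract hbar * c) (power_sum_mult k n t))"
    show "\<rho> = rho"
    proof (rule rho_unique)
      show "lie_representation W_algebra tr_category_frac \<rho>" using H by blast
      show "\<rho> (W_gen (C_gen k)) v = central_char k \<odot>\<^bsub>tr_category_frac\<^esub> v" if "v \<in> carrier tr_category_frac" for k v
        using H that unfolding central_char_def by blast
      fix g n c and u :: "('a, 'r) opr" assume u: "u \<in> Rop n" and g: "g \<notin> range C_gen"
      have t: "tr_op n u \<in> carrier (tr_R n)" using u by (simp add: carrier_tr)
      show "\<rho> (W_gen g) (rep_tv (tv_pure n c u)) = rep_tv (app (gen_endo g) (tv_pure n c u))"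
      proof (cases g)
        case (C_gen k)
        then show ?thesis using g by blast
      next
        case (D_neg k)
        then show ?thesis using H t neg[OF u] rep_tv_tv_pure[OF u] by simp
      next
        case (D0_Suc k)
        then show ?thesis using H t zer[OF u] rep_tv_tv_pure[OF u] by simp
      next
        case (D_pos k)
        then show ?thesis using H t pos[OF u] rep_tv_tv_pure[OF u] by simp
      qed
    qed
  qed
qed

end
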